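(* Let $M$ be a manifold of dimension $k+1$ with local coordinates $x_0,\ldots,x_k$, let $\partial_i=\partial/\partial x_i$, and let $t_0,\ldots,t_{k+1}\in\mathbb{R}$ be distinct numbers. Then any function $w=w(x_0,\ldots,x_k)$ with $\partial_iw\neq0$ for all $i$, satisfying the system $$\sum_{cycl(i,j,l)}a_{ij,l}\,\partial_i\partial_jw\,\partial_lw=0,\qquad 0\le i<j<l\le k,\qquad a_{ij,l}=(t_i-t_j)(t_{k+1}-t_l),$$ defines a paraconformal structure via $$\omega(t)=\sum_{i=0}^k(t_{k+1}-t_i)\prod_{j\in\{0,\ldots,k\},\,j\neq i}(t-t_j)\,\partial_iw\,dx_i,$$ and conversely, any paraconformal structure of Veronese type can be locally put in this form. Moreover, for a Veronese web given by such $w$: 1. If $k>2$ then all totally geodesic paraconformal connections for the Veronese web are given by $$\nabla\partial_i=\left(\frac{d(\partial_iw)}{\partial_iw}+\alpha\right)\partial_i,$$ where $\alpha$ is an arbitrary one-form on $M$. Moreover, there is a unique $\alpha$ such that the torsion of the corresponding paraconformal connection satisfies $T(\nabla)(V(t),V'(t))\in\mathrm{span}\{V(t)\}$ for all $t\in\mathbb{R}$. 2. If $k=2$ then the Veronese web defines the conformal metric $$\mathbf g=\sum_{i,j=0}^2(t_3-t_i)(t_3-t_j)\left(t_i^2+t_j^2-t_it_j-\sum_{l=0}^2t_l^2\right)\partial_iw\,\partial_jw\,dx_idx_j$$ and there is a unique torsion-free totally geodesic paraconformal connection $\nabla$ such that $([\mathbf g],\nabla)$ is an Einstein-Weyl structure.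 The Weyl one-form $\varphi$ for $\nabla$ is given by $$\varphi=\left(\frac{\partial_0\partial_1w}{\partial_1w}+\frac{\partial_0\partial_2w}{\partial_2w}\right)dx_0+\left(\frac{\partial_0\partial_1w}{\partial_0w}+\frac{\partial_1\partial_2w}{\partial_2w}\right)dx_1+\left(\frac{\partial_0\partial_2w}{\partial_0w}+\frac{\partial_1\partial_2w}{\partial_1w}\right)dx_2.$$ 3. If $k=1$ then for the given Veronese web there is a unique torsion-free paraconformal connection satisfying the additional condition $\nabla_YV(t)\in\mathrm{span}\{V(t)\}$ for any vector field $Y$ and any $t\in\mathbb{R}$. It is given by $$\nabla\partial_0=\left(\frac{\partial_0\partial_0w}{\partial_0w}-\frac{\partial_0\partial_1w}{\partial_1w}\right)dx_0\,\partial_0,\qquad\nabla\partial_1=\left(\frac{\partial_1\partial_1w}{\partial_1w}-\frac{\partial_0\partial_1w}{\partial_0w}\right)dx_1\,\partial_1.$$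
   Context: A Veronese web on a manifold $M$ of dimension $k+1$ is a one-parameter family $\{\mathcal{F}_t\}_{t\in\mathbb{R}}$ of codimension-one foliations such that locally there is a coframe $\omega_0,\ldots,\omega_k$ with $T\mathcal{F}_t=\ker\omega(t)$, $\omega(t)=\omega_0+t\omega_1+\cdots+t^k\omega_k$, for all $t$; thus $\omega(t)\wedge d\omega(t)=0$ for all $t$. It is given by $\omega(t)$ up to multiplication by a function on $M$. The dual curve $V(t)=V_0+tV_1+\cdots+t^kV_k$ ($V_0,\ldots,V_k$ a local frame) is determined, up to multiplication by a function on $M$, by $V(t)\in\ker\omega(t)\cap\ker\omega'(t)\cap\cdots\cap\ker\omega^{(k-1)}(t)$, where primes denote derivatives with respect to $t$; then $\ker\omega(t)=\mathrm{span}\{V(t),V'(t),\ldots,V^{(k-1)}(t)\}$. The curve $t\mapsto\mathbb{R}V(t)$ is a rational normal curve of degree $k$ in $P(T_xM)$, and the field of cones over these curves is the paraconformal structure defined by the web (in general, a paraconformal structure is a field of cones over rational normal curves of degree $k$ in the tangent spaces). Paraconformal structures obtained in this way are called of Veronese type; "defines a paraconformal structure via $\omega(t)$" refers to this construction. A connection $\nabla$ on $M$ (possibly with torsion) is paraconformal if $\nabla_YV(t)\in\mathrm{span}\{V(t),V'(t)\}$ for all $t$ and all vector fields $Y$. It is totally geodesic for the Veronese web if the leaves of all foliations $\mathcal{F}_t$ are totally geodesic submanifolds for $\nabla$. Torsion: $T(\nabla)(X,Y)=\nabla_XY-\nabla_YX-[X,Y]$. $\sum_{cycl(i,j,l)}$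 is the sum over cyclic permutations of $(i,j,l)$; for $k=1$ the system for $w$ is empty. For a metric $\mathbf g$ and a torsion-free connection $\nabla$ preserving its conformal class $[\mathbf g]$, the Weyl one-form $\varphi$ is defined by $\nabla\mathbf g=\varphi\,\mathbf g$. A pair $([\mathbf g],\nabla)$ of this kind in dimension 3 is Einstein-Weyl if the symmetric part of the Ricci tensor of $\nabla$ is $\frac13R_{\mathbf g}(\nabla)\mathbf g$, with $R_{\mathbf g}(\nabla)$ the scalar curvature with respect to $\mathbf g$.
   Formalization: In part 2 the printed metric is not null on V(t) (value a multiple of -2t²), so its coefficient is corrected by adding the product of t_m over m≠i and the product of t_m over m≠j, making g the discriminant of ω(t)(v) as a quadratic in t; all else is as stated. *)

theory Defs
  imports "HOL-Analysis.Analysis"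
begin

text \<open>
  Everything is formulated on an open set \<open>U\<close> of a Euclidean space, the domain of a coordinate
  chart. Tangent vectors are vectors of the ambient space; a one-form is encoded by its vector of
  coefficients and is evaluated on a tangent vector by the inner product, so on
  \<open>real ^ 'n\<close> the vector \<open>axis i 1\<close> stands both for the vector field
  \<open>\<partial>/\<partial>x\<^sub>i\<close> and for the one-form \<open>dx\<^sub>i\<close>.
  Functions, vector fields and forms only matter on \<open>U\<close>.
\<close>

subsection \<open>Smooth maps and charts\<close>

fun Ck_on :: "nat \<Rightarrow> 'a::real_normed_vector set \<Rightarrow> ('a \<Rightarrow> 'b::real_normed_vector) \<Rightarrow> bool" where
  "Ck_on 0 U f \<longleftrightarrow> continuous_on U f"
| "Ck_on (Suc n) U f \<longleftrightarrow>
     (\<forall>x\<in>U. f differentiable (at x)) \<and>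
     (\<forall>v. Ck_on n U (\<lambda>x. frechet_derivative f (at x) v))"

definition smooth_on :: "'a::real_normed_vector set \<Rightarrow> ('a \<Rightarrow> 'b::real_normed_vector) \<Rightarrow> bool" where
  "smooth_on U f \<longleftrightarrow> (\<forall>n. Ck_on n U f)"

definition coordinate_chart :: "'a::real_normed_vector set \<Rightarrow> ('a \<Rightarrow> 'a) \<Rightarrow> bool" where
  "coordinate_chart W \<phi> \<longleftrightarrow>
     open W \<and> open (\<phi> ` W) \<and> inj_on \<phi> W \<and> smooth_on W \<phi> \<and> smooth_on (\<phi> ` W) (inv_into W \<phi>)"

definition partial :: "'n::finite \<Rightarrow> (real ^ 'n \<Rightarrow> 'b::real_normed_vector) \<Rightarrow> real ^ 'n \<Rightarrow> 'b" where
  "partial i f x = frechet_derivative f (at x) (axis i 1)"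

definition lie_bracket :: "('a::real_normed_vector \<Rightarrow> 'a) \<Rightarrow> ('a \<Rightarrow> 'a) \<Rightarrow> 'a \<Rightarrow> 'a" where
  "lie_bracket X Y x = frechet_derivative Y (at x) (X x) - frechet_derivative X (at x) (Y x)"

subsection \<open>Foliations, Veronese webs and paraconformal structures\<close>

text \<open>
  A codimension-one foliation is given by its tangent distribution \<open>D\<close>: locally the leaves are
  the level sets of a submersion to the real line.
\<close>

definition defining_function ::
    "'a::euclidean_space set \<Rightarrow> ('a \<Rightarrow> 'a set) \<Rightarrow> ('a \<Rightarrow> real) \<Rightarrow> bool" where
  "defining_function W D f \<longleftrightarrow> open W \<and> smooth_on W f \<and>
     (\<forall>x\<in>W. frechet_derivative f (at x) \<noteq> (\<lambda>v. 0) \<and>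
            D x = {v. frechet_derivative f (at x) v = 0})"

definition codim1_foliation :: "'a::euclidean_space set \<Rightarrow> ('a \<Rightarrow> 'a set) \<Rightarrow> bool" where
  "codim1_foliation U D \<longleftrightarrow> (\<forall>p\<in>U. \<exists>W f. p \<in> W \<and> W \<subseteq> U \<and> defining_function W D f)"

text \<open>A (co)frame indexed by \<open>0, \<dots>, k\<close>.\<close>

definition smooth_frame :: "nat \<Rightarrow> 'a::euclidean_space set \<Rightarrow> (nat \<Rightarrow> 'a \<Rightarrow> 'a) \<Rightarrow> bool" where
  "smooth_frame k W E \<longleftrightarrow> (\<forall>i\<le>k. smooth_on W (E i)) \<and>
     (\<forall>x\<in>W. inj_on (\<lambda>i. E i x) {..k} \<and> independent ((\<lambda>i. E i x) ` {..k}) \<and>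
            span ((\<lambda>i. E i x) ` {..k}) = UNIV)"

definition poly_curve :: "nat \<Rightarrow> (nat \<Rightarrow> 'a \<Rightarrow> 'b::real_normed_vector) \<Rightarrow> real \<Rightarrow> 'a \<Rightarrow> 'b" where
  "poly_curve k V t x = (\<Sum>i\<le>k. t ^ i *\<^sub>R V i x)"

definition t_deriv :: "(real \<Rightarrow> 'a \<Rightarrow> 'b::real_normed_vector) \<Rightarrow> real \<Rightarrow> 'a \<Rightarrow> 'b" where
  "t_deriv F t x = vector_derivative (\<lambda>s. F s x) (at t)"

definition coframe_curve :: "nat \<Rightarrow> 'a::euclidean_space set \<Rightarrow> (real \<Rightarrow> 'a \<Rightarrow> 'a) \<Rightarrow> bool" where
  "coframe_curve k W \<omega> \<longleftrightarrow>
     (\<exists>\<eta>. smooth_frame k W \<eta> \<and> (\<forall>x\<in>W. \<forall>t. \<omega> t x = poly_curve k \<eta> t x))"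

definition ker_form :: "('a::real_inner \<Rightarrow> 'a) \<Rightarrow> 'a \<Rightarrow> 'a set" where
  "ker_form \<omega> x = {v. \<omega> x \<bullet> v = 0}"

definition web_form :: "nat \<Rightarrow> 'a::euclidean_space set \<Rightarrow> (real \<Rightarrow> 'a \<Rightarrow> 'a set) \<Rightarrow>
    (real \<Rightarrow> 'a \<Rightarrow> 'a) \<Rightarrow> bool" where
  "web_form k W D \<omega> \<longleftrightarrow> coframe_curve k W \<omega> \<and> (\<forall>x\<in>W. \<forall>t. D t x = ker_form (\<omega> t) x)"

text \<open>\<open>D t x\<close> is the tangent space at \<open>x\<close> of the foliation with parameter \<open>t\<close>.\<close>

definition veronese_web :: "nat \<Rightarrow> 'a::euclidean_space set \<Rightarrow> (real \<Rightarrow> 'a \<Rightarrow> 'a set) \<Rightarrow> bool" where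
  "veronese_web k U D \<longleftrightarrow> (\<forall>t. codim1_foliation U (D t)) \<and>
     (\<forall>p\<in>U. \<exists>W \<omega>. open W \<and> p \<in> W \<and> W \<subseteq> U \<and> web_form k W D \<omega>)"

definition dual_curve :: "nat \<Rightarrow> 'a::euclidean_space set \<Rightarrow> (real \<Rightarrow> 'a \<Rightarrow> 'a) \<Rightarrow>
    (nat \<Rightarrow> 'a \<Rightarrow> 'a) \<Rightarrow> bool" where
  "dual_curve k W \<omega> V \<longleftrightarrow> smooth_frame k W V \<and>
     (\<forall>x\<in>W. \<forall>t. \<forall>j<k. poly_curve k V t x \<in> ker_form ((t_deriv ^^ j) \<omega> t) x)"

text \<open>
  The cone over the rational normal curve of degree \<open>k\<close> spanned by \<open>V\<close>, in homogeneous
  parameters: \<open>a = 1, b = t\<close> gives the line of \<open>poly_curve k V t x\<close>, and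
  \<open>a = 0\<close> the line at infinite \<open>t\<close>, spanned by \<open>V k x\<close>.
\<close>

definition veronese_cone ::
    "nat \<Rightarrow> (nat \<Rightarrow> 'a::euclidean_space \<Rightarrow> 'a) \<Rightarrow> 'a \<Rightarrow> 'a set" where
  "veronese_cone k V x =
     {c *\<^sub>R (\<Sum>i\<le>k. (a ^ (k - i) * b ^ i) *\<^sub>R V i x) | a b c :: real. True}"

definition paraconformal_structure ::
    "nat \<Rightarrow> 'a::euclidean_space set \<Rightarrow> ('a \<Rightarrow> 'a set) \<Rightarrow> bool" where
  "paraconformal_structure k U C \<longleftrightarrow>
     (\<forall>p\<in>U. \<exists>W V. open W \<and> p \<in> W \<and> W \<subseteq> U \<and> smooth_frame k W V \<and>
        (\<forall>x\<in>W. C x = veronese_cone k V x))"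

definition paraconformal_of_web :: "nat \<Rightarrow> 'a::euclidean_space set \<Rightarrow>
    (real \<Rightarrow> 'a \<Rightarrow> 'a set) \<Rightarrow> ('a \<Rightarrow> 'a set) \<Rightarrow> bool" where
  "paraconformal_of_web k U D C \<longleftrightarrow>
     (\<forall>p\<in>U. \<exists>W \<omega> V. open W \<and> p \<in> W \<and> W \<subseteq> U \<and>
        web_form k W D \<omega> \<and> dual_curve k W \<omega> V \<and> (\<forall>x\<in>W. C x = veronese_cone k V x))"

subsection \<open>Connections\<close>

text \<open>
  A connection on \<open>U\<close> is given by its Christoffel symbols with respect to the coordinate fields:
  \<open>\<Gamma> x u v\<close> is the difference between the covariant derivative and the coordinate derivative
  of a field with value \<open>v\<close> in the direction \<open>u\<close>. It need not be symmetric in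
  \<open>u\<close> and \<open>v\<close>.
\<close>

definition connection :: "'a::euclidean_space set \<Rightarrow> ('a \<Rightarrow> 'a \<Rightarrow> 'a \<Rightarrow> 'a) \<Rightarrow> bool" where
  "connection U \<Gamma> \<longleftrightarrow> (\<forall>x\<in>U. bilinear (\<Gamma> x)) \<and> (\<forall>u v. smooth_on U (\<lambda>x. \<Gamma> x u v))"

definition nabla :: "('a::euclidean_space \<Rightarrow> 'a \<Rightarrow> 'a \<Rightarrow> 'a) \<Rightarrow> ('a \<Rightarrow> 'a) \<Rightarrow> ('a \<Rightarrow> 'a) \<Rightarrow> 'a \<Rightarrow> 'a" where
  "nabla \<Gamma> Y X x = frechet_derivative X (at x) (Y x) + \<Gamma> x (Y x) (X x)"

definition unique_connection ::
    "'a::euclidean_space set \<Rightarrow> (('a \<Rightarrow> 'a \<Rightarrow> 'a \<Rightarrow> 'a) \<Rightarrow> bool) \<Rightarrow> bool" where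
  "unique_connection U P \<longleftrightarrow>
     (\<exists>\<Gamma>. connection U \<Gamma> \<and> P \<Gamma> \<and> (\<forall>\<Gamma>'. connection U \<Gamma>' \<and> P \<Gamma>' \<longrightarrow> (\<forall>x\<in>U. \<Gamma>' x = \<Gamma> x)))"

definition torsion :: "('a::euclidean_space \<Rightarrow> 'a \<Rightarrow> 'a \<Rightarrow> 'a) \<Rightarrow> ('a \<Rightarrow> 'a) \<Rightarrow> ('a \<Rightarrow> 'a) \<Rightarrow> 'a \<Rightarrow> 'a" where
  "torsion \<Gamma> X Y x = nabla \<Gamma> X Y x - nabla \<Gamma> Y X x - lie_bracket X Y x"

definition torsion_free :: "'a::euclidean_space set \<Rightarrow> ('a \<Rightarrow> 'a \<Rightarrow> 'a \<Rightarrow> 'a) \<Rightarrow> bool" where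
  "torsion_free U \<Gamma> \<longleftrightarrow>
     (\<forall>X Y. smooth_on U X \<and> smooth_on U Y \<longrightarrow> (\<forall>x\<in>U. torsion \<Gamma> X Y x = 0))"

definition paraconformal_connection :: "nat \<Rightarrow> 'a::euclidean_space set \<Rightarrow>
    (nat \<Rightarrow> 'a \<Rightarrow> 'a) \<Rightarrow> ('a \<Rightarrow> 'a \<Rightarrow> 'a \<Rightarrow> 'a) \<Rightarrow> bool" where
  "paraconformal_connection k U V \<Gamma> \<longleftrightarrow>
     (\<forall>Y t. smooth_on U Y \<longrightarrow>
        (\<forall>x\<in>U. nabla \<Gamma> Y (poly_curve k V t) x
                 \<in> span {poly_curve k V t x, t_deriv (poly_curve k V) t x}))"

text \<open>\<open>\<gamma>'\<close> is the velocity of \<open>\<gamma>\<close>; the second clause is the geodesic equation.\<close>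

definition geodesic_on :: "'a::euclidean_space set \<Rightarrow> ('a \<Rightarrow> 'a \<Rightarrow> 'a \<Rightarrow> 'a) \<Rightarrow> real set \<Rightarrow>
    (real \<Rightarrow> 'a) \<Rightarrow> (real \<Rightarrow> 'a) \<Rightarrow> bool" where
  "geodesic_on U \<Gamma> I \<gamma> \<gamma>' \<longleftrightarrow>
     (\<forall>s\<in>I. \<gamma> s \<in> U \<and> (\<gamma> has_vector_derivative \<gamma>' s) (at s) \<and>
            (\<gamma>' has_vector_derivative - \<Gamma> (\<gamma> s) (\<gamma>' s) (\<gamma>' s)) (at s))"

text \<open>\<open>T x\<close> is the tangent space of the submanifold \<open>N\<close> at \<open>x\<close>.\<close>

definition totally_geodesic_submanifold :: "'a::euclidean_space set \<Rightarrow>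
    ('a \<Rightarrow> 'a \<Rightarrow> 'a \<Rightarrow> 'a) \<Rightarrow> 'a set \<Rightarrow> ('a \<Rightarrow> 'a set) \<Rightarrow> bool" where
  "totally_geodesic_submanifold U \<Gamma> N T \<longleftrightarrow>
     (\<forall>\<gamma> \<gamma>' \<epsilon>. \<epsilon> > 0 \<and> geodesic_on U \<Gamma> {-\<epsilon><..<\<epsilon>} \<gamma> \<gamma>' \<and> \<gamma> 0 \<in> N \<and> \<gamma>' 0 \<in> T (\<gamma> 0) \<longrightarrow>
        (\<forall>\<^sub>F s in at 0. \<gamma> s \<in> N))"

text \<open>
  Being totally geodesic is a local property of a leaf, and the leaves are glued from the level
  sets of local defining functions; hence it is imposed on the latter.
\<close>

definition totally_geodesic_for_web :: "'a::euclidean_space set \<Rightarrow> (real \<Rightarrow> 'a \<Rightarrow> 'a set) \<Rightarrow>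
    ('a \<Rightarrow> 'a \<Rightarrow> 'a \<Rightarrow> 'a) \<Rightarrow> bool" where
  "totally_geodesic_for_web U D \<Gamma> \<longleftrightarrow>
     (\<forall>t W f c. W \<subseteq> U \<and> defining_function W (D t) f \<longrightarrow>
        totally_geodesic_submanifold U \<Gamma> {x\<in>W. f x = c} (D t))"

subsection \<open>Metrics and Einstein--Weyl structures\<close>

definition metric_on :: "'a::euclidean_space set \<Rightarrow> ('a \<Rightarrow> 'a \<Rightarrow> 'a \<Rightarrow> real) \<Rightarrow> bool" where
  "metric_on U g \<longleftrightarrow> (\<forall>u v. smooth_on U (\<lambda>x. g x u v)) \<and>
     (\<forall>x\<in>U. bilinear (g x) \<and> (\<forall>u v. g x u v = g x v u) \<and>
            (\<forall>u. (\<forall>v. g x u v = 0) \<longrightarrow> u = 0))"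

definition nabla_metric :: "('a::euclidean_space \<Rightarrow> 'a \<Rightarrow> 'a \<Rightarrow> 'a) \<Rightarrow> ('a \<Rightarrow> 'a \<Rightarrow> 'a \<Rightarrow> real) \<Rightarrow>
    ('a \<Rightarrow> 'a) \<Rightarrow> ('a \<Rightarrow> 'a) \<Rightarrow> ('a \<Rightarrow> 'a) \<Rightarrow> 'a \<Rightarrow> real" where
  "nabla_metric \<Gamma> g Y X Z x =
     frechet_derivative (\<lambda>z. g z (X z) (Z z)) (at x) (Y x)
       - g x (nabla \<Gamma> Y X x) (Z x) - g x (X x) (nabla \<Gamma> Y Z x)"

definition weyl_form :: "'a::euclidean_space set \<Rightarrow> ('a \<Rightarrow> 'a \<Rightarrow> 'a \<Rightarrow> real) \<Rightarrow>
    ('a \<Rightarrow> 'a \<Rightarrow> 'a \<Rightarrow> 'a) \<Rightarrow> ('a \<Rightarrow> 'a) \<Rightarrow> bool" where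
  "weyl_form U g \<Gamma> \<phi> \<longleftrightarrow> smooth_on U \<phi> \<and>
     (\<forall>Y X Z. smooth_on U Y \<and> smooth_on U X \<and> smooth_on U Z \<longrightarrow>
        (\<forall>x\<in>U. nabla_metric \<Gamma> g Y X Z x = (\<phi> x \<bullet> Y x) * g x (X x) (Z x)))"

definition curvature :: "('a::euclidean_space \<Rightarrow> 'a \<Rightarrow> 'a \<Rightarrow> 'a) \<Rightarrow>
    ('a \<Rightarrow> 'a) \<Rightarrow> ('a \<Rightarrow> 'a) \<Rightarrow> ('a \<Rightarrow> 'a) \<Rightarrow> 'a \<Rightarrow> 'a" where
  "curvature \<Gamma> X Y Z x =
     nabla \<Gamma> X (nabla \<Gamma> Y Z) x - nabla \<Gamma> Y (nabla \<Gamma> X Z) x - nabla \<Gamma> (lie_bracket X Y) Z x"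

text \<open>
  The trace of \<open>X \<mapsto> R(X, u) v\<close>. The curvature is tensorial, so constant extensions of the
  arguments suffice.
\<close>

definition ricci :: "(real ^ 'n \<Rightarrow> real ^ 'n \<Rightarrow> real ^ 'n \<Rightarrow> real ^ 'n) \<Rightarrow>
    real ^ 'n::finite \<Rightarrow> real ^ 'n \<Rightarrow> real ^ 'n \<Rightarrow> real" where
  "ricci \<Gamma> x u v = (\<Sum>i\<in>UNIV. curvature \<Gamma> (\<lambda>_. axis i 1) (\<lambda>_. u) (\<lambda>_. v) x $ i)"

definition metric_matrix :: "(real ^ 'n \<Rightarrow> real ^ 'n \<Rightarrow> real ^ 'n \<Rightarrow> real) \<Rightarrow>
    real ^ 'n::finite \<Rightarrow> real ^ 'n ^ 'n" where
  "metric_matrix g x = (\<chi> i j. g x (axis i 1) (axis j 1))"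

definition scalar_curvature :: "(real ^ 'n \<Rightarrow> real ^ 'n \<Rightarrow> real ^ 'n \<Rightarrow> real) \<Rightarrow>
    (real ^ 'n \<Rightarrow> real ^ 'n \<Rightarrow> real ^ 'n \<Rightarrow> real ^ 'n) \<Rightarrow> real ^ 'n::finite \<Rightarrow> real" where
  "scalar_curvature g \<Gamma> x =
     (\<Sum>i\<in>UNIV. \<Sum>j\<in>UNIV. matrix_inv (metric_matrix g x) $ i $ j * ricci \<Gamma> x (axis i 1) (axis j 1))"

text \<open>In dimension three.\<close>

definition einstein_weyl :: "(real ^ 'n::finite) set \<Rightarrow> (real ^ 'n \<Rightarrow> real ^ 'n \<Rightarrow> real ^ 'n \<Rightarrow> real) \<Rightarrow>
    (real ^ 'n \<Rightarrow> real ^ 'n \<Rightarrow> real ^ 'n \<Rightarrow> real ^ 'n) \<Rightarrow> bool" where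
  "einstein_weyl U g \<Gamma> \<longleftrightarrow> torsion_free U \<Gamma> \<and> (\<exists>\<phi>. weyl_form U g \<Gamma> \<phi>) \<and>
     (\<forall>x\<in>U. \<forall>u v. (ricci \<Gamma> x u v + ricci \<Gamma> x v u) / 2 = 1 / 3 * scalar_curvature g \<Gamma> x * g x u v)"

subsection \<open>The system and the web of a solution\<close>

text \<open>
  \<open>e\<close> enumerates the coordinates: \<open>x\<^sub>i\<close> is the component with index
  \<open>e i\<close>, for \<open>i = 0, \<dots>, k\<close>.
\<close>

definition system_coeff :: "nat \<Rightarrow> (nat \<Rightarrow> real) \<Rightarrow> nat \<Rightarrow> nat \<Rightarrow> nat \<Rightarrow> real" where
  "system_coeff k \<tau> i j l = (\<tau> i - \<tau> j) * (\<tau> (k + 1) - \<tau> l)"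

definition admissible_solution :: "nat \<Rightarrow> (nat \<Rightarrow> 'n::finite) \<Rightarrow> (nat \<Rightarrow> real) \<Rightarrow>
    (real ^ 'n) set \<Rightarrow> (real ^ 'n \<Rightarrow> real) \<Rightarrow> bool" where
  "admissible_solution k e \<tau> U w \<longleftrightarrow> smooth_on U w \<and>
     (\<forall>i\<le>k. \<forall>x\<in>U. partial (e i) w x \<noteq> 0) \<and>
     (\<forall>i j l. i < j \<and> j < l \<and> l \<le> k \<longrightarrow> (\<forall>x\<in>U.
        system_coeff k \<tau> i j l * partial (e i) (partial (e j) w) x * partial (e l) w x +
        system_coeff k \<tau> j l i * partial (e j) (partial (e l) w) x * partial (e i) w x +
        system_coeff k \<tau> l i j * partial (e l) (partial (e i) w) x * partial (e j) w x = 0))"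

definition solution_form :: "nat \<Rightarrow> (nat \<Rightarrow> 'n::finite) \<Rightarrow> (nat \<Rightarrow> real) \<Rightarrow>
    (real ^ 'n \<Rightarrow> real) \<Rightarrow> real \<Rightarrow> real ^ 'n \<Rightarrow> real ^ 'n" where
  "solution_form k e \<tau> w t x =
     (\<Sum>i\<le>k. ((\<tau> (k + 1) - \<tau> i) * (\<Prod>j\<in>{..k} - {i}. t - \<tau> j) * partial (e i) w x) *\<^sub>R axis (e i) 1)"

text \<open>
  The case \<open>k = 2\<close>. For a tangent vector \<open>v\<close> write \<open>\<omega>(t)(v) = a t\<^sup>2 + b t + c\<close>;
  the vector lies on the cone iff this quadratic polynomial in \<open>t\<close> has a double root, and
  \<open>solution_metric\<close> is \<open>4 a c - b\<^sup>2\<close>. The last two products in the coefficient come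
  from \<open>2 a c\<close>. They cannot be dropped: the remaining terms alone give
  \<open>2 a c - b\<^sup>2\<close>, which takes a non-zero multiple of \<open>t\<^sup>2\<close> as its value on the
  dual curve at \<open>t\<close> and so does not vanish on the cone.
\<close>

definition solution_metric :: "(nat \<Rightarrow> 'n::finite) \<Rightarrow> (nat \<Rightarrow> real) \<Rightarrow> (real ^ 'n \<Rightarrow> real) \<Rightarrow>
    real ^ 'n \<Rightarrow> real ^ 'n \<Rightarrow> real ^ 'n \<Rightarrow> real" where
  "solution_metric e \<tau> w x u v =
     (\<Sum>i\<le>2. \<Sum>j\<le>2. (\<tau> 3 - \<tau> i) * (\<tau> 3 - \<tau> j) *
        ((\<tau> i)\<^sup>2 + (\<tau> j)\<^sup>2 - \<tau> i * \<tau> j - (\<Sum>l\<le>2. (\<tau> l)\<^sup>2)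
          + (\<Prod>m\<in>{..2} - {i}. \<tau> m) + (\<Prod>m\<in>{..2} - {j}. \<tau> m)) *
        partial (e i) w x * partial (e j) w x * (u $ e i) * (v $ e j))"

definition solution_weyl_form :: "(nat \<Rightarrow> 'n::finite) \<Rightarrow> (real ^ 'n \<Rightarrow> real) \<Rightarrow> real ^ 'n \<Rightarrow> real ^ 'n" where
  "solution_weyl_form e w x =
     (partial (e 0) (partial (e 1) w) x / partial (e 1) w x +
      partial (e 0) (partial (e 2) w) x / partial (e 2) w x) *\<^sub>R axis (e 0) 1 +
     (partial (e 0) (partial (e 1) w) x / partial (e 0) w x +
      partial (e 1) (partial (e 2) w) x / partial (e 2) w x) *\<^sub>R axis (e 1) 1 +
     (partial (e 0) (partial (e 2) w) x / partial (e 0) w x +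
      partial (e 1) (partial (e 2) w) x / partial (e 1) w x) *\<^sub>R axis (e 2) 1"

text \<open>\<open>\<nabla>\<partial>\<^sub>i = (d(\<partial>\<^sub>i w)/\<partial>\<^sub>i w + \<alpha>) \<partial>\<^sub>i\<close>\<close>

definition solution_connection :: "nat \<Rightarrow> (nat \<Rightarrow> 'n::finite) \<Rightarrow> (real ^ 'n) set \<Rightarrow>
    (real ^ 'n \<Rightarrow> real) \<Rightarrow> (real ^ 'n \<Rightarrow> real ^ 'n) \<Rightarrow>
    (real ^ 'n \<Rightarrow> real ^ 'n \<Rightarrow> real ^ 'n \<Rightarrow> real ^ 'n) \<Rightarrow> bool" where
  "solution_connection k e U w \<alpha> \<Gamma> \<longleftrightarrow> connection U \<Gamma> \<and>
     (\<forall>Y. smooth_on U Y \<longrightarrow> (\<forall>i\<le>k. \<forall>x\<in>U.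
        nabla \<Gamma> Y (\<lambda>_. axis (e i) 1) x =
          (frechet_derivative (partial (e i) w) (at x) (Y x) / partial (e i) w x + \<alpha> x \<bullet> Y x)
            *\<^sub>R axis (e i) 1))"

end

theory Submission
  imports Defs
begin

text \<open>
  Evaluated on a tangent vector, \<open>\<omega>(t)\<close> is a polynomial of degree \<open>k\<close> in \<open>t\<close>, and its values at
  \<open>t\<^sub>0, \<dots>, t\<^sub>k\<close> are multiples of the coordinates of the vector; so the coordinates diagonalise
  everything, and Lagrange interpolation replaces computations with the frame. The system for
  \<open>w\<close> is the integrability condition for a single further value of \<open>t\<close>, and it implies the
  condition for all \<open>t\<close>; Frobenius' theorem, obtained by integrating along lines with Picard
  iteration, then gives the foliations. Conversely, defining functions of the foliations at
  \<open>t\<^sub>0, \<dots>, t\<^sub>k\<close> are coordinates, \<open>w\<close> is a defining function at \<open>t\<^bsub>k+1\<^esub>\<close>, and the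
  foliation at one more value of \<open>t\<close> gives the system.

  A connection is compared with the flat diagonal one through its difference tensor. Being
  paraconformal makes each endomorphism of this tensor an element of \<open>gl(2)\<close> acting on binary forms
  of degree \<open>k\<close>, and total geodesy of the coordinate foliations kills entries of its matrix; for
  \<open>k > 2\<close> only scalars are left, while for \<open>k = 2\<close> one more term, given by the bracket of
  binary quadratic forms, is fixed by the absence of torsion.
\<close>


text \<open>The weights \<open>\<tau> (k + 1) - \<tau> i\<close> make the form at
  \<open>\<tau> (k + 1)\<close> a multiple of dw: multiplied by the product over the other nodes
  they give the product over all nodes, the same for every i. One more parameter value t decides
  integrability because, for the coefficients g_i(t) of \<partial>_i w dx_i, the products g_l (g_j -
  g_i) occurring in \<omega> \<and> d\<omega> equal \<open>\<tau> i - \<tau> j\<close> times the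
  weight of l times a factor common to the three cyclic terms. That factor vanishes at the k + 2
  nodes and nowhere else, so the nodes carry no information and every other t gives the same
  condition. The split between k > 2 and k = 2 comes from counting zeros: the gl(2) part of the
  difference tensor is a quadratic polynomial evaluated at the nodes, and total geodesy makes it
  vanish at k of them. Three zeros kill it; two zeros leave one number for each coordinate
  direction, and symmetry then yields a linear system for these numbers.\<close>

section \<open>Maps of class C^k depending on a continuous parameter\<close>

text \<open>Continuity is required jointly in (s, x), but derivatives are taken in x only: this is
  what solutions of an ODE provide as functions of time and initial data, and what survives
  integration in s.\<close>

fun Ck_param :: "'t::topological_space set \<Rightarrow> nat \<Rightarrow> 'a::real_normed_vector set \<Rightarrow>
    ('t \<Rightarrow> 'a \<Rightarrow> 'b::real_normed_vector) \<Rightarrow> bool" where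
  "Ck_param S 0 U q \<longleftrightarrow> continuous_on (S \<times> U) (\<lambda>(s, x). q s x)"
| "Ck_param S (Suc n) U q \<longleftrightarrow> continuous_on (S \<times> U) (\<lambda>(s, x). q s x) \<and>
     (\<forall>s\<in>S. \<forall>x\<in>U. q s differentiable (at x)) \<and>
     (\<forall>v. Ck_param S n U (\<lambda>s x. frechet_derivative (q s) (at x) v))"

lemma Ck_param_continuous: "Ck_param S n U q \<Longrightarrow> continuous_on (S \<times> U) (\<lambda>(s, x). q s x)"
  by (cases n) auto

lemma Ck_param_mono: "Ck_param S (Suc n) U q \<Longrightarrow> Ck_param S n U q"
  by (induction n arbitrary: q) auto

lemma Ck_param_cong_imp:
  assumes "open U" "\<And>s x. s \<in> S \<Longrightarrow> x \<in> U \<Longrightarrow> q s x = r s x" "Ck_param S n U q"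
  shows "Ck_param S n U r"
  using assms(2,3)
proof (induction n arbitrary: q r)
  case 0
  have "continuous_on (S \<times> U) (\<lambda>(s, x). q s x) = continuous_on (S \<times> U) (\<lambda>(s, x). r s x)"
    by (rule continuous_on_cong) (auto simp: 0)
  with 0 show ?case by simp
next
  case (Suc n)
  have c: "continuous_on (S \<times> U) (\<lambda>(s, x). q s x) = continuous_on (S \<times> U) (\<lambda>(s, x). r s x)"
    by (rule continuous_on_cong) (auto simp: Suc)
  have d: "(r s has_derivative frechet_derivative (q s) (at x)) (at x)" if "s \<in> S" "x \<in> U" for s x
  proof (rule has_derivative_transform_within_open[OF _ \<open>open U\<close> \<open>x \<in> U\<close>])
    show "(q s has_derivative frechet_derivative (q s) (at x)) (at x)"
      using Suc.prems(2) that frechet_derivative_works by auto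
  qed (use Suc.prems(1) that in auto)
  have "Ck_param S n U (\<lambda>s x. frechet_derivative (r s) (at x) v)" for v
  proof (rule Suc.IH)
    show "Ck_param S n U (\<lambda>s x. frechet_derivative (q s) (at x) v)" using Suc.prems by simp
    show "frechet_derivative (q s) (at x) v = frechet_derivative (r s) (at x) v"
      if "s \<in> S" "x \<in> U" for s x
      using frechet_derivative_at[OF d[OF that]] by simp
  qed
  then show ?case using c d Suc.prems(2) unfolding Ck_param.simps differentiable_def by blast
qed

text \<open>A derivative may be supplied in any closed form \<open>q'\<close>; the inductions below
  then work with such formulas instead of \<open>frechet_derivative\<close>.\<close>

lemma Ck_param_SucI:
  assumes "open U" "continuous_on (S \<times> U) (\<lambda>(s, x). q s x)"
    and "\<And>s x. s \<in> S \<Longrightarrow> x \<in> U \<Longrightarrow> (q s has_derivative q' s x) (at x)"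
    and "\<And>v. Ck_param S n U (\<lambda>s x. q' s x v)"
  shows "Ck_param S (Suc n) U q"
  unfolding Ck_param.simps
proof (intro conjI ballI allI)
  fix v
  show "Ck_param S n U (\<lambda>s x. frechet_derivative (q s) (at x) v)"
    by (rule Ck_param_cong_imp[OF \<open>open U\<close> _ assms(4)[of v]]) (metis assms(3) frechet_derivative_at)
qed (use assms in \<open>auto simp: differentiable_def\<close>)

lemma Ck_param_derivative:
  "Ck_param S (Suc n) U q \<Longrightarrow> s \<in> S \<Longrightarrow> x \<in> U \<Longrightarrow>
     (q s has_derivative frechet_derivative (q s) (at x)) (at x)"
  using frechet_derivative_works by auto

lemma Ck_param_const:
  fixes c :: "'t::topological_space \<Rightarrow> 'b::real_normed_vector"
  assumes "open U" "continuous_on S c"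
  shows "Ck_param S n U (\<lambda>s x. c s)"
  using assms(2)
proof (induction n arbitrary: c)
  case 0
  then show ?case by (auto simp: case_prod_beta intro!: continuous_intros continuous_on_compose2[OF 0])
next
  case (Suc n)
  show ?case
  proof (rule Ck_param_SucI[OF \<open>open U\<close>, where q' = "\<lambda>s x v. 0"])
    show "Ck_param S n U (\<lambda>s x. 0 :: 'b)" using Suc.IH[of "\<lambda>_. 0"] by auto
  qed (use Suc.prems in \<open>auto simp: case_prod_beta intro!: continuous_intros continuous_on_compose2[OF Suc.prems]\<close>)
qed

lemma Ck_param_ident:
  assumes "open U"
  shows "Ck_param S n U (\<lambda>s x. x)"
proof (cases n)
  case 0
  then show ?thesis by (auto simp: case_prod_beta intro!: continuous_intros)
next
  case (Suc m)
  show ?thesis unfolding Suc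
    by (rule Ck_param_SucI[OF assms, where q' = "\<lambda>s x v. v"])
       (auto simp: case_prod_beta intro!: continuous_intros Ck_param_const[OF assms])
qed

lemma Ck_param_linear:
  assumes "open U" "bounded_linear L" "Ck_param S n U q"
  shows "Ck_param S n U (\<lambda>s x. L (q s x))"
  using assms(3)
proof (induction n arbitrary: q)
  case 0
  then show ?case
    using bounded_linear.continuous_on[OF assms(2)] by (auto simp: case_prod_beta)
next
  case (Suc n)
  show ?case
  proof (rule Ck_param_SucI[OF \<open>open U\<close>, where q' = "\<lambda>s x v. L (frechet_derivative (q s) (at x) v)"])
    show "continuous_on (S \<times> U) (\<lambda>(s, x). L (q s x))"
      using bounded_linear.continuous_on[OF assms(2)] Ck_param_continuous[OF Suc.prems]
      by (auto simp: case_prod_beta)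
    show "((\<lambda>x. L (q s x)) has_derivative (\<lambda>v. L (frechet_derivative (q s) (at x) v))) (at x)"
      if "s \<in> S" "x \<in> U" for s x
      using bounded_linear.has_derivative[OF assms(2) Ck_param_derivative[OF Suc.prems that]] .
    show "Ck_param S n U (\<lambda>s x. L (frechet_derivative (q s) (at x) v))" for v
      by (rule Suc.IH) (use Suc.prems in simp)
  qed
qed

lemma Ck_param_add:
  assumes "open U" "Ck_param S n U q" "Ck_param S n U r"
  shows "Ck_param S n U (\<lambda>s x. q s x + r s x)"
  using assms(2,3)
proof (induction n arbitrary: q r)
  case 0
  then show ?case by (auto simp: case_prod_beta intro!: continuous_intros)
next
  case (Suc n)
  show ?case
  proof (rule Ck_param_SucI[OF \<open>open U\<close>,
        where q' = "\<lambda>s x v. frechet_derivative (q s) (at x) v + frechet_derivative (r s) (at x) v"])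
    show "continuous_on (S \<times> U) (\<lambda>(s, x). q s x + r s x)"
      using Suc.prems[THEN Ck_param_continuous] by (auto simp: case_prod_beta intro!: continuous_intros)
    show "Ck_param S n U (\<lambda>s x. frechet_derivative (q s) (at x) v + frechet_derivative (r s) (at x) v)" for v
      by (rule Suc.IH) (use Suc.prems in auto)
  qed (use Suc.prems[THEN Ck_param_derivative] in \<open>auto intro!: has_derivative_add\<close>)
qed

lemma Ck_param_sum:
  assumes "open U" "\<And>i. i \<in> I \<Longrightarrow> Ck_param S n U (q i)"
  shows "Ck_param S n U (\<lambda>s x. \<Sum>i\<in>I. q i s x)"
  using assms(2)
  by (induction I rule: infinite_finite_induct)
     (auto intro!: Ck_param_const[OF assms(1), where c = "\<lambda>_. 0"] Ck_param_add[OF assms(1)])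

lemma Ck_param_bilinear:
  assumes "open U" "bounded_bilinear B" "Ck_param S n U q" "Ck_param S n U r"
  shows "Ck_param S n U (\<lambda>s x. B (q s x) (r s x))"
  using assms(3,4)
proof (induction n arbitrary: q r)
  case 0
  then show ?case using bounded_bilinear.continuous_on[OF assms(2)] by (auto simp: case_prod_beta)
next
  case (Suc n)
  show ?case
  proof (rule Ck_param_SucI[OF \<open>open U\<close>, where q' = "\<lambda>s x v. B (q s x) (frechet_derivative (r s) (at x) v)
        + B (frechet_derivative (q s) (at x) v) (r s x)"])
    show "continuous_on (S \<times> U) (\<lambda>(s, x). B (q s x) (r s x))"
      using Suc.prems[THEN Ck_param_continuous] bounded_bilinear.continuous_on[OF assms(2)]
      by (auto simp: case_prod_beta)
    show "Ck_param S n U (\<lambda>s x. B (q s x) (frechet_derivative (r s) (at x) v)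
        + B (frechet_derivative (q s) (at x) v) (r s x))" for v
      using Suc.prems Suc.prems[THEN Ck_param_mono]
      by (intro Ck_param_add \<open>open U\<close> Suc.IH) auto
  qed (use Suc.prems[THEN Ck_param_derivative] in \<open>auto intro!: bounded_bilinear.FDERIV[OF assms(2)]\<close>)
qed

lemma Ck_param_inverse:
  fixes q :: "'t::topological_space \<Rightarrow> 'a::real_normed_vector \<Rightarrow> real"
  assumes "open U" "Ck_param S n U q" "\<And>s x. s \<in> S \<Longrightarrow> x \<in> U \<Longrightarrow> q s x \<noteq> 0"
  shows "Ck_param S n U (\<lambda>s x. inverse (q s x))"
  using assms(2)
proof (induction n)
  case 0
  then show ?case using assms(3) by (auto simp: case_prod_beta intro!: continuous_intros)
next
  case (Suc n)
  show ?case
  proof (rule Ck_param_SucI[OF \<open>open U\<close>, where q' = "\<lambda>s x v. (- frechet_derivative (q s) (at x) v)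
        * (inverse (q s x) * inverse (q s x))"])
    show "continuous_on (S \<times> U) (\<lambda>(s, x). inverse (q s x))"
      using Suc.prems[THEN Ck_param_continuous] assms(3)
      by (auto simp: case_prod_beta intro!: continuous_intros)
    show "Ck_param S n U (\<lambda>s x. (- frechet_derivative (q s) (at x) v)
        * (inverse (q s x) * inverse (q s x)))" for v
      using Suc.prems Suc.IH[OF Ck_param_mono[OF Suc.prems]]
      by (intro Ck_param_bilinear[OF \<open>open U\<close> bounded_bilinear_mult]
            Ck_param_linear[OF \<open>open U\<close> bounded_linear_minus[OF bounded_linear_ident]]) auto
    show "((\<lambda>x. inverse (q s x)) has_derivative (\<lambda>v. (- frechet_derivative (q s) (at x) v)
        * (inverse (q s x) * inverse (q s x)))) (at x)" if "s \<in> S" "x \<in> U" for s x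
      using Deriv.has_derivative_inverse[OF assms(3)[OF that] Ck_param_derivative[OF Suc.prems that]]
      by (simp add: algebra_simps)
  qed
qed

lemma Ck_param_exp:
  fixes q :: "'t::topological_space \<Rightarrow> 'a::real_normed_vector \<Rightarrow> real"
  assumes "open U" "Ck_param S n U q"
  shows "Ck_param S n U (\<lambda>s x. exp (q s x))"
  using assms(2)
proof (induction n)
  case 0
  then show ?case by (auto simp: case_prod_beta intro!: continuous_intros)
next
  case (Suc n)
  show ?case
  proof (rule Ck_param_SucI[OF \<open>open U\<close>, where q' = "\<lambda>s x v. exp (q s x) * frechet_derivative (q s) (at x) v"])
    show "continuous_on (S \<times> U) (\<lambda>(s, x). exp (q s x))"
      using Suc.prems[THEN Ck_param_continuous]
      by (auto simp: case_prod_beta intro!: continuous_intros)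
    show "Ck_param S n U (\<lambda>s x. exp (q s x) * frechet_derivative (q s) (at x) v)" for v
      using Suc.prems Suc.IH[OF Ck_param_mono[OF Suc.prems]]
      by (intro Ck_param_bilinear[OF \<open>open U\<close> bounded_bilinear_mult]) auto
    show "((\<lambda>x. exp (q s x)) has_derivative (\<lambda>v. exp (q s x) * frechet_derivative (q s) (at x) v)) (at x)"
      if "s \<in> S" "x \<in> U" for s x
      using has_derivative_exp[OF Ck_param_derivative[OF Suc.prems that]] by (simp add: mult.commute)
  qed
qed

text \<open>A one-point parameter set turns the parametric notion into the plain one, so each
  closure property is proved once. In the successor step continuity comes from
  differentiability.\<close>

lemma Ck_on_eq_Ck_param: "Ck_on n U f \<longleftrightarrow> Ck_param {0::real} n U (\<lambda>_. f)"
proof (induction n arbitrary: f)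
  case 0
  have "continuous_on ({0::real} \<times> U) (\<lambda>(s, x). f x) \<longleftrightarrow> continuous_on U f"
  proof
    assume c: "continuous_on ({0::real} \<times> U) (\<lambda>(s, x). f x)"
    have "continuous_on U (\<lambda>x. (\<lambda>(s, x). f x) (0::real, x))"
      by (rule continuous_on_compose2[OF c]) (auto intro!: continuous_intros)
    then show "continuous_on U f" by simp
  next
    assume "continuous_on U f"
    then show "continuous_on ({0::real} \<times> U) (\<lambda>(s, x). f x)"
      by (auto simp: case_prod_beta intro!: continuous_on_compose2[of U f] continuous_intros)
  qed
  then show ?case by simp
next
  case (Suc n)
  have "continuous_on ({0::real} \<times> U) (\<lambda>(s, x). f x)" if "\<forall>x\<in>U. f differentiable (at x)"
  proof -
    have "continuous_on U f"
      using that by (meson continuous_at_imp_continuous_on differentiable_imp_continuous_within)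
    then show ?thesis
      by (auto simp: case_prod_beta intro!: continuous_on_compose2[of U f] continuous_intros)
  qed
  then show ?case by (auto simp: Suc)
qed

lemma linear_euclidean_sum:
  fixes L :: "'a::euclidean_space \<Rightarrow> 'b::real_normed_vector"
  assumes "linear L"
  shows "(\<Sum>b\<in>Basis. (v \<bullet> b) *\<^sub>R L b) = L v"
proof -
  have "L v = L (\<Sum>b\<in>Basis. (v \<bullet> b) *\<^sub>R b)" by (simp add: euclidean_representation)
  also have "\<dots> = (\<Sum>b\<in>Basis. (v \<bullet> b) *\<^sub>R L b)" using assms by (simp only: linear_sum linear_scale)
  finally show ?thesis by simp
qed

lemma Ck_param_compose:
  fixes F :: "'b::euclidean_space \<Rightarrow> 'c::real_normed_vector"
  assumes "open U" "open W" "Ck_on n W F" "Ck_param S n U q"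
    and "\<And>s x. s \<in> S \<Longrightarrow> x \<in> U \<Longrightarrow> q s x \<in> W"
  shows "Ck_param S n U (\<lambda>s x. F (q s x))"
  using assms(3,4)
proof (induction n arbitrary: F)
  case 0
  have "continuous_on (S \<times> U) (\<lambda>y. F ((\<lambda>(s, x). q s x) y))"
    by (rule continuous_on_compose2[of W F]) (use 0 assms(5) in auto)
  then show ?case by (simp add: case_prod_beta)
next
  case (Suc n)
  have dF: "(F has_derivative frechet_derivative F (at y)) (at y)" if "y \<in> W" for y
    using Suc.prems(1) that frechet_derivative_works by auto
  \<comment> \<open>The chain rule is expanded over a basis because \<open>Ck_on\<close> controls
    the derivative of F only in a fixed direction, while the inner derivative is a direction that
    moves with s and x.\<close>
  show ?case
  proof (rule Ck_param_SucI[OF \<open>open U\<close>, where q' = "\<lambda>s x v. \<Sum>b\<in>Basis.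
        (frechet_derivative (q s) (at x) v \<bullet> b) *\<^sub>R frechet_derivative F (at (q s x)) b"])
    have "continuous_on W F" using dF has_derivative_continuous
      by (meson continuous_at_imp_continuous_on)
    then have "continuous_on (S \<times> U) (\<lambda>y. F ((\<lambda>(s, x). q s x) y))"
      by (rule continuous_on_compose2) (use Suc.prems(2)[THEN Ck_param_continuous] assms(5) in auto)
    then show "continuous_on (S \<times> U) (\<lambda>(s, x). F (q s x))" by (simp add: case_prod_beta)
    show "((\<lambda>x. F (q s x)) has_derivative (\<lambda>v. \<Sum>b\<in>Basis.
        (frechet_derivative (q s) (at x) v \<bullet> b) *\<^sub>R frechet_derivative F (at (q s x)) b)) (at x)"
      if "s \<in> S" "x \<in> U" for s x
    proof -
      have lin: "linear (frechet_derivative F (at (q s x)))"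
        using dF[OF assms(5)[OF that]] has_derivative_linear by blast
      have eq: "(\<lambda>v. \<Sum>b\<in>Basis. (frechet_derivative (q s) (at x) v \<bullet> b) *\<^sub>R frechet_derivative F (at (q s x)) b)
        = (\<lambda>v. frechet_derivative F (at (q s x)) (frechet_derivative (q s) (at x) v))"
        using linear_euclidean_sum[OF lin] by auto
      show ?thesis unfolding eq
        using has_derivative_compose[OF Ck_param_derivative[OF Suc.prems(2) that] dF[OF assms(5)[OF that]]] .
    qed
    show "Ck_param S n U (\<lambda>s x. \<Sum>b\<in>Basis.
        (frechet_derivative (q s) (at x) v \<bullet> b) *\<^sub>R frechet_derivative F (at (q s x)) b)" for v
    proof (intro Ck_param_sum Ck_param_bilinear[OF _ bounded_bilinear_scaleR] \<open>open U\<close> Suc.IH)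
      show "Ck_param S n U (\<lambda>s x. frechet_derivative (q s) (at x) v \<bullet> b)" for b
        using Suc.prems(2) by (intro Ck_param_linear[OF \<open>open U\<close> bounded_linear_inner_left]) simp
      show "Ck_param S n U q" by (rule Ck_param_mono[OF Suc.prems(2)])
      show "Ck_on n W (\<lambda>y. frechet_derivative F (at y) b)" for b
        using Suc.prems(1) by simp
    qed
  qed
qed

subsection \<open>Smooth maps\<close>

lemma smooth_on_iff: "smooth_on U f \<longleftrightarrow> (\<forall>n. Ck_param {0::real} n U (\<lambda>_. f))"
  by (simp add: smooth_on_def Ck_on_eq_Ck_param)

lemma smooth_on_cong:
  assumes "open U" "\<And>x. x \<in> U \<Longrightarrow> f x = g x" "smooth_on U f"
  shows "smooth_on U g"
  unfolding smooth_on_iff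
proof
  fix n
  show "Ck_param {0::real} n U (\<lambda>_. g)"
    by (rule Ck_param_cong_imp[OF assms(1), where q = "\<lambda>_. f"])
       (use assms(2,3) in \<open>auto simp: smooth_on_iff\<close>)
qed

lemma smooth_on_const: "open U \<Longrightarrow> smooth_on U (\<lambda>_. c)"
  unfolding smooth_on_iff using Ck_param_const[of U "{0}" "\<lambda>_. c"] by auto

lemma smooth_on_ident: "open U \<Longrightarrow> smooth_on U (\<lambda>x. x)"
  unfolding smooth_on_iff using Ck_param_ident by auto

lemma smooth_on_linear: "open U \<Longrightarrow> bounded_linear L \<Longrightarrow> smooth_on U f \<Longrightarrow> smooth_on U (\<lambda>x. L (f x))"
  unfolding smooth_on_iff using Ck_param_linear[of U L] by blast

lemma smooth_on_add: "open U \<Longrightarrow> smooth_on U f \<Longrightarrow> smooth_on U g \<Longrightarrow> smooth_on U (\<lambda>x. f x + g x)"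
  unfolding smooth_on_iff using Ck_param_add[of U] by blast

lemma smooth_on_sum:
  "open U \<Longrightarrow> (\<And>i. i \<in> I \<Longrightarrow> smooth_on U (f i)) \<Longrightarrow> smooth_on U (\<lambda>x. \<Sum>i\<in>I. f i x)"
  unfolding smooth_on_iff using Ck_param_sum[of U I "{0::real}" _ "\<lambda>i _. f i"] by blast

lemma smooth_on_bilinear:
  "open U \<Longrightarrow> bounded_bilinear B \<Longrightarrow> smooth_on U f \<Longrightarrow> smooth_on U g \<Longrightarrow> smooth_on U (\<lambda>x. B (f x) (g x))"
  unfolding smooth_on_iff using Ck_param_bilinear[of U B] by blast

lemmas smooth_on_mult = smooth_on_bilinear[OF _ bounded_bilinear_mult]
lemmas smooth_on_scaleR = smooth_on_bilinear[OF _ bounded_bilinear_scaleR]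
lemmas smooth_on_inner = smooth_on_bilinear[OF _ bounded_bilinear_inner]

lemma smooth_on_minus: "open U \<Longrightarrow> smooth_on U f \<Longrightarrow> smooth_on U (\<lambda>x. - f x)"
  by (rule smooth_on_linear[OF _ bounded_linear_minus[OF bounded_linear_ident]])

lemma smooth_on_diff: "open U \<Longrightarrow> smooth_on U f \<Longrightarrow> smooth_on U g \<Longrightarrow> smooth_on U (\<lambda>x. f x - g x)"
  using smooth_on_add[of U f "\<lambda>x. - g x"] smooth_on_minus[of U g] by simp

lemma smooth_on_inverse:
  fixes f :: "'a::real_normed_vector \<Rightarrow> real"
  shows "open U \<Longrightarrow> smooth_on U f \<Longrightarrow> (\<And>x. x \<in> U \<Longrightarrow> f x \<noteq> 0) \<Longrightarrow> smooth_on U (\<lambda>x. inverse (f x))"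
  unfolding smooth_on_iff using Ck_param_inverse[of U "{0::real}" _ "\<lambda>_. f"] by blast

lemma smooth_on_divide:
  fixes f :: "'a::real_normed_vector \<Rightarrow> real"
  shows "open U \<Longrightarrow> smooth_on U f \<Longrightarrow> smooth_on U g \<Longrightarrow> (\<And>x. x \<in> U \<Longrightarrow> g x \<noteq> 0) \<Longrightarrow>
    smooth_on U (\<lambda>x. f x / g x)"
  unfolding divide_inverse by (intro smooth_on_mult smooth_on_inverse)

lemma smooth_on_prod:
  fixes f :: "'i \<Rightarrow> 'a::real_normed_vector \<Rightarrow> real"
  shows "open U \<Longrightarrow> (\<And>i. i \<in> I \<Longrightarrow> smooth_on U (f i)) \<Longrightarrow> smooth_on U (\<lambda>x. \<Prod>i\<in>I. f i x)"
  by (induction I rule: infinite_finite_induct) (auto intro: smooth_on_const smooth_on_mult)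

lemma smooth_on_nth: "open U \<Longrightarrow> smooth_on U f \<Longrightarrow> smooth_on U (\<lambda>x. f x $ i)"
  using smooth_on_linear[OF _ bounded_linear_vec_nth] .

lemma smooth_on_compose:
  fixes F :: "'b::euclidean_space \<Rightarrow> 'c::real_normed_vector"
  assumes "open U" "open W" "smooth_on W F" "smooth_on U q" "\<And>x. x \<in> U \<Longrightarrow> q x \<in> W"
  shows "smooth_on U (\<lambda>x. F (q x))"
  using assms Ck_param_compose[of U W _ F "{0::real}" "\<lambda>_. q"] unfolding smooth_on_iff
  by (simp add: Ck_on_eq_Ck_param)

lemma smooth_on_vec_lambda:
  assumes "open U" "\<And>i. smooth_on U (\<lambda>x. f x i)"
  shows "smooth_on U (\<lambda>x. (\<chi> i::'n::finite. f x i) :: real ^ 'n)"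
proof -
  have eq: "(\<lambda>x. (\<chi> i. f x i) :: real ^ 'n) = (\<lambda>x. \<Sum>i\<in>UNIV. f x i *\<^sub>R axis i 1)"
    by (auto simp: fun_eq_iff vec_eq_iff axis_def if_distrib cong: if_cong)
  show ?thesis unfolding eq
    by (intro smooth_on_sum smooth_on_scaleR smooth_on_const assms)
qed

lemma smooth_on_subset: "smooth_on U f \<Longrightarrow> V \<subseteq> U \<Longrightarrow> smooth_on V f"
proof -
  have "Ck_on n U f \<Longrightarrow> V \<subseteq> U \<Longrightarrow> Ck_on n V f" for n
    by (induction n arbitrary: f) (auto intro: continuous_on_subset)
  then show "smooth_on U f \<Longrightarrow> V \<subseteq> U \<Longrightarrow> smooth_on V f" unfolding smooth_on_def by blast
qed

lemma smooth_on_has_derivative: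
  "smooth_on U f \<Longrightarrow> x \<in> U \<Longrightarrow> (f has_derivative frechet_derivative f (at x)) (at x)"
  unfolding smooth_on_def using frechet_derivative_works by (metis Ck_on.simps(2))

lemma smooth_on_frechet: "smooth_on U f \<Longrightarrow> smooth_on U (\<lambda>x. frechet_derivative f (at x) v)"
  unfolding smooth_on_def by (metis Ck_on.simps(2))

lemma smooth_on_partial: "smooth_on U f \<Longrightarrow> smooth_on U (partial i f)"
  unfolding partial_def by (rule smooth_on_frechet)

lemma smooth_on_continuous: "smooth_on U f \<Longrightarrow> continuous_on U f"
  unfolding smooth_on_def by (metis Ck_on.simps(1))

lemma smooth_on_linear_derivative:
  "smooth_on U f \<Longrightarrow> x \<in> U \<Longrightarrow> linear (frechet_derivative f (at x))"
  using smooth_on_has_derivative has_derivative_linear by blast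

section \<open>Symmetry of second derivatives\<close>

text \<open>The second difference of f over a small parallelogram is symmetric in u and v, and by
  the mean value theorem it is h^2 times either mixed derivative at some nearby point; continuity at
  x then makes the two derivatives agree there.\<close>

lemma smooth_derivative_symmetric:
  fixes f :: "'a::real_normed_vector \<Rightarrow> real"
  assumes "open U" "smooth_on U f" "x \<in> U"
  shows "frechet_derivative (\<lambda>y. frechet_derivative f (at y) u) (at x) v =
         frechet_derivative (\<lambda>y. frechet_derivative f (at y) v) (at x) u"
proof -
  define D where "D = (\<lambda>u v y. frechet_derivative (\<lambda>y. frechet_derivative f (at y) u) (at y) v)"
  obtain r where r: "r > 0" "ball x r \<subseteq> U" using assms open_contains_ball by blast
  define m where "m = norm u + norm v + 1"
  have m: "m > 0" by (auto simp: m_def add_nonneg_pos)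
  \<comment> \<open>u and v are bound anew here and in \<open>step\<close>, so that both orders of
    the two directions can be used; \<open>m\<close> is symmetric in them.\<close>
  have inU: "x + a *\<^sub>R u + b *\<^sub>R v \<in> U" "norm (a *\<^sub>R u + b *\<^sub>R v) \<le> h * m"
    if "0 \<le> a" "a \<le> h" "0 \<le> b" "b \<le> h" "h * m < r" "norm u + norm v + 1 = m" for a b h u v
  proof -
    have "norm (a *\<^sub>R u + b *\<^sub>R v) \<le> a * norm u + b * norm v"
      using norm_triangle_ineq[of "a *\<^sub>R u" "b *\<^sub>R v"] that by simp
    also have "\<dots> \<le> h * norm u + h * norm v"
      using that by (intro add_mono mult_right_mono) auto
    also have "\<dots> \<le> h * m" using that by (auto simp: algebra_simps that(6)[symmetric])
    finally show n: "norm (a *\<^sub>R u + b *\<^sub>R v) \<le> h * m" .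
    have "dist (x + (a *\<^sub>R u + b *\<^sub>R v)) x < r"
      unfolding dist_norm add_diff_cancel_left' using n that by linarith
    then have "x + (a *\<^sub>R u + b *\<^sub>R v) \<in> ball x r" by (simp only: mem_ball dist_commute)
    then show "x + a *\<^sub>R u + b *\<^sub>R v \<in> U" using r by (auto simp: add.assoc)
  qed
  (* the second difference, by two applications of the mean value theorem *)
  have step: "\<exists>a. norm (a - x) \<le> h * m \<and>
      f (x + h *\<^sub>R u + h *\<^sub>R v) - f (x + h *\<^sub>R u) - f (x + h *\<^sub>R v) + f x = h * h * D u v a"
    if h: "0 < h" "h * m < r" and uv: "norm u + norm v + 1 = m" for h u v
  proof -
    have der1: "((\<lambda>s. f (x + s *\<^sub>R u + b *\<^sub>R v)) has_real_derivative
        frechet_derivative f (at (x + s *\<^sub>R u + b *\<^sub>R v)) u) (at s)"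
      if "0 \<le> s" "s \<le> h" "0 \<le> b" "b \<le> h" for s b
    proof -
      note d = smooth_on_has_derivative[OF assms(2) inU(1)[OF that(1,2,3,4) h(2) uv]]
      have "((\<lambda>s. x + s *\<^sub>R u + b *\<^sub>R v) has_derivative (\<lambda>t. t *\<^sub>R u)) (at s)"
        by (auto intro!: derivative_eq_intros)
      from has_derivative_compose[OF this d]
      show ?thesis
        unfolding has_field_derivative_def using linear_scale[OF smooth_on_linear_derivative[OF assms(2) inU(1)[OF that(1,2,3,4) h(2) uv]]]
        by (simp add: mult.commute[of _ "frechet_derivative f _ u"])
    qed
    let ?g = "\<lambda>s. f (x + s *\<^sub>R u + h *\<^sub>R v) - f (x + s *\<^sub>R u)"
    have "\<exists>s. 0 < s \<and> s < h \<and> ?g h - ?g 0 = (h - 0) *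
        (frechet_derivative f (at (x + s *\<^sub>R u + h *\<^sub>R v)) u - frechet_derivative f (at (x + s *\<^sub>R u)) u)"
    proof (rule MVT2[OF h(1)])
      fix s :: real assume "0 \<le> s" "s \<le> h"
      then show "(?g has_real_derivative
          frechet_derivative f (at (x + s *\<^sub>R u + h *\<^sub>R v)) u - frechet_derivative f (at (x + s *\<^sub>R u)) u) (at s)"
        using DERIV_diff[OF der1[of s h] der1[of s 0]] h by simp
    qed
    then obtain s where s: "0 < s" "s < h" and gs: "?g h - ?g 0 = h *
        (frechet_derivative f (at (x + s *\<^sub>R u + h *\<^sub>R v)) u - frechet_derivative f (at (x + s *\<^sub>R u)) u)"
      by auto
    let ?F = "\<lambda>y. frechet_derivative f (at y) u"
    have der2: "((\<lambda>b. ?F (x + s *\<^sub>R u + b *\<^sub>R v)) has_real_derivative D u v (x + s *\<^sub>R u + b *\<^sub>R v)) (at b)"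
      if "0 \<le> b" "b \<le> h" for b
    proof -
      have y: "x + s *\<^sub>R u + b *\<^sub>R v \<in> U" using inU(1)[of s h b u v] s that h uv by simp
      have "((\<lambda>b. x + s *\<^sub>R u + b *\<^sub>R v) has_derivative (\<lambda>t. t *\<^sub>R v)) (at b)"
        by (auto intro!: derivative_eq_intros)
      from has_derivative_compose[OF this smooth_on_has_derivative[OF smooth_on_frechet[OF assms(2), where v = u] y]]
      show ?thesis
        unfolding has_field_derivative_def D_def
        using linear_scale[OF smooth_on_linear_derivative[OF smooth_on_frechet[OF assms(2), where v = u] y]]
        by (simp add: mult.commute[of _ "frechet_derivative _ _ v"])
    qed
    have "\<exists>b. 0 < b \<and> b < h \<and> ?F (x + s *\<^sub>R u + h *\<^sub>R v) - ?F (x + s *\<^sub>R u + 0 *\<^sub>R v)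
        = (h - 0) * D u v (x + s *\<^sub>R u + b *\<^sub>R v)"
      by (rule MVT2[OF h(1)]) (use der2 in auto)
    then obtain b where b: "0 < b" "b < h" "?F (x + s *\<^sub>R u + h *\<^sub>R v) - ?F (x + s *\<^sub>R u)
        = h * D u v (x + s *\<^sub>R u + b *\<^sub>R v)" by auto
    show ?thesis
      using inU(2)[of s h b u v] s b h uv gs
      by (intro exI[of _ "x + s *\<^sub>R u + b *\<^sub>R v"]) (auto simp: algebra_simps)
  qed
  show ?thesis
  proof (rule ccontr)
    assume ne: "\<not> ?thesis"
    define \<epsilon> where "\<epsilon> = \<bar>D u v x - D v u x\<bar> / 2"
    have \<epsilon>: "\<epsilon> > 0" using ne by (auto simp: \<epsilon>_def D_def)
    have cont: "continuous (at x) (D u v)" for u v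
      unfolding D_def using smooth_on_continuous[OF smooth_on_frechet[OF smooth_on_frechet[OF assms(2)]]]
        assms(1,3) continuous_on_eq_continuous_at by blast
    obtain d1 where d1: "d1 > 0" "\<And>y. dist y x < d1 \<Longrightarrow> dist (D u v y) (D u v x) < \<epsilon>"
      using cont[of u v] \<epsilon> unfolding continuous_at_eps_delta by blast
    obtain d2 where d2: "d2 > 0" "\<And>y. dist y x < d2 \<Longrightarrow> dist (D v u y) (D v u x) < \<epsilon>"
      using cont[of v u] \<epsilon> unfolding continuous_at_eps_delta by blast
    \<comment> \<open>The intermediate points lie within h * m of x; this h brings them into all
      three balls at once, the factor 2 making the inequalities strict.\<close>
    define h where "h = min r (min d1 d2) / (2 * m)"
    have h: "0 < h" "h * m < r" "h * m < d1" "h * m < d2"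
      using r m d1(1) d2(1) by (auto simp: h_def)
    obtain a where a: "norm (a - x) \<le> h * m"
      "f (x + h *\<^sub>R u + h *\<^sub>R v) - f (x + h *\<^sub>R u) - f (x + h *\<^sub>R v) + f x = h * h * D u v a"
      using step[OF h(1,2) m_def[symmetric]] by blast
    obtain b where b: "norm (b - x) \<le> h * m"
      "f (x + h *\<^sub>R v + h *\<^sub>R u) - f (x + h *\<^sub>R v) - f (x + h *\<^sub>R u) + f x = h * h * D v u b"
      using step[OF h(1,2), of v u] m_def by (metis add.commute)
    have "h * h * D u v a = h * h * D v u b" using a(2) b(2) by (simp add: algebra_simps)
    then have eq: "D u v a = D v u b" using h by simp
    have "dist (D u v a) (D u v x) < \<epsilon>" using d1(2)[of a] a(1) h by (simp add: dist_norm)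
    moreover have "dist (D v u b) (D v u x) < \<epsilon>" using d2(2)[of b] b(1) h by (simp add: dist_norm)
    moreover have "\<bar>D u v x - D v u x\<bar> \<le> dist (D u v a) (D u v x) + dist (D v u b) (D v u x)"
      unfolding eq dist_real_def by linarith
    moreover have "\<And>a b c :: real. a < c / 2 \<Longrightarrow> b < c / 2 \<Longrightarrow> c \<le> a + b \<Longrightarrow> False" by linarith
    ultimately show False unfolding \<epsilon>_def by blast
  qed
qed

subsection \<open>Lipschitz estimates for smooth maps\<close>

text \<open>Only derivatives in fixed directions are known to be continuous; compactness bounds them
  for the basis vectors, and linearity does the rest.\<close>

lemma smooth_on_derivative_bound:
  fixes f :: "'a::euclidean_space \<Rightarrow> 'b::real_normed_vector"
  assumes "smooth_on U f" "compact K" "K \<subseteq> U"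
  obtains M where "M \<ge> 0" "\<And>x v. x \<in> K \<Longrightarrow> norm (frechet_derivative f (at x) v) \<le> M * norm v"
proof -
  have "\<exists>B\<ge>0. \<forall>x\<in>K. norm (frechet_derivative f (at x) b) \<le> B" for b
  proof -
    have "continuous_on K (\<lambda>x. frechet_derivative f (at x) b)"
      using smooth_on_continuous[OF smooth_on_frechet[OF assms(1)]] assms(3) continuous_on_subset by blast
    then have "bounded ((\<lambda>x. frechet_derivative f (at x) b) ` K)"
      using assms(2) compact_continuous_image compact_imp_bounded by blast
    then obtain B where "\<forall>x\<in>K. norm (frechet_derivative f (at x) b) \<le> B" unfolding bounded_iff by auto
    then show ?thesis by (intro exI[of _ "max B 0"]) auto
  qed
  then obtain B where B: "\<And>b. B b \<ge> 0"
    "\<And>b x. x \<in> K \<Longrightarrow> norm (frechet_derivative f (at x) b) \<le> B b" by metis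
  show ?thesis
  proof (rule that[of "\<Sum>b\<in>Basis. B b"])
    fix x v assume x: "x \<in> K"
    have lin: "linear (frechet_derivative f (at x))"
      using smooth_on_linear_derivative[OF assms(1)] assms(3) x by blast
    have "norm (frechet_derivative f (at x) v) \<le> (\<Sum>b\<in>Basis. norm ((v \<bullet> b) *\<^sub>R frechet_derivative f (at x) b))"
      unfolding linear_euclidean_sum[OF lin, symmetric, of v] by (rule norm_sum)
    also have "\<dots> \<le> (\<Sum>b\<in>Basis. norm v * B b)"
      using B x Basis_le_norm by (intro sum_mono) (auto intro!: mult_mono)
    also have "\<dots> = (\<Sum>b\<in>Basis. B b) * norm v"
      by (simp add: sum_distrib_left mult.commute)
    finally show "norm (frechet_derivative f (at x) v) \<le> (\<Sum>b\<in>Basis. B b) * norm v" .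
  qed (use B in \<open>auto intro: sum_nonneg\<close>)
qed

lemma smooth_on_Lipschitz:
  fixes f :: "'a::euclidean_space \<Rightarrow> 'b::real_normed_vector"
  assumes "smooth_on U f" "compact K" "convex K" "K \<subseteq> U"
  obtains L where "L \<ge> 0" "\<And>x y. x \<in> K \<Longrightarrow> y \<in> K \<Longrightarrow> norm (f y - f x) \<le> L * norm (y - x)"
proof -
  obtain M where M: "M \<ge> 0" "\<And>x v. x \<in> K \<Longrightarrow> norm (frechet_derivative f (at x) v) \<le> M * norm v"
    using smooth_on_derivative_bound[OF assms(1,2,4)] by blast
  show ?thesis
  proof (rule that[OF M(1)])
    fix x y assume xy: "x \<in> K" "y \<in> K"
    show "norm (f y - f x) \<le> M * norm (y - x)"
    proof (rule differentiable_bound[OF assms(3) _ _ xy(2,1)])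
      fix z assume z: "z \<in> K"
      show "(f has_derivative frechet_derivative f (at z)) (at z within K)"
        using smooth_on_has_derivative[OF assms(1)] z assms(4) has_derivative_at_withinI by blast
      show "onorm (frechet_derivative f (at z)) \<le> M" using M z by (intro onorm_bound) auto
    qed
  qed
qed

text \<open>Subtracting from f its derivative at x leaves a map whose derivative at z is a
  difference of two derivatives, of size O(norm (z - x)) by the Lipschitz estimate; the mean value
  inequality on the segment gives the second factor.\<close>

lemma smooth_on_Taylor:
  fixes f :: "'a::euclidean_space \<Rightarrow> 'b::real_normed_vector"
  assumes "smooth_on U f" "compact K" "convex K" "K \<subseteq> U"
  obtains L where "L \<ge> 0"
    "\<And>x y. x \<in> K \<Longrightarrow> y \<in> K \<Longrightarrow> norm (f y - f x - frechet_derivative f (at x) (y - x)) \<le> L * norm (y - x) ^ 2"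
proof -
  let ?D = "\<lambda>b x. frechet_derivative f (at x) b"
  have "\<exists>M\<ge>0. \<forall>x\<in>K. \<forall>y\<in>K. norm (?D b y - ?D b x) \<le> M * norm (y - x)" for b
    using smooth_on_Lipschitz[OF smooth_on_frechet[OF assms(1), of b] assms(2-4)] by metis
  then obtain M where M: "\<And>b. M b \<ge> 0"
    "\<And>b x y. x \<in> K \<Longrightarrow> y \<in> K \<Longrightarrow> norm (?D b y - ?D b x) \<le> M b * norm (y - x)" by metis
  define L where "L = (\<Sum>b\<in>Basis. M b)"
  have L: "L \<ge> 0" unfolding L_def using M by (auto intro: sum_nonneg)
  have lin: "linear (\<lambda>v. ?D v y)" if "y \<in> K" for y
    using smooth_on_linear_derivative[OF assms(1)] that assms(4) by blast
  have DL: "norm (?D v y - ?D v x) \<le> (L * norm (y - x)) * norm v" if "x \<in> K" "y \<in> K" for x y v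
  proof -
    have "?D v y - ?D v x = (\<Sum>b\<in>Basis. (v \<bullet> b) *\<^sub>R (?D b y - ?D b x))"
      using linear_euclidean_sum[OF lin[OF that(1)], of v] linear_euclidean_sum[OF lin[OF that(2)], of v]
      by (simp add: scaleR_diff_right sum_subtractf)
    then have "norm (?D v y - ?D v x) \<le> (\<Sum>b\<in>Basis. norm ((v \<bullet> b) *\<^sub>R (?D b y - ?D b x)))"
      by (simp only: norm_sum)
    also have "\<dots> \<le> (\<Sum>b\<in>Basis. norm v * (M b * norm (y - x)))"
      using M that Basis_le_norm by (intro sum_mono) (auto intro!: mult_mono)
    also have "\<dots> = (L * norm (y - x)) * norm v"
      unfolding L_def sum_distrib_right by (intro sum.cong) auto
    finally show ?thesis .
  qed
  show ?thesis
  proof (rule that[OF L])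
    fix x y assume xy: "x \<in> K" "y \<in> K"
    have seg: "closed_segment x y \<subseteq> K" using assms(3) xy by (simp add: closed_segment_subset)
    let ?g = "\<lambda>z. f z - ?D z x"
    have "norm (?g y - ?g x) \<le> (L * norm (y - x)) * norm (y - x)"
    proof (rule differentiable_bound[where S = "closed_segment x y"])
      fix z assume z: "z \<in> closed_segment x y"
      then have zK: "z \<in> K" using seg by blast
      show "(?g has_derivative (\<lambda>v. ?D v z - ?D v x)) (at z within closed_segment x y)"
        using smooth_on_has_derivative[OF assms(1)] zK assms(4) has_derivative_at_withinI
          linear_imp_has_derivative[OF lin[OF xy(1)]] by (intro has_derivative_diff) blast+
      have "norm (z - x) \<le> norm (y - x)" using segment_bound1[OF z] by (simp add: norm_minus_commute)
      then have "(L * norm (z - x)) * norm v \<le> (L * norm (y - x)) * norm v" for v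
        using L by (intro mult_right_mono mult_left_mono) auto
      then show "onorm (\<lambda>v. ?D v z - ?D v x) \<le> L * norm (y - x)"
        using DL[OF xy(1) zK] L by (intro onorm_bound) (auto intro: order_trans)
    qed auto
    moreover have "?g y - ?g x = f y - f x - ?D (y - x) x"
      using linear_diff[OF lin[OF xy(1)], of y x] by simp
    ultimately show "norm (f y - f x - ?D (y - x) x) \<le> L * norm (y - x) ^ 2"
      by (simp only: power2_eq_square mult.assoc)
  qed
qed

subsection \<open>Integrals with variable upper limit\<close>

text \<open>The rescaling to \<open>[0, 1]\<close> keeps the domain of integration fixed.\<close>

definition integral_to :: "(real \<Rightarrow> 'b::banach) \<Rightarrow> real \<Rightarrow> 'b" where
  "integral_to q s = s *\<^sub>R integral {0..1} (\<lambda>\<theta>. q (\<theta> * s))"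

lemma scaled_mem_interval:
  fixes a b s \<theta> :: real
  assumes "a \<le> 0" "0 \<le> b" "s \<in> {a..b}" "\<theta> \<in> {0..1}"
  shows "\<theta> * s \<in> {a..b}"
proof -
  have "\<theta> * s + (1 - \<theta>) * 0 \<in> {a..b}"
    using convexD[OF convex_real_interval(5)[of a b] assms(3), of 0 \<theta> "1 - \<theta>"] assms by auto
  then show ?thesis by simp
qed

text \<open>By the substitution \<theta> s the rescaled integral is Q s - Q 0 for an antiderivative
  Q; this covers negative s without an orientation convention.\<close>

lemma integral_to_derivative:
  assumes "continuous_on {a..b} q" "a \<le> 0" "0 \<le> b" "s \<in> {a..b}"
  shows "(integral_to q has_vector_derivative q s) (at s within {a..b})"
proof -
  obtain Q where Q: "\<And>x. x \<in> {a..b} \<Longrightarrow> (Q has_vector_derivative q x) (at x within {a..b})"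
    using antiderivative_continuous[OF assms(1)] by blast
  have eq: "integral_to q s = Q s - Q 0" if s: "s \<in> {a..b}" for s
  proof -
    note mem = scaled_mem_interval[OF assms(2,3) s]
    have "((\<lambda>\<theta>. s *\<^sub>R q (\<theta> * s)) has_integral (Q (1 * s) - Q (0 * s))) {0..1}"
    proof (rule fundamental_theorem_of_calculus)
      fix \<theta> :: real assume \<theta>: "\<theta> \<in> {0..1}"
      have "(((\<lambda>x. Q x) \<circ> (\<lambda>\<theta>. \<theta> * s)) has_vector_derivative s *\<^sub>R q (\<theta> * s)) (at \<theta> within {0..1})"
      proof (rule vector_diff_chain_within)
        show "((\<lambda>\<theta>. \<theta> * s) has_vector_derivative s) (at \<theta> within {0..1})"
          by (auto intro!: derivative_eq_intros simp: has_vector_derivative_def)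
        show "(Q has_vector_derivative q (\<theta> * s)) (at (\<theta> * s) within (\<lambda>\<theta>. \<theta> * s) ` {0..1})"
          by (rule has_vector_derivative_within_subset[OF Q[OF mem[OF \<theta>]]]) (use mem in auto)
      qed
      then show "((\<lambda>\<theta>. Q (\<theta> * s)) has_vector_derivative s *\<^sub>R q (\<theta> * s)) (at \<theta> within {0..1})"
        by (simp add: o_def)
    qed auto
    from integral_unique[OF this] show ?thesis unfolding integral_to_def by simp
  qed
  have "((\<lambda>s. Q s - Q 0) has_vector_derivative q s) (at s within {a..b})"
    using Q[OF assms(4)] by (auto intro!: derivative_eq_intros)
  then show ?thesis
    by (rule has_vector_derivative_transform[OF assms(4), rotated]) (use eq in auto)
qed

lemma continuous_on_integral_to:
  fixes q :: "'p::topological_space \<Rightarrow> real \<Rightarrow> 'b::banach"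
  assumes "continuous_on ({a..b} \<times> P) (\<lambda>(s, p). q p s)" "a \<le> 0" "0 \<le> b"
  shows "continuous_on ({a..b} \<times> P) (\<lambda>(s, p). integral_to (q p) s)"
proof -
  have "continuous_on (({a..b} \<times> P) \<times> cbox 0 1) (\<lambda>(z, \<theta>). (\<lambda>z \<theta>. q (snd z) (\<theta> * fst z)) z \<theta>)"
  proof -
    have "continuous_on (({a..b} \<times> P) \<times> cbox 0 (1::real))
        (\<lambda>z. (\<lambda>(s, p). q p s) (snd z * fst (fst z), snd (fst z)))"
      by (rule continuous_on_compose2[OF assms(1)])
         (use scaled_mem_interval[OF assms(2,3)] in \<open>auto intro!: continuous_intros\<close>)
    then show ?thesis by (simp add: case_prod_beta)
  qed
  from integral_continuous_on_param[OF this]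
  show ?thesis unfolding integral_to_def by (auto simp: case_prod_beta intro!: continuous_intros)
qed

lemma norm_integral_to_le:
  fixes q :: "real \<Rightarrow> 'b::banach"
  assumes "continuous_on {a..b} q" "a \<le> 0" "0 \<le> b" "s \<in> {a..b}" "B \<ge> 0"
    and "\<And>\<sigma>. \<sigma> \<in> {a..b} \<Longrightarrow> norm (q \<sigma>) \<le> B"
  shows "norm (integral_to q s) \<le> \<bar>s\<bar> * B"
proof -
  note mem = scaled_mem_interval[OF assms(2,3,4)]
  have "continuous_on {0..1} (\<lambda>\<theta>. q (\<theta> * s))"
    by (rule continuous_on_compose2[OF assms(1)]) (use mem in \<open>auto intro!: continuous_intros\<close>)
  then have "norm (integral {0..1} (\<lambda>\<theta>. q (\<theta> * s))) \<le> B * (1 - 0)"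
    by (intro integral_bound) (use mem assms(6) in auto)
  then show ?thesis unfolding integral_to_def using assms(5) by (auto intro!: mult_left_mono)
qed

lemma integral_to_diff:
  fixes q :: "real \<Rightarrow> 'b::banach"
  assumes "continuous_on {a..b} q" "continuous_on {a..b} r" "a \<le> 0" "0 \<le> b" "s \<in> {a..b}"
  shows "integral_to q s - integral_to r s = integral_to (\<lambda>\<sigma>. q \<sigma> - r \<sigma>) s"
proof -
  note mem = scaled_mem_interval[OF assms(3,4,5)]
  have "continuous_on {0..1} (\<lambda>\<theta>. q (\<theta> * s))" "continuous_on {0..1} (\<lambda>\<theta>. r (\<theta> * s))"
    by (rule continuous_on_compose2[OF assms(1)] continuous_on_compose2[OF assms(2)];
        use mem in \<open>auto intro!: continuous_intros\<close>)+
  then show ?thesis unfolding integral_to_def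
    by (simp add: integral_diff integrable_continuous_real scaleR_diff_right)
qed

text \<open>Differentiation under the integral sign, n times. Since the integral runs over the fixed
  interval [0, 1], the Leibniz rule applies for each s separately.\<close>

lemma Ck_param_integral_to:
  fixes q :: "real \<Rightarrow> 'a::euclidean_space \<Rightarrow> 'b::banach"
  assumes "open U" "Ck_param {a..b} n U q" "a \<le> 0" "0 \<le> b"
  shows "Ck_param {a..b} n U (\<lambda>s x. integral_to (\<lambda>\<sigma>. q \<sigma> x) s)"
  using assms(2)
proof (induction n arbitrary: q)
  case 0
  then show ?case using continuous_on_integral_to[of a b U "\<lambda>x \<sigma>. q \<sigma> x"] assms(3,4) by simp
next
  case (Suc n)
  have cont: "continuous_on {a..b} (\<lambda>\<sigma>. q \<sigma> x)"
    if "continuous_on ({a..b} \<times> U) (\<lambda>(s, x). q s x)" "x \<in> U" for q :: "real \<Rightarrow> 'a \<Rightarrow> 'b" and x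
  proof -
    have "continuous_on {a..b} (\<lambda>\<sigma>. (\<lambda>(s, x). q s x) (\<sigma>, x))"
      by (rule continuous_on_compose2[OF that(1)]) (use that in \<open>auto intro!: continuous_intros\<close>)
    then show ?thesis by simp
  qed
  let ?D = "\<lambda>\<sigma> x v. frechet_derivative (q \<sigma>) (at x) v"
  have Dc: "continuous_on ({a..b} \<times> U) (\<lambda>(s, x). ?D s x v)" for v
    by (rule Ck_param_continuous[of _ n]) (use Suc.prems in simp)
  have bl: "bounded_linear (?D \<sigma> x)" if "\<sigma> \<in> {a..b}" "x \<in> U" for \<sigma> x
    using Ck_param_derivative[OF Suc.prems that] has_derivative_bounded_linear by blast
  show ?case
  proof (rule Ck_param_SucI[OF \<open>open U\<close>, where q' = "\<lambda>s x v. integral_to (\<lambda>\<sigma>. ?D \<sigma> x v) s"])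
    show "continuous_on ({a..b} \<times> U) (\<lambda>(s, x). integral_to (\<lambda>\<sigma>. q \<sigma> x) s)"
      using continuous_on_integral_to[of a b U "\<lambda>x \<sigma>. q \<sigma> x"] Ck_param_continuous[OF Suc.prems] assms(3,4)
      by simp
    show "Ck_param {a..b} n U (\<lambda>s x. integral_to (\<lambda>\<sigma>. ?D \<sigma> x v) s)" for v
      by (rule Suc.IH) (use Suc.prems in simp)
    fix s x assume s: "s \<in> {a..b}" and x: "x \<in> U"
    note mem = scaled_mem_interval[OF assms(3,4) s]
    obtain r where r: "r > 0" "ball x r \<subseteq> U" using \<open>open U\<close> x open_contains_ball by blast
    \<comment> \<open>The Leibniz rule asks for a continuous operator-valued derivative;
      \<open>Blinfun\<close> packages it, and continuity is checked direction by direction.\<close>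
    let ?fx = "\<lambda>y \<theta>. Blinfun (?D (\<theta> * s) y)"
    have app: "blinfun_apply (?fx y \<theta>) = ?D (\<theta> * s) y" if "y \<in> U" "\<theta> \<in> {0..1}" for y \<theta>
      by (rule bounded_linear_Blinfun_apply[OF bl[OF mem[OF that(2)] that(1)]])
    have cb: "continuous_on (ball x r \<times> cbox 0 1) (\<lambda>(y, \<theta>). ?fx y \<theta>)"
    proof (rule continuous_on_blinfun_componentwise)
      fix i :: 'a assume "i \<in> Basis"
      have "continuous_on (ball x r \<times> cbox 0 1) (\<lambda>z. (\<lambda>(s, x). ?D s x i) (snd z * s, fst z))"
        by (rule continuous_on_compose2[OF Dc])
           (use mem r in \<open>auto intro!: continuous_intros\<close>)
      then show "continuous_on (ball x r \<times> cbox 0 1) (\<lambda>z. blinfun_apply (case z of (y, \<theta>) \<Rightarrow> ?fx y \<theta>) i)"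
        by (rule continuous_on_cong[THEN iffD1, rotated 2]) (use app r in \<open>auto simp: case_prod_beta\<close>)
    qed
    have "((\<lambda>y. integral (cbox 0 1) (\<lambda>\<theta>. q (\<theta> * s) y)) has_derivative
        blinfun_apply (integral (cbox 0 1) (?fx x))) (at x within ball x r)"
    proof (rule leibniz_rule[OF _ _ cb])
      show "((\<lambda>y. q (\<theta> * s) y) has_derivative blinfun_apply (?fx y \<theta>)) (at y within ball x r)"
        if "y \<in> ball x r" "\<theta> \<in> cbox 0 1" for y \<theta>
      proof -
        have y: "y \<in> U" "\<theta> \<in> {0..1}" using that r by auto
        show ?thesis unfolding app[OF y]
          using Ck_param_derivative[OF Suc.prems mem[OF y(2)] y(1)] has_derivative_at_withinI by blast
      qed
      show "(\<lambda>\<theta>. q (\<theta> * s) y) integrable_on cbox 0 1" if "y \<in> ball x r" for y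
      proof -
        have "y \<in> U" using that r by auto
        then have "continuous_on {0..1} (\<lambda>\<theta>. q (\<theta> * s) y)"
          by (intro continuous_on_compose2[OF cont[OF Ck_param_continuous[OF Suc.prems]]])
             (use mem in \<open>auto intro!: continuous_intros\<close>)
        then show ?thesis by (simp add: integrable_continuous_real)
      qed
    qed (use r in auto)
    then have 1: "((\<lambda>y. integral {0..1} (\<lambda>\<theta>. q (\<theta> * s) y)) has_derivative
        blinfun_apply (integral {0..1} (?fx x))) (at x)"
      using r by (simp add: at_within_ball)
    have "continuous_on {0..1} (?fx x)"
    proof -
      have "continuous_on {0..1} (\<lambda>\<theta>. (\<lambda>(y, \<theta>). ?fx y \<theta>) (x, \<theta>))"
        by (rule continuous_on_compose2[OF cb]) (use r in \<open>auto intro!: continuous_intros\<close>)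
      then show ?thesis by simp
    qed
    then have "?fx x integrable_on {0..1}" by (rule integrable_continuous_real)
    then have "blinfun_apply (integral {0..1} (?fx x)) v = integral {0..1} (\<lambda>\<theta>. blinfun_apply (?fx x \<theta>) v)" for v
      using blinfun_apply_integral by blast
    also have "\<dots> v = integral {0..1} (\<lambda>\<theta>. ?D (\<theta> * s) x v)" for v
      by (intro integral_cong) (use app x in auto)
    finally have "blinfun_apply (integral {0..1} (?fx x)) = (\<lambda>v. integral {0..1} (\<lambda>\<theta>. ?D (\<theta> * s) x v))" by auto
    with 1 show "((\<lambda>x. integral_to (\<lambda>\<sigma>. q \<sigma> x) s) has_derivative (\<lambda>v. integral_to (\<lambda>\<sigma>. ?D \<sigma> x v) s)) (at x)"
      unfolding integral_to_def by (auto intro!: derivative_eq_intros)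
  qed
qed

subsection \<open>Ordinary differential equations\<close>

text \<open>The contraction acts on functions of time and parameter together, so that joint
  continuity in (s, p) comes with the fixed point. Speed at most R / 2 over unit time, from a start
  within R / 2 of the centre, keeps the curves in the ball of radius R; the Lipschitz constant 1 / 2
  over unit time is the contraction factor.\<close>

lemma Picard_Lindeloef:
  fixes F :: "real \<Rightarrow> 'b::euclidean_space \<Rightarrow> 'p::euclidean_space \<Rightarrow> 'b"
  assumes P: "closed P" "convex P" "P \<noteq> {}"
    and cont: "continuous_on ({-1..1} \<times> cball c R \<times> P) (\<lambda>(s, y, p). F s y p)"
    and bound: "\<And>s y p. s \<in> {-1..1} \<Longrightarrow> y \<in> cball c R \<Longrightarrow> p \<in> P \<Longrightarrow> norm (F s y p) \<le> R / 2"
    and Lipschitz: "\<And>s y z p. s \<in> {-1..1} \<Longrightarrow> y \<in> cball c R \<Longrightarrow> z \<in> cball c R \<Longrightarrow> p \<in> P \<Longrightarrow>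
      norm (F s y p - F s z p) \<le> 1 / 2 * norm (y - z)"
    and R: "R \<ge> 0"
    and init: "continuous_on P b" "\<And>p. p \<in> P \<Longrightarrow> b p \<in> cball c (R / 2)"
  obtains h where "continuous_on ({-1..1} \<times> P) (\<lambda>(s, p). h s p)"
    "\<And>s p. s \<in> {-1..1} \<Longrightarrow> p \<in> P \<Longrightarrow> h s p \<in> cball c R"
    "\<And>p. p \<in> P \<Longrightarrow> h 0 p = b p"
    "\<And>s p. s \<in> {-1..1} \<Longrightarrow> p \<in> P \<Longrightarrow>
      ((\<lambda>s. h s p) has_vector_derivative F s (h s p) p) (at s within {-1..1})"
proof -
  define K where "K = {-1..1::real} \<times> P"
  have K: "convex K" "closed K" "K \<noteq> {}"
    using P by (auto simp: K_def convex_Times closed_Times)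
  \<comment> \<open>Bounded continuous functions live on the whole space here. Composing with the
    closest-point map, which is continuous and fixes the closed convex set K, extends the integral
    operator beyond K without losing continuity.\<close>
  define r where "r = closest_point K"
  have rK: "r z \<in> K" for z unfolding r_def by (rule closest_point_in_set[OF K(2,3)])
  have r_id: "r z = z" if "z \<in> K" for z unfolding r_def by (rule closest_point_self[OF that])
  have r_cont: "continuous_on UNIV r" unfolding r_def using K by (rule continuous_on_closest_point)
  define S where "S = PiC UNIV (\<lambda>_::real \<times> 'p. cball c R)"
  have S_iff: "u \<in> S \<longleftrightarrow> (\<forall>z. apply_bcontfun u z \<in> cball c R)" for u
    by (auto simp: S_def mem_PiC_iff)
  have "complete S"
    unfolding complete_eq_closed S_def by (rule closed_PiC) auto
  define q where "q u p \<sigma> = F \<sigma> (apply_bcontfun u (\<sigma>, p)) p" for u p \<sigma>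
  have q_cont: "continuous_on ({-1..1} \<times> P) (\<lambda>(\<sigma>, p). q u p \<sigma>)" if "u \<in> S" for u
  proof -
    have "continuous_on ({-1..1} \<times> P) (\<lambda>z. (\<lambda>(s, y, p). F s y p) (fst z, apply_bcontfun u z, snd z))"
      by (rule continuous_on_compose2[OF cont])
         (use that in \<open>auto simp: S_iff simp del: mem_cball intro!: continuous_intros\<close>)
    then show ?thesis by (simp add: case_prod_beta q_def)
  qed
  have q_cont1: "continuous_on {-1..1} (q u p)" if "u \<in> S" "p \<in> P" for u p
  proof -
    have "continuous_on {-1..1} (\<lambda>\<sigma>. (\<lambda>(\<sigma>, p). q u p \<sigma>) (\<sigma>, p))"
      by (rule continuous_on_compose2[OF q_cont[OF that(1)]]) (use that in \<open>auto intro!: continuous_intros\<close>)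
    then show ?thesis by simp
  qed
  have q_bound: "norm (q u p \<sigma>) \<le> R / 2" if "u \<in> S" "p \<in> P" "\<sigma> \<in> {-1..1}" for u p \<sigma>
    unfolding q_def using that S_iff by (intro bound) auto
  define G where "G u z = b (snd (r z)) + integral_to (q u (snd (r z))) (fst (r z))" for u z
  have G_in: "G u z \<in> cball c R" if "u \<in> S" for u z
  proof -
    have z: "fst (r z) \<in> {-1..1}" "snd (r z) \<in> P" using rK[of z] by (auto simp: K_def mem_Times_iff)
    have "norm (integral_to (q u (snd (r z))) (fst (r z))) \<le> \<bar>fst (r z)\<bar> * (R / 2)"
      by (rule norm_integral_to_le[OF q_cont1[OF that z(2)] _ _ z(1)])
         (use R q_bound[OF that z(2)] in auto)
    also have "\<dots> \<le> 1 * (R / 2)" using z(1) R by (intro mult_right_mono) auto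
    finally have 1: "norm (integral_to (q u (snd (r z))) (fst (r z))) \<le> R / 2" by simp
    have 2: "norm (b (snd (r z)) - c) \<le> R / 2"
      using init(2)[OF z(2)] by (simp add: dist_norm norm_minus_commute)
    have "norm (G u z - c) \<le> norm (b (snd (r z)) - c) + norm (integral_to (q u (snd (r z))) (fst (r z)))"
      unfolding G_def by (metis add_diff_eq diff_add_eq norm_triangle_ineq)
    then show ?thesis using 1 2 by (simp add: dist_norm norm_minus_commute)
  qed
  have G_cont: "continuous_on UNIV (G u)" if "u \<in> S" for u
  proof -
    have "continuous_on K (\<lambda>(s, p). integral_to (q u p) s)"
      unfolding K_def by (rule continuous_on_integral_to[OF q_cont[OF that]]) auto
    then have "continuous_on UNIV (\<lambda>z. (\<lambda>(s, p). integral_to (q u p) s) (r z))"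
      by (rule continuous_on_compose2[OF _ r_cont]) (use rK in auto)
    moreover have "continuous_on UNIV (\<lambda>z. b (snd (r z)))"
      by (rule continuous_on_compose2[OF init(1)])
         (use rK r_cont in \<open>auto simp: K_def mem_Times_iff intro!: continuous_intros\<close>)
    ultimately show ?thesis unfolding G_def by (auto simp: case_prod_beta intro!: continuous_on_add)
  qed
  have G_b: "G u \<in> bcontfun" if "u \<in> S" for u
    using G_in[OF that] G_cont[OF that] bounded_subset[OF bounded_cball, of "range (G u)" c R]
    unfolding bcontfun_def by blast
  define \<Phi> where "\<Phi> u = Bcontfun (G u)" for u
  have \<Phi>: "apply_bcontfun (\<Phi> u) = G u" if "u \<in> S" for u
    unfolding \<Phi>_def by (rule Bcontfun_inverse[OF G_b[OF that]])
  have "\<exists>!u\<in>S. \<Phi> u = u"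
  proof (rule Banach_fix[where c = "1/2"])
    show "complete S" by fact
    have "c \<in> cball c R" using R by simp
    then have "const_bcontfun c \<in> S" by (simp add: S_iff const_bcontfun.rep_eq R)
    then show "S \<noteq> {}" by auto
    show "\<Phi> ` S \<subseteq> S" using \<Phi> G_in S_iff by auto
    fix u v assume "u \<in> S" "v \<in> S"
    then have uv: "u \<in> S \<and> v \<in> S" by blast
    show "dist (\<Phi> u) (\<Phi> v) \<le> 1 / 2 * dist u v"
    proof (rule dist_bound)
      fix z
      have z: "fst (r z) \<in> {-1..1}" "snd (r z) \<in> P" using rK[of z] by (auto simp: K_def mem_Times_iff)
      let ?p = "snd (r z)"
      have "G u z - G v z = integral_to (\<lambda>\<sigma>. q u ?p \<sigma> - q v ?p \<sigma>) (fst (r z))"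
        unfolding G_def using integral_to_diff[OF q_cont1 q_cont1 _ _ z(1)] uv z(2) by simp
      moreover have "norm \<dots> \<le> \<bar>fst (r z)\<bar> * (1 / 2 * dist u v)"
      proof (rule norm_integral_to_le[OF _ _ _ z(1)])
        show "continuous_on {-1..1} (\<lambda>\<sigma>. q u ?p \<sigma> - q v ?p \<sigma>)"
          using q_cont1 uv z by (auto intro!: continuous_on_diff)
        fix \<sigma> :: real assume \<sigma>: "\<sigma> \<in> {-1..1}"
        have "norm (q u ?p \<sigma> - q v ?p \<sigma>) \<le> 1 / 2 * norm (apply_bcontfun u (\<sigma>, ?p) - apply_bcontfun v (\<sigma>, ?p))"
          unfolding q_def using uv z \<sigma> S_iff by (intro Lipschitz) auto
        also have "\<dots> \<le> 1 / 2 * dist u v"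
          using dist_bounded[of u "(\<sigma>, ?p)" v] by (simp add: dist_norm)
        finally show "norm (q u ?p \<sigma> - q v ?p \<sigma>) \<le> 1 / 2 * dist u v" .
      qed auto
      moreover have "\<bar>fst (r z)\<bar> * (1 / 2 * dist u v) \<le> 1 * (1 / 2 * dist u v)"
        using z by (intro mult_right_mono) auto
      ultimately show "dist (apply_bcontfun (\<Phi> u) z) (apply_bcontfun (\<Phi> v) z) \<le> 1 / 2 * dist u v"
        using \<Phi> uv by (simp add: dist_norm)
    qed
  qed auto
  then obtain u where u: "u \<in> S" "\<Phi> u = u" by blast
  have fix_eq: "apply_bcontfun u z = G u z" for z using \<Phi>[OF u(1)] u(2) by metis
  define h where "h s p = apply_bcontfun u (s, p)" for s p
  have h_eq: "h s p = b p + integral_to (q u p) s" if "s \<in> {-1..1}" "p \<in> P" for s p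
    unfolding h_def fix_eq G_def using r_id[of "(s, p)"] that by (simp add: K_def)
  show ?thesis
  proof (rule that[of h])
    show "continuous_on ({-1..1} \<times> P) (\<lambda>(s, p). h s p)"
      by (simp add: h_def case_prod_beta)
    show "h s p \<in> cball c R" for s p using u(1) S_iff by (simp add: h_def)
    show "h 0 p = b p" if "p \<in> P" for p using h_eq[of 0 p] that by (simp add: integral_to_def)
    fix s p assume sp: "s \<in> {-1..1::real}" "p \<in> P"
    have "((\<lambda>s. b p + integral_to (q u p) s) has_vector_derivative q u p s) (at s within {-1..1})"
      using integral_to_derivative[OF q_cont1[OF u(1) sp(2)] _ _ sp(1)] by (auto intro!: derivative_eq_intros)
    then have "((\<lambda>s. h s p) has_vector_derivative q u p s) (at s within {-1..1})"
      by (rule has_vector_derivative_transform[OF sp(1), rotated]) (use h_eq sp in auto)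
    then show "((\<lambda>s. h s p) has_vector_derivative F s (h s p) p) (at s within {-1..1})"
      by (simp add: q_def h_def)
  qed
qed

text \<open>Time is rescaled by \<open>\<epsilon>\<close>, so that the field becomes small and
  slowly varying enough for Picard iteration on unit time; the one-point parameter set {0} stands
  for the absence of parameters.\<close>

lemma autonomous_ODE_local_solution:
  fixes f :: "'b::euclidean_space \<Rightarrow> 'b"
  assumes "open W" "smooth_on W f" "y0 \<in> W"
  obtains \<epsilon> y where "\<epsilon> > 0" "y 0 = y0"
    "\<And>s. s \<in> {-\<epsilon><..<\<epsilon>} \<Longrightarrow> y s \<in> W \<and> (y has_vector_derivative f (y s)) (at s)"
proof -
  obtain R where R: "R > 0" "cball y0 R \<subseteq> W" using assms open_contains_cball by blast
  obtain L where L: "L \<ge> 0" "\<And>x y. x \<in> cball y0 R \<Longrightarrow> y \<in> cball y0 R \<Longrightarrow> norm (f y - f x) \<le> L * norm (y - x)"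
    using smooth_on_Lipschitz[OF assms(2) compact_cball convex_cball R(2)] by blast
  have fc: "continuous_on (cball y0 R) f"
    using smooth_on_continuous[OF assms(2)] R(2) continuous_on_subset by blast
  then have "bounded (f ` cball y0 R)"
    using compact_cball compact_continuous_image compact_imp_bounded by blast
  then obtain B where B: "B > 0" "\<And>y. y \<in> cball y0 R \<Longrightarrow> norm (f y) \<le> B"
    unfolding bounded_pos by auto
  define \<epsilon> where "\<epsilon> = min (R / (2 * B)) (1 / (2 * (L + 1)))"
  have \<epsilon>: "\<epsilon> > 0" using R B L by (auto simp: \<epsilon>_def)
  have \<epsilon>B: "\<epsilon> * B \<le> R / 2"
  proof -
    have "\<epsilon> * B \<le> (R / (2 * B)) * B" using B by (intro mult_right_mono) (auto simp: \<epsilon>_def)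
    then show ?thesis using B by simp
  qed
  have \<epsilon>L: "\<epsilon> * L \<le> 1 / 2"
  proof -
    have "\<epsilon> * L \<le> (1 / (2 * (L + 1))) * (L + 1)" using L \<epsilon> by (intro mult_mono) (auto simp: \<epsilon>_def)
    also have "\<dots> = 1 / 2" using L(1) by (simp add: divide_simps)
    finally show ?thesis .
  qed
  obtain h where h: "\<And>s p. s \<in> {-1..1} \<Longrightarrow> p \<in> {0::real} \<Longrightarrow> h s p \<in> cball y0 R"
    "\<And>p. p \<in> {0::real} \<Longrightarrow> h 0 p = y0"
    "\<And>s p. s \<in> {-1..1} \<Longrightarrow> p \<in> {0::real} \<Longrightarrow>
      ((\<lambda>s. h s p) has_vector_derivative \<epsilon> *\<^sub>R f (h s p)) (at s within {-1..1})"
  proof (rule Picard_Lindeloef[where P = "{0::real}" and F = "\<lambda>s y p. \<epsilon> *\<^sub>R f y" and c = y0 and R = R and b = "\<lambda>_. y0"])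
    have "continuous_on ({-1..1} \<times> cball y0 R \<times> {0::real}) (\<lambda>z. f (fst (snd z)))"
      by (rule continuous_on_compose2[OF fc]) (auto intro!: continuous_intros)
    then show "continuous_on ({-1..1} \<times> cball y0 R \<times> {0::real}) (\<lambda>(s, y, p). \<epsilon> *\<^sub>R f y)"
      by (auto simp: case_prod_beta intro!: continuous_intros)
    show "norm (\<epsilon> *\<^sub>R f y) \<le> R / 2" if "y \<in> cball y0 R" for y
    proof -
      have "\<epsilon> * norm (f y) \<le> \<epsilon> * B" using B(2)[OF that] \<epsilon> by (intro mult_left_mono) auto
      moreover have "norm (\<epsilon> *\<^sub>R f y) = \<epsilon> * norm (f y)" using \<epsilon> by simp
      ultimately show ?thesis using \<epsilon>B by linarith
    qed
    show "norm (\<epsilon> *\<^sub>R f y - \<epsilon> *\<^sub>R f z) \<le> 1 / 2 * norm (y - z)"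
      if "y \<in> cball y0 R" "z \<in> cball y0 R" for y z
    proof -
      have "norm (\<epsilon> *\<^sub>R f y - \<epsilon> *\<^sub>R f z) = \<epsilon> * norm (f y - f z)"
        using \<epsilon> by (simp add: scaleR_diff_right[symmetric])
      also have "\<dots> \<le> \<epsilon> * (L * norm (y - z))"
        using L(2)[OF that(2,1)] \<epsilon> by (intro mult_left_mono) auto
      also have "\<dots> = (\<epsilon> * L) * norm (y - z)" by simp
      also have "\<dots> \<le> 1 / 2 * norm (y - z)" using \<epsilon>L by (intro mult_right_mono) auto
      finally show ?thesis .
    qed
  qed (use R in auto)
  define y where "y s = h (s / \<epsilon>) 0" for s
  show ?thesis
  proof (rule that[OF \<epsilon>, of y])
    show "y 0 = y0" using h(2)[of 0] by (simp add: y_def)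
    fix s assume s: "s \<in> {-\<epsilon><..<\<epsilon>}"
    then have s': "s / \<epsilon> \<in> {-1<..<1}" using \<epsilon> by (auto simp: field_simps)
    have "((\<lambda>s. h s 0) has_vector_derivative \<epsilon> *\<^sub>R f (h (s / \<epsilon>) 0)) (at (s / \<epsilon>) within {-1<..<1})"
      by (rule has_vector_derivative_within_subset[OF h(3)]) (use s' in auto)
    then have d: "((\<lambda>s. h s 0) has_vector_derivative \<epsilon> *\<^sub>R f (h (s / \<epsilon>) 0)) (at (s / \<epsilon>))"
      unfolding at_within_open[OF s' open_greaterThanLessThan] .
    have "(((\<lambda>s. h s 0) \<circ> (\<lambda>s. s / \<epsilon>)) has_vector_derivative (1 / \<epsilon>) *\<^sub>R (\<epsilon> *\<^sub>R f (h (s / \<epsilon>) 0))) (at s)"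
    proof (rule vector_diff_chain_at)
      show "((\<lambda>s. h s 0) has_vector_derivative \<epsilon> *\<^sub>R f (h (s / \<epsilon>) 0)) (at (s / \<epsilon>))" by (rule d)
      have "((\<lambda>s. s / \<epsilon>) has_real_derivative 1 / \<epsilon>) (at s)"
        using \<epsilon> by (auto intro!: derivative_eq_intros)
      then show "((\<lambda>s. s / \<epsilon>) has_vector_derivative 1 / \<epsilon>) (at s)"
        by (simp add: has_real_derivative_iff_has_vector_derivative)
    qed
    then have "(y has_vector_derivative f (y s)) (at s)"
      using \<epsilon> by (simp add: o_def y_def[abs_def])
    moreover have "y s \<in> W" using h(1)[of "s / \<epsilon>" 0] s' R(2) unfolding y_def by auto
    ultimately show "y s \<in> W \<and> (y has_vector_derivative f (y s)) (at s)" by blast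
  qed
qed

lemma connection_bilinear: "connection U \<Gamma> \<Longrightarrow> x \<in> U \<Longrightarrow> bilinear (\<Gamma> x)"
  unfolding connection_def by blast

text \<open>The geodesic equation is a first-order field on U times the whole space. Smoothness is
  known only for \<open>\<Gamma>\<close> with fixed vector arguments, so the field \<open>f\<close>
  is compared with its expansion \<open>g\<close> over a basis.\<close>

lemma geodesic_exists:
  fixes \<Gamma> :: "'a::euclidean_space \<Rightarrow> 'a \<Rightarrow> 'a \<Rightarrow> 'a"
  assumes "open U" "connection U \<Gamma>" "x \<in> U"
  obtains \<epsilon> \<gamma> \<gamma>' where "\<epsilon> > 0" "geodesic_on U \<Gamma> {-\<epsilon><..<\<epsilon>} \<gamma> \<gamma>'" "\<gamma> 0 = x" "\<gamma>' 0 = v"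
proof -
  let ?W = "U \<times> (UNIV :: 'a set)"
  have W: "open ?W" using assms(1) by (simp add: open_Times)
  define f where "f z = (snd z, - \<Gamma> (fst z) (snd z) (snd z))" for z :: "'a \<times> 'a"
  define g where "g z = (snd z, - (\<Sum>b\<in>Basis. \<Sum>d\<in>Basis. ((snd z \<bullet> b) * (snd z \<bullet> d)) *\<^sub>R \<Gamma> (fst z) b d))"
    for z :: "'a \<times> 'a"
  have sfst: "smooth_on ?W (\<lambda>z. fst z)" and ssnd: "smooth_on ?W (\<lambda>z. snd z)"
    using smooth_on_linear[OF W bounded_linear_fst smooth_on_ident[OF W]]
      smooth_on_linear[OF W bounded_linear_snd smooth_on_ident[OF W]] by auto
  have "smooth_on ?W (\<lambda>z. \<Gamma> (fst z) b d)" for b d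
    by (rule smooth_on_compose[OF W assms(1) _ sfst]) (use assms(2) in \<open>auto simp: connection_def\<close>)
  then have s2: "smooth_on ?W (\<lambda>z. - (\<Sum>b\<in>Basis. \<Sum>d\<in>Basis. ((snd z \<bullet> b) * (snd z \<bullet> d)) *\<^sub>R \<Gamma> (fst z) b d))"
    by (intro smooth_on_minus smooth_on_sum smooth_on_scaleR smooth_on_mult smooth_on_inner smooth_on_const W ssnd) auto
  have "bounded_linear (\<lambda>v::'a. (v, 0::'a))" "bounded_linear (\<lambda>v::'a. (0::'a, v))"
    by (auto intro!: bounded_linear_Pair bounded_linear_ident bounded_linear_zero)
  from smooth_on_add[OF W smooth_on_linear[OF W this(1) ssnd] smooth_on_linear[OF W this(2) s2]]
  have "smooth_on ?W g" by (simp add: g_def[abs_def])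
  then have sf: "smooth_on ?W f"
  proof (rule smooth_on_cong[OF W, rotated])
    fix z :: "'a \<times> 'a" assume "z \<in> ?W"
    then have bil: "bilinear (\<Gamma> (fst z))" using connection_bilinear[OF assms(2)] by auto
    have "\<Gamma> (fst z) (snd z) (snd z) = (\<Sum>b\<in>Basis. (snd z \<bullet> b) *\<^sub>R \<Gamma> (fst z) b (snd z))"
      by (rule linear_euclidean_sum[symmetric]) (use bil in \<open>simp add: bilinear_def\<close>)
    also have "\<dots> = (\<Sum>b\<in>Basis. (snd z \<bullet> b) *\<^sub>R (\<Sum>d\<in>Basis. (snd z \<bullet> d) *\<^sub>R \<Gamma> (fst z) b d))"
      by (intro sum.cong refl arg_cong2[of _ _ _ _ "(*\<^sub>R)"] linear_euclidean_sum[symmetric])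
         (use bil in \<open>simp add: bilinear_def\<close>)
    finally show "g z = f z" by (simp add: f_def g_def scaleR_sum_right)
  qed
  obtain \<epsilon> y where y: "\<epsilon> > 0" "y 0 = (x, v)"
    "\<And>s. s \<in> {-\<epsilon><..<\<epsilon>} \<Longrightarrow> y s \<in> ?W \<and> (y has_vector_derivative f (y s)) (at s)"
    using autonomous_ODE_local_solution[OF W sf, of "(x, v)"] assms(3) by auto
  show ?thesis
  proof (rule that[OF y(1), of "\<lambda>s. fst (y s)" "\<lambda>s. snd (y s)"])
    show "geodesic_on U \<Gamma> {-\<epsilon><..<\<epsilon>} (\<lambda>s. fst (y s)) (\<lambda>s. snd (y s))"
      unfolding geodesic_on_def
    proof (intro ballI conjI)
      fix s assume "s \<in> {-\<epsilon><..<\<epsilon>}"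
      note ys = y(3)[OF this]
      show "fst (y s) \<in> U" using ys by auto
      show "((\<lambda>s. fst (y s)) has_vector_derivative snd (y s)) (at s)"
        using bounded_linear.has_vector_derivative[OF bounded_linear_fst conjunct2[OF ys]] by (simp add: f_def)
      show "((\<lambda>s. snd (y s)) has_vector_derivative - \<Gamma> (fst (y s)) (snd (y s)) (snd (y s))) (at s)"
        using bounded_linear.has_vector_derivative[OF bounded_linear_snd conjunct2[OF ys]] by (simp add: f_def)
    qed
  qed (use y(2) in auto)
qed

lemma linear_scalar_ODE_zero:
  fixes q a :: "real \<Rightarrow> real"
  assumes "continuous_on {-\<epsilon><..<\<epsilon>} a" "\<And>s. s \<in> {-\<epsilon><..<\<epsilon>} \<Longrightarrow> (q has_real_derivative a s * q s) (at s)"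
    and "q 0 = 0" "s \<in> {-\<epsilon><..<\<epsilon>}"
  shows "q s = 0"
proof -
  \<comment> \<open>The coefficient is continuous on the open interval only; the antiderivative in
    the integrating factor is taken on a closed subinterval containing 0 and s.\<close>
  define d where "d = (\<bar>s\<bar> + \<epsilon>) / 2"
  have d: "0 < d" "\<bar>s\<bar> < d" "d < \<epsilon>" using assms(4) by (auto simp: d_def)
  have ac: "continuous_on {-d..d} a" by (rule continuous_on_subset[OF assms(1)]) (use d in auto)
  obtain A where A: "\<And>x. x \<in> {-d..d} \<Longrightarrow> (A has_vector_derivative a x) (at x within {-d..d})"
    using antiderivative_continuous[OF ac] by blast
  have "((\<lambda>s. q s * exp (- A s)) has_derivative (\<lambda>h. 0)) (at x within {-d..d})" if "x \<in> {-d..d}" for x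
  proof -
    have 1: "(A has_real_derivative a x) (at x within {-d..d})"
      using A[OF that] by (simp add: has_real_derivative_iff_has_vector_derivative)
    have 2: "(q has_real_derivative a x * q x) (at x within {-d..d})"
      by (rule DERIV_subset[OF assms(2)]) (use that d in auto)
    have "((\<lambda>s. q s * exp (- A s)) has_real_derivative
        (a x * q x) * exp (- A x) + (exp (- A x) * (- a x)) * q x) (at x within {-d..d})"
      by (rule DERIV_mult[OF 2 DERIV_chain2[OF DERIV_exp DERIV_minus[OF 1]]])
    then have "((\<lambda>s. q s * exp (- A s)) has_real_derivative 0) (at x within {-d..d})"
      by (simp add: algebra_simps)
    then show ?thesis by (simp add: has_field_derivative_def lambda_zero)
  qed
  then have "\<exists>c. \<forall>x\<in>{-d..d}. q x * exp (- A x) = c" by (intro has_derivative_zero_constant) auto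
  then obtain c where c: "\<And>x. x \<in> {-d..d} \<Longrightarrow> q x * exp (- A x) = c" by blast
  from c[of 0] c[of s] d assms(3) show ?thesis by (auto simp: abs_less_iff)
qed

section \<open>Frobenius' theorem for one-forms\<close>

lemma Ck_on_imp_Ck_param:
  fixes f :: "'a::euclidean_space \<Rightarrow> 'b::real_normed_vector"
  assumes "open U" "open W" "Ck_on n U f" "W \<subseteq> U"
  shows "Ck_param S n W (\<lambda>_. f)"
  using Ck_param_compose[OF assms(2,1,3) Ck_param_ident[OF assms(2)], of S] assms(4) by auto

lemma Ck_param_imp_Ck_on:
  assumes "Ck_param S n U q" "s \<in> S"
  shows "Ck_on n U (q s)"
  using assms(1)
proof (induction n arbitrary: q)
  case 0
  have "continuous_on U (\<lambda>x. (\<lambda>(s, x). q s x) (s, x))"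
    by (rule continuous_on_compose2[of "S \<times> U"]) (use 0 assms(2) in \<open>auto intro!: continuous_intros\<close>)
  then show ?case by simp
next
  case (Suc n)
  have "Ck_on n U (\<lambda>x. frechet_derivative (q s) (at x) v)" for v
    by (rule Suc.IH[of "\<lambda>s x. frechet_derivative (q s) (at x) v"]) (use Suc.prems in simp)
  then show ?case using Suc.prems assms(2) by simp
qed

text \<open>A Gronwall bound with coefficient 1 / 2 on an interval of length 1: at the maximum of
  |y| the term |y| / 2 is absorbed into the left side, which produces the factors 2.\<close>

lemma unit_time_growth:
  fixes y q :: "real \<Rightarrow> real"
  assumes der: "\<And>s. s \<in> {0..1} \<Longrightarrow> (y has_real_derivative q s) (at s within {0..1})"
    and le: "\<And>s. s \<in> {0..1} \<Longrightarrow> \<bar>q s\<bar> \<le> A + \<bar>y s\<bar> / 2"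
    and "s \<in> {0..1}"
  shows "\<bar>y s\<bar> \<le> 2 * \<bar>y 0\<bar> + 2 * A"
proof -
  have "continuous_on {0..1} y"
    using der by (meson DERIV_continuous continuous_on_eq_continuous_within)
  then have "continuous_on {0..1} (\<lambda>s. \<bar>y s\<bar>)" by (intro continuous_intros)
  then obtain t where t: "t \<in> {0..1}" "\<And>s. s \<in> {0..1} \<Longrightarrow> \<bar>y s\<bar> \<le> \<bar>y t\<bar>"
    using continuous_attains_sup[of "{0..1::real}" "\<lambda>s. \<bar>y s\<bar>"] by auto
  have B: "\<bar>q s\<bar> \<le> A + \<bar>y t\<bar> / 2" if "s \<in> {0..1}" for s using le[OF that] t(2)[OF that] by linarith
  have "norm (y t - y 0) \<le> (A + \<bar>y t\<bar> / 2) * norm (t - 0)"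
    by (rule field_differentiable_bound[of "{0..1}" y q]) (use der B t in auto)
  also have "\<dots> \<le> (A + \<bar>y t\<bar> / 2) * 1"
    using t(1) B[of 0] by (intro mult_left_mono) auto
  finally have "\<bar>y t - y 0\<bar> \<le> A + \<bar>y t\<bar> / 2" by simp
  moreover have "\<bar>y t\<bar> \<le> \<bar>y t - y 0\<bar> + \<bar>y 0\<bar>" by linarith
  ultimately have "\<bar>y t\<bar> \<le> 2 * \<bar>y 0\<bar> + 2 * A" by (simp add: field_simps)
  then show ?thesis using t(2)[OF assms(3)] by linarith
qed

lemma has_derivative_quadratic:
  fixes f :: "'a::euclidean_space \<Rightarrow> real"
  assumes "linear D" "r > 0" "\<And>v. norm v < r \<Longrightarrow> \<bar>f (x + v) - f x - D v\<bar> \<le> C * norm v ^ 2"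
  shows "(f has_derivative D) (at x)"
  unfolding has_derivative_at
proof
  show "bounded_linear D" using assms(1) by (simp add: linear_conv_bounded_linear)
  show "(\<lambda>v. norm (f (x + v) - f x - D v) / norm v) \<midarrow>0\<rightarrow> 0"
  proof (rule Lim_null_comparison)
    show "\<forall>\<^sub>F v in at 0. norm (norm (f (x + v) - f x - D v) / norm v) \<le> C * norm v"
      unfolding eventually_at
    proof (intro exI conjI ballI impI)
      fix v :: 'a assume v: "v \<noteq> 0 \<and> dist v 0 < r"
      then have "\<bar>f (x + v) - f x - D v\<bar> / norm v \<le> (C * norm v ^ 2) / norm v"
        by (intro divide_right_mono assms(3)) auto
      then show "norm (norm (f (x + v) - f x - D v) / norm v) \<le> C * norm v"
        using v by (simp add: power2_eq_square)
    qed (use assms(2) in auto)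
    show "((\<lambda>v. C * norm v) \<longlongrightarrow> 0) (at 0)" by (auto intro!: tendsto_eq_intros)
  qed
qed

text \<open>
  The leaf through \<open>x\<close> is followed along the curve \<open>s \<mapsto> p + (1 - s) z + h e\<close>, where
  \<open>z\<close> is the part of \<open>x - p\<close> orthogonal to \<open>e\<close>, up to the line
  \<open>p + \<real> e\<close> at time \<open>s = 1\<close>; the height reached there is a first integral.
  The derivative of \<open>h\<close> with respect to \<open>x\<close> is known in advance: by integrability,
  \<open>\<eta>\<close> evaluated on the variation of the curve solves a scalar linear equation. Since the
  formula involves only \<open>h\<close> itself and an integral, it also gives smoothness by induction.
\<close>

lemma Frobenius_normalised:
  fixes \<eta> :: "'a::euclidean_space \<Rightarrow> 'a"
  assumes "open V" "smooth_on V \<eta>" "norm e = 1" "p \<in> V"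
    and unit: "\<And>x. x \<in> V \<Longrightarrow> \<eta> x \<bullet> e = 1"
    and integrable: "\<And>x a b. x \<in> V \<Longrightarrow> \<eta> x \<bullet> a = 0 \<Longrightarrow>
      frechet_derivative \<eta> (at x) a \<bullet> b - frechet_derivative \<eta> (at x) b \<bullet> a =
      - (\<eta> x \<bullet> b) * (frechet_derivative \<eta> (at x) e \<bullet> a)"
  shows "\<exists>W f. open W \<and> p \<in> W \<and> W \<subseteq> V \<and> smooth_on W f \<and>
    (\<forall>x\<in>W. \<exists>c>0. \<forall>v. frechet_derivative f (at x) v = c * (\<eta> x \<bullet> v))"
proof -
  define D where "D = (\<lambda>x v. frechet_derivative \<eta> (at x) v)"
  have D: "(\<eta> has_derivative D x) (at x)" if "x \<in> V" for x
    unfolding D_def using smooth_on_has_derivative[OF assms(2) that] by simp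
  have linD: "linear (D x)" if "x \<in> V" for x using D[OF that] has_derivative_linear by blast
  have De: "D x v \<bullet> e = 0" if "x \<in> V" for x v
  proof -
    have "((\<lambda>y. \<eta> y \<bullet> e) has_derivative (\<lambda>v. D x v \<bullet> e)) (at x)"
      using D[OF that] by (auto intro!: derivative_eq_intros)
    moreover have "((\<lambda>y. \<eta> y \<bullet> e) has_derivative (\<lambda>v. 0)) (at x)"
      by (rule has_derivative_transform_within_open[OF has_derivative_const assms(1) that]) (use unit in auto)
    ultimately show ?thesis using has_derivative_unique by (metis (no_types))
  qed
  define \<pi> where "\<pi> v = v - (v \<bullet> e) *\<^sub>R e" for v
  have lin\<pi>: "linear \<pi>" unfolding \<pi>_def by (auto intro!: linearI simp: algebra_simps)
  have bl\<pi>: "bounded_linear \<pi>" using lin\<pi> by (simp add: linear_conv_bounded_linear)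
  have ee: "e \<bullet> e = 1" using assms(3) by (simp add: norm_eq_1)
  have norm\<pi>: "norm (\<pi> v) \<le> norm v" for v
  proof -
    have "norm v ^ 2 - norm (\<pi> v) ^ 2 = (v \<bullet> e)^2"
      unfolding power2_norm_eq_inner \<pi>_def using ee
      by (simp add: algebra_simps inner_commute power2_eq_square)
    then have "norm (\<pi> v) ^ 2 \<le> norm v ^ 2" by (smt (verit) zero_le_power2)
    then show ?thesis by (simp add: abs_le_square_iff[symmetric])
  qed
  obtain R where R: "R > 0" "cball p R \<subseteq> V" using assms open_contains_cball by blast
  obtain L where L: "L \<ge> 0" "\<And>x y. x \<in> cball p R \<Longrightarrow> y \<in> cball p R \<Longrightarrow> norm (\<eta> y - \<eta> x) \<le> L * norm (y - x)"
    using smooth_on_Lipschitz[OF assms(2) compact_cball convex_cball R(2)] by blast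
  obtain L2 where L2: "L2 \<ge> 0" "\<And>x y. x \<in> cball p R \<Longrightarrow> y \<in> cball p R \<Longrightarrow>
      norm (\<eta> y - \<eta> x - D x (y - x)) \<le> L2 * norm (y - x) ^ 2"
    using smooth_on_Taylor[OF assms(2) compact_cball convex_cball R(2)] unfolding D_def by blast
  obtain M where M: "M \<ge> 0" "\<And>x v. x \<in> cball p R \<Longrightarrow> norm (D x v) \<le> M * norm v"
    using smooth_on_derivative_bound[OF assms(2) compact_cball R(2)] unfolding D_def by blast
  have etac: "continuous_on (cball p R) \<eta>"
    using smooth_on_continuous[OF assms(2)] R(2) continuous_on_subset by blast
  then have "bounded (\<eta> ` cball p R)"
    using compact_cball compact_continuous_image compact_imp_bounded by blast
  then obtain B where B: "B > 0" "\<And>y. y \<in> cball p R \<Longrightarrow> norm (\<eta> y) \<le> B"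
    unfolding bounded_pos by auto
  \<comment> \<open>The first two bounds keep the curves and their speed within the ball of radius
    R; the third makes the right side of the ODE 1/2-Lipschitz in h; the fourth makes the
    coefficient \<open>m\<close> of the variational equation at most 1/2, as
    \<open>unit_time_growth\<close> requires.\<close>
  define r where "r = min (R / 4) (min (R / (4 * B)) (min (1 / (2 * (L + 1))) (1 / (2 * (M + 1)))))"
  have r: "r > 0" "r \<le> R / 4" using R B L M by (auto simp: r_def)
  have rB: "B * r \<le> R / 4"
  proof -
    have "r \<le> R / (4 * B)" by (simp add: r_def)
    then show ?thesis using B by (simp add: field_simps)
  qed
  have rL: "L * r \<le> 1 / 2"
  proof -
    have "L * r \<le> (L + 1) * (1 / (2 * (L + 1)))" using L r by (intro mult_mono) (auto simp: r_def)
    also have "\<dots> = 1 / 2" using L(1) by (simp add: divide_simps)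
    finally show ?thesis .
  qed
  have rM: "M * r \<le> 1 / 2"
  proof -
    have "M * r \<le> (M + 1) * (1 / (2 * (M + 1)))" using M r by (intro mult_mono) (auto simp: r_def)
    also have "\<dots> = 1 / 2" using M(1) by (simp add: divide_simps)
    finally show ?thesis .
  qed
  define z where "z x = \<pi> (x - p)" for x
  define \<gamma> where "\<gamma> s h x = p + (1 - s) *\<^sub>R z x + h *\<^sub>R e" for s h :: real and x
  have norm_z: "norm (z x) \<le> r" if "x \<in> cball p r" for x
    using norm\<pi>[of "x - p"] that unfolding z_def by (simp add: dist_norm norm_minus_commute)
  have \<gamma>_in: "\<gamma> s h x \<in> cball p R" if "s \<in> {-1..1}" "h \<in> cball 0 (R / 2)" "x \<in> cball p r" for s h x
  proof -
    have "norm ((1 - s) *\<^sub>R z x + h *\<^sub>R e) \<le> \<bar>1 - s\<bar> * norm (z x) + \<bar>h\<bar> * norm e"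
      by (metis norm_triangle_ineq norm_scaleR)
    also have "\<dots> \<le> 2 * r + R / 2 * 1"
      using that norm_z[OF that(3)] assms(3) R r by (intro add_mono mult_mono) auto
    also have "\<dots> \<le> R" using r by simp
    finally have "dist (\<gamma> s h x) p \<le> R" unfolding \<gamma>_def add.assoc dist_norm add_diff_cancel_left' .
    then show ?thesis by (simp only: mem_cball dist_commute)
  qed
  define F where "F s h x = \<eta> (\<gamma> s h x) \<bullet> z x" for s h x
  have \<gamma>_cont: "continuous_on X (\<lambda>(s, h, x). \<gamma> s h x)" for X
    unfolding \<gamma>_def z_def case_prod_beta
    by (intro continuous_intros bounded_linear.continuous_on[OF bl\<pi>])
  obtain h where h: "continuous_on ({-1..1} \<times> cball p r) (\<lambda>(s, x). h s x)"
    "\<And>s x. s \<in> {-1..1} \<Longrightarrow> x \<in> cball p r \<Longrightarrow> h s x \<in> cball 0 (R / 2)"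
    "\<And>x. x \<in> cball p r \<Longrightarrow> h 0 x = (x - p) \<bullet> e"
    "\<And>s x. s \<in> {-1..1} \<Longrightarrow> x \<in> cball p r \<Longrightarrow>
      ((\<lambda>s. h s x) has_vector_derivative F s (h s x) x) (at s within {-1..1})"
  proof (rule Picard_Lindeloef[where P = "cball p r" and F = F and c = 0 and R = "R / 2" and b = "\<lambda>x. (x - p) \<bullet> e"])
    show "continuous_on ({-1..1} \<times> cball 0 (R / 2) \<times> cball p r) (\<lambda>(s, h, x). F s h x)"
    proof -
      have "continuous_on ({-1..1} \<times> cball 0 (R / 2) \<times> cball p r) (\<lambda>a. \<eta> ((\<lambda>(s, h, x). \<gamma> s h x) a))"
        by (rule continuous_on_compose2[OF etac \<gamma>_cont]) (use \<gamma>_in in auto)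
      then show ?thesis
        unfolding F_def z_def case_prod_beta
        by (intro continuous_intros bounded_linear.continuous_on[OF bl\<pi>])
    qed
    fix s h :: real and x assume *: "s \<in> {-1..1::real}" "h \<in> cball 0 (R / 2)" "x \<in> cball p r"
    have "norm (F s h x) \<le> norm (\<eta> (\<gamma> s h x)) * norm (z x)"
      unfolding F_def real_norm_def by (rule Cauchy_Schwarz_ineq2)
    also have "\<dots> \<le> B * r" using B \<gamma>_in[OF *] norm_z[OF *(3)] r by (intro mult_mono) auto
    finally show "norm (F s h x) \<le> (R / 2) / 2" using rB by simp
    fix h' :: real assume **: "h' \<in> cball 0 (R / 2)"
    have "norm (F s h x - F s h' x) \<le> norm (\<eta> (\<gamma> s h x) - \<eta> (\<gamma> s h' x)) * norm (z x)"
      unfolding F_def inner_diff_left[symmetric] real_norm_def by (rule Cauchy_Schwarz_ineq2)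
    also have "\<dots> \<le> (L * norm (\<gamma> s h x - \<gamma> s h' x)) * r"
      using L \<gamma>_in * ** norm_z[OF *(3)] by (intro mult_mono) auto
    also have "\<gamma> s h x - \<gamma> s h' x = (h - h') *\<^sub>R e" by (simp add: \<gamma>_def algebra_simps)
    also have "(L * norm ((h - h') *\<^sub>R e)) * r = (L * r) * norm (h - h')" using assms(3) by simp
    also have "\<dots> \<le> 1 / 2 * norm (h - h')" using rL by (intro mult_right_mono) auto
    finally show "norm (F s h x - F s h' x) \<le> 1 / 2 * norm (h - h')" .
  next
    fix x assume "x \<in> cball p r"
    then have "\<bar>(x - p) \<bullet> e\<bar> \<le> r * 1"
      using Cauchy_Schwarz_ineq2[of "x - p" e] assms(3) by (auto simp: dist_norm norm_minus_commute)
    then show "(x - p) \<bullet> e \<in> cball 0 (R / 2 / 2)" using r by simp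
  qed (use r R in \<open>auto intro!: continuous_intros\<close>)
  define g where "g s x = \<gamma> s (h s x) x" for s x
  have g_in: "g s x \<in> cball p R" if "s \<in> {0..1}" "x \<in> cball p r" for s x
    unfolding g_def by (rule \<gamma>_in) (use that h(2) in auto)
  have g_V: "g s x \<in> V" if "s \<in> {0..1}" "x \<in> cball p r" for s x using g_in[OF that] R(2) by blast
  have g0: "g 0 x = x" if "x \<in> cball p r" for x
    unfolding g_def \<gamma>_def z_def \<pi>_def using h(3)[OF that] by simp
  have dh: "((\<lambda>s. h s x) has_real_derivative \<eta> (g s x) \<bullet> z x) (at s within {0..1})"
    if "s \<in> {0..1}" "x \<in> cball p r" for s x
    unfolding has_real_derivative_iff_has_vector_derivative g_def F_def[symmetric]
    by (rule has_vector_derivative_within_subset[OF h(4)]) (use that in auto)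
  have dg: "((\<lambda>s. g s x) has_vector_derivative - z x + (\<eta> (g s x) \<bullet> z x) *\<^sub>R e) (at s within {0..1})"
    if "s \<in> {0..1}" "x \<in> cball p r" for s x
    unfolding g_def[abs_def] \<gamma>_def
    using dh[OF that]
    by (auto intro!: derivative_eq_intros simp: g_def \<gamma>_def)
  define W where "W = ball p r"
  have W: "open W" "p \<in> W" "W \<subseteq> cball p r" "W \<subseteq> V" "cball p r \<subseteq> V"
    using r R unfolding W_def by (auto simp: subset_iff dist_norm)
  have smooth_comp: "Ck_param {0..1} n W (\<lambda>s x. G (g s x))"
    if "Ck_param {0..1} n W g" "Ck_on n V G" for n and G :: "'a \<Rightarrow> 'a"
    by (rule Ck_param_compose[OF W(1) assms(1) that(2,1)]) (use g_V W in blast)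
  have z_Ck: "Ck_param {0..1} n W (\<lambda>s x. z x)" for n
    unfolding z_def diff_conv_add_uminus
    by (intro Ck_param_linear[OF W(1) bl\<pi>] Ck_param_add W Ck_param_ident Ck_param_const) auto
  have g_Ck: "Ck_param {0..1} n W g" if "Ck_param {0..1} n W h" for n
    unfolding g_def[abs_def] \<gamma>_def
    by (intro Ck_param_add W Ck_param_const Ck_param_bilinear[OF _ bounded_bilinear_scaleR] z_Ck that)
       (auto intro!: continuous_intros)
  have Ck_D: "Ck_on n V (\<lambda>x. D x v)" for n v
    using smooth_on_frechet[OF assms(2), of v] by (simp add: smooth_on_def D_def)
  have Ck_eta: "Ck_on n V \<eta>" for n using assms(2) by (simp add: smooth_on_def)
  have h0: "Ck_param {0..1} 0 W h"
    using h(1) W(3) by (auto elim!: continuous_on_subset)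
  \<comment> \<open>The coefficient of the scalar linear equation satisfied by \<eta> on the
    variation of the curve; \<open>exp (I s x)\<close> will be its propagator from time 0 to
    s.\<close>
  define m where "m s x = D (g s x) e \<bullet> z x" for s x
  have m_Ck: "Ck_param {0..1} n W m" if "Ck_param {0..1} n W h" for n
    unfolding m_def[abs_def]
    by (intro Ck_param_bilinear[OF W(1) bounded_bilinear_inner] smooth_comp[OF g_Ck[OF that]] Ck_D z_Ck)
  have m_cont: "continuous_on {0..1} (\<lambda>s. m s x)" if "x \<in> W" for x
  proof -
    have "continuous_on {0..1} (\<lambda>s. (\<lambda>(s, x). m s x) (s, x))"
      by (rule continuous_on_compose2[OF Ck_param_continuous[OF m_Ck[OF h0]]])
         (use that in \<open>auto intro!: continuous_intros\<close>)
    then show ?thesis by simp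
  qed
  define I where "I s x = integral_to (\<lambda>\<sigma>. m \<sigma> x) s" for s x
  have dI: "((\<lambda>s. I s x) has_real_derivative m s x) (at s within {0..1})" if "s \<in> {0..1}" "x \<in> W" for s x
    unfolding I_def has_real_derivative_iff_has_vector_derivative
    by (rule integral_to_derivative[OF m_cont[OF that(2)] _ _ that(1)]) auto
  \<comment> \<open>Candidate for the derivative of \<open>h s\<close>: the variation of the curve
    in direction v is (1 - s) \<pi> v + w e, \<eta> takes on it the value (\<eta> x \<bullet> v) exp
    I, and \<eta> \<bullet> e = 1 lets this be solved for w.\<close>
  define w where "w s x v = (\<eta> x \<bullet> v) * exp (I s x) - (1 - s) * (\<eta> (g s x) \<bullet> \<pi> v)" for s x v
  have w0: "w 0 x v = v \<bullet> e" if "x \<in> W" for x v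
  proof -
    have "g 0 x = x" "\<eta> x \<bullet> e = 1" using g0 unit that W by blast+
    then show ?thesis unfolding w_def I_def integral_to_def by (simp add: \<pi>_def algebra_simps)
  qed
  \<comment> \<open>This is the ODE for h linearised along the solution. Integrability enters
    through \<open>int\<close>, with the velocity \<open>g'\<close> as the vector annihilated by
    \<eta>.\<close>
  have dw: "((\<lambda>s. w s x v) has_real_derivative
      D (g s x) ((1 - s) *\<^sub>R \<pi> v + w s x v *\<^sub>R e) \<bullet> z x + \<eta> (g s x) \<bullet> \<pi> v) (at s within {0..1})"
    if s: "s \<in> {0..1}" and x: "x \<in> W" for s x v
  proof -
    have xc: "x \<in> cball p r" using x W by blast
    note gV = g_V[OF s xc]
    define g' where "g' = - z x + (\<eta> (g s x) \<bullet> z x) *\<^sub>R e"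
    have g'0: "\<eta> (g s x) \<bullet> g' = 0" using unit[OF gV] by (simp add: g'_def algebra_simps)
    have int: "D (g s x) g' \<bullet> \<pi> v - D (g s x) (\<pi> v) \<bullet> g' = - (\<eta> (g s x) \<bullet> \<pi> v) * (D (g s x) e \<bullet> g')"
      using integrable[OF gV g'0] unfolding D_def .
    have zg': "D (g s x) a \<bullet> g' = - (D (g s x) a \<bullet> z x)" for a
      unfolding g'_def using De[OF gV] by (simp add: algebra_simps)
    have "((\<lambda>s. \<eta> (g s x)) has_derivative (\<lambda>h. D (g s x) (h *\<^sub>R g'))) (at s within {0..1})"
      using has_derivative_compose[OF dg[OF s xc, unfolded has_vector_derivative_def] D[OF gV]]
      unfolding g'_def .
    then have deta: "((\<lambda>s. \<eta> (g s x) \<bullet> \<pi> v) has_real_derivative D (g s x) g' \<bullet> \<pi> v) (at s within {0..1})"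
      unfolding has_field_derivative_def linear_scale[OF linD[OF gV]]
      by (auto intro!: derivative_eq_intros simp: mult.commute)
    have "((\<lambda>s. w s x v) has_real_derivative
        (\<eta> x \<bullet> v) * (exp (I s x) * m s x) - ((1 - s) * (D (g s x) g' \<bullet> \<pi> v) - (\<eta> (g s x) \<bullet> \<pi> v)))
        (at s within {0..1})"
      unfolding w_def using dI[OF s x] deta by (auto intro!: derivative_eq_intros)
    moreover have "(\<eta> x \<bullet> v) * (exp (I s x) * m s x) - ((1 - s) * (D (g s x) g' \<bullet> \<pi> v) - (\<eta> (g s x) \<bullet> \<pi> v))
        = D (g s x) ((1 - s) *\<^sub>R \<pi> v + w s x v *\<^sub>R e) \<bullet> z x + \<eta> (g s x) \<bullet> \<pi> v"
    proof -
      have 1: "D (g s x) g' \<bullet> \<pi> v = (\<eta> (g s x) \<bullet> \<pi> v) * m s x - D (g s x) (\<pi> v) \<bullet> z x"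
        using int unfolding zg' m_def by (simp add: algebra_simps)
      have 2: "D (g s x) ((1 - s) *\<^sub>R \<pi> v + w s x v *\<^sub>R e) \<bullet> z x
          = (1 - s) * (D (g s x) (\<pi> v) \<bullet> z x) + w s x v * m s x"
        unfolding m_def linear_add[OF linD[OF gV]] linear_scale[OF linD[OF gV]] by (simp add: inner_add_left)
      show ?thesis unfolding 1 2 unfolding w_def by (simp add: algebra_simps)
    qed
    ultimately show ?thesis by simp
  qed
  have linw: "linear (w s x)" for s x
    unfolding w_def using lin\<pi> by (auto intro!: linearI simp: linear_add linear_scale algebra_simps)
  \<comment> \<open>C1 is the growth bound 2 + 2 (1/2 + B) for the difference of two solutions; C
    collects the Taylor remainder of \<eta> and the product of its increment with \<pi> v, both
    quadratic in v.\<close>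
  define C1 where "C1 = 3 + 2 * B"
  define C where "C = L2 * (1 + C1)^2 * r + L * (1 + C1)"
  have Cpos: "C1 \<ge> 0" "C \<ge> 0" using B L L2 r by (auto simp: C1_def C_def intro!: add_nonneg_nonneg mult_nonneg_nonneg)
  have w_deriv: "((\<lambda>x. h s x) has_derivative w s x) (at x)" if s: "s \<in> {0..1}" and x: "x \<in> W" for s x
  proof -
    obtain d where d: "d > 0" "ball x d \<subseteq> W" using W(1) x open_contains_ball by blast
    show ?thesis
    proof (rule has_derivative_quadratic[OF linw d(1)])
      fix v :: 'a assume v: "norm v < d"
      have xv: "x + v \<in> W" using d v by (auto simp: subset_iff dist_norm)
      have xc: "x \<in> cball p r" "x + v \<in> cball p r" using x xv W by blast+
      define \<delta> where "\<delta> s = h s (x + v) - h s x" for s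
      define \<epsilon> where "\<epsilon> s = \<delta> s - w s x v" for s
      define \<Delta> where "\<Delta> s = (1 - s) *\<^sub>R \<pi> v + \<delta> s *\<^sub>R e" for s
      have zv: "z (x + v) = z x + \<pi> v" unfolding z_def using lin\<pi>
        by (metis add.commute add_diff_eq linear_add)
      have g\<Delta>: "g s (x + v) = g s x + \<Delta> s" for s
        unfolding g_def \<gamma>_def \<Delta>_def \<delta>_def zv by (simp add: algebra_simps)
      have n\<Delta>: "norm (\<Delta> s) \<le> norm v + \<bar>\<delta> s\<bar>" if "s \<in> {0..1}" for s
      proof -
        have "norm (\<Delta> s) \<le> \<bar>1 - s\<bar> * norm (\<pi> v) + \<bar>\<delta> s\<bar> * norm e"
          unfolding \<Delta>_def by (metis norm_triangle_ineq norm_scaleR)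
        also have "\<dots> \<le> 1 * norm v + \<bar>\<delta> s\<bar> * 1"
          using that norm\<pi> assms(3) by (intro add_mono mult_mono) auto
        finally show ?thesis by simp
      qed
      have eta_L: "norm (\<eta> (g s x + \<Delta> s) - \<eta> (g s x)) \<le> L * norm (\<Delta> s)" if "s \<in> {0..1}" for s
        using L(2)[OF g_in[OF that xc(1)] g_in[OF that xc(2)]] unfolding g\<Delta> by simp
      have d\<delta>: "(\<delta> has_real_derivative
          (\<eta> (g s x + \<Delta> s) - \<eta> (g s x)) \<bullet> z x + \<eta> (g s x + \<Delta> s) \<bullet> \<pi> v) (at s within {0..1})"
        if "s \<in> {0..1}" for s
        unfolding \<delta>_def[abs_def] using DERIV_diff[OF dh[OF that xc(2)] dh[OF that xc(1)]]
        unfolding g\<Delta> zv by (simp add: algebra_simps)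
      have \<delta>_le: "\<bar>\<delta> s\<bar> \<le> C1 * norm v" if "s \<in> {0..1}" for s
      proof -
        have "\<bar>\<delta> s\<bar> \<le> 2 * \<bar>\<delta> 0\<bar> + 2 * ((1/2 + B) * norm v)"
        proof (rule unit_time_growth[OF d\<delta> _ that])
          fix s :: real assume s: "s \<in> {0..1}"
          have "\<bar>(\<eta> (g s x + \<Delta> s) - \<eta> (g s x)) \<bullet> z x\<bar> \<le> (L * norm (\<Delta> s)) * r"
            using eta_L[OF s] norm_z[OF xc(1)] L r
            by (intro order_trans[OF Cauchy_Schwarz_ineq2] mult_mono) auto
          also have "\<dots> = (L * r) * norm (\<Delta> s)" by simp
          also have "\<dots> \<le> 1 / 2 * (norm v + \<bar>\<delta> s\<bar>)" using rL n\<Delta>[OF s] by (intro mult_mono) auto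
          finally have 1: "\<bar>(\<eta> (g s x + \<Delta> s) - \<eta> (g s x)) \<bullet> z x\<bar> \<le> 1 / 2 * (norm v + \<bar>\<delta> s\<bar>)" .
          have 2: "\<bar>\<eta> (g s x + \<Delta> s) \<bullet> \<pi> v\<bar> \<le> B * norm v"
            using B(2)[OF g_in[OF s xc(2)]] norm\<pi>[of v] B(1) unfolding g\<Delta>
            by (intro order_trans[OF Cauchy_Schwarz_ineq2] mult_mono) auto
          show "\<bar>(\<eta> (g s x + \<Delta> s) - \<eta> (g s x)) \<bullet> z x + \<eta> (g s x + \<Delta> s) \<bullet> \<pi> v\<bar>
              \<le> (1/2 + B) * norm v + \<bar>\<delta> s\<bar> / 2"
            using 1 2 by (simp add: algebra_simps)
        qed
        also have "\<delta> 0 = v \<bullet> e" unfolding \<delta>_def h(3)[OF xc(1)] h(3)[OF xc(2)] by (simp add: inner_diff_left inner_add_left)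
        also have "2 * \<bar>v \<bullet> e\<bar> \<le> 2 * (norm v * 1)"
          using Cauchy_Schwarz_ineq2[of v e] assms(3) by simp
        finally show ?thesis by (simp add: C1_def algebra_simps)
      qed
      have \<Delta>_le: "norm (\<Delta> s) \<le> (1 + C1) * norm v" if "s \<in> {0..1}" for s
        using n\<Delta>[OF that] \<delta>_le[OF that] by (simp add: algebra_simps)
      \<comment> \<open>The linearisation error starts at 0 and satisfies a linear equation with
        coefficient at most 1/2 and a source of order norm v ^ 2, so it stays of that order; this is
        differentiability with derivative \<open>w\<close>.\<close>
      have "\<bar>\<epsilon> s\<bar> \<le> 2 * \<bar>\<epsilon> 0\<bar> + 2 * (C * norm v ^ 2)"
      proof (rule unit_time_growth[OF _ _ s])
        fix s :: real assume s: "s \<in> {0..1}"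
        note gV = g_V[OF s xc(1)]
        let ?q = "(\<eta> (g s x + \<Delta> s) - \<eta> (g s x) - D (g s x) (\<Delta> s)) \<bullet> z x
            + (\<eta> (g s x + \<Delta> s) - \<eta> (g s x)) \<bullet> \<pi> v + \<epsilon> s * m s x"
        have "(1 - s) *\<^sub>R \<pi> v + w s x v *\<^sub>R e = \<Delta> s - \<epsilon> s *\<^sub>R e"
          by (simp add: \<Delta>_def \<epsilon>_def algebra_simps)
        then have eq: "D (g s x) ((1 - s) *\<^sub>R \<pi> v + w s x v *\<^sub>R e) \<bullet> z x = D (g s x) (\<Delta> s) \<bullet> z x - \<epsilon> s * m s x"
          unfolding m_def by (simp add: linear_diff[OF linD[OF gV]] linear_scale[OF linD[OF gV]] inner_diff_left)
        show "(\<epsilon> has_real_derivative ?q) (at s within {0..1})"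
          unfolding \<epsilon>_def[abs_def] using DERIV_diff[OF d\<delta>[OF s] dw[OF s x, of v]] unfolding eq
          by (simp add: algebra_simps \<epsilon>_def)
        have "\<bar>(\<eta> (g s x + \<Delta> s) - \<eta> (g s x) - D (g s x) (\<Delta> s)) \<bullet> z x\<bar>
            \<le> (L2 * ((1 + C1) * norm v)^2) * r"
        proof (intro order_trans[OF Cauchy_Schwarz_ineq2] mult_mono)
          have "norm (\<eta> (g s x + \<Delta> s) - \<eta> (g s x) - D (g s x) (\<Delta> s)) \<le> L2 * norm (\<Delta> s) ^ 2"
            using L2(2)[OF g_in[OF s xc(1)] g_in[OF s xc(2)]] unfolding g\<Delta> by simp
          also have "\<dots> \<le> L2 * ((1 + C1) * norm v)^2"
            using \<Delta>_le[OF s] L2 by (intro mult_left_mono power_mono) auto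
          finally show "norm (\<eta> (g s x + \<Delta> s) - \<eta> (g s x) - D (g s x) (\<Delta> s)) \<le> L2 * ((1 + C1) * norm v)^2" .
        qed (use norm_z[OF xc(1)] L2 in auto)
        then have 1: "\<bar>(\<eta> (g s x + \<Delta> s) - \<eta> (g s x) - D (g s x) (\<Delta> s)) \<bullet> z x\<bar>
            \<le> (L2 * (1 + C1)^2 * r) * norm v ^ 2" by (simp add: power_mult_distrib mult_ac)
        have "\<bar>(\<eta> (g s x + \<Delta> s) - \<eta> (g s x)) \<bullet> \<pi> v\<bar> \<le> (L * ((1 + C1) * norm v)) * norm v"
        proof (intro order_trans[OF Cauchy_Schwarz_ineq2] mult_mono)
          show "norm (\<eta> (g s x + \<Delta> s) - \<eta> (g s x)) \<le> L * ((1 + C1) * norm v)"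
            using eta_L[OF s] \<Delta>_le[OF s] L by (meson mult_left_mono order_trans)
        qed (use norm\<pi> L Cpos in auto)
        then have 2: "\<bar>(\<eta> (g s x + \<Delta> s) - \<eta> (g s x)) \<bullet> \<pi> v\<bar> \<le> (L * (1 + C1)) * norm v ^ 2"
          by (simp add: power2_eq_square mult_ac)
        have "\<bar>m s x\<bar> \<le> (M * 1) * r"
          unfolding m_def using M(2)[OF g_in[OF s xc(1)], of e] norm_z[OF xc(1)] M(1) assms(3)
          by (intro order_trans[OF Cauchy_Schwarz_ineq2] mult_mono) auto
        then have "\<bar>\<epsilon> s * m s x\<bar> \<le> \<bar>\<epsilon> s\<bar> * (1 / 2)"
          unfolding abs_mult using rM by (intro mult_left_mono) auto
        then show "\<bar>?q\<bar> \<le> C * norm v ^ 2 + \<bar>\<epsilon> s\<bar> / 2"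
          using 1 2 unfolding C_def by (simp add: algebra_simps)
      qed
      moreover have "\<epsilon> 0 = 0" unfolding \<epsilon>_def \<delta>_def h(3)[OF xc(1)] h(3)[OF xc(2)] w0[OF x]
        by (simp add: inner_diff_left inner_add_left)
      ultimately show "\<bar>h s (x + v) - h s x - w s x v\<bar> \<le> (2 * C) * norm v ^ 2"
        by (simp add: \<epsilon>_def \<delta>_def)
    qed
  qed
  have h_Ck: "Ck_param {0..1} n W h" for n
  proof (induction n)
    case 0
    show ?case by (rule h0)
  next
    case (Suc n)
    show ?case
    proof (rule Ck_param_SucI[OF W(1) Ck_param_continuous[OF Suc] w_deriv])
      fix v
      show "Ck_param {0..1} n W (\<lambda>s x. w s x v)"
        unfolding w_def diff_conv_add_uminus[of "_ * exp _"] mult_minus_left[symmetric]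
      proof (intro Ck_param_add Ck_param_bilinear[OF W(1) bounded_bilinear_mult] Ck_param_exp W)
        show "Ck_param {0..1} n W (\<lambda>s x. \<eta> x \<bullet> v)"
          by (intro Ck_param_linear[OF W(1) bounded_linear_inner_left] Ck_on_imp_Ck_param[OF assms(1) W(1) Ck_eta W(4)])
        show "Ck_param {0..1} n W I"
          unfolding I_def[abs_def] by (intro Ck_param_integral_to[OF W(1) m_Ck[OF Suc]]) auto
        show "Ck_param {0..1} n W (\<lambda>s x. \<eta> (g s x) \<bullet> \<pi> v)"
          by (intro Ck_param_linear[OF W(1) bounded_linear_inner_left] smooth_comp[OF g_Ck[OF Suc]] Ck_eta)
        show "Ck_param {0..1} n W (\<lambda>s x. - (1 - s))"
          by (intro Ck_param_const W(1) continuous_intros)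
      qed
    qed
  qed
  show ?thesis
  proof (intro exI[of _ W] exI[of _ "h 1"] conjI ballI)
    show "open W" "p \<in> W" "W \<subseteq> V" by (rule W)+
    show "smooth_on W (h 1)"
      unfolding smooth_on_def using Ck_param_imp_Ck_on[OF h_Ck, of 1] by simp
    fix x assume x: "x \<in> W"
    \<comment> \<open>At s = 1 the second term of \<open>w\<close> drops out, and the derivative is
      the positive multiple \<open>exp (I 1 x)\<close> of \<eta>.\<close>
    have "frechet_derivative (h 1) (at x) = w 1 x"
      using frechet_derivative_at[OF w_deriv[of 1 x]] x by simp
    then show "\<exists>c>0. \<forall>v. frechet_derivative (h 1) (at x) v = c * (\<eta> x \<bullet> v)"
      by (intro exI[of _ "exp (I 1 x)"]) (simp add: w_def)
  qed
qed

text \<open>This is (\<omega> \<and> d\<omega>)(a, b, c) = 0, with d\<omega>(a, b) written through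
  derivatives of the coefficient vector.\<close>

definition integrable_form :: "'a::euclidean_space set \<Rightarrow> ('a \<Rightarrow> 'a) \<Rightarrow> bool" where
  "integrable_form U \<omega> \<longleftrightarrow> (\<forall>x\<in>U. \<forall>a b c.
     (\<omega> x \<bullet> c) * (frechet_derivative \<omega> (at x) a \<bullet> b - frechet_derivative \<omega> (at x) b \<bullet> a) +
     (\<omega> x \<bullet> a) * (frechet_derivative \<omega> (at x) b \<bullet> c - frechet_derivative \<omega> (at x) c \<bullet> b) +
     (\<omega> x \<bullet> b) * (frechet_derivative \<omega> (at x) c \<bullet> a - frechet_derivative \<omega> (at x) a \<bullet> c) = 0)"

text \<open>Dividing by a component \<omega> \<bullet> e that is nonzero near p changes neither the
  kernels nor integrability and reduces to the normalised case. The normalised condition is \<omega>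
  \<and> d\<omega> = 0 with e as one of the three vectors.\<close>

theorem Frobenius_codim1:
  fixes \<omega> :: "'a::euclidean_space \<Rightarrow> 'a"
  assumes "open U" "smooth_on U \<omega>" "\<And>x. x \<in> U \<Longrightarrow> \<omega> x \<noteq> 0" "integrable_form U \<omega>"
  shows "codim1_foliation U (ker_form \<omega>)"
  unfolding codim1_foliation_def
proof
  fix p assume p: "p \<in> U"
  obtain e where e: "e \<in> Basis" "\<omega> p \<bullet> e \<noteq> 0"
    using assms(3)[OF p] euclidean_all_zero_iff by blast
  define a where "a x = \<omega> x \<bullet> e" for x
  have sa: "smooth_on U a" unfolding a_def by (intro smooth_on_inner smooth_on_const assms)
  define V where "V = U \<inter> a -` (- {0})"
  have V: "open V" unfolding V_def
    by (rule continuous_open_preimage[OF smooth_on_continuous[OF sa] assms(1)]) auto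
  have VU: "V \<subseteq> U" and aV: "\<And>x. x \<in> V \<Longrightarrow> a x \<noteq> 0" and pV: "p \<in> V"
    using p e by (auto simp: V_def a_def)
  define \<eta> where "\<eta> x = inverse (a x) *\<^sub>R \<omega> x" for x
  have s\<eta>: "smooth_on V \<eta>" unfolding \<eta>_def
    by (intro smooth_on_scaleR smooth_on_inverse V aV smooth_on_subset[OF sa VU] smooth_on_subset[OF assms(2) VU])
  have unit: "\<eta> x \<bullet> e = 1" if "x \<in> V" for x using aV[OF that] by (simp add: \<eta>_def a_def)
  let ?D = "\<lambda>x v. frechet_derivative \<omega> (at x) v"
  have D\<eta>: "frechet_derivative \<eta> (at x) v =
      inverse (a x) *\<^sub>R ?D x v - (?D x v \<bullet> e / (a x)^2) *\<^sub>R \<omega> x" if "x \<in> V" for x v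
  proof -
    have d: "(\<omega> has_derivative ?D x) (at x)" using smooth_on_has_derivative[OF assms(2)] that VU by blast
    have "(a has_derivative (\<lambda>v. ?D x v \<bullet> e)) (at x)"
      unfolding a_def[abs_def] by (auto intro!: derivative_eq_intros d)
    from has_derivative_scaleR[OF Deriv.has_derivative_inverse[OF aV[OF that] this] d]
    have "(\<eta> has_derivative (\<lambda>v. inverse (a x) *\<^sub>R ?D x v - (?D x v \<bullet> e / (a x)^2) *\<^sub>R \<omega> x)) (at x)"
      unfolding \<eta>_def[abs_def]
      by (rule has_derivative_eq_rhs) (auto simp: fun_eq_iff power2_eq_square divide_inverse mult_ac)
    from fun_cong[OF frechet_derivative_at[OF this], of v] show ?thesis by (rule sym)
  qed
  have "\<exists>W f. open W \<and> p \<in> W \<and> W \<subseteq> V \<and> smooth_on W f \<and>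
    (\<forall>x\<in>W. \<exists>c>0. \<forall>v. frechet_derivative f (at x) v = c * (\<eta> x \<bullet> v))"
  proof (rule Frobenius_normalised[OF V s\<eta> _ pV unit])
    show "norm e = 1" using e by simp
    fix x b c assume x: "x \<in> V" and "\<eta> x \<bullet> b = 0"
    then have b0: "\<omega> x \<bullet> b = 0" using aV by (simp add: \<eta>_def)
    have I: "(\<omega> x \<bullet> e) * (?D x b \<bullet> c - ?D x c \<bullet> b) + (\<omega> x \<bullet> b) * (?D x c \<bullet> e - ?D x e \<bullet> c) +
       (\<omega> x \<bullet> c) * (?D x e \<bullet> b - ?D x b \<bullet> e) = 0"
      using assms(4) x VU unfolding integrable_form_def by blast
    have aeq: "\<omega> x \<bullet> e = a x" by (simp add: a_def)
    have I': "a x * (?D x b \<bullet> c - ?D x c \<bullet> b) + (\<omega> x \<bullet> c) * (?D x e \<bullet> b - ?D x b \<bullet> e) = 0"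
      using I unfolding b0 aeq by simp
    show "frechet_derivative \<eta> (at x) b \<bullet> c - frechet_derivative \<eta> (at x) c \<bullet> b =
        - (\<eta> x \<bullet> c) * (frechet_derivative \<eta> (at x) e \<bullet> b)"
      unfolding D\<eta>[OF x] inner_diff_left inner_scaleR_left b0 \<eta>_def
      using I' aV[OF x] by (simp add: field_simps power2_eq_square) algebra
  qed
  then obtain W f where Wf: "open W" "p \<in> W" "W \<subseteq> V" "smooth_on W f"
    "\<forall>x\<in>W. \<exists>c>0. \<forall>v. frechet_derivative f (at x) v = c * (\<eta> x \<bullet> v)"
    by (elim exE conjE)
  have "defining_function W (ker_form \<omega>) f"
    unfolding defining_function_def
  proof (intro conjI ballI Wf)
    fix x assume x: "x \<in> W"
    obtain c where c: "c > 0" "\<And>v. frechet_derivative f (at x) v = c * (\<eta> x \<bullet> v)" using bspec[OF Wf(5) x] by blast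
    have xV: "x \<in> V" using x Wf by blast
    have "frechet_derivative f (at x) e \<noteq> 0" using c unit[OF xV] by simp
    then show "frechet_derivative f (at x) \<noteq> (\<lambda>v. 0)" by metis
    show "ker_form \<omega> x = {v. frechet_derivative f (at x) v = 0}"
      using c aV[OF xV] by (auto simp: ker_form_def \<eta>_def)
  qed
  then show "\<exists>W f. p \<in> W \<and> W \<subseteq> U \<and> defining_function W (ker_form \<omega>) f"
    using Wf VU by blast
qed

subsection \<open>Polynomials and nodes\<close>

lemma higher_pderiv_linear_power:
  fixes t :: real
  shows "\<exists>c. (pderiv ^^ j) ([:- t, 1:] ^ k) = smult c ([:- t, 1:] ^ (k - j))"
proof (induction j)
  case 0
  then show ?case by (intro exI[of _ 1]) simp
next
  case (Suc j)
  then obtain c where c: "(pderiv ^^ j) ([:- t, 1:] ^ k) = smult c ([:- t, 1:] ^ (k - j))" by blast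
  have "pderiv ([:- t, 1:] ^ (k - j)) = smult (of_nat (k - j)) ([:- t, 1:] ^ (k - Suc j))"
    by (simp add: pderiv_power pderiv_pCons)
  then show ?case using c by (auto simp: pderiv_smult)
qed

text \<open>Induction on k through the derivative: if the derivative of q is a multiple of (x -
  t)^k, then q differs from a multiple of (x - t)^(k + 1) by a constant, and q(t) = 0 removes
  it.\<close>

lemma vanishing_derivatives_iff:
  fixes q :: "real poly"
  assumes "degree q \<le> k"
  shows "(\<forall>j<k. poly ((pderiv ^^ j) q) t = 0) \<longleftrightarrow> (\<exists>c. q = smult c ([:- t, 1:] ^ k))"
proof
  show "\<exists>c. q = smult c ([:- t, 1:] ^ k)" if "\<forall>j<k. poly ((pderiv ^^ j) q) t = 0"
    using assms that
  proof (induction k arbitrary: q)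
    case 0
    then show ?case by (auto elim!: degree_eq_zeroE)
  next
    case (Suc k)
    have "\<exists>c. pderiv q = smult c ([:- t, 1:] ^ k)"
    proof (rule Suc.IH)
      show "degree (pderiv q) \<le> k" using Suc.prems(1) by (simp add: degree_pderiv)
      show "\<forall>j<k. poly ((pderiv ^^ j) (pderiv q)) t = 0"
      proof (intro allI impI)
        fix j assume "j < k"
        then show "poly ((pderiv ^^ j) (pderiv q)) t = 0"
          using Suc.prems(2)[rule_format, of "Suc j"] by (simp add: funpow_swap1)
      qed
    qed
    then obtain c where c: "pderiv q = smult c ([:- t, 1:] ^ k)" by blast
    define r where "r = q - smult (c / of_nat (Suc k)) ([:- t, 1:] ^ Suc k)"
    have "pderiv r = 0"
      unfolding r_def pderiv_diff pderiv_smult pderiv_power_Suc c by (simp add: pderiv_pCons)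
    then obtain a where a: "r = [:a:]" by (auto simp: pderiv_eq_0_iff elim!: degree_eq_zeroE)
    have "poly r t = 0" using Suc.prems(2)[rule_format, of 0] by (simp add: r_def)
    then have "r = 0" using a by simp
    then show ?case unfolding r_def by auto
  qed
  show "\<forall>j<k. poly ((pderiv ^^ j) q) t = 0" if ex: "\<exists>c. q = smult c ([:- t, 1:] ^ k)"
  proof (intro allI impI)
    fix j assume j: "j < k"
    have sm: "(pderiv ^^ j) (smult c p) = smult c ((pderiv ^^ j) p)" for c and p :: "real poly"
      by (induction j) (auto simp: pderiv_smult)
    from ex higher_pderiv_linear_power[of j t k] show "poly ((pderiv ^^ j) q) t = 0"
      using j by (auto simp: sm)
  qed
qed

definition node_poly :: "nat \<Rightarrow> (nat \<Rightarrow> real) \<Rightarrow> nat \<Rightarrow> real poly" where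
  "node_poly k \<tau> i = (\<Prod>j\<in>{..k} - {i}. [:- \<tau> j, 1:])"

lemma poly_node_poly: "poly (node_poly k \<tau> i) t = (\<Prod>j\<in>{..k} - {i}. t - \<tau> j)"
  unfolding node_poly_def poly_prod by (intro prod.cong) auto

lemma degree_node_poly: "i \<le> k \<Longrightarrow> degree (node_poly k \<tau> i) = k"
  unfolding node_poly_def by (subst degree_prod_sum_eq) auto

lemma coeff_node_poly: "i \<le> k \<Longrightarrow> coeff (node_poly k \<tau> i) k = 1"
  using lead_coeff_prod[of "\<lambda>j. [:- \<tau> j, 1:]" "{..k} - {i}"] degree_node_poly[of i k \<tau>]
  by (simp add: node_poly_def)

locale nodes =
  fixes k :: nat and \<tau> :: "nat \<Rightarrow> real"
  assumes k1: "k \<ge> 1" and inj: "inj_on \<tau> {..k + 1}"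
begin

abbreviation np where "np i t \<equiv> poly (node_poly k \<tau> i) t"

definition wt where "wt i = \<tau> (k + 1) - \<tau> i"

text \<open>At \<open>\<tau> i\<close> only the i-th node polynomial survives, and
  \<open>bw i\<close> is the constant left in front of \<partial>_i w dx_i.\<close>

definition bw where "bw i = wt i * np i (\<tau> i)"

lemma node_eq_iff: "i \<le> k + 1 \<Longrightarrow> j \<le> k + 1 \<Longrightarrow> \<tau> i = \<tau> j \<longleftrightarrow> i = j"
  using inj by (auto simp: inj_on_eq_iff)

lemma wt_nonzero: "i \<le> k \<Longrightarrow> wt i \<noteq> 0"
  using node_eq_iff[of "k + 1" i] by (simp add: wt_def)

lemma np_self_nonzero: "i \<le> k \<Longrightarrow> np i (\<tau> i) \<noteq> 0"
  using node_eq_iff by (auto simp: poly_node_poly)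

lemma np_other: "j \<le> k \<Longrightarrow> i \<noteq> j \<Longrightarrow> np i (\<tau> j) = 0"
  by (auto simp: poly_node_poly)

lemma np_last_nonzero: "i \<le> k \<Longrightarrow> np i (\<tau> (k + 1)) \<noteq> 0"
  using node_eq_iff[of "k + 1"] by (auto simp: poly_node_poly)

lemma bw_nonzero: "i \<le> k \<Longrightarrow> bw i \<noteq> 0"
  using wt_nonzero np_self_nonzero by (simp add: bw_def)

lemma card_nodes: "card (\<tau> ` {..k}) = k + 1"
  using card_image[OF inj_on_subset[OF inj, of "{..k}"]] by simp

lemma interpolation:
  assumes "degree p \<le> k"
  shows "p = (\<Sum>i\<le>k. smult (poly p (\<tau> i) / np i (\<tau> i)) (node_poly k \<tau> i))"
proof (rule poly_eqI_degree[of "\<tau> ` {..k}"])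
  fix x assume "x \<in> \<tau> ` {..k}"
  then obtain j where j: "j \<le> k" "x = \<tau> j" by auto
  have "(\<Sum>i\<le>k. poly p (\<tau> i) / np i (\<tau> i) * np i (\<tau> j)) = (\<Sum>i\<le>k. if i = j then poly p (\<tau> j) else 0)"
    by (rule sum.cong) (use j np_other np_self_nonzero in auto)
  then show "poly p x = poly (\<Sum>i\<le>k. smult (poly p (\<tau> i) / np i (\<tau> i)) (node_poly k \<tau> i)) x"
    using j by (simp add: poly_sum)
next
  show "card (\<tau> ` {..k}) > degree (\<Sum>i\<le>k. smult (poly p (\<tau> i) / np i (\<tau> i)) (node_poly k \<tau> i))"
  proof -
    have "degree (\<Sum>i\<le>k. smult (poly p (\<tau> i) / np i (\<tau> i)) (node_poly k \<tau> i)) \<le> k"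
      by (intro degree_sum_le order_trans[OF degree_smult_le]) (auto simp: degree_node_poly)
    then show ?thesis unfolding card_nodes by simp
  qed
qed (use assms card_nodes in auto)

lemma interpolation_poly:
  assumes "degree p \<le> k"
  shows "poly p t = (\<Sum>i\<le>k. poly p (\<tau> i) / np i (\<tau> i) * np i t)"
  using arg_cong[OF interpolation[OF assms], of "\<lambda>q. poly q t"] by (simp add: poly_sum)

lemma divided_difference:
  assumes "degree p \<le> k"
  shows "(\<Sum>i\<le>k. poly p (\<tau> i) / np i (\<tau> i)) = coeff p k"
  using arg_cong[OF interpolation[OF assms], of "\<lambda>q. coeff q k"] coeff_node_poly
  by (simp add: coeff_sum)

text \<open>A divided difference picks the coefficient of x^k: 1 for (x - t)^k, and 0 for (x - t)^(k
  - 1) in the next lemma. Together they separate the two unknown multiples in a vector a (\<tau> i -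
  t)^k + b (\<tau> i - t)^(k - 1).\<close>

lemma sum_power_k: "(\<Sum>i\<le>k. (\<tau> i - t) ^ k / np i (\<tau> i)) = 1"
  using divided_difference[of "[:- t, 1:] ^ k"] coeff_linear_poly_power[of k k "- t" 1]
  by (simp add: degree_linear_power)

lemma sum_power_pred: "(\<Sum>i\<le>k. (\<tau> i - t) ^ (k - 1) / np i (\<tau> i)) = 0"
proof -
  have "degree ([:- t, 1:] ^ (k - 1)) < k" using k1 by (simp add: degree_linear_power)
  then show ?thesis
    using divided_difference[of "[:- t, 1:] ^ (k - 1)"] coeff_eq_0[of "[:- t, 1:] ^ (k - 1)" k] by simp
qed

text \<open>The points ((\<tau> i - t)^k)_i of the rational normal curve span the whole space as t
  varies: the sum is a polynomial in t whose coefficients are, up to nonzero binomial factors, the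
  moments of u, and pairing the moments with a node polynomial isolates one
  \<open>u i\<close>.\<close>

lemma powers_independent:
  assumes "\<And>t. (\<Sum>i\<le>k. u i * (\<tau> i - t) ^ k) = 0" "i \<le> k"
  shows "u i = 0"
proof -
  define Q where "Q = (\<Sum>i\<le>k. smult (u i) ([:\<tau> i, - 1:] ^ k))"
  have "poly Q = poly 0" using assms(1) by (auto simp: Q_def poly_sum)
  then have Q0: "Q = 0" by (simp only: poly_eq_poly_eq_iff)
  have pow: "(\<Sum>i\<le>k. u i * \<tau> i ^ m) = 0" if m: "m \<le> k" for m
  proof -
    have "coeff Q (k - m) = (\<Sum>i\<le>k. u i * (of_nat (k choose (k - m)) * (- 1) ^ (k - m) * \<tau> i ^ m))"
      unfolding Q_def coeff_sum coeff_smult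
      using m by (simp add: coeff_linear_poly_power)
    also have "\<dots> = (of_nat (k choose (k - m)) * (- 1) ^ (k - m)) * (\<Sum>i\<le>k. u i * \<tau> i ^ m)"
      unfolding sum_distrib_left by (intro sum.cong) (auto simp: mult_ac)
    finally have "(of_nat (k choose (k - m)) * (- 1) ^ (k - m)) * (\<Sum>i\<le>k. u i * \<tau> i ^ m) = 0" using Q0 by simp
    moreover have "k choose (k - m) \<noteq> 0" using m by simp
    ultimately show ?thesis by simp
  qed
  have "(\<Sum>l\<le>k. u l * np i (\<tau> l)) = (\<Sum>l\<le>k. \<Sum>m\<le>k. coeff (node_poly k \<tau> i) m * (u l * \<tau> l ^ m))"
    unfolding poly_altdef degree_node_poly[OF assms(2)] sum_distrib_left
    by (intro sum.cong refl) (auto simp: mult_ac)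
  also have "\<dots> = (\<Sum>m\<le>k. coeff (node_poly k \<tau> i) m * (\<Sum>l\<le>k. u l * \<tau> l ^ m))"
    by (subst sum.swap) (simp add: sum_distrib_left)
  also have "\<dots> = 0" using pow by simp
  finally have "(\<Sum>l\<le>k. u l * np i (\<tau> l)) = 0" .
  moreover have "(\<Sum>l\<le>k. u l * np i (\<tau> l)) = (\<Sum>l\<le>k. if l = i then u i * np i (\<tau> i) else 0)"
    by (rule sum.cong) (use np_other in auto)
  ultimately have "u i * np i (\<tau> i) = 0" using assms(2) by simp
  then show ?thesis using np_self_nonzero[OF assms(2)] by simp
qed

section \<open>Endomorphisms preserving the osculating flag to first order\<close>

text \<open>Up to the factor 1 / k this is the differentiation matrix of Lagrange interpolation: the
  derivative at node i of the j-th basis polynomial.\<close>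

definition kap where "kap i j = poly (pderiv (node_poly k \<tau> j)) (\<tau> i) / (np j (\<tau> j) * real k)"

text \<open>The interpolation formula of (x - t)^k is differentiated at node i; the second
  osculating vector thus becomes the image of the first under the matrix \<open>kap\<close>.\<close>

lemma power_pred_expansion:
  assumes "i \<le> k"
  shows "(\<tau> i - t) ^ (k - 1) = (\<Sum>j\<le>k. kap i j * (\<tau> j - t) ^ k)"
proof -
  let ?p = "[:- t, 1:] ^ k"
  have "pderiv ?p = smult (real k) ([:- t, 1:] ^ (k - 1))"
    by (simp add: pderiv_power pderiv_pCons)
  then have 1: "poly (pderiv ?p) (\<tau> i) = real k * (\<tau> i - t) ^ (k - 1)" by simp
  have "poly (pderiv ?p) (\<tau> i) = poly (pderiv (\<Sum>i\<le>k. smult (poly ?p (\<tau> i) / np i (\<tau> i)) (node_poly k \<tau> i))) (\<tau> i)"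
    by (subst interpolation[of ?p]) (simp_all add: degree_linear_power)
  also have "\<dots> = (\<Sum>j\<le>k. (\<tau> j - t) ^ k / np j (\<tau> j) * poly (pderiv (node_poly k \<tau> j)) (\<tau> i))"
    using higher_pderiv_sum[of 1 "\<lambda>i. smult (poly ?p (\<tau> i) / np i (\<tau> i)) (node_poly k \<tau> i)" "{..k}"]
    by (simp add: poly_sum pderiv_smult)
  finally have "real k * (\<tau> i - t) ^ (k - 1)
      = (\<Sum>j\<le>k. (\<tau> j - t) ^ k / np j (\<tau> j) * poly (pderiv (node_poly k \<tau> j)) (\<tau> i))" using 1 by simp
  then have "(\<tau> i - t) ^ (k - 1)
      = (\<Sum>j\<le>k. (\<tau> j - t) ^ k / np j (\<tau> j) * poly (pderiv (node_poly k \<tau> j)) (\<tau> i)) / real k"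
    using k1 by (simp add: field_simps)
  then show ?thesis unfolding sum_divide_distrib kap_def by (simp add: mult_ac)
qed

lemma pderiv_node_poly_other:
  assumes "i \<le> k" "j \<le> k" "i \<noteq> j"
  shows "poly (pderiv (node_poly k \<tau> j)) (\<tau> i) = (\<Prod>m\<in>{..k} - {j} - {i}. \<tau> i - \<tau> m)"
proof -
  have "node_poly k \<tau> j = [:- \<tau> i, 1:] * (\<Prod>m\<in>{..k} - {j} - {i}. [:- \<tau> m, 1:])"
    unfolding node_poly_def using assms by (intro prod.remove) auto
  then have "pderiv (node_poly k \<tau> j) = [:- \<tau> i, 1:] * pderiv (\<Prod>m\<in>{..k} - {j} - {i}. [:- \<tau> m, 1:])
      + (\<Prod>m\<in>{..k} - {j} - {i}. [:- \<tau> m, 1:]) * pderiv [:- \<tau> i, 1:]"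
    by (simp only: pderiv_mult)
  then show ?thesis by (simp add: pderiv_pCons poly_prod)
qed

lemma kap_nonzero: "i \<le> k \<Longrightarrow> j \<le> k \<Longrightarrow> i \<noteq> j \<Longrightarrow> kap i j \<noteq> 0"
  unfolding kap_def using pderiv_node_poly_other[of i j] np_self_nonzero[of j] node_eq_iff k1 by auto

lemma three_nodes_quadratic:
  fixes a b c :: real
  assumes "I \<subseteq> {..k}" "card I \<ge> 3" "\<And>i. i \<in> I \<Longrightarrow> a + b * \<tau> i + c * \<tau> i ^ 2 = 0"
  shows "a = 0" "b = 0" "c = 0"
proof -
  have "card (\<tau> ` I) = card I"
    by (rule card_image[OF inj_on_subset[OF inj]]) (use assms(1) in force)
  moreover have "degree [:a, b, c:] \<le> 2" by simp
  ultimately have "[:a, b, c:] = 0"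
    by (intro poly_eqI_degree[of "\<tau> ` I"])
       (use assms(2,3) in \<open>auto simp: power2_eq_square algebra_simps simp del: degree_pCons_eq_if\<close>)
  then show "a = 0" "b = 0" "c = 0" by auto
qed

text \<open>
  An endomorphism preserving the osculating flag of the rational normal curve up to first order
  is a multiple of the identity plus the action of a vector field \<open>p0 + p1 s + p2 s\<^sup>2\<close>.
\<close>

lemma osculating_endomorphism:
  assumes "\<And>t. \<exists>a b. \<forall>i\<le>k. (\<Sum>j\<le>k. M i j * (\<tau> j - t) ^ k) = a * (\<tau> i - t) ^ k + b * (\<tau> i - t) ^ (k - 1)"
  shows "\<exists>c p0 p1 p2. \<forall>i\<le>k. \<forall>j\<le>k.
    M i j = (if i = j then c - p2 * \<tau> i else 0) + (p0 + p1 * \<tau> i + p2 * \<tau> i ^ 2) * kap i j"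
proof -
  obtain a b where ab: "\<And>t i. i \<le> k \<Longrightarrow>
      (\<Sum>j\<le>k. M i j * (\<tau> j - t) ^ k) = a t * (\<tau> i - t) ^ k + b t * (\<tau> i - t) ^ (k - 1)"
    using assms by metis
  define q where "q i = (\<Sum>j\<le>k. smult (M i j) ([:\<tau> j, - 1:] ^ k))" for i
  have poly_q: "poly (q i) t = (\<Sum>j\<le>k. M i j * (\<tau> j - t) ^ k)" for i t by (simp add: q_def poly_sum)
  have deg_q: "degree (q i) \<le> k" for i
    unfolding q_def by (intro degree_sum_le order_trans[OF degree_smult_le]) auto
  \<comment> \<open>Summing over i with the weights 1 / np i (\<tau> i) turns the right side into a
    t, because the divided differences of the two powers are 1 and 0; so a is a polynomial in
    t.\<close>
  define L where "L = (\<Sum>i\<le>k. smult (1 / np i (\<tau> i)) (q i))"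
  have poly_L: "poly L t = a t" for t
  proof -
    have "poly L t = (\<Sum>i\<le>k. a t * ((\<tau> i - t) ^ k / np i (\<tau> i)) + b t * ((\<tau> i - t) ^ (k - 1) / np i (\<tau> i)))"
      unfolding L_def poly_sum poly_smult poly_q
      by (intro sum.cong refl) (auto simp: ab add_divide_distrib)
    then show ?thesis unfolding sum.distrib sum_distrib_left[symmetric] sum_power_k sum_power_pred by simp
  qed
  \<comment> \<open>The same sum with the extra weight \<tau> i - t gives a t * S + b t, which
    exhibits b as a polynomial too.\<close>
  define S where "S = (\<Sum>i\<le>k. smult (1 / np i (\<tau> i)) ([:\<tau> i, - 1:] ^ (k + 1)))"
  have poly_minus_node: "poly [:\<tau> i, - 1:] t = \<tau> i - t" for i t by simp
  define N where "N = (\<Sum>i\<le>k. smult (1 / np i (\<tau> i)) ([:\<tau> i, - 1:] * q i)) - L * S"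
  have poly_N: "poly N t = b t" for t
  proof -
    have "(\<Sum>i\<le>k. (1 / np i (\<tau> i)) * ((\<tau> i - t) * poly (q i) t)) =
        (\<Sum>i\<le>k. a t * ((1 / np i (\<tau> i)) * (\<tau> i - t) ^ (k + 1)) + b t * ((\<tau> i - t) ^ k / np i (\<tau> i)))"
      unfolding poly_q
    proof (intro sum.cong refl)
      fix i assume "i \<in> {..k}"
      then have i: "i \<le> k" by simp
      have "(\<tau> i - t) ^ k = (\<tau> i - t) * (\<tau> i - t) ^ (k - 1)" using k1 by (metis power_eq_if not_one_le_zero)
      then show "1 / np i (\<tau> i) * ((\<tau> i - t) * (\<Sum>j\<le>k. M i j * (\<tau> j - t) ^ k)) =
          a t * (1 / np i (\<tau> i) * (\<tau> i - t) ^ (k + 1)) + b t * ((\<tau> i - t) ^ k / np i (\<tau> i))"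
        unfolding ab[OF i] by (simp add: divide_simps) (simp add: algebra_simps)
    qed
    also have "\<dots> = a t * poly S t + b t"
      unfolding S_def poly_sum poly_smult poly_power poly_minus_node sum.distrib sum_distrib_left[symmetric] sum_power_k by simp
    finally show ?thesis
      unfolding N_def poly_diff poly_mult poly_sum poly_smult poly_minus_node poly_L by simp
  qed
  \<comment> \<open>\<open>E i\<close> stands for a (\<tau> i - t) + b. Since \<open>q i\<close> is
    (\<tau> i - t)^(k - 1) times \<open>E i\<close> and has degree at most k, \<open>E i\<close> has
    degree at most 1; so has L, which up to a factor is the difference of two of them.\<close>
  define E where "E i = N + L * [:\<tau> i, - 1:]" for i
  have q_eq: "q i = [:\<tau> i, - 1:] ^ (k - 1) * E i" if "i \<le> k" for i
  proof -
    have "poly (q i) t = poly ([:\<tau> i, - 1:] ^ (k - 1) * E i) t" for t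
    proof -
      have pw: "(\<tau> i - t) ^ k = (\<tau> i - t) * (\<tau> i - t) ^ (k - 1)" using k1 by (metis power_eq_if not_one_le_zero)
      show ?thesis
        unfolding poly_q ab[OF that] E_def poly_mult poly_power poly_add poly_minus_node poly_L poly_N pw
        by (simp add: algebra_simps)
    qed
    then have "poly (q i) = poly ([:\<tau> i, - 1:] ^ (k - 1) * E i)" by blast
    then show ?thesis by (simp only: poly_eq_poly_eq_iff)
  qed
  have deg_E: "degree (E i) \<le> 1" if "i \<le> k" for i
  proof (cases "E i = 0")
    case False
    then have "degree (q i) = (k - 1) + degree (E i)"
      unfolding q_eq[OF that] by (subst degree_mult_eq) auto
    then show ?thesis using deg_q[of i] k1 by linarith
  qed simp
  have E_eq: "E i = E 0 + smult (\<tau> i - \<tau> 0) L" for i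
  proof -
    have "poly (E i) = poly (E 0 + smult (\<tau> i - \<tau> 0) L)" by (auto simp: E_def algebra_simps)
    then show ?thesis by (simp only: poly_eq_poly_eq_iff)
  qed
  have deg_L: "degree L \<le> 1"
  proof -
    have ne: "\<tau> 1 - \<tau> 0 \<noteq> 0" using node_eq_iff[of 1 0] k1 by simp
    have "degree (smult (\<tau> 1 - \<tau> 0) L) \<le> 1"
      using degree_diff_le[OF deg_E[of 1] deg_E[of 0]] k1 E_eq[of 1] by simp
    then show ?thesis using ne by simp
  qed
  define r3 where "r3 = coeff L 1"
  define r1 where "r1 = coeff L 0"
  define r2 where "r2 = coeff (E 0) 1 - r3 * \<tau> 0"
  define r0 where "r0 = coeff (E 0) 0 - r1 * \<tau> 0"
  have poly_E: "poly (E i) t = r0 + r1 * \<tau> i + t * (r2 + r3 * \<tau> i)" for i t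
  proof -
    have lin: "poly p t = coeff p 0 + coeff p 1 * t" if "degree p \<le> 1" for p :: "real poly"
      using poly_as_sum_of_monoms'[OF that, THEN arg_cong[of _ _ "\<lambda>p. poly p t"]]
      by (simp add: poly_monom)
    show ?thesis
      unfolding E_eq[of i] poly_add poly_smult lin[OF deg_E[OF le0]] lin[OF deg_L]
      by (simp add: r0_def r1_def r2_def r3_def algebra_simps)
  qed
  show ?thesis
  proof (intro exI allI impI)
    fix i j assume ij: "i \<le> k" "j \<le> k"
    \<comment> \<open>The expression, of degree one in t and in \<tau> i, is expanded in powers of
      \<tau> i - t: the constant term is the quadratic vector field multiplying \<open>kap\<close>,
      the linear term gives the diagonal entry.\<close>
    let ?n = "- r2 - r3 * \<tau> i" and ?m = "r0 + (r1 + r2) * \<tau> i + r3 * \<tau> i ^ 2"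
    define u where "u j = M i j - ((if i = j then ?n else 0) + ?m * kap i j)" for j
    have "u j = 0"
    proof (rule powers_independent[OF _ ij(2)])
      fix t
      have "(\<Sum>j\<le>k. M i j * (\<tau> j - t) ^ k) = (\<tau> i - t) ^ (k - 1) * poly (E i) t"
        using q_eq[OF ij(1)] poly_q[of i t] by simp
      also have "poly (E i) t = ?m + ?n * (\<tau> i - t)"
        unfolding poly_E by (simp add: algebra_simps power2_eq_square)
      also have "(\<tau> i - t) ^ (k - 1) * (?m + ?n * (\<tau> i - t)) = ?m * (\<tau> i - t) ^ (k - 1) + ?n * (\<tau> i - t) ^ k"
        using k1 by (cases k) (auto simp: algebra_simps)
      also have "\<dots> = (\<Sum>j\<le>k. ?m * (kap i j * (\<tau> j - t) ^ k)) + (\<Sum>j\<le>k. if i = j then ?n * (\<tau> i - t) ^ k else 0)"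
        using ij(1) unfolding power_pred_expansion[OF ij(1)] sum_distrib_left by simp
      finally have *: "(\<Sum>j\<le>k. M i j * (\<tau> j - t) ^ k) = \<dots>" .
      have "(\<Sum>j\<le>k. u j * (\<tau> j - t) ^ k) = (\<Sum>j\<le>k. M i j * (\<tau> j - t) ^ k)
          - ((\<Sum>j\<le>k. ?m * (kap i j * (\<tau> j - t) ^ k)) + (\<Sum>j\<le>k. if i = j then ?n * (\<tau> i - t) ^ k else 0))"
        unfolding sum.distrib[symmetric] sum_subtractf[symmetric] u_def
        by (intro sum.cong) (auto simp: algebra_simps)
      then show "(\<Sum>j\<le>k. u j * (\<tau> j - t) ^ k) = 0" using * by simp
    qed
    then show "M i j = (if i = j then - r2 - r3 * \<tau> i else 0) + ?m * kap i j"
      by (simp add: u_def)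
  qed
qed

text \<open>A zero in row i of column l, off the diagonal, forces the quadratic vector field to
  vanish at node i, since \<open>kap\<close> is nonzero there. With k > 2 at least three nodes
  differ from l, and a quadratic with three zeros is zero.\<close>

lemma endomorphism_scalar:
  assumes "k > 2" "l \<le> k"
    and "\<And>t. \<exists>a b. \<forall>i\<le>k. (\<Sum>j\<le>k. M i j * (\<tau> j - t) ^ k) = a * (\<tau> i - t) ^ k + b * (\<tau> i - t) ^ (k - 1)"
    and "\<And>i. i \<le> k \<Longrightarrow> i \<noteq> l \<Longrightarrow> M i l = 0"
  obtains c where "\<And>i j. i \<le> k \<Longrightarrow> j \<le> k \<Longrightarrow> M i j = (if i = j then c else 0)"
proof -
  from osculating_endomorphism[OF assms(3)]
  obtain c p0 p1 p2 where M: "\<forall>i\<le>k. \<forall>j\<le>k.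
    M i j = (if i = j then c - p2 * \<tau> i else 0) + (p0 + p1 * \<tau> i + p2 * \<tau> i ^ 2) * kap i j"
    by (elim exE)
  have "p0 + p1 * \<tau> i + p2 * \<tau> i ^ 2 = 0" if "i \<in> {..k} - {l}" for i
    using M[rule_format, of i l] assms(2) assms(4)[of i] kap_nonzero[of i l] that by auto
  moreover have "card ({..k} - {l}) \<ge> 3" using assms(1,2) by (simp add: card_Diff_singleton)
  ultimately have "p0 = 0" "p1 = 0" "p2 = 0" using three_nodes_quadratic[of "{..k} - {l}" p0 p1 p2] by auto
  then show ?thesis using that[of c] M by simp
qed

text \<open>The factor c(t) is the divided difference of the components, hence a polynomial; the
  degree bound leaves no room for a nonconstant one.\<close>

lemma dual_polynomial:
  assumes deg: "\<And>i. i \<le> k \<Longrightarrow> degree (V i) \<le> k"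
    and dual: "\<And>t. \<exists>c. \<forall>i\<le>k. poly (V i) t = c * (\<tau> i - t) ^ k"
  obtains C where "\<And>t i. i \<le> k \<Longrightarrow> poly (V i) t = C * (\<tau> i - t) ^ k"
proof -
  obtain c where c: "\<And>t i. i \<le> k \<Longrightarrow> poly (V i) t = c t * (\<tau> i - t) ^ k" using dual by metis
  define q where "q = (\<Sum>i\<le>k. smult (1 / np i (\<tau> i)) (V i))"
  have q: "poly q t = c t" for t
  proof -
    have "poly q t = (\<Sum>i\<le>k. c t * ((\<tau> i - t) ^ k / np i (\<tau> i)))"
      unfolding q_def poly_sum by (intro sum.cong) (auto simp: c)
    then show ?thesis unfolding sum_distrib_left[symmetric] sum_power_k by simp
  qed
  have "poly (V 0) = poly (q * [:\<tau> 0, - 1:] ^ k)" using c[of 0] q by auto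
  then have V0: "V 0 = q * [:\<tau> 0, - 1:] ^ k" by (simp only: poly_eq_poly_eq_iff)
  have "degree q = 0"
  proof (cases "q = 0")
    case False
    then have "degree (V 0) = degree q + k" unfolding V0 by (subst degree_mult_eq) auto
    then show ?thesis using deg[of 0] by simp
  qed simp
  then obtain C where "q = [:C:]" by (rule degree_eq_zeroE)
  then show ?thesis using that[of C] c q by simp
qed

end

subsection \<open>Coordinates\<close>

locale coordinates =
  fixes k :: nat and e :: "nat \<Rightarrow> 'n::finite"
  assumes bij_e: "bij_betw e {..k} UNIV"
begin

lemma e_eq_iff: "i \<le> k \<Longrightarrow> j \<le> k \<Longrightarrow> e i = e j \<longleftrightarrow> i = j"
  using bij_betw_imp_inj_on[OF bij_e] by (auto simp: inj_on_eq_iff)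

lemma e_surj: obtains i where "i \<le> k" "m = e i"
  using bij_betw_imp_surj_on[OF bij_e] by (metis UNIV_I atMost_iff imageE)

lemma sum_coords: "(\<Sum>m\<in>UNIV. f m) = (\<Sum>i\<le>k. f (e i))"
  using sum.reindex_bij_betw[OF bij_e, of f] by simp

lemma vec_eqI: "(\<And>i. i \<le> k \<Longrightarrow> u $ e i = v $ e i) \<Longrightarrow> u = v"
  unfolding vec_eq_iff by (metis e_surj)

lemma axis_coord: "i \<le> k \<Longrightarrow> j \<le> k \<Longrightarrow> axis (e i) (1::real) $ e j = (if i = j then 1 else 0)"
  by (simp add: axis_def e_eq_iff)

lemma sum_axis_coord:
  "j \<le> k \<Longrightarrow> (\<Sum>i\<le>k. f i *\<^sub>R axis (e i) (1::real)) $ e j = f j"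
  by (simp add: axis_def e_eq_iff if_distrib sum.delta cong: if_cong)

lemma sum_mult_axis_coord:
  "j \<le> k \<Longrightarrow> (\<Sum>i\<le>k. f i * axis (e i) (1::real) $ e j) = f j"
  using sum_axis_coord[of j f] by simp

lemma inner_coords: "u \<bullet> v = (\<Sum>i\<le>k. u $ e i * v $ e i)" for u v :: "real ^ 'n"
  by (simp add: inner_vec_def sum_coords)

lemma inner_axis_coord: "u \<bullet> axis (e i) 1 = u $ e i" for u :: "real ^ 'n"
  by (simp add: inner_axis)

lemma coord_expansion: "v = (\<Sum>i\<le>k. v $ e i *\<^sub>R axis (e i) (1::real))"
  by (rule vec_eqI) (simp add: sum_mult_axis_coord)

lemma linear_coords:
  fixes L :: "real ^ 'n \<Rightarrow> 'b::real_vector"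
  assumes "linear L"
  shows "L v = (\<Sum>i\<le>k. v $ e i *\<^sub>R L (axis (e i) 1))"
  by (subst coord_expansion) (simp only: linear_sum[OF assms] linear_scale[OF assms])

lemma card_coords: "CARD('n) = k + 1"
  using bij_betw_same_card[OF bij_e] by simp

lemma smooth_frameI:
  fixes E :: "nat \<Rightarrow> real ^ 'n \<Rightarrow> real ^ 'n"
  assumes "\<And>i. i \<le> k \<Longrightarrow> smooth_on W (E i)" "\<And>x. x \<in> W \<Longrightarrow> span ((\<lambda>i. E i x) ` {..k}) = UNIV"
  shows "smooth_frame k W E"
  unfolding smooth_frame_def
proof (intro conjI allI impI ballI assms)
  fix x assume x: "x \<in> W"
  let ?B = "(\<lambda>i. E i x) ` {..k}"
  have "dim (UNIV :: (real ^ 'n) set) \<le> card ?B"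
    by (rule dim_le_card) (use assms(2)[OF x] in auto)
  then have ge: "k + 1 \<le> card ?B" using card_coords by simp
  have le: "card ?B \<le> k + 1" using card_image_le[of "{..k}" "\<lambda>i. E i x"] by simp
  show "inj_on (\<lambda>i. E i x) {..k}" using ge le by (intro eq_card_imp_inj_on) auto
  show "independent ?B"
    by (rule card_le_dim_spanning[of _ UNIV]) (use assms(2)[OF x] le card_coords in auto)
qed

lemma span_eq_UNIV:
  fixes B :: "(real ^ 'n) set"
  assumes "\<And>i. i \<le> k \<Longrightarrow> axis (e i) 1 \<in> span B"
  shows "span B = UNIV"
proof -
  have "v \<in> span B" for v :: "real ^ 'n"
    by (subst coord_expansion) (intro span_sum span_scale assms, simp)
  then show ?thesis by blast
qed

lemma frechet_coords:
  fixes f :: "real ^ 'n \<Rightarrow> 'b::real_normed_vector"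
  assumes "smooth_on U f" "x \<in> U"
  shows "frechet_derivative f (at x) v = (\<Sum>i\<le>k. v $ e i *\<^sub>R partial (e i) f x)"
  unfolding partial_def by (rule linear_coords[OF smooth_on_linear_derivative[OF assms]])

text \<open>The cyclic expression is trilinear in the three vectors, with partial derivatives as its
  coefficients, so the coordinate fields suffice.\<close>

lemma integrable_formI:
  fixes \<omega> :: "real ^ 'n \<Rightarrow> real ^ 'n"
  assumes "smooth_on U \<omega>"
    and "\<And>x i j l. x \<in> U \<Longrightarrow> i \<le> k \<Longrightarrow> j \<le> k \<Longrightarrow> l \<le> k \<Longrightarrow>
      \<omega> x $ e l * (partial (e i) \<omega> x $ e j - partial (e j) \<omega> x $ e i) +
      \<omega> x $ e i * (partial (e j) \<omega> x $ e l - partial (e l) \<omega> x $ e j) +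
      \<omega> x $ e j * (partial (e l) \<omega> x $ e i - partial (e i) \<omega> x $ e l) = 0"
  shows "integrable_form U \<omega>"
  unfolding integrable_form_def
proof (intro ballI allI)
  fix x a b c assume x: "x \<in> U"
  define d where "d i j = partial (e i) \<omega> x $ e j - partial (e j) \<omega> x $ e i" for i j
  have dd: "frechet_derivative \<omega> (at x) u \<bullet> v - frechet_derivative \<omega> (at x) v \<bullet> u
      = (\<Sum>i\<le>k. \<Sum>j\<le>k. u $ e i * v $ e j * d i j)" for u v
  proof -
    have 1: "frechet_derivative \<omega> (at x) u \<bullet> v = (\<Sum>i\<le>k. \<Sum>j\<le>k. u $ e i * v $ e j * partial (e i) \<omega> x $ e j)" for u v
      unfolding frechet_coords[OF assms(1) x] inner_sum_left inner_scaleR_left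
      by (intro sum.cong refl) (simp add: inner_coords sum_distrib_left mult_ac)
    show ?thesis unfolding 1[of u v] 1[of v u] d_def
      by (subst (2) sum.swap) (simp add: sum_subtractf[symmetric] algebra_simps)
  qed
  have 1: "(\<omega> x \<bullet> c) * (\<Sum>i\<le>k. \<Sum>j\<le>k. a $ e i * b $ e j * d i j) =
      (\<Sum>i\<le>k. \<Sum>j\<le>k. \<Sum>l\<le>k. a $ e i * b $ e j * c $ e l * (\<omega> x $ e l * d i j))"
  proof -
    have "(\<omega> x \<bullet> c) * (\<Sum>i\<le>k. \<Sum>j\<le>k. a $ e i * b $ e j * d i j) =
      (\<Sum>l\<le>k. \<Sum>i\<le>k. \<Sum>j\<le>k. a $ e i * b $ e j * c $ e l * (\<omega> x $ e l * d i j))"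
      unfolding inner_coords sum_distrib_right
      by (intro sum.cong refl) (simp add: sum_distrib_left mult_ac)
    also have "\<dots> = (\<Sum>i\<le>k. \<Sum>l\<le>k. \<Sum>j\<le>k. a $ e i * b $ e j * c $ e l * (\<omega> x $ e l * d i j))"
      by (rule sum.swap)
    also have "\<dots> = (\<Sum>i\<le>k. \<Sum>j\<le>k. \<Sum>l\<le>k. a $ e i * b $ e j * c $ e l * (\<omega> x $ e l * d i j))"
      by (rule sum.cong[OF refl sum.swap])
    finally show ?thesis .
  qed
  have 2: "(\<omega> x \<bullet> a) * (\<Sum>j\<le>k. \<Sum>l\<le>k. b $ e j * c $ e l * d j l) =
      (\<Sum>i\<le>k. \<Sum>j\<le>k. \<Sum>l\<le>k. a $ e i * b $ e j * c $ e l * (\<omega> x $ e i * d j l))"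
    unfolding inner_coords sum_distrib_right
    by (intro sum.cong refl) (simp add: sum_distrib_left mult_ac)
  have 3: "(\<omega> x \<bullet> b) * (\<Sum>l\<le>k. \<Sum>i\<le>k. c $ e l * a $ e i * d l i) =
      (\<Sum>i\<le>k. \<Sum>j\<le>k. \<Sum>l\<le>k. a $ e i * b $ e j * c $ e l * (\<omega> x $ e j * d l i))"
  proof -
    have "(\<omega> x \<bullet> b) * (\<Sum>l\<le>k. \<Sum>i\<le>k. c $ e l * a $ e i * d l i) =
      (\<Sum>j\<le>k. \<Sum>l\<le>k. \<Sum>i\<le>k. a $ e i * b $ e j * c $ e l * (\<omega> x $ e j * d l i))"
      unfolding inner_coords sum_distrib_right
      by (intro sum.cong refl) (simp add: sum_distrib_left mult_ac)
    also have "\<dots> = (\<Sum>j\<le>k. \<Sum>i\<le>k. \<Sum>l\<le>k. a $ e i * b $ e j * c $ e l * (\<omega> x $ e j * d l i))"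
      by (rule sum.cong[OF refl sum.swap])
    also have "\<dots> = (\<Sum>i\<le>k. \<Sum>j\<le>k. \<Sum>l\<le>k. a $ e i * b $ e j * c $ e l * (\<omega> x $ e j * d l i))"
      by (rule sum.swap)
    finally show ?thesis .
  qed
  show "(\<omega> x \<bullet> c) * (frechet_derivative \<omega> (at x) a \<bullet> b - frechet_derivative \<omega> (at x) b \<bullet> a) +
     (\<omega> x \<bullet> a) * (frechet_derivative \<omega> (at x) b \<bullet> c - frechet_derivative \<omega> (at x) c \<bullet> b) +
     (\<omega> x \<bullet> b) * (frechet_derivative \<omega> (at x) c \<bullet> a - frechet_derivative \<omega> (at x) a \<bullet> c) = 0"
    unfolding dd 1 2 3 sum.distrib[symmetric]
    by (intro sum.neutral ballI) (use assms(2)[OF x] in \<open>simp add: d_def distrib_left[symmetric]\<close>)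
qed

end

subsection \<open>Polynomial curves of forms\<close>

lemma t_deriv_iterate:
  assumes "\<And>s. \<omega> s x = poly_curve k \<eta> s x"
  shows "(t_deriv ^^ j) \<omega> t x = (\<Sum>i\<le>k. poly ((pderiv ^^ j) (monom 1 i)) t *\<^sub>R \<eta> i x)"
proof (induction j arbitrary: t)
  case 0
  then show ?case by (simp add: assms poly_curve_def poly_monom)
next
  case (Suc j)
  have "((\<lambda>s. \<Sum>i\<le>k. poly ((pderiv ^^ j) (monom 1 i)) s *\<^sub>R \<eta> i x) has_vector_derivative
      (\<Sum>i\<le>k. poly (pderiv ((pderiv ^^ j) (monom 1 i))) t *\<^sub>R \<eta> i x)) (at t)"
    by (auto intro!: derivative_eq_intros poly_DERIV)
  moreover have "(t_deriv ^^ Suc j) \<omega> t x = vector_derivative (\<lambda>s. (t_deriv ^^ j) \<omega> s x) (at t)"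
    by (simp add: t_deriv_def[of "(t_deriv ^^ j) \<omega>"])
  ultimately show ?case unfolding Suc by (simp add: vector_derivative_at)
qed

text \<open>Applied to v, the form is a polynomial of degree at most k in the parameter;
  annihilation by the derivatives of order 0 to k - 1 means that t is a root of multiplicity at
  least k.\<close>

lemma ker_derivatives_iff:
  fixes \<omega> :: "real \<Rightarrow> 'a::real_inner \<Rightarrow> 'a"
  assumes "\<And>s. \<omega> s x = poly_curve k \<eta> s x"
  shows "(\<forall>j<k. v \<in> ker_form ((t_deriv ^^ j) \<omega> t) x) \<longleftrightarrow> (\<exists>c. \<forall>s. \<omega> s x \<bullet> v = c * (s - t) ^ k)"
proof -
  define q where "q = (\<Sum>i\<le>k. smult (\<eta> i x \<bullet> v) (monom 1 i))"
  have deg: "degree q \<le> k" unfolding q_def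
    by (intro degree_sum_le order_trans[OF degree_smult_le]) (auto simp: degree_monom_eq)
  have 1: "v \<in> ker_form ((t_deriv ^^ j) \<omega> t) x \<longleftrightarrow> poly ((pderiv ^^ j) q) t = 0" for j
    unfolding ker_form_def q_def t_deriv_iterate[of \<omega> x k \<eta>, OF assms] higher_pderiv_sum higher_pderiv_smult
    by (simp add: poly_sum inner_sum_left mult.commute)
  have 2: "poly q s = \<omega> s x \<bullet> v" for s
    unfolding assms poly_curve_def q_def by (simp add: poly_sum poly_monom inner_sum_left mult.commute)
  have "q = smult c ([:- t, 1:] ^ k) \<longleftrightarrow> (\<forall>s. \<omega> s x \<bullet> v = c * (s - t) ^ k)" for c
    unfolding poly_eq_poly_eq_iff[symmetric] fun_eq_iff 2[symmetric] by simp
  then show ?thesis unfolding 1 vanishing_derivatives_iff[OF deg] by simp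
qed

subsection \<open>The web of a solution\<close>

locale solution = nodes k \<tau> + coordinates k e
  for k :: nat and \<tau> :: "nat \<Rightarrow> real" and e :: "nat \<Rightarrow> 'n::finite" +
  fixes U :: "(real ^ 'n) set" and w :: "real ^ 'n \<Rightarrow> real"
  assumes openU: "open U" and sol: "admissible_solution k e \<tau> U w"
begin

abbreviation dw where "dw i \<equiv> partial (e i) w"

abbreviation ddw where "ddw i j \<equiv> partial (e i) (partial (e j) w)"

abbreviation form where "form \<equiv> solution_form k e \<tau> w"

lemma smooth_w: "smooth_on U w"
  and dw_nonzero: "i \<le> k \<Longrightarrow> x \<in> U \<Longrightarrow> dw i x \<noteq> 0"
  using sol by (auto simp: admissible_solution_def)

lemma smooth_dw: "smooth_on U (dw i)"
  by (rule smooth_on_partial[OF smooth_w])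

lemma smooth_ddw: "smooth_on U (ddw i j)"
  by (rule smooth_on_partial[OF smooth_dw])

lemma ddw_sym: "x \<in> U \<Longrightarrow> ddw i j x = ddw j i x"
  unfolding partial_def[of "e i" "partial (e j) w"] partial_def[of "e j" "partial (e i) w"]
  using smooth_derivative_symmetric[OF openU smooth_w] unfolding partial_def[abs_def] by blast

text \<open>The assumption covers increasing indices only. The expression is invariant under cyclic
  shifts and changes sign when i and j are exchanged, so it vanishes for every order and for
  repeated indices.\<close>

lemma system:
  assumes "x \<in> U" "i \<le> k" "j \<le> k" "l \<le> k"
  shows "(\<tau> i - \<tau> j) * wt l * ddw i j x * dw l x + (\<tau> j - \<tau> l) * wt i * ddw j l x * dw i x
    + (\<tau> l - \<tau> i) * wt j * ddw l i x * dw j x = 0"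
proof -
  define S where "S i j l = (\<tau> i - \<tau> j) * wt l * ddw i j x * dw l x + (\<tau> j - \<tau> l) * wt i * ddw j l x * dw i x
    + (\<tau> l - \<tau> i) * wt j * ddw l i x * dw j x" for i j l
  have sorted: "S i j l = 0" if "i < j" "j < l" "l \<le> k" for i j l
    using sol that assms(1) unfolding admissible_solution_def system_coeff_def S_def wt_def by blast
  have cyc: "S i j l = S j l i" for i j l by (simp add: S_def)
  have swap: "S i j l = - S j i l" for i j l
    using ddw_sym[OF assms(1)] by (simp add: S_def algebra_simps)
  have "S i j l = 0"
  proof (cases "i = j \<or> j = l \<or> i = l")
    case True
    then show ?thesis
    proof (elim disjE)
      assume "i = j" then show ?thesis using swap[of i j l] by simp
    next
      assume "j = l" then show ?thesis using swap[of j l i] cyc[of i j l] by simp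
    next
      assume "i = l" then show ?thesis using swap[of l i j] cyc[of l i j] by simp
    qed
  next
    case False
    then consider "i < j" "j < l" | "i < l" "l < j" | "j < i" "i < l" | "j < l" "l < i" | "l < i" "i < j" | "l < j" "j < i"
      by linarith
    then show ?thesis
    proof cases
      case 1 then show ?thesis using sorted assms by blast
    next
      case 2 then show ?thesis using sorted[of i l j] swap[of l i j] cyc[of l i j] assms by simp
    next
      case 3 then show ?thesis using sorted[of j i l] swap[of i j l] assms by simp
    next
      case 4 then show ?thesis using sorted[of j l i] cyc[of i j l] assms by simp
    next
      case 5 then show ?thesis using sorted[of l i j] cyc[of l i j] assms by simp
    next
      case 6 then show ?thesis using sorted[of l j i] swap[of j l i] cyc[of i j l] assms by simp
    qed
  qed
  then show ?thesis by (simp add: S_def)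
qed

lemma form_eq: "form t x = (\<Sum>i\<le>k. (wt i * np i t * dw i x) *\<^sub>R axis (e i) 1)"
  unfolding solution_form_def wt_def poly_node_poly ..

lemma form_coord: "i \<le> k \<Longrightarrow> form t x $ e i = wt i * np i t * dw i x"
  unfolding form_eq by (rule sum_axis_coord)

lemma form_inner: "form t x \<bullet> v = (\<Sum>i\<le>k. wt i * np i t * dw i x * v $ e i)"
  unfolding inner_coords by (intro sum.cong refl) (simp add: form_coord)

lemma form_at_node: "i \<le> k \<Longrightarrow> form (\<tau> i) x \<bullet> v = bw i * dw i x * v $ e i"
proof -
  assume i: "i \<le> k"
  have "form (\<tau> i) x \<bullet> v = (\<Sum>j\<le>k. if j = i then bw i * dw i x * v $ e i else 0)"
    unfolding form_inner by (rule sum.cong) (use i np_other in \<open>auto simp: bw_def\<close>)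
  then show ?thesis using i by simp
qed

lemma smooth_form: "smooth_on U (form t)"
  unfolding form_eq[abs_def] by (intro smooth_on_sum smooth_on_scaleR smooth_on_mult smooth_on_const smooth_dw openU)

definition form_coeff where
  "form_coeff j x = (\<Sum>i\<le>k. (wt i * coeff (node_poly k \<tau> i) j * dw i x) *\<^sub>R axis (e i) (1::real))"

lemma form_poly_curve: "form t x = poly_curve k form_coeff t x"
proof (rule vec_eqI)
  fix i assume i: "i \<le> k"
  have "np i t = (\<Sum>j\<le>k. coeff (node_poly k \<tau> i) j * t ^ j)"
    unfolding poly_altdef degree_node_poly[OF i] ..
  then show "form t x $ e i = poly_curve k form_coeff t x $ e i"
    unfolding form_coord[OF i] poly_curve_def sum_component vector_scaleR_component
      form_coeff_def sum_axis_coord[OF i, unfolded sum_component vector_scaleR_component]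
    by (simp add: sum_distrib_left sum_distrib_right mult_ac)
qed

text \<open>At the node \<open>\<tau> i\<close> the form is a nonzero multiple of dx_i; these values
  are combinations of the coefficients, which therefore span.\<close>

lemma coframe: "coframe_curve k U form"
  unfolding coframe_curve_def
proof (intro exI[of _ form_coeff] conjI ballI allI form_poly_curve smooth_frameI)
  show "smooth_on U (form_coeff i)" for i
    unfolding form_coeff_def[abs_def]
    by (intro smooth_on_sum smooth_on_scaleR smooth_on_mult smooth_on_const smooth_dw openU)
  fix x assume x: "x \<in> U"
  show "span ((\<lambda>i. form_coeff i x) ` {..k}) = UNIV"
  proof (rule span_eq_UNIV)
    fix i assume i: "i \<le> k"
    have "form (\<tau> i) x = (bw i * dw i x) *\<^sub>R axis (e i) 1"
    proof (rule vec_eqI)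
      fix j assume j: "j \<le> k"
      then show "form (\<tau> i) x $ e j = ((bw i * dw i x) *\<^sub>R axis (e i) 1) $ e j"
        using i np_other[of i j] by (auto simp: form_coord axis_coord bw_def)
    qed
    then have eq: "axis (e i) 1 = (1 / (bw i * dw i x)) *\<^sub>R form (\<tau> i) x"
      using bw_nonzero[OF i] dw_nonzero[OF i x] by simp
    show "axis (e i) 1 \<in> span ((\<lambda>i. form_coeff i x) ` {..k})"
      unfolding eq form_poly_curve poly_curve_def
      by (intro span_scale span_sum) (auto intro: span_base)
  qed
qed

lemma form_nonzero: "x \<in> U \<Longrightarrow> form t x \<noteq> 0"
proof
  assume x: "x \<in> U" and 0: "form t x = 0"
  have "np i t = 0" if "i \<le> k" for i
    using form_coord[OF that, of t x] 0 wt_nonzero[OF that] dw_nonzero[OF that x] by simp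
  \<comment> \<open>All node polynomials would vanish at t, but the constant 1 is a combination of
    them.\<close>
  then have "(1::real) = 0" using interpolation_poly[of 1 t] by simp
  then show False by simp
qed

lemma partial_form:
  assumes "x \<in> U" "i \<le> k"
  shows "partial m (form t) x $ e i = wt i * np i t * partial m (dw i) x"
proof -
  have "((\<lambda>y. form t y $ e i) has_derivative (\<lambda>v. frechet_derivative (form t) (at x) v $ e i)) (at x)"
    using bounded_linear.has_derivative[OF bounded_linear_vec_nth smooth_on_has_derivative[OF smooth_form assms(1)]] .
  moreover have "((\<lambda>y. wt i * np i t * dw i y) has_derivative (\<lambda>v. wt i * np i t * frechet_derivative (dw i) (at x) v)) (at x)"
    by (auto intro!: derivative_eq_intros smooth_on_has_derivative[OF smooth_dw assms(1)])
  ultimately have "(\<lambda>v. frechet_derivative (form t) (at x) v $ e i) = (\<lambda>v. wt i * np i t * frechet_derivative (dw i) (at x) v)"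
    unfolding form_coord[OF assms(2)] by (rule has_derivative_unique)
  then show ?thesis unfolding partial_def by metis
qed

lemma integrable: "integrable_form U (form t)"
proof (rule integrable_formI[OF smooth_form])
  fix x i j l assume x: "x \<in> U" and ijl: "i \<le> k" "j \<le> k" "l \<le> k"
  define g where "g i = wt i * np i t" for i
  have sym: "ddw j i x = ddw i j x" "ddw l j x = ddw j l x" "ddw i l x = ddw l i x" using ddw_sym[OF x] by auto
  have "g l * dw l x * ((g j - g i) * ddw i j x) + g i * dw i x * ((g l - g j) * ddw j l x)
      + g j * dw j x * ((g i - g l) * ddw l i x) = 0"
  proof (cases "i = j \<or> j = l \<or> i = l")
    case True
    then show ?thesis using sym by (elim disjE) (auto simp: algebra_simps)
  next
    case False
    define R where "R = (\<Prod>m\<in>{..k} - {i, j, l}. t - \<tau> m)"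
    have split: "np a t = (t - \<tau> b) * (t - \<tau> c) * R" if "{a, b, c} = {i, j, l}" "b \<noteq> c" "a \<noteq> b" "a \<noteq> c" for a b c
    proof -
      have 1: "{..k} - {a} = insert b (insert c ({..k} - {i, j, l}))" using that ijl by auto
      have 2: "b \<notin> insert c ({..k} - {i, j, l})" "c \<notin> {..k} - {i, j, l}" using that(1,2) by blast+
      show ?thesis unfolding poly_node_poly R_def 1 using 2 by (simp add: mult.assoc)
    qed
    have P: "g i = wt i * ((t - \<tau> j) * (t - \<tau> l) * R)" "g j = wt j * ((t - \<tau> i) * (t - \<tau> l) * R)"
      "g l = wt l * ((t - \<tau> i) * (t - \<tau> j) * R)"
      unfolding g_def using split[of i j l] split[of j i l] split[of l i j] False by auto
    \<comment> \<open>The common factor rests on wt j (t - \<tau> i) - wt i (t - \<tau> j) = (\<tau>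
      i - \<tau> j) (t - \<tau> (k + 1)); it is the same in all three terms, so the system
      applies.\<close>
    let ?c = "R ^ 2 * ((t - \<tau> i) * (t - \<tau> j) * (t - \<tau> l) * (t - \<tau> (k + 1)))"
    have d: "g l * (g j - g i) = ?c * ((\<tau> i - \<tau> j) * wt l)"
      "g i * (g l - g j) = ?c * ((\<tau> j - \<tau> l) * wt i)"
      "g j * (g i - g l) = ?c * ((\<tau> l - \<tau> i) * wt j)"
      unfolding P unfolding wt_def power2_eq_square by algebra+
    have "g l * dw l x * ((g j - g i) * ddw i j x) + g i * dw i x * ((g l - g j) * ddw j l x)
        + g j * dw j x * ((g i - g l) * ddw l i x)
      = (g l * (g j - g i)) * ddw i j x * dw l x + (g i * (g l - g j)) * ddw j l x * dw i x
        + (g j * (g i - g l)) * ddw l i x * dw j x" by (simp add: mult_ac)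
    also have "\<dots> = ?c * ((\<tau> i - \<tau> j) * wt l * ddw i j x * dw l x + (\<tau> j - \<tau> l) * wt i * ddw j l x * dw i x
      + (\<tau> l - \<tau> i) * wt j * ddw l i x * dw j x)" unfolding d by algebra
    also have "\<dots> = 0" using system[OF x ijl] by simp
    finally show ?thesis .
  qed
  then show "form t x $ e l * (partial (e i) (form t) x $ e j - partial (e j) (form t) x $ e i) +
      form t x $ e i * (partial (e j) (form t) x $ e l - partial (e l) (form t) x $ e j) +
      form t x $ e j * (partial (e l) (form t) x $ e i - partial (e i) (form t) x $ e l) = 0"
    unfolding partial_form[OF x ijl(1)] partial_form[OF x ijl(2)] partial_form[OF x ijl(3)]
      form_coord[OF ijl(1)] form_coord[OF ijl(2)] form_coord[OF ijl(3)] sym g_def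
    by (simp add: algebra_simps)
qed

lemma foliation: "codim1_foliation U (ker_form (form t))"
  by (rule Frobenius_codim1[OF openU smooth_form form_nonzero integrable])

lemma web: "veronese_web k U (\<lambda>t. ker_form (form t))"
  unfolding veronese_web_def web_form_def using foliation coframe openU by blast

text \<open>The coefficients of the curve on which the form at s takes the value (s - t)^k; its
  components are forced by the values at the nodes.\<close>

definition dual_coeff where
  "dual_coeff j x = (\<Sum>i\<le>k. (coeff ([:\<tau> i, - 1:] ^ k) j / (bw i * dw i x)) *\<^sub>R axis (e i) (1::real))"

lemma dual_coeff_curve:
  assumes "i \<le> k"
  shows "poly_curve k dual_coeff t x $ e i = (\<tau> i - t) ^ k / (bw i * dw i x)"
proof -
  have "(\<tau> i - t) ^ k = poly ([:\<tau> i, - 1:] ^ k) t" by simp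
  also have "\<dots> = (\<Sum>j\<le>k. coeff ([:\<tau> i, - 1:] ^ k) j * t ^ j)"
    unfolding poly_altdef degree_linear_power_neg ..
  finally show ?thesis
    unfolding poly_curve_def sum_component vector_scaleR_component
      dual_coeff_def sum_axis_coord[OF assms, unfolded sum_component vector_scaleR_component]
    by (simp add: sum_divide_distrib mult_ac)
qed

text \<open>Evaluation at s = \<tau> i reads off component i; conversely these components
  interpolate (s - t)^k, a polynomial of degree k, at the k + 1 nodes.\<close>

lemma form_power_iff:
  assumes "x \<in> U"
  shows "(\<forall>s. form s x \<bullet> v = c * (s - t) ^ k) \<longleftrightarrow> (\<forall>i\<le>k. v $ e i = c * (\<tau> i - t) ^ k / (bw i * dw i x))"
proof
  assume "\<forall>s. form s x \<bullet> v = c * (s - t) ^ k"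
  then show "\<forall>i\<le>k. v $ e i = c * (\<tau> i - t) ^ k / (bw i * dw i x)"
    using form_at_node[of _ x v] bw_nonzero dw_nonzero assms by (metis no_zero_divisors nonzero_mult_div_cancel_left)
next
  assume v: "\<forall>i\<le>k. v $ e i = c * (\<tau> i - t) ^ k / (bw i * dw i x)"
  show "\<forall>s. form s x \<bullet> v = c * (s - t) ^ k"
  proof
    fix s
    have "form s x \<bullet> v = (\<Sum>i\<le>k. c * ((\<tau> i - t) ^ k / np i (\<tau> i) * np i s))"
      unfolding form_inner
    proof (intro sum.cong refl)
      fix i assume "i \<in> {..k}"
      then have i: "i \<le> k" by simp
      show "wt i * np i s * dw i x * v $ e i = c * ((\<tau> i - t) ^ k / np i (\<tau> i) * np i s)"
        using v i wt_nonzero[OF i] dw_nonzero[OF i assms] np_self_nonzero[OF i] by (simp add: bw_def)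
    qed
    also have "\<dots> = c * (s - t) ^ k"
      using interpolation_poly[of "[:- t, 1:] ^ k" s] by (simp add: degree_linear_power sum_distrib_left)
    finally show "form s x \<bullet> v = c * (s - t) ^ k" .
  qed
qed

text \<open>A covector annihilating the span annihilates the whole curve, and
  \<open>powers_independent\<close> makes its coordinates vanish.\<close>

lemma dual_coeff_frame: "smooth_frame k U dual_coeff"
proof (rule smooth_frameI)
  show "smooth_on U (dual_coeff j)" for j
    unfolding dual_coeff_def[abs_def]
    by (intro smooth_on_sum smooth_on_scaleR smooth_on_const smooth_on_divide smooth_on_mult smooth_dw openU)
       (use bw_nonzero dw_nonzero in auto)
  fix x assume x: "x \<in> U"
  show "span ((\<lambda>j. dual_coeff j x) ` {..k}) = UNIV"
  proof (rule ccontr)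
    let ?S = "span ((\<lambda>j. dual_coeff j x) ` {..k})"
    assume "?S \<noteq> UNIV"
    then obtain a where a: "a \<noteq> 0" "\<And>v. v \<in> ?S \<Longrightarrow> a \<bullet> v = 0"
      using span_not_UNIV_orthogonal by blast
    have "a $ e i / (bw i * dw i x) = 0" if "i \<le> k" for i
    proof (rule powers_independent[OF _ that])
      fix t
      have "poly_curve k dual_coeff t x \<in> ?S"
        unfolding poly_curve_def by (intro span_sum span_scale) (auto intro: span_base)
      then have "a \<bullet> poly_curve k dual_coeff t x = 0" by (rule a(2))
      then show "(\<Sum>i\<le>k. a $ e i / (bw i * dw i x) * (\<tau> i - t) ^ k) = 0"
        unfolding inner_coords using dual_coeff_curve by simp
    qed
    then have "a = 0" using bw_nonzero dw_nonzero x by (intro vec_eqI) auto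
    then show False using a by simp
  qed
qed

lemma dual_coeff_dual: "dual_curve k U form dual_coeff"
  unfolding dual_curve_def
proof (intro conjI dual_coeff_frame ballI allI impI)
  fix x t j assume x: "x \<in> U" and j: "j < k"
  have "\<forall>s. form s x \<bullet> poly_curve k dual_coeff t x = 1 * (s - t) ^ k"
    unfolding form_power_iff[OF x] using dual_coeff_curve by simp
  then show "poly_curve k dual_coeff t x \<in> ker_form ((t_deriv ^^ j) form t) x"
    using ker_derivatives_iff[of form x k form_coeff, OF form_poly_curve] j by blast
qed

text \<open>The rigidity in \<open>dual_polynomial\<close>, applied to the components multiplied by
  \<open>bw i * dw i x\<close>, makes the factor independent of t.\<close>

lemma dual_pointwise:
  assumes "x \<in> U" "\<And>t. \<exists>c. \<forall>s. form s x \<bullet> (\<Sum>j\<le>k. t ^ j *\<^sub>R V j) = c * (s - t) ^ k"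
  shows "\<exists>C. \<forall>t. \<forall>i\<le>k. (\<Sum>j\<le>k. t ^ j *\<^sub>R V j) $ e i = C * (\<tau> i - t) ^ k / (bw i * dw i x)"
proof -
  define q where "q i = smult (bw i * dw i x) (\<Sum>j\<le>k. monom (V j $ e i) j)" for i
  have poly_q: "poly (q i) t = bw i * dw i x * (\<Sum>j\<le>k. t ^ j *\<^sub>R V j) $ e i" for i t
    by (simp add: q_def poly_sum poly_monom mult.commute)
  have nz: "bw i * dw i x \<noteq> 0" if "i \<le> k" for i using bw_nonzero dw_nonzero assms(1) that by simp
  have "\<exists>C. \<forall>t. \<forall>i\<le>k. poly (q i) t = C * (\<tau> i - t) ^ k"
  proof (rule dual_polynomial[of q])
    show "degree (q i) \<le> k" for i unfolding q_def
      by (intro order_trans[OF degree_smult_le] degree_sum_le order_trans[OF degree_monom_le]) auto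
    show "\<exists>c. \<forall>i\<le>k. poly (q i) t = c * (\<tau> i - t) ^ k" for t
    proof -
      obtain c where "\<forall>s. form s x \<bullet> (\<Sum>j\<le>k. t ^ j *\<^sub>R V j) = c * (s - t) ^ k" using assms(2) by blast
      then have "\<forall>i\<le>k. (\<Sum>j\<le>k. t ^ j *\<^sub>R V j) $ e i = c * (\<tau> i - t) ^ k / (bw i * dw i x)"
        using form_power_iff[OF assms(1)] by blast
      then show ?thesis unfolding poly_q using nz by (intro exI[of _ c]) auto
    qed
  qed blast
  then show ?thesis unfolding poly_q using nz by (auto simp: field_simps)
qed

end

subsection \<open>Connections of a solution\<close>

lemma torsion_eq: "torsion \<Gamma> X Y x = \<Gamma> x (X x) (Y x) - \<Gamma> x (Y x) (X x)"
  by (simp add: torsion_def nabla_def lie_bracket_def)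

lemma nabla_constant: "nabla \<Gamma> Y (\<lambda>_. v) x = \<Gamma> x (Y x) v"
  by (simp add: nabla_def)

lemma has_real_derivative_along:
  fixes f :: "'a::real_normed_vector \<Rightarrow> real"
  assumes "(g has_vector_derivative v) (at s)" "(f has_derivative D) (at (g s))"
  shows "((\<lambda>s. f (g s)) has_real_derivative D v) (at s)"
proof -
  have "(\<lambda>h. D (h *\<^sub>R v)) = (*) (D v)"
    using linear_scale[OF has_derivative_linear[OF assms(2)]] by (simp add: fun_eq_iff)
  with has_derivative_compose[OF assms(1)[unfolded has_vector_derivative_def] assms(2)]
  show ?thesis by (simp add: has_field_derivative_def)
qed

context solution
begin

definition grad_log where "grad_log i x u = frechet_derivative (dw i) (at x) u / dw i x"

lemma linear_grad_log: "x \<in> U \<Longrightarrow> linear (grad_log i x)"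
  using smooth_on_linear_derivative[OF smooth_dw]
  by (auto simp: grad_log_def[abs_def] linear_iff add_divide_distrib)

lemma grad_log_coords:
  assumes "x \<in> U"
  shows "grad_log i x u = (\<Sum>j\<le>k. u $ e j * (ddw j i x / dw i x))"
  unfolding grad_log_def frechet_coords[OF smooth_dw assms] sum_divide_distrib by simp

text \<open>The difference of a connection and the flat connection with \<open>\<nabla>\<partial>\<^sub>i = d(\<partial>\<^sub>i w)/\<partial>\<^sub>i w \<partial>\<^sub>i\<close>.\<close>

definition diff_tensor where
  "diff_tensor \<Gamma> x u v = \<Gamma> x u v - (\<Sum>i\<le>k. (grad_log i x u * v $ e i) *\<^sub>R axis (e i) (1::real))"

lemma diff_tensor_coord:
  "i \<le> k \<Longrightarrow> diff_tensor \<Gamma> x u v $ e i = \<Gamma> x u v $ e i - grad_log i x u * v $ e i"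
  unfolding diff_tensor_def vector_minus_component by (simp only: sum_axis_coord)

lemma diff_tensor_bilinear:
  assumes "connection U \<Gamma>" "x \<in> U"
  shows "bilinear (diff_tensor \<Gamma> x)"
proof -
  have b: "bilinear (\<Gamma> x)" by (rule connection_bilinear[OF assms])
  note lin = linear_grad_log[OF assms(2)]
  show ?thesis unfolding bilinear_def
  proof (intro conjI allI linearI vec_eqI)
    fix u v v' r i assume i: "i \<le> k"
    show "diff_tensor \<Gamma> x u (v + v') $ e i = (diff_tensor \<Gamma> x u v + diff_tensor \<Gamma> x u v') $ e i"
      using i by (simp add: diff_tensor_coord bilinear_radd[OF b] algebra_simps)
    show "diff_tensor \<Gamma> x u (r *\<^sub>R v) $ e i = (r *\<^sub>R diff_tensor \<Gamma> x u v) $ e i"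
      using i by (simp add: diff_tensor_coord bilinear_rmul[OF b] algebra_simps)
    show "diff_tensor \<Gamma> x (v + v') u $ e i = (diff_tensor \<Gamma> x v u + diff_tensor \<Gamma> x v' u) $ e i"
      using i by (simp add: diff_tensor_coord bilinear_ladd[OF b] linear_add[OF lin] algebra_simps)
    show "diff_tensor \<Gamma> x (r *\<^sub>R v) u $ e i = (r *\<^sub>R diff_tensor \<Gamma> x v u) $ e i"
      using i by (simp add: diff_tensor_coord bilinear_lmul[OF b] linear_scale[OF lin] algebra_simps)
  qed
qed

lemma smooth_grad_log: "smooth_on U (\<lambda>x. grad_log i x u)" if "i \<le> k"
  unfolding grad_log_def
  by (intro smooth_on_divide smooth_on_frechet smooth_dw openU) (use dw_nonzero that in auto)

lemma smooth_diff_tensor: "connection U \<Gamma> \<Longrightarrow> smooth_on U (\<lambda>x. diff_tensor \<Gamma> x u v)"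
  unfolding diff_tensor_def
  by (intro smooth_on_diff smooth_on_sum smooth_on_scaleR smooth_on_mult smooth_on_const smooth_grad_log openU)
     (auto simp: connection_def)

text \<open>Relative to the flat connection the family is \<alpha> times the identity. Testing with
  constant fields Y turns a condition on vector fields into one on vectors.\<close>

lemma solution_connection_iff:
  "solution_connection k e U w \<alpha> \<Gamma> \<longleftrightarrow>
     connection U \<Gamma> \<and> (\<forall>x\<in>U. \<forall>u v. diff_tensor \<Gamma> x u v = (\<alpha> x \<bullet> u) *\<^sub>R v)"
proof (cases "connection U \<Gamma>")
  case True
  have eq: "\<Gamma> x u (axis (e i) 1) = (grad_log i x u + \<alpha> x \<bullet> u) *\<^sub>R axis (e i) 1 \<longleftrightarrow>
      diff_tensor \<Gamma> x u (axis (e i) 1) = (\<alpha> x \<bullet> u) *\<^sub>R axis (e i) 1" if "i \<le> k" for i x u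
  proof -
    have "(\<Sum>j\<le>k. (grad_log j x u * axis (e i) 1 $ e j) *\<^sub>R axis (e j) (1::real)) = grad_log i x u *\<^sub>R axis (e i) 1"
    proof (rule vec_eqI)
      fix j assume j: "j \<le> k"
      show "(\<Sum>j\<le>k. (grad_log j x u * axis (e i) 1 $ e j) *\<^sub>R axis (e j) (1::real)) $ e j
          = (grad_log i x u *\<^sub>R axis (e i) 1) $ e j"
        unfolding sum_axis_coord[OF j] using that j by (simp add: axis_coord)
    qed
    then show ?thesis unfolding diff_tensor_def by (auto simp: algebra_simps)
  qed
  have "solution_connection k e U w \<alpha> \<Gamma> \<longleftrightarrow>
    (\<forall>i\<le>k. \<forall>x\<in>U. \<forall>u. \<Gamma> x u (axis (e i) 1) = (grad_log i x u + \<alpha> x \<bullet> u) *\<^sub>R axis (e i) 1)"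
  proof
    assume *: "solution_connection k e U w \<alpha> \<Gamma>"
    show "\<forall>i\<le>k. \<forall>x\<in>U. \<forall>u. \<Gamma> x u (axis (e i) 1) = (grad_log i x u + \<alpha> x \<bullet> u) *\<^sub>R axis (e i) 1"
    proof (intro allI impI ballI)
      fix i x and u :: "real ^ 'n" assume i: "i \<le> k" "x \<in> U"
      have "smooth_on U (\<lambda>_. u)" by (rule smooth_on_const[OF openU])
      with * i show "\<Gamma> x u (axis (e i) 1) = (grad_log i x u + \<alpha> x \<bullet> u) *\<^sub>R axis (e i) 1"
        unfolding solution_connection_def nabla_constant grad_log_def by auto
    qed
  qed (auto simp: solution_connection_def nabla_constant grad_log_def True)
  also have "\<dots> \<longleftrightarrow> (\<forall>i\<le>k. \<forall>x\<in>U. \<forall>u. diff_tensor \<Gamma> x u (axis (e i) 1) = (\<alpha> x \<bullet> u) *\<^sub>R axis (e i) 1)"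
    using eq by auto
  also have "\<dots> \<longleftrightarrow> (\<forall>x\<in>U. \<forall>u v. diff_tensor \<Gamma> x u v = (\<alpha> x \<bullet> u) *\<^sub>R v)"
  proof
    assume *: "\<forall>i\<le>k. \<forall>x\<in>U. \<forall>u. diff_tensor \<Gamma> x u (axis (e i) 1) = (\<alpha> x \<bullet> u) *\<^sub>R axis (e i) 1"
    show "\<forall>x\<in>U. \<forall>u v. diff_tensor \<Gamma> x u v = (\<alpha> x \<bullet> u) *\<^sub>R v"
    proof (intro ballI allI)
      fix x u v assume x: "x \<in> U"
      have lin: "linear (diff_tensor \<Gamma> x u)" using diff_tensor_bilinear[OF True x] by (simp add: bilinear_def)
      have "diff_tensor \<Gamma> x u v = (\<Sum>i\<le>k. v $ e i *\<^sub>R ((\<alpha> x \<bullet> u) *\<^sub>R axis (e i) 1))"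
        unfolding linear_coords[OF lin, of v] by (intro sum.cong refl) (use * x in auto)
      also have "\<dots> = (\<alpha> x \<bullet> u) *\<^sub>R (\<Sum>i\<le>k. v $ e i *\<^sub>R axis (e i) 1)"
        unfolding scaleR_sum_right by (intro sum.cong refl) (simp add: mult.commute)
      finally show "diff_tensor \<Gamma> x u v = (\<alpha> x \<bullet> u) *\<^sub>R v" unfolding coord_expansion[symmetric] .
    qed
  qed auto
  finally show ?thesis using True by simp
qed (simp add: solution_connection_def)

lemma solution_connection_exists:
  assumes "smooth_on U \<alpha>"
  shows "\<exists>\<Gamma>. solution_connection k e U w \<alpha> \<Gamma>"
proof -
  define \<Gamma> where "\<Gamma> x u v = (\<Sum>i\<le>k. (grad_log i x u * v $ e i) *\<^sub>R axis (e i) (1::real)) + (\<alpha> x \<bullet> u) *\<^sub>R v" for x u v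
  have "connection U \<Gamma>"
    unfolding connection_def
  proof (intro conjI ballI allI)
    fix x assume x: "x \<in> U"
    note lin = linear_grad_log[OF x]
    have c: "\<Gamma> x u v $ e i = grad_log i x u * v $ e i + (\<alpha> x \<bullet> u) * v $ e i" if "i \<le> k" for i u v
      unfolding \<Gamma>_def vector_add_component sum_axis_coord[OF that] by simp
    show "bilinear (\<Gamma> x)"
      unfolding bilinear_def
      by (intro conjI allI linearI vec_eqI)
         (auto simp: c linear_add[OF lin] linear_scale[OF lin] algebra_simps)
  next
    show "smooth_on U (\<lambda>x. \<Gamma> x u v)" for u v
      unfolding \<Gamma>_def
      by (intro smooth_on_add smooth_on_sum smooth_on_scaleR smooth_on_mult smooth_on_const smooth_on_inner
            smooth_grad_log openU assms) auto
  qed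
  then show ?thesis unfolding solution_connection_iff by (intro exI[of _ \<Gamma>]) (simp add: diff_tensor_def \<Gamma>_def)
qed

section \<open>Total geodesy of the leaves\<close>

text \<open>Along a geodesic, the form evaluated on the velocity satisfies a scalar linear equation
  with coefficient - \<alpha>(velocity), the derivatives of \<partial>_i w cancelling against the
  flat part. It starts at zero, so the velocity stays tangent to the foliation and the defining
  function is constant.\<close>

lemma totally_geodesicI:
  assumes conn: "connection U \<Gamma>" and \<alpha>: "continuous_on U \<alpha>"
    and diag: "\<And>x v. x \<in> U \<Longrightarrow> diff_tensor \<Gamma> x v v = (\<alpha> x \<bullet> v) *\<^sub>R v"
  shows "totally_geodesic_for_web U (\<lambda>t. ker_form (form t)) \<Gamma>"
  unfolding totally_geodesic_for_web_def totally_geodesic_submanifold_def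
proof (intro allI impI)
  fix t W f c \<gamma> \<gamma>' and \<epsilon> :: real
  assume W: "W \<subseteq> U \<and> defining_function W (ker_form (form t)) f"
    and *: "\<epsilon> > 0 \<and> geodesic_on U \<Gamma> {-\<epsilon><..<\<epsilon>} \<gamma> \<gamma>' \<and> \<gamma> 0 \<in> {x \<in> W. f x = c} \<and> \<gamma>' 0 \<in> ker_form (form t) (\<gamma> 0)"
  have \<gamma>: "\<gamma> s \<in> U" "(\<gamma> has_vector_derivative \<gamma>' s) (at s)"
    "(\<gamma>' has_vector_derivative - \<Gamma> (\<gamma> s) (\<gamma>' s) (\<gamma>' s)) (at s)" if "s \<in> {-\<epsilon><..<\<epsilon>}" for s
    using * that unfolding geodesic_on_def by blast+
  have cont: "continuous_on {-\<epsilon><..<\<epsilon>} \<gamma>" "continuous_on {-\<epsilon><..<\<epsilon>} \<gamma>'"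
    using \<gamma>(2,3) has_vector_derivative_continuous by (meson continuous_at_imp_continuous_on)+
  define q where "q s = form t (\<gamma> s) \<bullet> \<gamma>' s" for s
  have q_zero: "q s = 0" if "s \<in> {-\<epsilon><..<\<epsilon>}" for s
  proof (rule linear_scalar_ODE_zero[OF _ _ _ that, where a = "\<lambda>s. - (\<alpha> (\<gamma> s) \<bullet> \<gamma>' s)"])
    have "continuous_on {-\<epsilon><..<\<epsilon>} (\<lambda>s. \<alpha> (\<gamma> s))"
      by (rule continuous_on_compose2[OF \<alpha> cont(1)]) (use \<gamma> in auto)
    then show "continuous_on {-\<epsilon><..<\<epsilon>} (\<lambda>s. - (\<alpha> (\<gamma> s) \<bullet> \<gamma>' s))"
      using cont(2) by (intro continuous_intros)
    show "q 0 = 0" using * by (simp add: q_def ker_form_def)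
    fix s assume s: "s \<in> {-\<epsilon><..<\<epsilon>}"
    have dcomp: "((\<lambda>s. dw i (\<gamma> s)) has_real_derivative frechet_derivative (dw i) (at (\<gamma> s)) (\<gamma>' s)) (at s)" for i
      by (rule has_real_derivative_along[OF \<gamma>(2)[OF s] smooth_on_has_derivative[OF smooth_dw \<gamma>(1)[OF s]]])
    have dvel: "((\<lambda>s. \<gamma>' s $ e i) has_real_derivative - \<Gamma> (\<gamma> s) (\<gamma>' s) (\<gamma>' s) $ e i) (at s)" for i
      using bounded_linear.has_vector_derivative[OF bounded_linear_vec_nth \<gamma>(3)[OF s], of "e i"]
      by (simp add: has_real_derivative_iff_has_vector_derivative)
    have "((\<lambda>s. \<Sum>i\<le>k. wt i * np i t * dw i (\<gamma> s) * \<gamma>' s $ e i) has_real_derivative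
      (\<Sum>i\<le>k. wt i * np i t * (frechet_derivative (dw i) (at (\<gamma> s)) (\<gamma>' s) * \<gamma>' s $ e i
         + dw i (\<gamma> s) * (- \<Gamma> (\<gamma> s) (\<gamma>' s) (\<gamma>' s) $ e i)))) (at s)"
      by (rule DERIV_sum) (auto intro!: derivative_eq_intros dcomp dvel simp: algebra_simps)
    moreover have "(\<Sum>i\<le>k. wt i * np i t * (frechet_derivative (dw i) (at (\<gamma> s)) (\<gamma>' s) * \<gamma>' s $ e i
         + dw i (\<gamma> s) * (- \<Gamma> (\<gamma> s) (\<gamma>' s) (\<gamma>' s) $ e i))) = - (\<alpha> (\<gamma> s) \<bullet> \<gamma>' s) * q s"
      unfolding q_def form_inner sum_distrib_left
    proof (intro sum.cong refl)
      fix i assume "i \<in> {..k}"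
      then have i: "i \<le> k" by simp
      have "\<Gamma> (\<gamma> s) (\<gamma>' s) (\<gamma>' s) $ e i =
          grad_log i (\<gamma> s) (\<gamma>' s) * \<gamma>' s $ e i + (\<alpha> (\<gamma> s) \<bullet> \<gamma>' s) * \<gamma>' s $ e i"
        using arg_cong[OF diag[OF \<gamma>(1)[OF s], of "\<gamma>' s"], of "\<lambda>v. v $ e i"]
        unfolding diff_tensor_coord[OF i] by simp
      then show "wt i * np i t * (frechet_derivative (dw i) (at (\<gamma> s)) (\<gamma>' s) * \<gamma>' s $ e i
         + dw i (\<gamma> s) * (- \<Gamma> (\<gamma> s) (\<gamma>' s) (\<gamma>' s) $ e i))
         = - (\<alpha> (\<gamma> s) \<bullet> \<gamma>' s) * (wt i * np i t * dw i (\<gamma> s) * \<gamma>' s $ e i)"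
        using dw_nonzero[OF i \<gamma>(1)[OF s]] unfolding grad_log_def by (simp add: field_simps)
    qed
    ultimately show "(q has_real_derivative - (\<alpha> (\<gamma> s) \<bullet> \<gamma>' s) * q s) (at s)"
      unfolding q_def[abs_def] form_inner by simp
  qed
  have Wopen: "open W" and f: "\<And>x. x \<in> W \<Longrightarrow> (f has_derivative frechet_derivative f (at x)) (at x)"
    and Dker: "\<And>x v. x \<in> W \<Longrightarrow> v \<in> ker_form (form t) x \<Longrightarrow> frechet_derivative f (at x) v = 0"
    using W smooth_on_has_derivative unfolding defining_function_def by blast+
  have "open ({-\<epsilon><..<\<epsilon>} \<inter> \<gamma> -` W)"
    by (rule continuous_open_preimage[OF cont(1) _ Wopen]) auto
  moreover have "0 \<in> {-\<epsilon><..<\<epsilon>} \<inter> \<gamma> -` W" using * by auto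
  ultimately obtain d where d: "d > 0" "ball 0 d \<subseteq> {-\<epsilon><..<\<epsilon>} \<inter> \<gamma> -` W"
    by (meson open_contains_ball)
  have "((\<lambda>s. f (\<gamma> s)) has_derivative (\<lambda>h. 0)) (at s within ball 0 d)" if "s \<in> ball 0 d" for s
  proof -
    have s: "s \<in> {-\<epsilon><..<\<epsilon>}" "\<gamma> s \<in> W" using d that by auto
    have z: "frechet_derivative f (at (\<gamma> s)) (\<gamma>' s) = 0"
      using q_zero[OF s(1)] by (intro Dker[OF s(2)]) (simp add: ker_form_def q_def)
    have "((\<lambda>s. f (\<gamma> s)) has_derivative (\<lambda>h. frechet_derivative f (at (\<gamma> s)) (h *\<^sub>R \<gamma>' s))) (at s)"
      using has_derivative_compose[OF \<gamma>(2)[OF s(1), unfolded has_vector_derivative_def] f[OF s(2)]] .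
    then show ?thesis
      unfolding linear_scale[OF has_derivative_linear[OF f[OF s(2)]]] z
      by (simp add: has_derivative_at_withinI)
  qed
  then have "\<exists>b. \<forall>s\<in>ball 0 d. f (\<gamma> s) = b" by (intro has_derivative_zero_constant) auto
  then have fc: "f (\<gamma> s) = c" if "s \<in> ball 0 d" for s
    using * d(1) that by (metis (mono_tags, lifting) centre_in_ball mem_Collect_eq)
  show "\<forall>\<^sub>F s in at 0. \<gamma> s \<in> {x \<in> W. f x = c}"
    unfolding eventually_at
  proof (intro exI[of _ d] conjI ballI impI d)
    fix s :: real assume "s \<noteq> 0 \<and> dist s 0 < d"
    then have "s \<in> ball 0 d" by (simp add: dist_commute)
    then show "\<gamma> s \<in> {x \<in> W. f x = c}" using fc d by auto
  qed
qed

text \<open>The hyperplanes x_i = const are leaves for the parameter \<open>\<tau> i\<close>. A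
  geodesic with velocity v at x stays in its leaf for a while, so its i-th coordinate is constant,
  and its second derivative at 0 is read off from the geodesic equation.\<close>

lemma totally_geodesicD:
  assumes conn: "connection U \<Gamma>" and tg: "totally_geodesic_for_web U (\<lambda>t. ker_form (form t)) \<Gamma>"
    and x: "x \<in> U" and i: "i \<le> k" and v: "v $ e i = 0"
  shows "\<Gamma> x v v $ e i = 0"
proof -
  let ?f = "\<lambda>y::real ^ 'n. y $ e i"
  have df: "(?f has_derivative (\<lambda>v. v $ e i)) (at y)" for y
    by (rule bounded_linear_imp_has_derivative[OF bounded_linear_vec_nth])
  then have fd: "frechet_derivative ?f (at y) = (\<lambda>v. v $ e i)" for y
    using frechet_derivative_at by metis
  have "defining_function U (ker_form (form (\<tau> i))) ?f"
    unfolding defining_function_def fd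
  proof (intro conjI ballI openU smooth_on_nth smooth_on_ident)
    fix y assume y: "y \<in> U"
    have "axis (e i) (1::real) $ e i \<noteq> 0" by simp
    then show "(\<lambda>v::real ^ 'n. v $ e i) \<noteq> (\<lambda>v. 0)" by metis
    show "ker_form (form (\<tau> i)) y = {v. v $ e i = 0}"
      using form_at_node[OF i] bw_nonzero[OF i] dw_nonzero[OF i y] by (simp add: ker_form_def)
  qed
  with tg have sub: "totally_geodesic_submanifold U \<Gamma> {y \<in> U. ?f y = x $ e i} (ker_form (form (\<tau> i)))"
    unfolding totally_geodesic_for_web_def by blast
  obtain \<epsilon> \<gamma> \<gamma>' where g: "\<epsilon> > 0" "geodesic_on U \<Gamma> {-\<epsilon><..<\<epsilon>} \<gamma> \<gamma>'" "\<gamma> 0 = x" "\<gamma>' 0 = v"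
    by (rule geodesic_exists[OF openU conn x, of v])
  have "v \<in> ker_form (form (\<tau> i)) x" using v form_at_node[OF i] by (simp add: ker_form_def)
  then have "\<forall>\<^sub>F s in at 0. \<gamma> s \<in> {y \<in> U. ?f y = x $ e i}"
    using sub g x unfolding totally_geodesic_submanifold_def by blast
  then obtain d where d: "d > 0" "\<And>s. s \<noteq> 0 \<Longrightarrow> dist s 0 < d \<Longrightarrow> \<gamma> s $ e i = x $ e i"
    unfolding eventually_at by auto
  define \<delta> where "\<delta> = min d \<epsilon>"
  have \<delta>: "\<delta> > 0" "\<delta> \<le> \<epsilon>" "\<delta> \<le> d" using d(1) g(1) by (auto simp: \<delta>_def)
  have const: "\<gamma> s $ e i = x $ e i" if "s \<in> {-\<delta><..<\<delta>}" for s
    using d(2)[of s] that \<delta>(3) g(3) by (cases "s = 0") auto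
  have geo: "(\<gamma> has_vector_derivative \<gamma>' s) (at s)"
    "(\<gamma>' has_vector_derivative - \<Gamma> (\<gamma> s) (\<gamma>' s) (\<gamma>' s)) (at s)" if "s \<in> {-\<delta><..<\<delta>}" for s
    using g(2) that \<delta>(2) unfolding geodesic_on_def by auto
  have unique_zero: "a = 0" if "(h has_real_derivative a) (at s)" "s \<in> {-\<delta><..<\<delta>}"
    "\<And>r. r \<in> {-\<delta><..<\<delta>} \<Longrightarrow> h r = b" for h a s and b :: real
  proof -
    have "(h has_real_derivative 0) (at s)"
      by (rule has_field_derivative_transform_within_open[OF DERIV_const open_greaterThanLessThan that(2)])
         (use that(3) in auto)
    then show ?thesis using DERIV_unique that(1) by blast
  qed
  have vel: "\<gamma>' s $ e i = 0" if "s \<in> {-\<delta><..<\<delta>}" for s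
    using bounded_linear.has_vector_derivative[OF bounded_linear_vec_nth geo(1)[OF that], of "e i"]
    by (intro unique_zero[OF _ that const]) (auto simp: has_real_derivative_iff_has_vector_derivative)
  have "- \<Gamma> (\<gamma> 0) (\<gamma>' 0) (\<gamma>' 0) $ e i = 0"
    using bounded_linear.has_vector_derivative[OF bounded_linear_vec_nth geo(2)[of 0], of "e i"] \<delta>(1)
    by (intro unique_zero[OF _ _ vel]) (auto simp: has_real_derivative_iff_has_vector_derivative)
  then show ?thesis using g by simp
qed

end

section \<open>Dual curves and paraconformal connections\<close>

locale solution_dual = solution k \<tau> e U w
  for k :: nat and \<tau> :: "nat \<Rightarrow> real" and e :: "nat \<Rightarrow> 'n::finite"
    and U :: "(real ^ 'n) set" and w :: "real ^ 'n \<Rightarrow> real" +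
  fixes V :: "nat \<Rightarrow> real ^ 'n \<Rightarrow> real ^ 'n"
  assumes dual: "dual_curve k U form V"
begin

abbreviation Vt where "Vt \<equiv> poly_curve k V"

text \<open>The factor between the given dual curve and the standard one, read off in component 0 at
  the parameter where \<tau> 0 - t is 1; in this form it is visibly smooth.\<close>

definition scale where "scale x = Vt (\<tau> 0 - 1) x $ e 0 * (bw 0 * dw 0 x)"

lemma V_coord:
  assumes x: "x \<in> U" and i: "i \<le> k"
  shows "Vt t x $ e i = scale x * (\<tau> i - t) ^ k / (bw i * dw i x)"
proof -
  have "\<exists>c. \<forall>s. form s x \<bullet> (\<Sum>j\<le>k. t ^ j *\<^sub>R V j x) = c * (s - t) ^ k" for t
    using ker_derivatives_iff[of form x k form_coeff, OF form_poly_curve] dual x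
    unfolding dual_curve_def poly_curve_def by blast
  from dual_pointwise[OF x this] obtain C where
    C: "\<And>t i. i \<le> k \<Longrightarrow> Vt t x $ e i = C * (\<tau> i - t) ^ k / (bw i * dw i x)"
    unfolding poly_curve_def by blast
  have "scale x = C" unfolding scale_def using C[of 0 "\<tau> 0 - 1"] bw_nonzero[of 0] dw_nonzero[OF _ x, of 0] by simp
  then show ?thesis using C[OF i] by simp
qed

lemma scale_nonzero: "x \<in> U \<Longrightarrow> scale x \<noteq> 0"
proof
  assume x: "x \<in> U" and 0: "scale x = 0"
  have "Vt 0 x = 0" by (rule vec_eqI) (use V_coord[OF x] 0 in simp)
  moreover have "Vt 0 x = V 0 x"
  proof -
    have "Vt 0 x = (\<Sum>i\<le>k. if i = 0 then V 0 x else 0)"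
      unfolding poly_curve_def by (rule sum.cong) auto
    then show ?thesis by simp
  qed
  moreover have "0 \<notin> (\<lambda>i. V i x) ` {..k}"
    using dual x dependent_zero unfolding dual_curve_def smooth_frame_def by metis
  ultimately show False by force
qed

lemma smooth_V: "j \<le> k \<Longrightarrow> smooth_on U (V j)"
  using dual unfolding dual_curve_def smooth_frame_def by blast

lemma smooth_Vt: "smooth_on U (Vt t)"
  unfolding poly_curve_def[abs_def]
  by (intro smooth_on_sum smooth_on_scaleR smooth_on_const openU smooth_V) simp

lemma smooth_scale: "smooth_on U scale"
  unfolding scale_def[abs_def]
  by (intro smooth_on_mult smooth_on_const smooth_on_nth smooth_Vt smooth_dw openU)

lemma V_deriv_coord:
  assumes x: "x \<in> U" and i: "i \<le> k"
  shows "t_deriv Vt t x $ e i = - real k * scale x * (\<tau> i - t) ^ (k - 1) / (bw i * dw i x)"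
proof -
  have "((\<lambda>s. Vt s x) has_vector_derivative (\<Sum>j\<le>k. (real j * t ^ (j - 1)) *\<^sub>R V j x)) (at t)"
    unfolding poly_curve_def by (auto intro!: derivative_eq_intros simp: has_real_derivative_iff_has_vector_derivative[symmetric])
  then have "((\<lambda>s. Vt s x) has_vector_derivative t_deriv Vt t x) (at t)"
    unfolding t_deriv_def by (simp add: vector_derivative_at)
  from bounded_linear.has_vector_derivative[OF bounded_linear_vec_nth this, of "e i"]
  have "((\<lambda>s. scale x * (\<tau> i - s) ^ k / (bw i * dw i x)) has_real_derivative t_deriv Vt t x $ e i) (at t)"
    unfolding V_coord[OF x i] by (simp add: has_real_derivative_iff_has_vector_derivative)
  moreover have "((\<lambda>s. scale x * (\<tau> i - s) ^ k / (bw i * dw i x)) has_real_derivative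
      - real k * scale x * (\<tau> i - t) ^ (k - 1) / (bw i * dw i x)) (at t)"
    using bw_nonzero[OF i] dw_nonzero[OF i x]
    by (auto intro!: derivative_eq_intros simp: mult_ac)
  ultimately show ?thesis by (rule DERIV_unique)
qed

text \<open>The components of V are constants times scale / \<partial>_i w. The flat connection
  differentiates \<partial>_i w away and only the logarithmic derivative of \<open>scale\<close>
  remains, so paraconformality becomes a pointwise condition on the difference tensor.\<close>

lemma nabla_V:
  assumes x: "x \<in> U"
  shows "nabla \<Gamma> Y (Vt t) x =
    (frechet_derivative scale (at x) (Y x) / scale x) *\<^sub>R Vt t x + diff_tensor \<Gamma> x (Y x) (Vt t x)"
proof (rule vec_eqI)
  fix i assume i: "i \<le> k"
  note nz = bw_nonzero[OF i] dw_nonzero[OF i x] scale_nonzero[OF x]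
  let ?D = "\<lambda>f v. frechet_derivative f (at x) v"
  have 1: "((\<lambda>y. Vt t y $ e i) has_derivative (\<lambda>v. ?D (Vt t) v $ e i)) (at x)"
    using bounded_linear.has_derivative[OF bounded_linear_vec_nth smooth_on_has_derivative[OF smooth_Vt x]] .
  have "((\<lambda>y. scale y * (\<tau> i - t) ^ k / (bw i * dw i y)) has_derivative
      (\<lambda>v. ?D scale v * (\<tau> i - t) ^ k / (bw i * dw i x)
         - scale x * (\<tau> i - t) ^ k * ?D (dw i) v / (bw i * dw i x * dw i x))) (at x)"
    using nz
    by (auto intro!: derivative_eq_intros smooth_on_has_derivative[OF smooth_scale x]
        smooth_on_has_derivative[OF smooth_dw x] simp: fun_eq_iff field_simps)
  then have "((\<lambda>y. Vt t y $ e i) has_derivative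
      (\<lambda>v. ?D scale v * (\<tau> i - t) ^ k / (bw i * dw i x)
         - scale x * (\<tau> i - t) ^ k * ?D (dw i) v / (bw i * dw i x * dw i x))) (at x)"
    by (rule has_derivative_transform_within_open[OF _ openU x]) (use V_coord[OF _ i] in auto)
  from fun_cong[OF has_derivative_unique[OF 1 this], of "Y x"]
  have "?D (Vt t) (Y x) $ e i = ?D scale (Y x) * (\<tau> i - t) ^ k / (bw i * dw i x)
         - scale x * (\<tau> i - t) ^ k * ?D (dw i) (Y x) / (bw i * dw i x * dw i x)" .
  then show "nabla \<Gamma> Y (Vt t) x $ e i =
    ((?D scale (Y x) / scale x) *\<^sub>R Vt t x + diff_tensor \<Gamma> x (Y x) (Vt t x)) $ e i"
    unfolding nabla_def vector_add_component diff_tensor_coord[OF i] grad_log_def vector_scaleR_component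
      V_coord[OF x i]
    using nz by (simp add: field_simps)
qed

end

lemma span_pairD: "x \<in> span {a, b} \<Longrightarrow> \<exists>p q. x = p *\<^sub>R a + q *\<^sub>R b"
  unfolding span_insert by (auto simp: span_singleton algebra_simps)

lemma span_singletonD: "x \<in> span {a} \<Longrightarrow> \<exists>p. x = p *\<^sub>R a"
  unfolding span_singleton by auto

context solution_dual
begin

text \<open>Conjugating with the diagonal matrix \<open>bw i * dw i x\<close> carries V to a
  multiple of ((\<tau> i - t)^k)_i and its t-derivative to a multiple of ((\<tau> i - t)^(k - 1))_i,
  the setting of \<open>osculating_endomorphism\<close>.\<close>

lemma osculating_span:
  assumes x: "x \<in> U" and lin: "linear L" and i_span: "L (Vt t x) \<in> span {Vt t x, t_deriv Vt t x}"
  shows "\<exists>a b. \<forall>i\<le>k. (\<Sum>j\<le>k. bw i * dw i x * L (axis (e j) 1) $ e i / (bw j * dw j x) * (\<tau> j - t) ^ k)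
    = a * (\<tau> i - t) ^ k + b * (\<tau> i - t) ^ (k - 1)"
proof -
  obtain p q where pq: "L (Vt t x) = p *\<^sub>R Vt t x + q *\<^sub>R t_deriv Vt t x"
    using span_pairD[OF i_span] by blast
  show ?thesis
  proof (intro exI allI impI)
    fix i assume i: "i \<le> k"
    note nz = bw_nonzero[OF i] dw_nonzero[OF i x] scale_nonzero[OF x]
    have "L (Vt t x) $ e i = (\<Sum>j\<le>k. scale x * (\<tau> j - t) ^ k / (bw j * dw j x) * L (axis (e j) 1) $ e i)"
      unfolding linear_coords[OF lin, of "Vt t x"] sum_component vector_scaleR_component
      by (intro sum.cong refl) (simp add: V_coord[OF x])
    also have "\<dots> = scale x / (bw i * dw i x) *
        (\<Sum>j\<le>k. bw i * dw i x * L (axis (e j) 1) $ e i / (bw j * dw j x) * (\<tau> j - t) ^ k)"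
      unfolding sum_distrib_left using nz by (intro sum.cong refl) (simp add: mult_ac)
    finally have "(\<Sum>j\<le>k. bw i * dw i x * L (axis (e j) 1) $ e i / (bw j * dw j x) * (\<tau> j - t) ^ k)
        = (bw i * dw i x / scale x) * L (Vt t x) $ e i" using nz by simp
    also have "\<dots> = p * (\<tau> i - t) ^ k + (- real k * q) * (\<tau> i - t) ^ (k - 1)"
      unfolding pq vector_add_component vector_scaleR_component V_coord[OF x i] V_deriv_coord[OF x i]
      using nz by (simp add: field_simps)
    finally show "(\<Sum>j\<le>k. bw i * dw i x * L (axis (e j) 1) $ e i / (bw j * dw j x) * (\<tau> j - t) ^ k)
        = p * (\<tau> i - t) ^ k + (- real k * q) * (\<tau> i - t) ^ (k - 1)" .
  qed
qed

lemma scalar_connection_span: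
  assumes "x \<in> U" "\<And>u v. diff_tensor \<Gamma> x u v = (\<alpha> x \<bullet> u) *\<^sub>R v"
  shows "nabla \<Gamma> Y (Vt t) x \<in> span {Vt t x}"
  unfolding nabla_V[OF assms(1)] assms(2) by (intro span_add span_scale span_base) auto

lemma solution_connection_paraconformal:
  assumes "solution_connection k e U w \<alpha> \<Gamma>"
  shows "paraconformal_connection k U V \<Gamma>"
  unfolding paraconformal_connection_def
proof (intro allI impI ballI)
  fix Y t x assume x: "x \<in> U"
  have "nabla \<Gamma> Y (Vt t) x \<in> span {Vt t x}"
    using assms x by (intro scalar_connection_span[where \<alpha> = \<alpha>]) (auto simp: solution_connection_iff)
  then show "nabla \<Gamma> Y (Vt t) x \<in> span {Vt t x, t_deriv Vt t x}"
    using span_mono[of "{Vt t x}" "{Vt t x, t_deriv Vt t x}"] by blast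
qed

lemma paraconformal_diff_tensor:
  assumes "paraconformal_connection k U V \<Gamma>" "x \<in> U"
  shows "diff_tensor \<Gamma> x u (Vt t x) \<in> span {Vt t x, t_deriv Vt t x}"
proof -
  have "nabla \<Gamma> (\<lambda>_. u) (Vt t) x \<in> span {Vt t x, t_deriv Vt t x}"
    using assms smooth_on_const[OF openU] unfolding paraconformal_connection_def by blast
  then have "nabla \<Gamma> (\<lambda>_. u) (Vt t) x - (frechet_derivative scale (at x) u / scale x) *\<^sub>R Vt t x
      \<in> span {Vt t x, t_deriv Vt t x}"
    by (rule span_diff) (simp add: span_scale span_base)
  then show ?thesis unfolding nabla_V[OF assms(2)] by simp
qed

section \<open>Classification of the connections for k > 2\<close>

text \<open>For each coordinate field \<partial>_l the difference tensor gives an osculating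
  endomorphism, and its column l is zero off the diagonal because the coordinate leaves are totally
  geodesic; \<open>endomorphism_scalar\<close> then applies.\<close>

lemma classification:
  assumes k: "k > 2" and conn: "connection U \<Gamma>"
  shows "paraconformal_connection k U V \<Gamma> \<and> totally_geodesic_for_web U (\<lambda>t. ker_form (form t)) \<Gamma> \<longleftrightarrow>
    (\<exists>\<alpha>. smooth_on U \<alpha> \<and> solution_connection k e U w \<alpha> \<Gamma>)"
proof
  assume "\<exists>\<alpha>. smooth_on U \<alpha> \<and> solution_connection k e U w \<alpha> \<Gamma>"
  then obtain \<alpha> where \<alpha>: "smooth_on U \<alpha>" "solution_connection k e U w \<alpha> \<Gamma>" by blast
  have "totally_geodesic_for_web U (\<lambda>t. ker_form (form t)) \<Gamma>"
    by (rule totally_geodesicI[OF conn smooth_on_continuous[OF \<alpha>(1)]])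
       (use \<alpha>(2) in \<open>auto simp: solution_connection_iff\<close>)
  then show "paraconformal_connection k U V \<Gamma> \<and> totally_geodesic_for_web U (\<lambda>t. ker_form (form t)) \<Gamma>"
    using solution_connection_paraconformal[OF \<alpha>(2)] by blast
next
  assume *: "paraconformal_connection k U V \<Gamma> \<and> totally_geodesic_for_web U (\<lambda>t. ker_form (form t)) \<Gamma>"
  \<comment> \<open>Each endomorphism will turn out to be scalar, so its entry (0, 0) gives the
    coefficient; as an entry of the difference tensor it is smooth in x.\<close>
  define \<alpha> where "\<alpha> x = (\<Sum>l\<le>k. (diff_tensor \<Gamma> x (axis (e l) 1) (axis (e 0) 1) $ e 0) *\<^sub>R axis (e l) (1::real))" for x
  have "smooth_on U \<alpha>" unfolding \<alpha>_def
    by (intro smooth_on_sum smooth_on_scaleR smooth_on_const smooth_on_nth smooth_diff_tensor conn openU)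
  moreover have "diff_tensor \<Gamma> x u v = (\<alpha> x \<bullet> u) *\<^sub>R v" if x: "x \<in> U" for x u v
  proof -
    note bil = diff_tensor_bilinear[OF conn x]
    have linr: "linear (diff_tensor \<Gamma> x u)" and linl: "linear (\<lambda>u. diff_tensor \<Gamma> x u v)" for u v
      using bil by (auto simp: bilinear_def)
    have basis: "\<exists>c. \<forall>j\<le>k. diff_tensor \<Gamma> x (axis (e l) 1) (axis (e j) 1) = c *\<^sub>R axis (e j) 1" if l: "l \<le> k" for l
    proof -
      let ?L = "diff_tensor \<Gamma> x (axis (e l) 1)"
      have diag: "?L (axis (e l) 1) $ e i = 0" if "i \<le> k" "i \<noteq> l" for i
        using totally_geodesicD[OF conn conjunct2[OF *] x that(1), of "axis (e l) 1"] that l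
        by (simp add: diff_tensor_coord axis_coord)
      obtain c where c: "\<And>i j. i \<le> k \<Longrightarrow> j \<le> k \<Longrightarrow>
          bw i * dw i x * ?L (axis (e j) 1) $ e i / (bw j * dw j x) = (if i = j then c else 0)"
      proof (rule endomorphism_scalar[OF k l])
        show "\<exists>a b. \<forall>i\<le>k. (\<Sum>j\<le>k. bw i * dw i x * ?L (axis (e j) 1) $ e i / (bw j * dw j x) * (\<tau> j - t) ^ k)
          = a * (\<tau> i - t) ^ k + b * (\<tau> i - t) ^ (k - 1)" for t
          by (rule osculating_span[OF x linr paraconformal_diff_tensor[OF conjunct1[OF *] x]])
      qed (use diag in auto)
      show ?thesis
      proof (intro exI allI impI vec_eqI)
        fix i j assume ij: "j \<le> k" "i \<le> k"
        show "?L (axis (e j) 1) $ e i = (c *\<^sub>R axis (e j) 1) $ e i"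
          using c[OF ij(2,1)] bw_nonzero dw_nonzero[OF _ x] ij by (auto simp: axis_coord split: if_splits)
      qed
    qed
    have basis': "diff_tensor \<Gamma> x (axis (e l) 1) v = (\<alpha> x \<bullet> axis (e l) 1) *\<^sub>R v" if l: "l \<le> k" for l v
    proof -
      obtain c where c: "\<And>j. j \<le> k \<Longrightarrow> diff_tensor \<Gamma> x (axis (e l) 1) (axis (e j) 1) = c *\<^sub>R axis (e j) 1"
        using basis[OF l] by blast
      have "\<alpha> x \<bullet> axis (e l) 1 = c"
        unfolding inner_axis_coord \<alpha>_def sum_axis_coord[OF l] using c[of 0] by simp
      moreover have "diff_tensor \<Gamma> x (axis (e l) 1) v = (\<Sum>j\<le>k. v $ e j *\<^sub>R (c *\<^sub>R axis (e j) 1))"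
        unfolding linear_coords[OF linr, of _ v] by (intro sum.cong refl) (use c in auto)
      moreover have "\<dots> = c *\<^sub>R (\<Sum>j\<le>k. v $ e j *\<^sub>R axis (e j) 1)"
        unfolding scaleR_sum_right by (intro sum.cong refl) (simp add: mult.commute)
      ultimately show ?thesis unfolding coord_expansion[symmetric] by simp
    qed
    have "diff_tensor \<Gamma> x u v = (\<Sum>l\<le>k. u $ e l *\<^sub>R ((\<alpha> x \<bullet> axis (e l) 1) *\<^sub>R v))"
      unfolding linear_coords[OF linl, of u] by (intro sum.cong refl) (use basis' in auto)
    also have "\<dots> = (\<Sum>l\<le>k. u $ e l * (\<alpha> x \<bullet> axis (e l) 1)) *\<^sub>R v" by (simp add: scaleR_sum_left)
    also have "(\<Sum>l\<le>k. u $ e l * (\<alpha> x \<bullet> axis (e l) 1)) = \<alpha> x \<bullet> u"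
      unfolding inner_coords[of "\<alpha> x" u] inner_axis_coord by (simp add: mult.commute)
    finally show ?thesis .
  qed
  ultimately show "\<exists>\<alpha>. smooth_on U \<alpha> \<and> solution_connection k e U w \<alpha> \<Gamma>"
    using conn solution_connection_iff by blast
qed

subsection \<open>Normalised torsion\<close>

text \<open>The cocycle described below at the pair (i, 0): an additive cocycle is the coboundary of
  its values against a base index.\<close>

definition pot where "pot i x = (\<tau> i - \<tau> 0) * ddw i 0 x / (dw i x * dw 0 x * (wt i * wt 0))"

text \<open>The system says that \<open>(\<tau> i - \<tau> j) ddw i j / (wt i wt j dw i dw j)\<close> is an additive cocycle.\<close>

lemma ddw_potential:
  assumes x: "x \<in> U" and ij: "i \<le> k" "j \<le> k"
  shows "(\<tau> i - \<tau> j) * ddw i j x = dw i x * dw j x * (wt i * wt j) * (pot i x - pot j x)"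
proof -
  note nz = dw_nonzero[OF ij(1) x] dw_nonzero[OF ij(2) x] dw_nonzero[OF le0 x]
    wt_nonzero[OF ij(1)] wt_nonzero[OF ij(2)] wt_nonzero[OF le0]
  have sys: "(\<tau> i - \<tau> j) * wt 0 * ddw i j x * dw 0 x + (\<tau> j - \<tau> 0) * wt i * ddw j 0 x * dw i x
    + (\<tau> 0 - \<tau> i) * wt j * ddw 0 i x * dw j x = 0" using system[OF x ij le0] .
  have i: "(\<tau> i - \<tau> 0) * ddw i 0 x = pot i x * (dw i x * dw 0 x * (wt i * wt 0))"
    and j: "(\<tau> j - \<tau> 0) * ddw j 0 x = pot j x * (dw j x * dw 0 x * (wt j * wt 0))"
    using nz by (simp_all add: pot_def)
  have "(wt 0 * dw 0 x) * ((\<tau> i - \<tau> j) * ddw i j x) =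
      (wt 0 * dw 0 x) * (dw i x * dw j x * (wt i * wt j) * (pot i x - pot j x))"
    using sys i j unfolding ddw_sym[OF x, of 0 i] by algebra
  then show ?thesis using nz by simp
qed

text \<open>Chosen so that its value on V cancels the coefficient of V' in \<open>torsion_V\<close>.
  To write that coefficient through the powers (\<tau> l - t)^k, the factor \<tau> (k + 1) - t is
  split as (\<tau> j - t) + wt j, and the lower power is expanded by \<open>kap\<close>.\<close>

definition torsion_form where
  "torsion_form x = (\<Sum>l\<le>k. (- bw l * dw l x * (pot l x / np l (\<tau> l) +
     (\<Sum>j\<le>k. pot j x * wt j * kap j l / np j (\<tau> j)))) *\<^sub>R axis (e l) (1::real))"

lemma smooth_torsion_form: "smooth_on U torsion_form"
proof -
  have "smooth_on U (pot j)" if "j \<le> k" for j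
    unfolding pot_def[abs_def]
    by (intro smooth_on_divide smooth_on_mult smooth_on_const smooth_dw smooth_ddw openU)
       (use dw_nonzero wt_nonzero that in auto)
  then have *: "smooth_on U (\<lambda>x. pot l x / np l (\<tau> l) +
     (\<Sum>j\<le>k. pot j x * wt j * kap j l / np j (\<tau> j)))" if "l \<le> k" for l
    by (intro smooth_on_add smooth_on_sum smooth_on_divide smooth_on_mult smooth_on_const openU)
       (use np_self_nonzero that in auto)
  show ?thesis
    unfolding torsion_form_def[abs_def]
    by (intro smooth_on_sum smooth_on_scaleR smooth_on_mult smooth_on_const smooth_dw openU *) simp
qed

lemma torsion_form_V:
  assumes x: "x \<in> U"
  shows "torsion_form x \<bullet> Vt t x =
    - scale x * (\<tau> (k + 1) - t) * (\<Sum>j\<le>k. pot j x / np j (\<tau> j) * (\<tau> j - t) ^ (k - 1))"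
proof -
  have pw: "(\<tau> j - t) ^ k = (\<tau> j - t) * (\<tau> j - t) ^ (k - 1)" for j using k1 by (metis power_eq_if not_one_le_zero)
  have "torsion_form x \<bullet> Vt t x = (\<Sum>l\<le>k. - scale x * ((pot l x / np l (\<tau> l) +
     (\<Sum>j\<le>k. pot j x * wt j * kap j l / np j (\<tau> j))) * (\<tau> l - t) ^ k))"
    unfolding inner_coords torsion_form_def
  proof (intro sum.cong refl)
    fix l assume "l \<in> {..k}"
    then have l: "l \<le> k" by simp
    show "(\<Sum>l\<le>k. (- bw l * dw l x * (pot l x / np l (\<tau> l) +
       (\<Sum>j\<le>k. pot j x * wt j * kap j l / np j (\<tau> j)))) *\<^sub>R axis (e l) (1::real)) $ e l * Vt t x $ e l
      = - scale x * ((pot l x / np l (\<tau> l) + (\<Sum>j\<le>k. pot j x * wt j * kap j l / np j (\<tau> j))) * (\<tau> l - t) ^ k)"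
      unfolding sum_axis_coord[OF l] V_coord[OF x l] using bw_nonzero[OF l] dw_nonzero[OF l x] by simp
  qed
  also have "\<dots> = - scale x * ((\<Sum>l\<le>k. pot l x / np l (\<tau> l) * (\<tau> l - t) ^ k) +
      (\<Sum>l\<le>k. \<Sum>j\<le>k. pot j x * wt j / np j (\<tau> j) * (kap j l * (\<tau> l - t) ^ k)))"
    unfolding sum_distrib_left[symmetric] distrib_right sum.distrib sum_distrib_right
    by (simp add: mult_ac)
  also have "(\<Sum>l\<le>k. \<Sum>j\<le>k. pot j x * wt j / np j (\<tau> j) * (kap j l * (\<tau> l - t) ^ k)) =
      (\<Sum>j\<le>k. pot j x * wt j / np j (\<tau> j) * (\<tau> j - t) ^ (k - 1))"
    by (subst sum.swap) (intro sum.cong refl, simp only: atMost_iff power_pred_expansion sum_distrib_left)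
  also have "(\<Sum>l\<le>k. pot l x / np l (\<tau> l) * (\<tau> l - t) ^ k) +
      (\<Sum>j\<le>k. pot j x * wt j / np j (\<tau> j) * (\<tau> j - t) ^ (k - 1)) =
      (\<tau> (k + 1) - t) * (\<Sum>j\<le>k. pot j x / np j (\<tau> j) * (\<tau> j - t) ^ (k - 1))"
    unfolding sum_distrib_left sum.distrib[symmetric]
  proof (intro sum.cong refl)
    fix j
    have "\<tau> (k + 1) - t = (\<tau> j - t) + wt j" by (simp add: wt_def)
    then show "pot j x / np j (\<tau> j) * (\<tau> j - t) ^ k + pot j x * wt j / np j (\<tau> j) * (\<tau> j - t) ^ (k - 1)
        = (\<tau> (k + 1) - t) * (pot j x / np j (\<tau> j) * (\<tau> j - t) ^ (k - 1))"
      unfolding pw[of j] by (simp add: algebra_simps add_divide_distrib diff_divide_distrib)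
  qed
  finally show ?thesis by (simp add: mult.assoc)
qed

text \<open>With the mixed derivatives written as differences of \<open>pot\<close>, the part
  containing \<open>pot i\<close> multiplies a divided difference of a polynomial of degree k - 1
  and disappears. The rest is the common factor s times a vector in the span of V and V'.\<close>

lemma torsion_V:
  fixes t :: real
  assumes x: "x \<in> U" and S: "\<And>u v. diff_tensor \<Gamma> x u v = (a \<bullet> u) *\<^sub>R v"
  defines "s \<equiv> (\<Sum>j\<le>k. pot j x / np j (\<tau> j) * (\<tau> j - t) ^ (k - 1))"
  shows "torsion \<Gamma> (Vt t) (t_deriv Vt t) x =
    (scale x * (\<tau> (k + 1) - t) * s + a \<bullet> Vt t x) *\<^sub>R t_deriv Vt t x
      + (real k * scale x * s - a \<bullet> t_deriv Vt t x) *\<^sub>R Vt t x"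
proof (rule vec_eqI)
  fix i assume i: "i \<le> k"
  let ?V = "Vt t x" and ?V' = "t_deriv Vt t x"
  note nz = bw_nonzero[OF i] dw_nonzero[OF i x]
  have \<Gamma>: "\<Gamma> x u v $ e i = grad_log i x u * v $ e i + (a \<bullet> u) * v $ e i" for u v
    using arg_cong[OF S[of u v], of "\<lambda>v. v $ e i"] unfolding diff_tensor_coord[OF i] by simp
  have pw: "(\<tau> j - t) ^ k = (\<tau> j - t) * (\<tau> j - t) ^ (k - 1)" for j using k1 by (metis power_eq_if not_one_le_zero)
  let ?y = "\<lambda>j. (\<tau> j - t) ^ (k - 1)" and ?c = "real k * scale x ^ 2 * (\<tau> i - t) ^ (k - 1) * wt i / (bw i * dw i x)"
  have "grad_log i x ?V * ?V' $ e i - grad_log i x ?V' * ?V $ e i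
      = (\<Sum>j\<le>k. (ddw j i x / dw i x) * (?V $ e j * ?V' $ e i - ?V' $ e j * ?V $ e i))"
    unfolding grad_log_coords[OF x] sum_distrib_right sum_subtractf[symmetric]
    by (intro sum.cong refl) (simp add: algebra_simps)
  also have "\<dots> = (\<Sum>j\<le>k. ?c * (pot i x * (?y j / np j (\<tau> j)) - pot j x / np j (\<tau> j) * ?y j))"
  proof (intro sum.cong refl)
    fix j assume "j \<in> {..k}"
    then have j: "j \<le> k" by simp
    note nz' = bw_nonzero[OF j] dw_nonzero[OF j x] np_self_nonzero[OF j] wt_nonzero[OF j]
    have "?V $ e j * ?V' $ e i - ?V' $ e j * ?V $ e i
        = real k * scale x ^ 2 * (?y i * ?y j) * (\<tau> i - \<tau> j) / (bw i * dw i x * (bw j * dw j x))"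
      unfolding V_coord[OF x i] V_coord[OF x j] V_deriv_coord[OF x i] V_deriv_coord[OF x j] pw[of i] pw[of j]
      using nz nz' by (simp add: divide_simps) (simp add: algebra_simps power2_eq_square)
    then have "(ddw j i x / dw i x) * (?V $ e j * ?V' $ e i - ?V' $ e j * ?V $ e i)
        = real k * scale x ^ 2 * (?y i * ?y j) * ((\<tau> i - \<tau> j) * ddw i j x) / (dw i x * (bw i * dw i x * (bw j * dw j x)))"
      unfolding ddw_sym[OF x, of j i] by (simp add: mult_ac)
    also have "\<dots> = ?c * (pot i x * (?y j / np j (\<tau> j)) - pot j x / np j (\<tau> j) * ?y j)"
      unfolding ddw_potential[OF x i j] bw_def[of j] using nz nz'
      by (simp add: divide_simps) (simp add: algebra_simps)
    finally show "(ddw j i x / dw i x) * (?V $ e j * ?V' $ e i - ?V' $ e j * ?V $ e i)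
        = ?c * (pot i x * (?y j / np j (\<tau> j)) - pot j x / np j (\<tau> j) * ?y j)" .
  qed
  also have "\<dots> = ?c * (pot i x * 0 - s)"
    unfolding s_def sum_power_pred[of t, symmetric] sum_distrib_left sum_subtractf[symmetric] ..
  \<comment> \<open>wt i = (\<tau> (k + 1) - t) - (\<tau> i - t) splits the remaining vector into V'
    and V.\<close>
  also have "\<dots> = scale x * (\<tau> (k + 1) - t) * s * ?V' $ e i + real k * scale x * s * ?V $ e i"
    unfolding V_coord[OF x i] V_deriv_coord[OF x i] pw[of i] wt_def using nz
    by (simp add: field_simps power2_eq_square)
  finally have G: "grad_log i x ?V * ?V' $ e i - grad_log i x ?V' * ?V $ e i
      = scale x * (\<tau> (k + 1) - t) * s * ?V' $ e i + real k * scale x * s * ?V $ e i" .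
  show "torsion \<Gamma> (Vt t) (t_deriv Vt t) x $ e i =
    ((scale x * (\<tau> (k + 1) - t) * s + a \<bullet> ?V) *\<^sub>R ?V' + (real k * scale x * s - a \<bullet> ?V') *\<^sub>R ?V) $ e i"
    unfolding torsion_eq vector_minus_component \<Gamma> vector_add_component vector_scaleR_component
    using G by (simp add: algebra_simps)
qed

lemma V_deriv_independent:
  assumes k: "k > 2" and x: "x \<in> U" and eq: "a *\<^sub>R t_deriv Vt t x \<in> span {Vt t x}"
  shows "a = 0"
proof -
  obtain c where c: "a *\<^sub>R t_deriv Vt t x = c *\<^sub>R Vt t x" using span_singletonD[OF eq] by blast
  have rel: "- real k * a = c * (\<tau> i - t)" if i: "i \<le> k" "\<tau> i \<noteq> t" for i
  proof -
    have pw: "(\<tau> i - t) ^ k = (\<tau> i - t) * (\<tau> i - t) ^ (k - 1)" using k1 by (metis power_eq_if not_one_le_zero)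
    have "a * (- real k * scale x * (\<tau> i - t) ^ (k - 1) / (bw i * dw i x))
        = c * (scale x * ((\<tau> i - t) * (\<tau> i - t) ^ (k - 1)) / (bw i * dw i x))"
      using arg_cong[OF c, of "\<lambda>v. v $ e i"] V_coord[OF x i(1)] V_deriv_coord[OF x i(1)] pw by simp
    then have "(scale x * (\<tau> i - t) ^ (k - 1) / (bw i * dw i x)) * (- real k * a)
        = (scale x * (\<tau> i - t) ^ (k - 1) / (bw i * dw i x)) * (c * (\<tau> i - t))"
      by (simp add: mult_ac)
    moreover have "scale x * (\<tau> i - t) ^ (k - 1) / (bw i * dw i x) \<noteq> 0"
      using bw_nonzero[OF i(1)] dw_nonzero[OF i(1) x] scale_nonzero[OF x] i(2) by simp
    ultimately show ?thesis unfolding mult_cancel_left by blast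
  qed
  \<comment> \<open>Of the nodes 0, 1, 2 at most one equals t; the two others force c = 0.\<close>
  have "\<exists>i j. i \<le> k \<and> j \<le> k \<and> i \<noteq> j \<and> \<tau> i \<noteq> t \<and> \<tau> j \<noteq> t"
  proof (cases "\<tau> 0 = t")
    case True
    then show ?thesis using k node_eq_iff[of 1 0] node_eq_iff[of 2 0]
      by (intro exI[of _ 1] exI[of _ 2]) auto
  next
    case False
    show ?thesis
    proof (cases "\<tau> 1 = t")
      case True
      then show ?thesis using False k node_eq_iff[of 2 1] by (intro exI[of _ 0] exI[of _ 2]) auto
    next
      case F: False
      then show ?thesis using False k by (intro exI[of _ 0] exI[of _ 1]) auto
    qed
  qed
  then obtain i j where ij: "i \<le> k" "j \<le> k" "i \<noteq> j" "\<tau> i \<noteq> t" "\<tau> j \<noteq> t" by blast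
  have "c * (\<tau> i - \<tau> j) = 0" using rel[OF ij(1,4)] rel[OF ij(2,5)] by (simp add: algebra_simps)
  then have "c = 0" using node_eq_iff[of i j] ij by simp
  then show "a = 0" using rel[OF ij(1,4)] k by simp
qed

text \<open>The condition on the torsion fixes the value of \<alpha> on V for every t, and the
  points of the curve span the tangent space, which gives uniqueness. Existence is
  \<open>torsion_form\<close>, built for this purpose.\<close>

lemma torsion_normalisation:
  assumes k: "k > 2"
  defines "good \<equiv> \<lambda>\<alpha>. smooth_on U \<alpha> \<and> (\<exists>\<Gamma>. solution_connection k e U w \<alpha> \<Gamma> \<and>
    (\<forall>t. \<forall>x\<in>U. torsion \<Gamma> (Vt t) (t_deriv Vt t) x \<in> span {Vt t x}))"
  shows "\<exists>\<alpha>. good \<alpha> \<and> (\<forall>\<beta>. good \<beta> \<longrightarrow> (\<forall>x\<in>U. \<beta> x = \<alpha> x))"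
proof (intro exI[of _ torsion_form] conjI allI impI ballI)
  let ?s = "\<lambda>t x. \<Sum>j\<le>k. pot j x / np j (\<tau> j) * (\<tau> j - t) ^ (k - 1)"
  obtain \<Gamma> where \<Gamma>: "solution_connection k e U w torsion_form \<Gamma>"
    using solution_connection_exists[OF smooth_torsion_form] by blast
  have "torsion \<Gamma> (Vt t) (t_deriv Vt t) x \<in> span {Vt t x}" if x: "x \<in> U" for t x
  proof -
    have S: "\<And>u v. diff_tensor \<Gamma> x u v = (torsion_form x \<bullet> u) *\<^sub>R v"
      using \<Gamma> x by (simp add: solution_connection_iff)
    have "scale x * (\<tau> (k + 1) - t) * ?s t x + torsion_form x \<bullet> Vt t x = 0"
      unfolding torsion_form_V[OF x] by simp
    then show ?thesis
      unfolding torsion_V[OF x S] by (simp add: span_scale span_base del: scaleR_left_diff_distrib)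
  qed
  then show "good torsion_form" using smooth_torsion_form \<Gamma> unfolding good_def by blast
  fix \<beta> x assume \<beta>: "good \<beta>" and x: "x \<in> U"
  then obtain \<Gamma>' where \<Gamma>': "solution_connection k e U w \<beta> \<Gamma>'"
    "\<And>t. torsion \<Gamma>' (Vt t) (t_deriv Vt t) x \<in> span {Vt t x}" unfolding good_def by blast
  have S: "\<And>u v. diff_tensor \<Gamma>' x u v = (\<beta> x \<bullet> u) *\<^sub>R v"
    using \<Gamma>'(1) x by (simp add: solution_connection_iff)
  have eq: "\<beta> x \<bullet> Vt t x = torsion_form x \<bullet> Vt t x" for t
  proof -
    let ?a = "scale x * (\<tau> (k + 1) - t) * ?s t x + \<beta> x \<bullet> Vt t x"
      and ?b = "real k * scale x * ?s t x - \<beta> x \<bullet> t_deriv Vt t x"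
    have "(?a *\<^sub>R t_deriv Vt t x + ?b *\<^sub>R Vt t x) - ?b *\<^sub>R Vt t x \<in> span {Vt t x}"
      by (rule span_diff[OF \<Gamma>'(2)[of t, unfolded torsion_V[OF x S]]]) (simp add: span_scale span_base)
    then have "?a *\<^sub>R t_deriv Vt t x \<in> span {Vt t x}" by (simp only: add_diff_cancel_right')
    from V_deriv_independent[OF k x this] show ?thesis unfolding torsion_form_V[OF x] by (simp add: algebra_simps)
  qed
  show "\<beta> x = torsion_form x"
  proof (rule vec_eqI)
    fix i assume i: "i \<le> k"
    have "(\<beta> x - torsion_form x) $ e i * (scale x / (bw i * dw i x)) = 0"
    proof (rule powers_independent[OF _ i])
      fix t
      have "(\<Sum>i\<le>k. (\<beta> x - torsion_form x) $ e i * (scale x / (bw i * dw i x)) * (\<tau> i - t) ^ k)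
          = (\<beta> x - torsion_form x) \<bullet> Vt t x"
        unfolding inner_coords by (intro sum.cong refl) (simp add: V_coord[OF x])
      also have "\<dots> = 0" unfolding inner_diff_left eq by simp
      finally show "(\<Sum>i\<le>k. (\<beta> x - torsion_form x) $ e i * (scale x / (bw i * dw i x)) * (\<tau> i - t) ^ k) = 0" .
    qed
    then show "\<beta> x $ e i = torsion_form x $ e i"
      using bw_nonzero[OF i] dw_nonzero[OF i x] scale_nonzero[OF x] by simp
  qed
qed

end

section \<open>Symmetric families of osculating endomorphisms for k = 2\<close>

context nodes
begin

text \<open>The zero entries make the quadratic field of index a vanish at the two other nodes, so
  it is fixed by its value g_a at node a. Comparing symmetric entries eliminates the diagonal
  constants and leaves 2 g_a + g_b + g_c = 0 for each a, a system with nonsingular matrix.\<close>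

lemma symmetric_endomorphisms_zero:
  assumes k: "k = 2"
    and osc: "\<And>a t. a \<le> k \<Longrightarrow>
      \<exists>p q. \<forall>i\<le>k. (\<Sum>j\<le>k. M a i j * (\<tau> j - t) ^ k) = p * (\<tau> i - t) ^ k + q * (\<tau> i - t) ^ (k - 1)"
    and sym: "\<And>a i j. a \<le> k \<Longrightarrow> i \<le> k \<Longrightarrow> j \<le> k \<Longrightarrow> M a i j = M j i a"
    and diag: "\<And>a i. a \<le> k \<Longrightarrow> i \<le> k \<Longrightarrow> i \<noteq> a \<Longrightarrow> M a i a = 0"
    and "a \<le> k" "i \<le> k" "j \<le> k"
  shows "M a i j = 0"
proof -
  have "\<forall>a. \<exists>c p0 p1 p2. a \<le> k \<longrightarrow> (\<forall>i\<le>k. \<forall>j\<le>k.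
    M a i j = (if i = j then c - p2 * \<tau> i else 0) + (p0 + p1 * \<tau> i + p2 * \<tau> i ^ 2) * kap i j)"
    using osculating_endomorphism[OF osc] by blast
  then obtain c p0 p1 p2 where M: "\<And>a i j. a \<le> k \<Longrightarrow> i \<le> k \<Longrightarrow> j \<le> k \<Longrightarrow>
    M a i j = (if i = j then c a - p2 a * \<tau> i else 0) + (p0 a + p1 a * \<tau> i + p2 a * \<tau> i ^ 2) * kap i j"
    by metis
  define Q where "Q a s = p0 a + p1 a * s + p2 a * s ^ 2" for a s
  have Q0: "Q a (\<tau> i) = 0" if "a \<le> k" "i \<le> k" "i \<noteq> a" for a i
    using M[OF that(1,2,1)] diag[OF that] kap_nonzero[OF that(2,1,3)] that(3) by (simp add: Q_def)
  have step: "2 * Q a (\<tau> a) + Q b (\<tau> b) + Q c' (\<tau> c') = 0 \<and> Q a (\<tau> a) = p2 a * ((\<tau> a - \<tau> b) * (\<tau> a - \<tau> c'))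
      \<and> c a - p2 a * \<tau> b = Q b (\<tau> b) * kap b a"
    if abc: "a \<le> 2" "b \<le> 2" "c' \<le> 2" "a \<noteq> b" "b \<noteq> c'" "a \<noteq> c'" for a b c'
  proof -
    have le: "a \<le> k" "b \<le> k" "c' \<le> k" using abc k by auto
    have ne: "\<tau> a - \<tau> b \<noteq> 0" "\<tau> a - \<tau> c' \<noteq> 0" "\<tau> b - \<tau> c' \<noteq> 0" using node_eq_iff le abc by auto
    have sets: "{..k} - {a} = {b, c'}" "{..k} - {a} - {b} = {c'}" "{..k} - {a} - {c'} = {b}"
      using abc k by (auto simp: le_Suc_eq numeral_2_eq_2)
    have np: "np a (\<tau> a) = (\<tau> a - \<tau> b) * (\<tau> a - \<tau> c')" unfolding poly_node_poly sets(1) using abc by simp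
    have kb: "kap b a = (\<tau> b - \<tau> c') / ((\<tau> a - \<tau> b) * (\<tau> a - \<tau> c') * 2)"
      unfolding kap_def pderiv_node_poly_other[OF le(2,1) abc(4)[symmetric]] sets(2) np using k by simp
    have kc: "kap c' a = (\<tau> c' - \<tau> b) / ((\<tau> a - \<tau> b) * (\<tau> a - \<tau> c') * 2)"
      unfolding kap_def pderiv_node_poly_other[OF le(3,1) abc(6)[symmetric]] sets(3) np using k by simp
    \<comment> \<open>Entry (b, b) of endomorphism a equals entry (b, a) of endomorphism b by
      symmetry; the field of index a contributes nothing at node b.\<close>
    have 1: "c a - p2 a * \<tau> b = Q b (\<tau> b) * kap b a"
      using M[OF le(1,2,2)] M[OF le(2,2,1)] sym[OF le(1,2,2)] Q0[OF le(1,2)] abc by (simp add: Q_def)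
    have 2: "c a - p2 a * \<tau> c' = Q c' (\<tau> c') * kap c' a"
      using M[OF le(1,3,3)] M[OF le(3,3,1)] sym[OF le(1,3,3)] Q0[OF le(1,3)] abc by (simp add: Q_def)
    have z: "Q a (\<tau> b) = 0" "Q a (\<tau> c') = 0" using Q0[OF le(1,2)] Q0[OF le(1,3)] abc by auto
    have "(\<tau> b - \<tau> c') * (Q a (\<tau> a) - p2 a * ((\<tau> a - \<tau> b) * (\<tau> a - \<tau> c'))) = 0"
      using z unfolding Q_def by algebra
    then have 3: "Q a (\<tau> a) = p2 a * ((\<tau> a - \<tau> b) * (\<tau> a - \<tau> c'))" using ne by simp
    have "kap b a * ((\<tau> a - \<tau> b) * (\<tau> a - \<tau> c') * 2) = \<tau> b - \<tau> c'"
      "kap c' a * ((\<tau> a - \<tau> b) * (\<tau> a - \<tau> c') * 2) = \<tau> c' - \<tau> b"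
      unfolding kb kc using ne(1,2) by simp_all
    then have "- 2 * (p2 a * ((\<tau> a - \<tau> b) * (\<tau> a - \<tau> c'))) * (\<tau> b - \<tau> c') = (Q b (\<tau> b) + Q c' (\<tau> c')) * (\<tau> b - \<tau> c')"
      using 1 2 by algebra
    then have "- 2 * Q a (\<tau> a) = Q b (\<tau> b) + Q c' (\<tau> c')" unfolding 3 using ne(3) mult_right_cancel by blast
    then show ?thesis using 1 3 by simp
  qed
  have "2 * Q 0 (\<tau> 0) + Q 1 (\<tau> 1) + Q 2 (\<tau> 2) = 0" "2 * Q 1 (\<tau> 1) + Q 0 (\<tau> 0) + Q 2 (\<tau> 2) = 0"
    "2 * Q 2 (\<tau> 2) + Q 0 (\<tau> 0) + Q 1 (\<tau> 1) = 0"
    by (rule conjunct1[OF step]; simp)+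
  then have g: "Q 0 (\<tau> 0) = 0" "Q 1 (\<tau> 1) = 0" "Q 2 (\<tau> 2) = 0" by linarith+
  have le: "a \<le> 2" using assms(5) k by simp
  then have ga: "\<And>b. b \<le> 2 \<Longrightarrow> Q b (\<tau> b) = 0" using g by (auto simp: le_Suc_eq numeral_2_eq_2)
  obtain b c' where bc: "b \<le> 2" "c' \<le> 2" "a \<noteq> b" "b \<noteq> c'" "a \<noteq> c'"
  proof (cases "a = 0")
    case True then show ?thesis using that[of 1 2] by simp
  next
    case False
    show ?thesis
    proof (cases "a = 1")
      case True then show ?thesis using that[of 0 2] by simp
    next
      case F: False then show ?thesis using that[of 0 1] False le by simp
    qed
  qed
  note s = step[OF le bc(1,2,3,4,5)]
  have "\<tau> a \<noteq> \<tau> b" "\<tau> a \<noteq> \<tau> c'" using node_eq_iff le bc k by auto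
  then have p2: "p2 a = 0" using s ga[OF le] by simp
  then have "c a = 0" using s ga[OF bc(1)] by simp
  moreover have "Q a (\<tau> i) = 0" using ga[OF le] Q0[OF assms(5,6)] by blast
  ultimately show ?thesis using M[OF assms(5-7)] p2 by (simp add: Q_def)
qed

end

context solution
begin

lemma torsion_free_iff:
  "torsion_free U \<Gamma> \<longleftrightarrow> (\<forall>x\<in>U. \<forall>u v. \<Gamma> x u v = \<Gamma> x v u)"
proof
  assume *: "torsion_free U \<Gamma>"
  show "\<forall>x\<in>U. \<forall>u v. \<Gamma> x u v = \<Gamma> x v u"
  proof (intro ballI allI)
    fix x u v assume "x \<in> U"
    then have "torsion \<Gamma> (\<lambda>_. u) (\<lambda>_. v) x = 0"
      using * smooth_on_const[OF openU] unfolding torsion_free_def by blast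
    then show "\<Gamma> x u v = \<Gamma> x v u" by (simp add: torsion_eq)
  qed
qed (simp add: torsion_free_def torsion_eq)

lemma diff_tensor_eqD:
  assumes "connection U \<Gamma>" "x \<in> U" "diff_tensor \<Gamma> x = diff_tensor \<Gamma>' x"
  shows "\<Gamma> x = \<Gamma>' x"
proof (intro ext)
  fix u v
  have "diff_tensor \<Gamma> x u v = diff_tensor \<Gamma>' x u v" using assms(3) by simp
  then show "\<Gamma> x u v = \<Gamma>' x u v" by (simp add: diff_tensor_def)
qed

end

subsection \<open>The case of two variables\<close>

context solution_dual
begin

text \<open>Forced by vanishing torsion: with a scalar difference tensor, the 0-component of
  \<Gamma>(\<partial>_0, \<partial>_1) is zero, and that of \<Gamma>(\<partial>_1, \<partial>_0) is
  the logarithmic derivative of \<partial>_0 w along \<partial>_1 plus the value of the form on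
  \<partial>_1; likewise with 0 and 1 exchanged.\<close>

definition plane_form where
  "plane_form x = (- (ddw 0 1 x / dw 1 x)) *\<^sub>R axis (e 0) (1::real) + (- (ddw 0 1 x / dw 0 x)) *\<^sub>R axis (e 1) 1"

abbreviation plane_condition where
  "plane_condition \<Gamma> \<equiv> torsion_free U \<Gamma> \<and> paraconformal_connection k U V \<Gamma> \<and>
     (\<forall>Y t. smooth_on U Y \<longrightarrow> (\<forall>x\<in>U. nabla \<Gamma> Y (Vt t) x \<in> span {Vt t x}))"

context
  assumes k_eq: "k = 1"
begin

lemma sum2: "(\<Sum>i\<le>k. f i) = f 0 + f 1" for f :: "nat \<Rightarrow> 'b::comm_monoid_add"
  using k_eq by simp

lemma smooth_plane_form: "smooth_on U plane_form"
  unfolding plane_form_def[abs_def]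
  by (intro smooth_on_add smooth_on_scaleR smooth_on_const smooth_on_minus smooth_on_divide smooth_ddw smooth_dw openU)
     (use dw_nonzero k_eq in auto)

lemma plane_form_coord: "plane_form x $ e 0 = - (ddw 0 1 x / dw 1 x)" "plane_form x $ e 1 = - (ddw 0 1 x / dw 0 x)"
  using k_eq by (auto simp: plane_form_def axis_coord)

lemma plane_condition_sufficient:
  assumes "solution_connection k e U w plane_form \<Gamma>"
  shows "plane_condition \<Gamma>"
proof (intro conjI allI impI ballI)
  have S: "\<And>x u v. x \<in> U \<Longrightarrow> diff_tensor \<Gamma> x u v = (plane_form x \<bullet> u) *\<^sub>R v"
    using assms by (simp add: solution_connection_iff)
  show "torsion_free U \<Gamma>"
    unfolding torsion_free_iff
  proof (intro ballI allI vec_eqI)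
    fix x u v i assume x: "x \<in> U" and i: "i \<le> k"
    have \<Gamma>: "\<Gamma> x u v $ e i = grad_log i x u * v $ e i + (plane_form x \<bullet> u) * v $ e i" for u v
      using arg_cong[OF S[OF x, of u v], of "\<lambda>v. v $ e i"] unfolding diff_tensor_coord[OF i] by simp
    have "i = 0 \<or> i = 1" using i k_eq by auto
    then show "\<Gamma> x u v $ e i = \<Gamma> x v u $ e i"
      unfolding \<Gamma> grad_log_coords[OF x] inner_coords sum2 plane_form_coord
      by (elim disjE) (auto simp: algebra_simps ddw_sym[OF x, of "Suc 0" 0])
  qed
  show "paraconformal_connection k U V \<Gamma>" by (rule solution_connection_paraconformal[OF assms])
  fix Y t x assume "x \<in> U"
  then show "nabla \<Gamma> Y (Vt t) x \<in> span {Vt t x}" using S scalar_connection_span by blast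
qed

lemma plane_condition_necessary:
  assumes conn: "connection U \<Gamma>" and P: "plane_condition \<Gamma>"
  shows "solution_connection k e U w plane_form \<Gamma>"
  unfolding solution_connection_iff
proof (intro conjI ballI allI conn)
  fix x u v assume x: "x \<in> U"
  note bil = diff_tensor_bilinear[OF conn x]
  have linr: "linear (diff_tensor \<Gamma> x u)" and linl: "linear (\<lambda>u. diff_tensor \<Gamma> x u v)" for u v
    using bil by (auto simp: bilinear_def)
  have nz: "bw 0 \<noteq> 0" "bw 1 \<noteq> 0" "dw 0 x \<noteq> 0" "dw 1 x \<noteq> 0" "scale x \<noteq> 0" "\<tau> 0 \<noteq> \<tau> 1" "\<tau> 0 \<noteq> \<tau> 2" "\<tau> 1 \<noteq> \<tau> 2"
    using bw_nonzero dw_nonzero[OF _ x] scale_nonzero[OF x] node_eq_iff k_eq by auto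
  have scalar: "diff_tensor \<Gamma> x u (axis (e 0) 1) $ e 1 = 0 \<and> diff_tensor \<Gamma> x u (axis (e 1) 1) $ e 0 = 0 \<and>
    diff_tensor \<Gamma> x u (axis (e 1) 1) $ e 1 = diff_tensor \<Gamma> x u (axis (e 0) 1) $ e 0" for u
  proof -
    let ?L = "diff_tensor \<Gamma> x u"
    have "\<exists>p. ?L (Vt t x) = p *\<^sub>R Vt t x" for t
    proof -
      have "nabla \<Gamma> (\<lambda>_. u) (Vt t) x \<in> span {Vt t x}"
        using P x smooth_on_const[OF openU] by blast
      then have "nabla \<Gamma> (\<lambda>_. u) (Vt t) x - (frechet_derivative scale (at x) u / scale x) *\<^sub>R Vt t x \<in> span {Vt t x}"
        by (rule span_diff) (simp add: span_scale span_base)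
      then show ?thesis unfolding nabla_V[OF x] by (intro span_singletonD) simp
    qed
    then obtain p where p: "\<And>t. ?L (Vt t x) = p t *\<^sub>R Vt t x" by metis
    have Vc: "Vt t x $ e 0 = scale x * (\<tau> 0 - t) / (bw 0 * dw 0 x)" "Vt t x $ e 1 = scale x * (\<tau> 1 - t) / (bw 1 * dw 1 x)" for t
      using V_coord[OF x, of 0] V_coord[OF x, of 1] k_eq by auto
    have eq: "Vt t x $ e 0 * ?L (axis (e 0) 1) $ e i + Vt t x $ e 1 * ?L (axis (e 1) 1) $ e i = p t * Vt t x $ e i" for t i
      using arg_cong[OF p[of t], of "\<lambda>v. v $ e i"] unfolding linear_coords[OF linr, of _ "Vt t x"] sum2 by simp
    \<comment> \<open>At t = \<tau> 1 the curve points along \<partial>_0, at t = \<tau> 0 along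
      \<partial>_1, so both directions are eigenvectors; the third value \<tau> 2, where both
      components are nonzero, equates the eigenvalues.\<close>
    have 1: "?L (axis (e 0) 1) $ e 1 = 0" using eq[of "\<tau> 1" 1] nz unfolding Vc by simp
    have 2: "?L (axis (e 1) 1) $ e 0 = 0" using eq[of "\<tau> 0" 0] nz unfolding Vc by simp
    have "?L (axis (e 0) 1) $ e 0 = p (\<tau> 2)" "?L (axis (e 1) 1) $ e 1 = p (\<tau> 2)"
      using eq[of "\<tau> 2" 0] eq[of "\<tau> 2" 1] nz unfolding 1 2 Vc by simp_all
    then show ?thesis using 1 2 by simp
  qed
  define p where "p u = diff_tensor \<Gamma> x u (axis (e 0) 1) $ e 0" for u
  have S: "diff_tensor \<Gamma> x u v = p u *\<^sub>R v" for u v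
  proof (rule vec_eqI)
    fix i assume "i \<le> k"
    then have "i = 0 \<or> i = 1" using k_eq by auto
    then show "diff_tensor \<Gamma> x u v $ e i = (p u *\<^sub>R v) $ e i"
      unfolding linear_coords[OF linr, of u v] sum2 using scalar[of u] by (auto simp: p_def)
  qed
  have sym: "\<Gamma> x u v = \<Gamma> x v u" for u v using P x unfolding torsion_free_iff by blast
  have \<Gamma>: "\<Gamma> x u v $ e i = grad_log i x u * v $ e i + p u * v $ e i" if "i \<le> k" for u v i
    using arg_cong[OF S[of u v], of "\<lambda>v. v $ e i"] unfolding diff_tensor_coord[OF that] by simp
  have ax: "axis (e 0) (1::real) $ e 0 = 1" "axis (e (Suc 0)) (1::real) $ e (Suc 0) = 1"
    "axis (e 0) (1::real) $ e (Suc 0) = 0" "axis (e (Suc 0)) (1::real) $ e 0 = 0"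
    using k_eq by (auto simp: axis_coord)
  have "p (axis (e 1) 1) = - (ddw 0 1 x / dw 0 x)"
    using \<Gamma>[of 0 "axis (e 1) 1" "axis (e 0) 1"] \<Gamma>[of 0 "axis (e 0) 1" "axis (e 1) 1"]
      sym[of "axis (e 1) 1" "axis (e 0) 1"] ddw_sym[OF x, of 1 0]
    by (simp add: grad_log_coords[OF x] sum2 ax)
  moreover have "p (axis (e 0) 1) = - (ddw 0 1 x / dw 1 x)"
    using \<Gamma>[of 1 "axis (e 1) 1" "axis (e 0) 1"] \<Gamma>[of 1 "axis (e 0) 1" "axis (e 1) 1"]
      sym[of "axis (e 1) 1" "axis (e 0) 1"] k_eq
    by (simp add: grad_log_coords[OF x] sum2 ax)
  moreover have "p u = u $ e 0 * p (axis (e 0) 1) + u $ e 1 * p (axis (e 1) 1)"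
    unfolding p_def linear_coords[OF linl, of u] sum2 by simp
  ultimately have "p u = plane_form x \<bullet> u"
    unfolding inner_coords sum2 plane_form_coord by (simp add: mult.commute)
  then show "diff_tensor \<Gamma> x u v = (plane_form x \<bullet> u) *\<^sub>R v" using S by simp
qed

lemma plane_connection_unique: "unique_connection U plane_condition"
proof -
  obtain \<Gamma> where \<Gamma>: "solution_connection k e U w plane_form \<Gamma>"
    using solution_connection_exists[OF smooth_plane_form] by blast
  show ?thesis
    unfolding unique_connection_def
  proof (rule exI[of _ \<Gamma>], rule conjI[OF _ conjI])
    show "connection U \<Gamma>" using \<Gamma> by (simp add: solution_connection_iff)
    show "plane_condition \<Gamma>" by (rule plane_condition_sufficient[OF \<Gamma>])
    show "\<forall>\<Gamma>'. connection U \<Gamma>' \<and> plane_condition \<Gamma>' \<longrightarrow> (\<forall>x\<in>U. \<Gamma>' x = \<Gamma> x)"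
    proof (intro allI impI ballI)
      fix \<Gamma>' x assume *: "connection U \<Gamma>' \<and> plane_condition \<Gamma>'" and x: "x \<in> U"
      have "solution_connection k e U w plane_form \<Gamma>'"
        by (rule plane_condition_necessary[OF conjunct1[OF *] conjunct2[OF *]])
      then have "diff_tensor \<Gamma>' x u v = diff_tensor \<Gamma> x u v" for u v
        using \<Gamma> x unfolding solution_connection_iff by simp
      then show "\<Gamma>' x = \<Gamma> x" by (intro diff_tensor_eqD[OF conjunct1[OF *] x] ext)
    qed
  qed
qed

lemma plane_connection_formula:
  assumes "connection U \<Gamma>" "plane_condition \<Gamma>" "x \<in> U"
  shows "nabla \<Gamma> Y (\<lambda>_. axis (e 0) 1) x =
      ((ddw 0 0 x / dw 0 x - ddw 0 1 x / dw 1 x) * (Y x $ e 0)) *\<^sub>R axis (e 0) 1"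
    and "nabla \<Gamma> Y (\<lambda>_. axis (e 1) 1) x =
      ((ddw 1 1 x / dw 1 x - ddw 0 1 x / dw 0 x) * (Y x $ e 1)) *\<^sub>R axis (e 1) 1"
proof -
  have S: "\<And>u v. diff_tensor \<Gamma> x u v = (plane_form x \<bullet> u) *\<^sub>R v"
    using plane_condition_necessary[OF assms(1,2)] assms(3) by (simp add: solution_connection_iff)
  have \<Gamma>: "\<Gamma> x u v $ e i = grad_log i x u * v $ e i + (plane_form x \<bullet> u) * v $ e i" if "i \<le> k" for u v i
    using arg_cong[OF S[of u v], of "\<lambda>v. v $ e i"] unfolding diff_tensor_coord[OF that] by simp
  have 01: "i = 0 \<or> i = 1" if "i \<le> k" for i using that k_eq by auto
  show "nabla \<Gamma> Y (\<lambda>_. axis (e 0) 1) x =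
      ((ddw 0 0 x / dw 0 x - ddw 0 1 x / dw 1 x) * (Y x $ e 0)) *\<^sub>R axis (e 0) 1"
    unfolding nabla_constant
  proof (rule vec_eqI)
    fix i assume i: "i \<le> k"
    then show "\<Gamma> x (Y x) (axis (e 0) 1) $ e i =
      (((ddw 0 0 x / dw 0 x - ddw 0 1 x / dw 1 x) * (Y x $ e 0)) *\<^sub>R axis (e 0) 1) $ e i"
      unfolding \<Gamma>[OF i] grad_log_coords[OF assms(3)] inner_coords sum2 plane_form_coord
      using 01[OF i] k_eq by (auto simp: axis_coord algebra_simps ddw_sym[OF assms(3), of "Suc 0" 0])
  qed
  show "nabla \<Gamma> Y (\<lambda>_. axis (e 1) 1) x =
      ((ddw 1 1 x / dw 1 x - ddw 0 1 x / dw 0 x) * (Y x $ e 1)) *\<^sub>R axis (e 1) 1"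
    unfolding nabla_constant
  proof (rule vec_eqI)
    fix i assume i: "i \<le> k"
    then show "\<Gamma> x (Y x) (axis (e 1) 1) $ e i =
      (((ddw 1 1 x / dw 1 x - ddw 0 1 x / dw 0 x) * (Y x $ e 1)) *\<^sub>R axis (e 1) 1) $ e i"
      unfolding \<Gamma>[OF i] grad_log_coords[OF assms(3)] inner_coords sum2 plane_form_coord
      using 01[OF i] k_eq by (auto simp: axis_coord algebra_simps ddw_sym[OF assms(3), of "Suc 0" 0])
  qed
qed

end

end

subsection \<open>Ricci tensors in coordinates\<close>

lemma frechet_cong:
  assumes "open U" "x \<in> U" "smooth_on U f" "\<And>y. y \<in> U \<Longrightarrow> f y = g y"
  shows "frechet_derivative g (at x) = frechet_derivative f (at x)"
proof -
  have "(g has_derivative frechet_derivative f (at x)) (at x)"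
    by (rule has_derivative_transform_within_open[OF smooth_on_has_derivative[OF assms(3,2)] assms(1,2)])
       (use assms(4) in auto)
  from frechet_derivative_at[OF this] show ?thesis by (rule sym)
qed

lemma frechet_nth:
  assumes "smooth_on U f" "x \<in> U"
  shows "frechet_derivative f (at x) v $ i = frechet_derivative (\<lambda>y. f y $ i) (at x) v"
  using fun_cong[OF frechet_derivative_at[OF bounded_linear.has_derivative[OF bounded_linear_vec_nth
      smooth_on_has_derivative[OF assms]]], of v i] by simp

context coordinates
begin

lemma curvature_constant:
  assumes "connection U \<Gamma>" "x \<in> U"
  shows "curvature \<Gamma> (\<lambda>_. z) (\<lambda>_. u) (\<lambda>_. v) x =
    frechet_derivative (\<lambda>y. \<Gamma> y u v) (at x) z + \<Gamma> x z (\<Gamma> x u v)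
      - (frechet_derivative (\<lambda>y. \<Gamma> y z v) (at x) u + \<Gamma> x u (\<Gamma> x z v))"
proof -
  have "lie_bracket (\<lambda>_. z) (\<lambda>_. u) x = 0" by (simp add: lie_bracket_def)
  then have "nabla \<Gamma> (lie_bracket (\<lambda>_. z) (\<lambda>_. u)) (\<lambda>_. v) x = 0"
    unfolding nabla_constant using bilinear_lzero[OF connection_bilinear[OF assms]] by simp
  then show ?thesis unfolding curvature_def nabla_constant[abs_def] by (simp add: nabla_def)
qed

text \<open>The derivative terms rely on linearity of \<open>\<Gamma>\<close> in its arguments,
  which is known on U only; openness of U allows this identity to be differentiated.\<close>

lemma ricci_bilinear:
  fixes \<Gamma> :: "real ^ 'n \<Rightarrow> real ^ 'n \<Rightarrow> real ^ 'n \<Rightarrow> real ^ 'n"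
  assumes "open U" and conn: "connection U \<Gamma>" and x: "x \<in> U"
  shows "bilinear (ricci \<Gamma> x)"
proof -
  note bil = connection_bilinear[OF conn]
  have sm: "smooth_on U (\<lambda>y. \<Gamma> y u v)" for u v using conn by (simp add: connection_def)
  note d = smooth_on_has_derivative[OF sm x]
  have Dl: "frechet_derivative (\<lambda>y. \<Gamma> y (u + u') v) (at x) z =
      frechet_derivative (\<lambda>y. \<Gamma> y u v) (at x) z + frechet_derivative (\<lambda>y. \<Gamma> y u' v) (at x) z" for u u' v z
    using fun_cong[OF frechet_derivative_at[OF has_derivative_add[OF d[of u v] d[of u' v]]], of z]
      frechet_cong[OF assms(1) x sm, of "u + u'" v "\<lambda>y. \<Gamma> y u v + \<Gamma> y u' v"] bilinear_ladd[OF bil] by auto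
  have Dr: "frechet_derivative (\<lambda>y. \<Gamma> y u (v + v')) (at x) z =
      frechet_derivative (\<lambda>y. \<Gamma> y u v) (at x) z + frechet_derivative (\<lambda>y. \<Gamma> y u v') (at x) z" for u v v' z
    using fun_cong[OF frechet_derivative_at[OF has_derivative_add[OF d[of u v] d[of u v']]], of z]
      frechet_cong[OF assms(1) x sm, of u "v + v'" "\<lambda>y. \<Gamma> y u v + \<Gamma> y u v'"] bilinear_radd[OF bil] by auto
  have sl: "frechet_derivative (\<lambda>y. \<Gamma> y (r *\<^sub>R u) v) (at x) z = r *\<^sub>R frechet_derivative (\<lambda>y. \<Gamma> y u v) (at x) z" for r u v z
    using fun_cong[OF frechet_derivative_at[OF has_derivative_scaleR_right[OF d[of u v], of r]], of z]
      frechet_cong[OF assms(1) x sm, of "r *\<^sub>R u" v "\<lambda>y. r *\<^sub>R \<Gamma> y u v"] bilinear_lmul[OF bil] by auto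
  have sr: "frechet_derivative (\<lambda>y. \<Gamma> y u (r *\<^sub>R v)) (at x) z = r *\<^sub>R frechet_derivative (\<lambda>y. \<Gamma> y u v) (at x) z" for r u v z
    using fun_cong[OF frechet_derivative_at[OF has_derivative_scaleR_right[OF d[of u v], of r]], of z]
      frechet_cong[OF assms(1) x sm, of u "r *\<^sub>R v" "\<lambda>y. r *\<^sub>R \<Gamma> y u v"] bilinear_rmul[OF bil] by auto
  note lin = smooth_on_linear_derivative[OF sm x]
  show ?thesis
    unfolding bilinear_def ricci_def curvature_constant[OF conn x]
    by (intro conjI allI linearI)
       (simp_all add: Dl Dr sl sr linear_add[OF lin] linear_scale[OF lin] bilinear_ladd[OF bil[OF x]]
         bilinear_radd[OF bil[OF x]] bilinear_lmul[OF bil[OF x]] bilinear_rmul[OF bil[OF x]]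
         sum.distrib[symmetric] sum_distrib_left algebra_simps)
qed

lemma ricci_coords:
  fixes \<Gamma> :: "real ^ 'n \<Rightarrow> real ^ 'n \<Rightarrow> real ^ 'n \<Rightarrow> real ^ 'n"
  assumes conn: "connection U \<Gamma>" and x: "x \<in> U"
  defines "c \<equiv> \<lambda>i j l y. \<Gamma> y (axis (e j) 1) (axis (e l) 1) $ e i"
  shows "ricci \<Gamma> x (axis (e j) 1) (axis (e l) 1) =
    (\<Sum>i\<le>k. partial (e i) (c i j l) x + (\<Sum>m\<le>k. c m j l x * c i i m x)
      - (partial (e j) (c i i l) x + (\<Sum>m\<le>k. c m i l x * c i j m x)))"
proof -
  note bil = connection_bilinear[OF conn x]
  have sm: "smooth_on U (\<lambda>y. \<Gamma> y u v)" for u v using conn by (simp add: connection_def)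
  have lin: "linear (\<Gamma> x u)" for u using bil by (simp add: bilinear_def)
  have comp: "\<Gamma> x u (\<Gamma> x (axis (e a) 1) (axis (e l) 1)) $ e i
      = (\<Sum>m\<le>k. c m a l x * \<Gamma> x u (axis (e m) 1) $ e i)" for u a i
    unfolding linear_coords[OF lin[of u], of "\<Gamma> x (axis (e a) 1) (axis (e l) 1)"] by (simp add: c_def)
  have fr: "frechet_derivative (\<lambda>y. \<Gamma> y (axis (e a) 1) (axis (e l) 1)) (at x) (axis (e b) 1) $ e i
      = partial (e b) (c i a l) x" for a b i
    unfolding partial_def c_def by (rule frechet_nth[OF sm x])
  show ?thesis
    unfolding ricci_def curvature_constant[OF conn x] sum_coords vector_minus_component
      vector_add_component comp fr unfolding c_def ..
qed

text \<open>The inverse of a symmetric matrix is symmetric, so the trace sees only the symmetrised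
  Ricci tensor, and the trace of the identity is the dimension.\<close>

lemma scalar_curvature_proportional:
  fixes g :: "real ^ 'n \<Rightarrow> real ^ 'n \<Rightarrow> real ^ 'n \<Rightarrow> real"
  assumes metric: "metric_on U g" and x: "x \<in> U"
    and prp: "\<And>u v. (ricci \<Gamma> x u v + ricci \<Gamma> x v u) / 2 = c * g x u v"
  shows "scalar_curvature g \<Gamma> x = real CARD('n) * c"
proof -
  let ?G = "metric_matrix g x" and ?I = "matrix_inv (metric_matrix g x)"
  have bil: "bilinear (g x)" and sym: "\<And>u v. g x u v = g x v u" and nondeg: "\<And>u. (\<forall>v. g x u v = 0) \<Longrightarrow> u = 0"
    using metric x unfolding metric_on_def by blast+
  have lin: "linear (g x u)" and linl: "linear (\<lambda>u. g x u v)" for u v using bil by (auto simp: bilinear_def)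
  have "u = 0" if "?G *v u = 0" for u
  proof (rule nondeg, rule allI)
    fix v
    have "g x (axis m 1) u = 0" for m
    proof -
      have "(?G *v u) $ m = (\<Sum>i\<le>k. u $ e i * g x (axis m 1) (axis (e i) 1))"
        unfolding matrix_vector_mult_def metric_matrix_def by (simp add: sum_coords mult.commute)
      also have "\<dots> = g x (axis m 1) u" unfolding linear_coords[OF lin, of _ u] by simp
      finally show ?thesis using that by simp
    qed
    then show "g x u v = 0" unfolding sym[of u v] linear_coords[OF linl, of v] by simp
  qed
  then have inv: "invertible ?G"
    by (metis invertible_left_inverse matrix_left_invertible_ker)
  have GT: "transpose ?G = ?G" unfolding transpose_def metric_matrix_def using sym by (simp add: vec_eq_iff)
  have "?G ** ?I = mat 1 \<and> ?I ** ?G = mat 1"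
    using inv unfolding invertible_def matrix_inv_def by (rule someI_ex)
  then have right: "?G ** ?I = mat 1" and left: "?I ** ?G = mat 1" by auto
  have "transpose ?I ** ?G = mat 1"
    using arg_cong[OF right, of transpose] unfolding matrix_transpose_mul GT transpose_mat .
  then have IT: "transpose ?I = ?I"
    using right left by (metis matrix_mul_assoc matrix_mul_lid matrix_mul_rid)
  have Isym: "?I $ i $ j = ?I $ j $ i" for i j
    using arg_cong[OF IT, of "\<lambda>A. A $ j $ i"] by (simp add: transpose_def)
  define R where "R i j = ricci \<Gamma> x (axis i 1) (axis j 1)" for i j
  have "scalar_curvature g \<Gamma> x = (\<Sum>i\<in>UNIV. \<Sum>j\<in>UNIV. ?I $ i $ j * R i j)"
    by (simp add: scalar_curvature_def R_def)
  moreover have "\<dots> = (\<Sum>i\<in>UNIV. \<Sum>j\<in>UNIV. ?I $ i $ j * R j i)"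
    by (subst sum.swap) (simp add: Isym)
  ultimately have "2 * scalar_curvature g \<Gamma> x = (\<Sum>i\<in>UNIV. \<Sum>j\<in>UNIV. ?I $ i $ j * (R i j + R j i))"
    by (simp add: distrib_left sum.distrib)
  also have "\<dots> = (\<Sum>i\<in>UNIV. \<Sum>j\<in>UNIV. 2 * c * (?I $ i $ j * ?G $ j $ i))"
  proof (intro sum.cong refl)
    fix i j
    have "R i j + R j i = 2 * (c * g x (axis i 1) (axis j 1))"
      using prp[of "axis i 1" "axis j 1"] unfolding R_def by (simp add: field_simps)
    then show "?I $ i $ j * (R i j + R j i) = 2 * c * (?I $ i $ j * ?G $ j $ i)"
      by (simp add: metric_matrix_def sym[of "axis j 1"])
  qed
  also have "\<dots> = 2 * c * (\<Sum>i\<in>UNIV. (?I ** ?G) $ i $ i)"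
    by (simp add: matrix_matrix_mult_def sum_distrib_left)
  also have "\<dots> = 2 * c * real CARD('n)" unfolding left by (simp add: mat_def)
  finally show ?thesis by simp
qed

end

subsection \<open>The case of three variables\<close>

lemma sum_le_2: "(\<Sum>i\<le>2::nat. f i) = f 0 + f 1 + f 2" for f :: "nat \<Rightarrow> 'b::comm_monoid_add"
  by (simp add: numeral_2_eq_2 One_nat_def)

lemma atMost_2_minus: "{..2::nat} - {0} = {1, 2}" "{..2::nat} - {1} = {0, 2}" "{..2::nat} - {2} = {0, 1}"
  by (auto simp: numeral_2_eq_2 le_Suc_eq)

context solution
begin

text \<open>The weights that give the metric constant coefficients in the variables gap i *
  \<partial>_i w * u_i; the three of them add up to zero.\<close>

definition gap where
  "gap (i::nat) = (if i = 0 then wt 0 * (\<tau> 1 - \<tau> 2) else if i = 1 then wt 1 * (\<tau> 2 - \<tau> 0) else wt 2 * (\<tau> 0 - \<tau> 1))"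

text \<open>For k = 2 the system says that the differences of the quotients \<partial>_i
  \<partial>_j w / (\<partial>_i w \<partial>_j w) are proportional to the gaps; this is a quarter
  of the common ratio, and it becomes the coefficient of the bracket term.\<close>

definition hir where
  "hir x = (ddw 0 1 x * dw 2 x - ddw 0 2 x * dw 1 x) / (4 * gap 0 * dw 0 x * dw 1 x * dw 2 x)"

text \<open>Components of - 1/2 times the Weyl form: shifting a connection by \<alpha> times the
  identity changes the covariant derivative of a metric by - 2 \<alpha> times the metric.\<close>

definition wey where
  "wey (i::nat) x = - (if i = 0 then ddw 0 1 x / dw 1 x + ddw 0 2 x / dw 2 x
     else if i = 1 then ddw 0 1 x / dw 0 x + ddw 1 2 x / dw 2 x
     else ddw 0 2 x / dw 0 x + ddw 1 2 x / dw 1 x) / 2"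

text \<open>This and \<open>chr_diag\<close> come from symmetrising the connection
  \<nabla>\<partial>_i = (d(\<partial>_i w)/\<partial>_i w + wey) \<partial>_i: a mixed symbol
  occurs there in one of its two orders only, hence the half, while the diagonal one is
  unchanged.\<close>

definition chr_off where
  "chr_off i j x = (ddw i j x / dw i x + wey j x) / 2"

definition chr_diag where
  "chr_diag i x = ddw i i x / dw i x + wey i x"

definition three_coord where
  "three_coord (i::nat) x u v =
    (if i = 0 then chr_diag 0 x * (u $ e 0 * v $ e 0) + chr_off 0 1 x * (u $ e 0 * v $ e 1 + u $ e 1 * v $ e 0)
       + chr_off 0 2 x * (u $ e 0 * v $ e 2 + u $ e 2 * v $ e 0)
     else if i = 1 then chr_diag 1 x * (u $ e 1 * v $ e 1) + chr_off 1 0 x * (u $ e 1 * v $ e 0 + u $ e 0 * v $ e 1)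
       + chr_off 1 2 x * (u $ e 1 * v $ e 2 + u $ e 2 * v $ e 1)
     else chr_diag 2 x * (u $ e 2 * v $ e 2) + chr_off 2 0 x * (u $ e 2 * v $ e 0 + u $ e 0 * v $ e 2)
       + chr_off 2 1 x * (u $ e 2 * v $ e 1 + u $ e 1 * v $ e 2))"

definition three_conn where
  "three_conn x u v = (\<Sum>i\<le>k. three_coord i x u v *\<^sub>R axis (e i) (1::real))"

abbreviation gw where "gw i x \<equiv> gap i * dw i x"

text \<open>The bracket of binary quadratic forms.\<close>

definition bracket_coord where
  "bracket_coord (i::nat) x u v =
    (if i = 0 then - gw 1 x * (u $ e 0 * v $ e 1 - u $ e 1 * v $ e 0) + gw 2 x * (u $ e 0 * v $ e 2 - u $ e 2 * v $ e 0)
     else if i = 1 then - gw 2 x * (u $ e 1 * v $ e 2 - u $ e 2 * v $ e 1) + gw 0 x * (u $ e 1 * v $ e 0 - u $ e 0 * v $ e 1)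
     else - gw 0 x * (u $ e 2 * v $ e 0 - u $ e 0 * v $ e 2) + gw 1 x * (u $ e 2 * v $ e 1 - u $ e 1 * v $ e 2))"

context
  notes [simp del] = One_nat_def
  assumes k_eq: "k = 2"
begin

lemma sum3: "(\<Sum>i\<le>k. f i) = f 0 + f 1 + f 2" for f :: "nat \<Rightarrow> 'b::comm_monoid_add"
  using k_eq sum_le_2 by simp

lemma le_k: "0 \<le> k" "1 \<le> k" "2 \<le> k" "i \<le> k \<longleftrightarrow> i = 0 \<or> i = 1 \<or> i = 2"
  using k_eq by auto

lemma wt_eq: "\<tau> 3 - \<tau> i = wt i"
  unfolding wt_def using k_eq by simp

lemma node_diffs: "\<tau> 0 - \<tau> 1 \<noteq> 0" "\<tau> 1 - \<tau> 2 \<noteq> 0" "\<tau> 2 - \<tau> 0 \<noteq> 0"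
  using node_eq_iff[of 0 1] node_eq_iff[of 1 2] node_eq_iff[of 2 0] k_eq by auto

lemma gap_nonzero: "gap 0 \<noteq> 0" "gap 1 \<noteq> 0" "gap 2 \<noteq> 0"
  using node_diffs wt_nonzero le_k unfolding gap_def by auto

lemma dw3: "x \<in> U \<Longrightarrow> dw 0 x \<noteq> 0" "x \<in> U \<Longrightarrow> dw 1 x \<noteq> 0" "x \<in> U \<Longrightarrow> dw 2 x \<noteq> 0"
  using dw_nonzero le_k by blast+

lemma atMost_k_minus: "{..k} - {0} = {1, 2}" "{..k} - {1} = {0, 2}" "{..k} - {2} = {0, 1}"
  using k_eq atMost_2_minus by simp_all

lemma bw3: "bw 0 = wt 0 * ((\<tau> 0 - \<tau> 1) * (\<tau> 0 - \<tau> 2))" "bw 1 = wt 1 * ((\<tau> 1 - \<tau> 0) * (\<tau> 1 - \<tau> 2))"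
  "bw 2 = wt 2 * ((\<tau> 2 - \<tau> 0) * (\<tau> 2 - \<tau> 1))"
  unfolding bw_def poly_node_poly atMost_k_minus by simp_all

lemma np3: "np 0 t = (t - \<tau> 1) * (t - \<tau> 2)" "np 1 t = (t - \<tau> 0) * (t - \<tau> 2)" "np 2 t = (t - \<tau> 0) * (t - \<tau> 1)"
  unfolding poly_node_poly atMost_k_minus by simp_all

lemma sym3: "x \<in> U \<Longrightarrow> ddw 1 0 x = ddw 0 1 x" "x \<in> U \<Longrightarrow> ddw 2 0 x = ddw 0 2 x" "x \<in> U \<Longrightarrow> ddw 2 1 x = ddw 1 2 x"
  using ddw_sym by auto

text \<open>The first equation is the definition of \<open>hir\<close>; the system, written for the
  quotients, and the vanishing sum of the gaps yield the other two.\<close>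

lemma hir_eqs:
  assumes x: "x \<in> U"
  shows "4 * hir x * gap 0 = ddw 0 1 x / (dw 0 x * dw 1 x) - ddw 0 2 x / (dw 0 x * dw 2 x)"
    and "4 * hir x * gap 1 = ddw 1 2 x / (dw 1 x * dw 2 x) - ddw 0 1 x / (dw 0 x * dw 1 x)"
    and "4 * hir x * gap 2 = ddw 0 2 x / (dw 0 x * dw 2 x) - ddw 1 2 x / (dw 1 x * dw 2 x)"
proof -
  note nz = dw3[OF x] gap_nonzero
  define y01 where "y01 = ddw 0 1 x / (dw 0 x * dw 1 x)"
  define y02 where "y02 = ddw 0 2 x / (dw 0 x * dw 2 x)"
  define y12 where "y12 = ddw 1 2 x / (dw 1 x * dw 2 x)"
  have y: "ddw 0 1 x = y01 * (dw 0 x * dw 1 x)" "ddw 0 2 x = y02 * (dw 0 x * dw 2 x)" "ddw 1 2 x = y12 * (dw 1 x * dw 2 x)"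
    using nz by (simp_all add: y01_def y02_def y12_def)
  have gsum: "gap 0 + gap 1 + gap 2 = 0" unfolding gap_def wt_def by (simp add: algebra_simps)
  have "(dw 0 x * dw 1 x * dw 2 x) * (gap 2 * y01 + gap 0 * y12 + gap 1 * y02) = 0"
    using system[OF x le_k(1,2,3)] unfolding sym3(2)[OF x] y gap_def by (simp add: algebra_simps)
  then have sys: "gap 2 * y01 + gap 0 * y12 + gap 1 * y02 = 0" using nz by simp
  have 0: "4 * hir x * gap 0 = y01 - y02"
    unfolding hir_def y using nz by (simp add: field_simps)
  have "gap 0 * (4 * hir x * gap 1) = gap 0 * (y12 - y01)" using 0 sys gsum by algebra
  then have 1: "4 * hir x * gap 1 = y12 - y01" using nz by simp
  have "gap 0 * (4 * hir x * gap 2) = gap 0 * (y02 - y12)" using 0 sys gsum by algebra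
  then have 2: "4 * hir x * gap 2 = y02 - y12" using nz by simp
  show "4 * hir x * gap 0 = ddw 0 1 x / (dw 0 x * dw 1 x) - ddw 0 2 x / (dw 0 x * dw 2 x)"
    "4 * hir x * gap 1 = ddw 1 2 x / (dw 1 x * dw 2 x) - ddw 0 1 x / (dw 0 x * dw 1 x)"
    "4 * hir x * gap 2 = ddw 0 2 x / (dw 0 x * dw 2 x) - ddw 1 2 x / (dw 1 x * dw 2 x)"
    using 0 1 2 by (simp_all add: y01_def y02_def y12_def)
qed

text \<open>With this choice of \<open>wey\<close> each mixed symbol is a quarter of a difference of
  two quotients times a first derivative of w, so \<open>hir_eqs\<close> applies.\<close>

lemma chr_off_eqs:
  assumes x: "x \<in> U"
  shows "chr_off 0 1 x = - hir x * gw 1 x" "chr_off 1 2 x = - hir x * gw 2 x" "chr_off 2 0 x = - hir x * gw 0 x"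
    "chr_off 1 0 x = hir x * gw 0 x" "chr_off 2 1 x = hir x * gw 1 x" "chr_off 0 2 x = hir x * gw 2 x"
proof -
  note nz = dw3[OF x]
  have h: "hir x * gw 0 x = (4 * hir x * gap 0) * dw 0 x / 4" "hir x * gw 1 x = (4 * hir x * gap 1) * dw 1 x / 4"
    "hir x * gw 2 x = (4 * hir x * gap 2) * dw 2 x / 4" by simp_all
  show "chr_off 0 1 x = - hir x * gw 1 x" "chr_off 1 2 x = - hir x * gw 2 x" "chr_off 2 0 x = - hir x * gw 0 x"
    "chr_off 1 0 x = hir x * gw 0 x" "chr_off 2 1 x = hir x * gw 1 x" "chr_off 0 2 x = hir x * gw 2 x"
    unfolding minus_mult_left[symmetric] h hir_eqs[OF x] chr_off_def wey_def sym3[OF x] using nz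
    by (simp_all add: field_simps)
qed

lemma three_conn_coord: "i \<le> k \<Longrightarrow> three_conn x u v $ e i = three_coord i x u v"
  unfolding three_conn_def by (rule sum_axis_coord)

lemma smooth_chr: "smooth_on U (wey i)" "i \<le> k \<Longrightarrow> smooth_on U (chr_off i j)" "i \<le> k \<Longrightarrow> smooth_on U (chr_diag i)"
proof -
  have d: "i \<le> k \<Longrightarrow> smooth_on U (\<lambda>x. ddw j l x / dw i x)" for i j l
    by (intro smooth_on_divide smooth_ddw smooth_dw openU) (use dw_nonzero in auto)
  have w: "smooth_on U (wey i)" for i
    unfolding wey_def[abs_def]
    by (cases "i = 0"; cases "i = 1"; simp;
        intro smooth_on_divide smooth_on_minus smooth_on_add smooth_on_diff d smooth_on_const openU; simp add: le_k)
  show "smooth_on U (wey i)" by (rule w)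
  show "i \<le> k \<Longrightarrow> smooth_on U (chr_off i j)" "i \<le> k \<Longrightarrow> smooth_on U (chr_diag i)"
    unfolding chr_off_def[abs_def] chr_diag_def[abs_def]
    by (intro smooth_on_divide smooth_on_add w d smooth_on_const openU; simp)+
qed

lemma three_conn_connection: "connection U three_conn"
  unfolding connection_def
proof (intro conjI ballI allI)
  fix x assume "x \<in> U"
  show "bilinear (three_conn x)"
    unfolding bilinear_def
    by (intro conjI allI linearI vec_eqI)
       (simp_all add: three_conn_coord three_coord_def algebra_simps)
next
  fix u v
  have "smooth_on U (\<lambda>x. three_coord i x u v)" for i
    unfolding three_coord_def
    by (cases "i = 0"; cases "i = 1"; simp;
        intro smooth_on_add smooth_on_mult smooth_chr smooth_on_const openU; simp add: le_k)
  then show "smooth_on U (\<lambda>x. three_conn x u v)"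
    unfolding three_conn_def by (intro smooth_on_sum smooth_on_scaleR smooth_on_const openU)
qed

lemma three_conn_sym: "three_conn x u v = three_conn x v u"
  by (rule vec_eqI) (auto simp: three_conn_coord three_coord_def le_k algebra_simps)

definition wey_vec where "wey_vec x = (- 1 / 2) *\<^sub>R solution_weyl_form e w x"

lemma wey_vec_coord: "i \<le> k \<Longrightarrow> wey_vec x $ e i = wey i x"
  unfolding wey_vec_def solution_weyl_form_def
  by (auto simp: le_k axis_coord wey_def)

lemma smooth_weyl: "smooth_on U (solution_weyl_form e w)"
  unfolding solution_weyl_form_def[abs_def]
  by (intro smooth_on_add smooth_on_scaleR smooth_on_divide smooth_on_const smooth_ddw smooth_dw openU)
     (use dw3 in auto)

lemma smooth_wey_vec: "smooth_on U wey_vec"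
  unfolding wey_vec_def[abs_def] by (intro smooth_on_scaleR smooth_on_const smooth_weyl openU)

lemma hir_bracket:
  assumes x: "x \<in> U"
  shows "hir x * bracket_coord 0 x u v =
      chr_off 0 1 x * (u $ e 0 * v $ e 1 - u $ e 1 * v $ e 0) + chr_off 0 2 x * (u $ e 0 * v $ e 2 - u $ e 2 * v $ e 0)"
    and "hir x * bracket_coord 1 x u v =
      chr_off 1 2 x * (u $ e 1 * v $ e 2 - u $ e 2 * v $ e 1) + chr_off 1 0 x * (u $ e 1 * v $ e 0 - u $ e 0 * v $ e 1)"
    and "hir x * bracket_coord 2 x u v =
      chr_off 2 0 x * (u $ e 2 * v $ e 0 - u $ e 0 * v $ e 2) + chr_off 2 1 x * (u $ e 2 * v $ e 1 - u $ e 1 * v $ e 2)"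
  unfolding chr_off_eqs[OF x] bracket_coord_def by (simp_all add: algebra_simps)

lemma grad_log3:
  "x \<in> U \<Longrightarrow> grad_log i x u = u $ e 0 * (ddw i 0 x / dw i x) + u $ e 1 * (ddw i 1 x / dw i x) + u $ e 2 * (ddw i 2 x / dw i x)"
  unfolding grad_log_coords sum3 using ddw_sym by simp

lemma wey_inner: "wey_vec x \<bullet> u = wey 0 x * u $ e 0 + wey 1 x * u $ e 1 + wey 2 x * u $ e 2"
  unfolding inner_coords sum3 using wey_vec_coord le_k by simp

text \<open>Symmetrising a connection changes it by an antisymmetric tensor; here its coefficients
  are the mixed symbols, and by \<open>hir_bracket\<close> they assemble to the bracket.\<close>

lemma three_diff_coord:
  assumes x: "x \<in> U" and i: "i \<le> k"
  shows "diff_tensor three_conn x u v $ e i = (wey_vec x \<bullet> u) * v $ e i + hir x * bracket_coord i x u v"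
proof -
  have off: "ddw i j x / dw i x = 2 * chr_off i j x - wey j x" for i j
    by (simp add: chr_off_def add_divide_distrib)
  have "i = 0 \<or> i = 1 \<or> i = 2" using i le_k by blast
  then show ?thesis
    unfolding diff_tensor_coord[OF i] three_conn_coord[OF i] grad_log3[OF x] wey_inner
    by (elim disjE) (simp_all only: hir_bracket[OF x],
      simp_all add: three_coord_def chr_diag_def off, simp_all add: algebra_simps)
qed

subsection \<open>The conformal metric\<close>

abbreviation metric where "metric \<equiv> solution_metric e \<tau> w"

text \<open>In the variables \<xi>_i = gw i x * u_i the quadratic form is twice the sum of the mixed
  products minus the sum of the squares: nodes and derivatives of w disappear from the coefficients,
  and the computations below rely on this shape.\<close>

lemma metric_eq:
  "metric x u v =
    - (gw 0 x * u $ e 0 * (gw 0 x * v $ e 0)) - gw 1 x * u $ e 1 * (gw 1 x * v $ e 1) - gw 2 x * u $ e 2 * (gw 2 x * v $ e 2)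
    + (gw 0 x * u $ e 0 * (gw 1 x * v $ e 1) + gw 1 x * u $ e 1 * (gw 0 x * v $ e 0))
    + (gw 0 x * u $ e 0 * (gw 2 x * v $ e 2) + gw 2 x * u $ e 2 * (gw 0 x * v $ e 0))
    + (gw 1 x * u $ e 1 * (gw 2 x * v $ e 2) + gw 2 x * u $ e 2 * (gw 1 x * v $ e 1))"
proof -
  have g: "gap 0 = wt 0 * (\<tau> 1 - \<tau> 2)" "gap 1 = wt 1 * (\<tau> 2 - \<tau> 0)" "gap 2 = wt 2 * (\<tau> 0 - \<tau> 1)"
    by (simp_all add: gap_def)
  show ?thesis
    unfolding solution_metric_def sum_le_2 atMost_2_minus wt_eq g by simp algebra
qed

lemma metric_on_U: "metric_on U metric"
  unfolding metric_on_def
proof (intro conjI allI ballI impI)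
  show "smooth_on U (\<lambda>x. metric x u v)" for u v
    unfolding metric_eq diff_conv_add_uminus
    by (intro smooth_on_add smooth_on_minus smooth_on_mult smooth_on_const smooth_dw openU)
  fix x assume x: "x \<in> U"
  show "bilinear (metric x)"
    unfolding bilinear_def metric_eq by (intro conjI allI linearI) (simp_all add: algebra_simps)
  show "metric x u v = metric x v u" for u v unfolding metric_eq by (simp add: algebra_simps)
  fix u assume u: "\<forall>v. metric x u v = 0"
  have nz: "gw 0 x \<noteq> 0" "gw 1 x \<noteq> 0" "gw 2 x \<noteq> 0" using dw3[OF x] gap_nonzero by auto
  have ax: "axis (e i) (1::real) $ e j = (if i = j then 1 else 0)" if "i \<in> {0, 1, 2}" "j \<in> {0, 1, 2}" for i j
    by (rule axis_coord) (use that le_k in auto)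
  have "gw 0 x * (- (gw 0 x * u $ e 0) + gw 1 x * u $ e 1 + gw 2 x * u $ e 2) = 0"
    using u[rule_format, of "axis (e 0) 1"] unfolding metric_eq by (simp add: ax algebra_simps)
  moreover have "gw 1 x * (gw 0 x * u $ e 0 - gw 1 x * u $ e 1 + gw 2 x * u $ e 2) = 0"
    using u[rule_format, of "axis (e 1) 1"] unfolding metric_eq by (simp add: ax algebra_simps)
  moreover have "gw 2 x * (gw 0 x * u $ e 0 + gw 1 x * u $ e 1 - gw 2 x * u $ e 2) = 0"
    using u[rule_format, of "axis (e 2) 1"] unfolding metric_eq by (simp add: ax algebra_simps)
  ultimately have "- (gw 0 x * u $ e 0) + gw 1 x * u $ e 1 + gw 2 x * u $ e 2 = 0"
    "gw 0 x * u $ e 0 - gw 1 x * u $ e 1 + gw 2 x * u $ e 2 = 0"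
    "gw 0 x * u $ e 0 + gw 1 x * u $ e 1 - gw 2 x * u $ e 2 = 0"
    using nz unfolding mult_eq_0_iff by blast+
  \<comment> \<open>Each sum of two of the three equations isolates one variable.\<close>
  then have "gw 0 x * u $ e 0 = 0" "gw 1 x * u $ e 1 = 0" "gw 2 x * u $ e 2 = 0" by linarith+
  then have "u $ e 0 = 0" "u $ e 1 = 0" "u $ e 2 = 0" using nz by (metis mult_eq_0_iff)+
  then show "u = 0" by (intro vec_eqI) (auto simp: le_k)
qed

text \<open>In the variables \<xi> the covariant derivative is the ordinary one, plus a scaling by
  \<open>wey_vec\<close>, plus \<open>hir\<close> times the bracket. The first part respects the
  constant coefficients, the bracket is skew for the metric, and the scaling contributes the Weyl
  form.\<close>

lemma three_weyl: "weyl_form U metric three_conn (solution_weyl_form e w)"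
  unfolding weyl_form_def
proof (intro conjI smooth_weyl allI impI ballI)
  fix Y X Z :: "real ^ 'n \<Rightarrow> real ^ 'n" and x assume sm: "smooth_on U Y \<and> smooth_on U X \<and> smooth_on U Z" and x: "x \<in> U"
  define y where "y = Y x"
  define \<xi> where "\<xi> X i z = gw i z * X z $ e i" for X :: "real ^ 'n \<Rightarrow> real ^ 'n" and i z
  define D where "D X i v = gap i * (frechet_derivative (dw i) (at x) v * X x $ e i + dw i x * frechet_derivative X (at x) v $ e i)"
    for X :: "real ^ 'n \<Rightarrow> real ^ 'n" and i v
  have dX: "((\<lambda>z. X z $ e i) has_derivative (\<lambda>v. frechet_derivative X (at x) v $ e i)) (at x)"
    if "smooth_on U X" for X :: "real ^ 'n \<Rightarrow> real ^ 'n" and i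
    using bounded_linear.has_derivative[OF bounded_linear_vec_nth smooth_on_has_derivative[OF that x]] .
  have d\<xi>: "(\<xi> X i has_derivative D X i) (at x)" if "smooth_on U X" for X :: "real ^ 'n \<Rightarrow> real ^ 'n" and i
    unfolding \<xi>_def[abs_def] D_def[abs_def]
    by (auto intro!: derivative_eq_intros dX[OF that] smooth_on_has_derivative[OF smooth_dw x] simp: algebra_simps)
  note dX' = d\<xi>[OF conjunct1[OF conjunct2[OF sm]]] and dZ' = d\<xi>[OF conjunct2[OF conjunct2[OF sm]]]
  have m: "metric z (X z) (Z z) =
      - (\<xi> X 0 z * \<xi> Z 0 z) - \<xi> X 1 z * \<xi> Z 1 z - \<xi> X 2 z * \<xi> Z 2 z
      + (\<xi> X 0 z * \<xi> Z 1 z + \<xi> X 1 z * \<xi> Z 0 z) + (\<xi> X 0 z * \<xi> Z 2 z + \<xi> X 2 z * \<xi> Z 0 z)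
      + (\<xi> X 1 z * \<xi> Z 2 z + \<xi> X 2 z * \<xi> Z 1 z)" for z
    unfolding metric_eq \<xi>_def ..
  have "((\<lambda>z. metric z (X z) (Z z)) has_derivative (\<lambda>v.
      - (\<xi> X 0 x * D Z 0 v + D X 0 v * \<xi> Z 0 x) - (\<xi> X 1 x * D Z 1 v + D X 1 v * \<xi> Z 1 x)
      - (\<xi> X 2 x * D Z 2 v + D X 2 v * \<xi> Z 2 x)
      + ((\<xi> X 0 x * D Z 1 v + D X 0 v * \<xi> Z 1 x) + (\<xi> X 1 x * D Z 0 v + D X 1 v * \<xi> Z 0 x))
      + ((\<xi> X 0 x * D Z 2 v + D X 0 v * \<xi> Z 2 x) + (\<xi> X 2 x * D Z 0 v + D X 2 v * \<xi> Z 0 x))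
      + ((\<xi> X 1 x * D Z 2 v + D X 1 v * \<xi> Z 2 x) + (\<xi> X 2 x * D Z 1 v + D X 2 v * \<xi> Z 1 x)))) (at x)"
    unfolding m
    by (intro has_derivative_add has_derivative_diff has_derivative_minus has_derivative_mult dX' dZ')
  from fun_cong[OF frechet_derivative_at[OF this], of y, symmetric]
  have fr: "frechet_derivative (\<lambda>z. metric z (X z) (Z z)) (at x) y =
      - (\<xi> X 0 x * D Z 0 y + D X 0 y * \<xi> Z 0 x) - (\<xi> X 1 x * D Z 1 y + D X 1 y * \<xi> Z 1 x)
      - (\<xi> X 2 x * D Z 2 y + D X 2 y * \<xi> Z 2 x)
      + ((\<xi> X 0 x * D Z 1 y + D X 0 y * \<xi> Z 1 x) + (\<xi> X 1 x * D Z 0 y + D X 1 y * \<xi> Z 0 x))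
      + ((\<xi> X 0 x * D Z 2 y + D X 0 y * \<xi> Z 2 x) + (\<xi> X 2 x * D Z 0 y + D X 2 y * \<xi> Z 0 x))
      + ((\<xi> X 1 x * D Z 2 y + D X 1 y * \<xi> Z 2 x) + (\<xi> X 2 x * D Z 1 y + D X 2 y * \<xi> Z 1 x))" .
  have nab: "gw i x * nabla three_conn Y X x $ e i =
      D X i y + (wey_vec x \<bullet> y) * \<xi> X i x + hir x * (gw i x * bracket_coord i x y (X x))" if i: "i \<le> k" for X i
  proof -
    have "three_conn x y (X x) $ e i = grad_log i x y * X x $ e i + ((wey_vec x \<bullet> y) * X x $ e i + hir x * bracket_coord i x y (X x))"
      using three_diff_coord[OF x i, of y "X x"] unfolding diff_tensor_coord[OF i] by simp
    moreover have "dw i x * grad_log i x y = frechet_derivative (dw i) (at x) y"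
      using dw_nonzero[OF i x] by (simp add: grad_log_def)
    ultimately show ?thesis
      unfolding nabla_def y_def[symmetric] vector_add_component D_def \<xi>_def by algebra
  qed
  note n0 = nab[OF le_k(1)] and n1 = nab[OF le_k(2)] and n2 = nab[OF le_k(3)]
  have b: "gw 0 x * bracket_coord 0 x y (X x) = - (\<xi> Y 0 x * \<xi> X 1 x - \<xi> Y 1 x * \<xi> X 0 x) + (\<xi> Y 0 x * \<xi> X 2 x - \<xi> Y 2 x * \<xi> X 0 x)"
    "gw 1 x * bracket_coord 1 x y (X x) = - (\<xi> Y 1 x * \<xi> X 2 x - \<xi> Y 2 x * \<xi> X 1 x) + (\<xi> Y 1 x * \<xi> X 0 x - \<xi> Y 0 x * \<xi> X 1 x)"
    "gw 2 x * bracket_coord 2 x y (X x) = - (\<xi> Y 2 x * \<xi> X 0 x - \<xi> Y 0 x * \<xi> X 2 x) + (\<xi> Y 2 x * \<xi> X 1 x - \<xi> Y 1 x * \<xi> X 2 x)"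
    for X
    unfolding bracket_coord_def \<xi>_def y_def by (simp_all add: algebra_simps)
  have phi: "solution_weyl_form e w x \<bullet> y = - 2 * (wey_vec x \<bullet> y)" unfolding wey_vec_def by simp
  show "nabla_metric three_conn metric Y X Z x = (solution_weyl_form e w x \<bullet> Y x) * metric x (X x) (Z x)"
    unfolding nabla_metric_def y_def[symmetric] phi m fr[unfolded m]
    unfolding metric_eq n0 n1 n2 b \<xi>_def[of X 0 x, symmetric] \<xi>_def[of X 1 x, symmetric] \<xi>_def[of X 2 x, symmetric]
      \<xi>_def[of Z 0 x, symmetric] \<xi>_def[of Z 1 x, symmetric] \<xi>_def[of Z 2 x, symmetric]
    by (simp add: algebra_simps)
qed

end

end

section \<open>The Ricci tensor and the Einstein-Weyl equation for k = 2\<close>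

context solution
begin

lemma einstein_weyl_cong:
  assumes "connection U \<Gamma>" "connection U \<Gamma>'" "\<And>x. x \<in> U \<Longrightarrow> \<Gamma>' x = \<Gamma> x" "weyl_form U g \<Gamma> \<phi>"
  shows "weyl_form U g \<Gamma>' \<phi>"
  using assms(3,4) unfolding weyl_form_def nabla_metric_def nabla_def by simp

context
  notes [simp del] = One_nat_def
  assumes k_eq: "k = 2"
begin

lemmas three = sum3[OF k_eq] le_k[OF k_eq]

text \<open>The symbols are logarithmic derivatives of \<partial>_i w plus terms in
  \<open>wey\<close>, so both sides agree by symmetry of third derivatives. The identity removes the
  derivatives of the diagonal symbols from the symmetrised mixed Ricci components.\<close>

lemma partial_chr_identity:
  assumes x: "x \<in> U" and jl: "j \<le> k" "l \<le> k"
  shows "partial (e j) (chr_off j l) x + partial (e l) (chr_off l j) x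
    = (partial (e j) (chr_diag l) x + partial (e l) (chr_diag j) x) / 2"
proof -
  have dd: "(ddw i j has_derivative frechet_derivative (ddw i j) (at x)) (at x)" for i j
    by (rule smooth_on_has_derivative[OF smooth_ddw x])
  have d: "(dw i has_derivative frechet_derivative (dw i) (at x)) (at x)" for i
    by (rule smooth_on_has_derivative[OF smooth_dw x])
  have wd: "(wey i has_derivative frechet_derivative (wey i) (at x)) (at x)" for i
    by (rule smooth_on_has_derivative[OF smooth_chr(1)[OF k_eq] x])
  let ?q = "\<lambda>a b i z. (frechet_derivative (ddw a b) (at x) z * dw i x - ddw a b x * frechet_derivative (dw i) (at x) z) / (dw i x * dw i x)"
  have q: "((\<lambda>y. ddw a b y / dw i y) has_derivative ?q a b i) (at x)" if "i \<le> k" for a b i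
    using has_derivative_divide'[OF dd d dw_nonzero[OF that x]] .
  have off: "partial m (chr_off i j) x = (?q i j i (axis m 1) + partial m (wey j) x) / 2" if "i \<le> k" for i j m
  proof -
    have "(chr_off i j has_derivative (\<lambda>z. (?q i j i z + frechet_derivative (wey j) (at x) z) / 2)) (at x)"
      unfolding chr_off_def[abs_def]
      by (rule bounded_linear.has_derivative[OF bounded_linear_divide has_derivative_add[OF q[OF that] wd]])
    from fun_cong[OF frechet_derivative_at[OF this], of "axis m 1", symmetric] show ?thesis unfolding partial_def .
  qed
  have diag: "partial m (chr_diag i) x = ?q i i i (axis m 1) + partial m (wey i) x" if "i \<le> k" for i m
  proof -
    have "(chr_diag i has_derivative (\<lambda>z. ?q i i i z + frechet_derivative (wey i) (at x) z)) (at x)"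
      unfolding chr_diag_def[abs_def] by (rule has_derivative_add[OF q[OF that] wd])
    from fun_cong[OF frechet_derivative_at[OF this], of "axis m 1", symmetric] show ?thesis unfolding partial_def .
  qed
  have third: "frechet_derivative (ddw l l) (at x) (axis (e j) 1) = frechet_derivative (ddw l j) (at x) (axis (e l) 1)" for j l
  proof -
    have "frechet_derivative (ddw l l) (at x) (axis (e j) 1) = frechet_derivative (ddw j l) (at x) (axis (e l) 1)"
      unfolding partial_def[of "e l" "dw l", abs_def] partial_def[of "e j" "dw l", abs_def]
      by (rule smooth_derivative_symmetric[OF openU smooth_dw x])
    also have "frechet_derivative (ddw j l) (at x) = frechet_derivative (ddw l j) (at x)"
      by (rule frechet_cong[OF openU x smooth_ddw ddw_sym])
    finally show ?thesis .
  qed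
  have pd: "frechet_derivative (dw i) (at x) (axis (e m) 1) = ddw m i x" for i m by (simp add: partial_def)
  show ?thesis
    unfolding off[OF jl(1)] off[OF jl(2)] diag[OF jl(1)] diag[OF jl(2)] pd third[of j l] third[of l j]
    unfolding ddw_sym[OF x, of j l] by (simp add: field_simps)
qed

text \<open>By \<open>chr_off_eqs\<close> the two mixed symbols with the same second index are
  opposite on the open set U, where the identity can be differentiated.\<close>

lemma partial_chr_off_neg:
  assumes x: "x \<in> U"
  shows "partial m (chr_off 2 0) x = - partial m (chr_off 1 0) x" "partial m (chr_off 2 1) x = - partial m (chr_off 0 1) x"
    "partial m (chr_off 1 2) x = - partial m (chr_off 0 2) x"
proof -
  have "partial m f x = - partial m g x" if "smooth_on U g" "\<And>y. y \<in> U \<Longrightarrow> f y = - g y" for f g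
  proof -
    have "frechet_derivative f (at x) = frechet_derivative (\<lambda>y. - g y) (at x)"
      by (rule frechet_cong[OF openU x smooth_on_minus[OF openU that(1)]]) (use that(2) in auto)
    also have "\<dots> = (\<lambda>v. - frechet_derivative g (at x) v)"
      using frechet_derivative_at[OF has_derivative_minus[OF smooth_on_has_derivative[OF that(1) x]]] by simp
    finally show ?thesis by (simp add: partial_def)
  qed
  note * = this
  show "partial m (chr_off 2 0) x = - partial m (chr_off 1 0) x" "partial m (chr_off 2 1) x = - partial m (chr_off 0 1) x"
    "partial m (chr_off 1 2) x = - partial m (chr_off 0 2) x"
    by (rule *; (rule smooth_chr(2)[OF k_eq])?; simp add: three chr_off_eqs[OF k_eq])+
qed

lemma three_christoffel:
  assumes "i \<in> {0, 1, 2}" "j \<in> {0, 1, 2}" "l \<in> {0, 1, 2}"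
  shows "(\<lambda>y. three_conn y (axis (e j) 1) (axis (e l) 1) $ e i) =
    (if i = j then if i = l then chr_diag i else chr_off i l else if i = l then chr_off i j else (\<lambda>_. 0))"
proof -
  have ax: "axis (e a) (1::real) $ e b = (if a = b then 1 else 0)" if "a \<in> {0, 1, 2}" "b \<in> {0, 1, 2}" for a b
    by (rule axis_coord) (use that three in auto)
  have i: "i \<le> k" using assms(1) three by auto
  show ?thesis
    using assms unfolding three_conn_coord[OF k_eq i] three_coord_def
    by (elim insertE emptyE) (simp_all add: ax fun_eq_iff)
qed

lemma partial_zero: "partial m (\<lambda>_. 0) x = 0"
  by (simp add: partial_def)

text \<open>All derivative terms cancel: by \<open>partial_chr_off_neg\<close> in the diagonal
  components, with the help of \<open>partial_chr_identity\<close> in the symmetrised mixed ones.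
  The products that remain are quadratic in \<open>hir\<close>.\<close>

lemma ricci3:
  assumes x: "x \<in> U"
  defines "R \<equiv> \<lambda>j l. ricci three_conn x (axis (e j) 1) (axis (e l) 1)"
  shows "R 0 0 = - 2 * (hir x * gw 0 x)^2" "R 1 1 = - 2 * (hir x * gw 1 x)^2" "R 2 2 = - 2 * (hir x * gw 2 x)^2"
    "R 0 1 + R 1 0 = 4 * hir x ^ 2 * (gw 0 x * gw 1 x)" "R 0 2 + R 2 0 = 4 * hir x ^ 2 * (gw 0 x * gw 2 x)"
    "R 1 2 + R 2 1 = 4 * hir x ^ 2 * (gw 1 x * gw 2 x)"
proof -
  note co = three_conn_connection[OF k_eq]
  note r = ricci_coords[OF co x] three(1)
  note c = three_christoffel
  note n = partial_chr_off_neg[OF x]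
  note id01 = partial_chr_identity[OF x three(2,3)] and id02 = partial_chr_identity[OF x three(2,4)]
    and id12 = partial_chr_identity[OF x three(3,4)]
  have val: "three_conn x (axis (e j) 1) (axis (e l) 1) $ e i =
    (if i = j then if i = l then chr_diag i x else chr_off i l x else if i = l then chr_off i j x else 0)"
    if "i \<in> {0, 1, 2}" "j \<in> {0, 1, 2}" "l \<in> {0, 1, 2}" for i j l
    using fun_cong[OF c[OF that], of x] by simp
  note off = chr_off_eqs[OF k_eq x]
  show "R 0 0 = - 2 * (hir x * gw 0 x)^2"
    unfolding R_def r by (simp add: c val partial_zero n off power2_eq_square algebra_simps)
  show "R 1 1 = - 2 * (hir x * gw 1 x)^2"
    unfolding R_def r by (simp add: c val partial_zero n off power2_eq_square algebra_simps)
  show "R 2 2 = - 2 * (hir x * gw 2 x)^2"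
    unfolding R_def r by (simp add: c val partial_zero n off power2_eq_square algebra_simps)
  show "R 0 1 + R 1 0 = 4 * hir x ^ 2 * (gw 0 x * gw 1 x)"
    unfolding R_def r using id01 by (simp add: c val partial_zero n off power2_eq_square algebra_simps)
  show "R 0 2 + R 2 0 = 4 * hir x ^ 2 * (gw 0 x * gw 2 x)"
    unfolding R_def r using id02 by (simp add: c val partial_zero n off power2_eq_square algebra_simps)
  show "R 1 2 + R 2 1 = 4 * hir x ^ 2 * (gw 1 x * gw 2 x)"
    unfolding R_def r using id12 by (simp add: c val partial_zero n off power2_eq_square algebra_simps)
qed

lemma ricci_metric:
  assumes x: "x \<in> U"
  shows "(ricci three_conn x u v + ricci three_conn x v u) / 2 = 2 * hir x ^ 2 * solution_metric e \<tau> w x u v"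
proof -
  have bil: "bilinear (ricci three_conn x)" by (rule ricci_bilinear[OF openU three_conn_connection[OF k_eq] x])
  have linr: "linear (ricci three_conn x u)" and linl: "linear (\<lambda>u. ricci three_conn x u v)" for u v
    using bil by (auto simp: bilinear_def)
  let ?R = "\<lambda>j l. ricci three_conn x (axis (e j) 1) (axis (e l) 1)"
  have ex: "ricci three_conn x u v = u $ e 0 * (v $ e 0 * ?R 0 0 + v $ e 1 * ?R 0 1 + v $ e 2 * ?R 0 2)
      + u $ e 1 * (v $ e 0 * ?R 1 0 + v $ e 1 * ?R 1 1 + v $ e 2 * ?R 1 2)
      + u $ e 2 * (v $ e 0 * ?R 2 0 + v $ e 1 * ?R 2 1 + v $ e 2 * ?R 2 2)" for u v
  proof -
    have 1: "ricci three_conn x u v = u $ e 0 * ricci three_conn x (axis (e 0) 1) v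
        + u $ e 1 * ricci three_conn x (axis (e 1) 1) v + u $ e 2 * ricci three_conn x (axis (e 2) 1) v"
      using linear_coords[OF linl, of u v] unfolding three(1) by simp
    have 2: "ricci three_conn x a v = v $ e 0 * ricci three_conn x a (axis (e 0) 1)
        + v $ e 1 * ricci three_conn x a (axis (e 1) 1) + v $ e 2 * ricci three_conn x a (axis (e 2) 1)" for a
      using linear_coords[OF linr, of a v] unfolding three(1) by simp
    show ?thesis unfolding 1 2[of "axis _ 1"] ..
  qed
  have sum: "ricci three_conn x u v + ricci three_conn x v u =
      2 * (u $ e 0 * v $ e 0 * ?R 0 0 + u $ e 1 * v $ e 1 * ?R 1 1 + u $ e 2 * v $ e 2 * ?R 2 2)
      + (u $ e 0 * v $ e 1 + u $ e 1 * v $ e 0) * (?R 0 1 + ?R 1 0)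
      + (u $ e 0 * v $ e 2 + u $ e 2 * v $ e 0) * (?R 0 2 + ?R 2 0)
      + (u $ e 1 * v $ e 2 + u $ e 2 * v $ e 1) * (?R 1 2 + ?R 2 1)"
    unfolding ex[of u v] ex[of v u] by (simp add: algebra_simps)
  have "ricci three_conn x u v + ricci three_conn x v u = 2 * (2 * hir x ^ 2 * solution_metric e \<tau> w x u v)"
    unfolding sum ricci3[OF x] metric_eq[OF k_eq] by (simp add: algebra_simps power2_eq_square)
  then show ?thesis by simp
qed

lemma three_einstein_weyl:
  assumes conn: "connection U \<Gamma>" and eq: "\<And>x. x \<in> U \<Longrightarrow> \<Gamma> x = three_conn x"
  shows "einstein_weyl U (solution_metric e \<tau> w) \<Gamma>"
  unfolding einstein_weyl_def
proof (intro conjI ballI allI)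
  show "torsion_free U \<Gamma>" unfolding torsion_free_iff using eq three_conn_sym[OF k_eq] by simp
  have "weyl_form U (solution_metric e \<tau> w) \<Gamma> (solution_weyl_form e w)"
    by (rule einstein_weyl_cong[OF three_conn_connection[OF k_eq] conn eq three_weyl[OF k_eq]])
  then show "\<exists>\<phi>. weyl_form U (solution_metric e \<tau> w) \<Gamma> \<phi>" by blast
  fix x u v assume x: "x \<in> U"
  have sm: "smooth_on U (\<lambda>y. three_conn y u v)" for u v
    using three_conn_connection[OF k_eq] by (simp add: connection_def)
  have fr: "frechet_derivative (\<lambda>y. \<Gamma> y u v) (at x) = frechet_derivative (\<lambda>y. three_conn y u v) (at x)" for u v
    by (rule frechet_cong[OF openU x sm]) (use eq in auto)
  have "ricci \<Gamma> x u v = ricci three_conn x u v" for u v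
    unfolding ricci_def curvature_constant[OF conn x] curvature_constant[OF three_conn_connection[OF k_eq] x] fr eq[OF x] ..
  then have R: "(ricci \<Gamma> x u v + ricci \<Gamma> x v u) / 2 = 2 * hir x ^ 2 * solution_metric e \<tau> w x u v" for u v
    using ricci_metric[OF x] by simp
  \<comment> \<open>The dimension 3 cancels the factor 1 / 3 of the Einstein-Weyl equation, which
    recovers the factor 2 hir^2 of \<open>ricci_metric\<close>.\<close>
  have "scalar_curvature (solution_metric e \<tau> w) \<Gamma> x = real CARD('n) * (2 * hir x ^ 2)"
    by (rule scalar_curvature_proportional[OF metric_on_U[OF k_eq] x R])
  then show "(ricci \<Gamma> x u v + ricci \<Gamma> x v u) / 2
      = 1 / 3 * scalar_curvature (solution_metric e \<tau> w) \<Gamma> x * solution_metric e \<tau> w x u v"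
    unfolding R card_coords using k_eq by simp
qed

end

end

section \<open>The cone of the metric, and uniqueness for k = 2\<close>

context solution_dual
begin

text \<open>For a \<noteq> 0 the point is a rescaled point of the affine curve. For a = 0 it is a
  multiple of the top coefficient of the curve, found by comparing leading coefficients.\<close>

lemma homogeneous_coord:
  assumes x: "x \<in> U" and m: "m \<le> k"
  shows "(\<Sum>i\<le>k. (a ^ (k - i) * b ^ i) *\<^sub>R V i x) $ e m = scale x * (a * \<tau> m - b) ^ k / (bw m * dw m x)"
proof (cases "a = 0")
  case False
  have "(\<Sum>i\<le>k. (a ^ (k - i) * b ^ i) *\<^sub>R V i x) = a ^ k *\<^sub>R Vt (b / a) x"
    unfolding poly_curve_def scaleR_sum_right
  proof (intro sum.cong refl)
    fix i assume "i \<in> {..k}"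
    then have "a ^ k = a ^ (k - i) * a ^ i" by (simp add: power_add[symmetric])
    then show "(a ^ (k - i) * b ^ i) *\<^sub>R V i x = a ^ k *\<^sub>R (b / a) ^ i *\<^sub>R V i x"
      using False by (simp add: power_divide)
  qed
  moreover have "a ^ k * (\<tau> m - b / a) ^ k = (a * \<tau> m - b) ^ k"
    using False by (simp add: power_mult_distrib[symmetric] algebra_simps)
  ultimately show ?thesis using V_coord[OF x m, of "b / a"] by (simp add: mult_ac)
next
  case True
  define q where "q = (\<Sum>j\<le>k. monom (V j x $ e m) j)"
  have "poly q t = poly (smult (scale x / (bw m * dw m x)) ([:\<tau> m, - 1:] ^ k)) t" for t
    using V_coord[OF x m, of t] unfolding q_def poly_curve_def by (simp add: poly_sum poly_monom mult.commute)
  then have "poly q = poly (smult (scale x / (bw m * dw m x)) ([:\<tau> m, - 1:] ^ k))" by blast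
  then have "coeff q k = coeff (smult (scale x / (bw m * dw m x)) ([:\<tau> m, - 1:] ^ k)) k"
    by (simp only: poly_eq_poly_eq_iff)
  then have Vk: "V k x $ e m = scale x / (bw m * dw m x) * (- 1) ^ k"
    unfolding q_def coeff_sum coeff_smult coeff_monom by (simp add: coeff_linear_poly_power)
  have "(\<Sum>i\<le>k. (a ^ (k - i) * b ^ i) *\<^sub>R V i x) = (\<Sum>i\<le>k. if i = k then b ^ k *\<^sub>R V k x else 0)"
    by (rule sum.cong) (use True in auto)
  moreover have "(a * \<tau> m - b) ^ k = b ^ k * (- 1) ^ k" using True by (simp add: power_mult_distrib[symmetric])
  ultimately show ?thesis using Vk by (simp add: mult_ac)
qed

context
  notes [simp del] = One_nat_def
  assumes k_eq: "k = 2"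
begin

lemmas three' = sum3[OF k_eq] le_k[OF k_eq]

text \<open>The quotient wt i / bw i is the reciprocal of a node polynomial at its own node: over
  one common denominator it is minus the difference of the other two nodes in cyclic order.\<close>

lemma node_weight_V:
  assumes x: "x \<in> U"
  defines "c \<equiv> scale x / ((\<tau> 0 - \<tau> 1) * (\<tau> 1 - \<tau> 2) * (\<tau> 2 - \<tau> 0))"
  shows "(wt 0 * dw 0 x) * ((s :: real) * (scale x / (bw 0 * dw 0 x))) = - c * (\<tau> 1 - \<tau> 2) * s"
    "(wt 1 * dw 1 x) * (s * (scale x / (bw 1 * dw 1 x))) = - c * (\<tau> 2 - \<tau> 0) * s"
    "(wt 2 * dw 2 x) * (s * (scale x / (bw 2 * dw 2 x))) = - c * (\<tau> 0 - \<tau> 1) * s"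
proof -
  note nz = dw3[OF k_eq x] node_diffs[OF k_eq] wt_nonzero[OF three'(2)] wt_nonzero[OF three'(3)] wt_nonzero[OF three'(4)]
  have nz': "\<tau> 1 - \<tau> 0 \<noteq> 0" "\<tau> 2 - \<tau> 1 \<noteq> 0" "\<tau> 0 - \<tau> 2 \<noteq> 0" using nz by auto
  show "(wt 0 * dw 0 x) * (s * (scale x / (bw 0 * dw 0 x))) = - c * (\<tau> 1 - \<tau> 2) * s"
    "(wt 1 * dw 1 x) * (s * (scale x / (bw 1 * dw 1 x))) = - c * (\<tau> 2 - \<tau> 0) * s"
    "(wt 2 * dw 2 x) * (s * (scale x / (bw 2 * dw 2 x))) = - c * (\<tau> 0 - \<tau> 1) * s"
    unfolding c_def bw3[OF k_eq] using nz nz' by (simp_all add: divide_simps) (simp_all add: algebra_simps)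
qed

text \<open>With P the quadratic polynomial t \<mapsto> form t x \<bullet> u, the bracket of P with
  the square (s - t)^2 corresponds to P' V - P V' at t; so the endomorphism keeps V in the span of V
  and V'.\<close>

lemma bracket_V:
  assumes x: "x \<in> U"
  shows "\<exists>p. \<forall>i\<le>k. bracket_coord i x u (Vt t x) = p * Vt t x $ e i - (form t x \<bullet> u) * t_deriv Vt t x $ e i"
proof -
  \<comment> \<open>The t-derivative of \<open>form t x \<bullet> u\<close>, which serves as the
    factor p.\<close>
  define P' where "P' \<equiv> \<lambda>u t. wt 0 * dw 0 x * u $ e 0 * (2 * t - \<tau> 1 - \<tau> 2) + wt 1 * dw 1 x * u $ e 1 * (2 * t - \<tau> 0 - \<tau> 2)
      + wt 2 * dw 2 x * u $ e 2 * (2 * t - \<tau> 0 - \<tau> 1)"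
  define c where "c = scale x / ((\<tau> 0 - \<tau> 1) * (\<tau> 1 - \<tau> 2) * (\<tau> 2 - \<tau> 0))"
  have V: "Vt t x $ e j = (\<tau> j - t) ^ 2 * (scale x / (bw j * dw j x))" if "j \<le> k" for j
    using V_coord[OF x that] k_eq by simp
  have V': "t_deriv Vt t x $ e j = (- (2 * (\<tau> j - t))) * (scale x / (bw j * dw j x))" if "j \<le> k" for j
    unfolding V_deriv_coord[OF x that] using k_eq
    by (simp add: algebra_simps add_divide_distrib diff_divide_distrib)
  note nw = node_weight_V[OF x, folded c_def]
  have X: "wt 0 * dw 0 x * Vt t x $ e 0 = - c * (\<tau> 1 - \<tau> 2) * (\<tau> 0 - t)^2"
    "wt 1 * dw 1 x * Vt t x $ e 1 = - c * (\<tau> 2 - \<tau> 0) * (\<tau> 1 - t)^2"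
    "wt 2 * dw 2 x * Vt t x $ e 2 = - c * (\<tau> 0 - \<tau> 1) * (\<tau> 2 - t)^2"
    unfolding V[OF three'(2)] V[OF three'(3)] V[OF three'(4)] nw by (rule refl)+
  have X': "wt 0 * dw 0 x * t_deriv Vt t x $ e 0 = - c * (\<tau> 1 - \<tau> 2) * (- (2 * (\<tau> 0 - t)))"
    "wt 1 * dw 1 x * t_deriv Vt t x $ e 1 = - c * (\<tau> 2 - \<tau> 0) * (- (2 * (\<tau> 1 - t)))"
    "wt 2 * dw 2 x * t_deriv Vt t x $ e 2 = - c * (\<tau> 0 - \<tau> 1) * (- (2 * (\<tau> 2 - t)))"
    unfolding V'[OF three'(2)] V'[OF three'(3)] V'[OF three'(4)] nw by (rule refl)+
  define X0 where "X0 = wt 0 * dw 0 x * Vt t x $ e 0"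
  define X1 where "X1 = wt 1 * dw 1 x * Vt t x $ e 1"
  define X2 where "X2 = wt 2 * dw 2 x * Vt t x $ e 2"
  note X012 = X0_def X1_def X2_def
  define U0 where "U0 = wt 0 * dw 0 x * u $ e 0"
  define U1 where "U1 = wt 1 * dw 1 x * u $ e 1"
  define U2 where "U2 = wt 2 * dw 2 x * u $ e 2"
  have P: "form t x \<bullet> u = U0 * ((t - \<tau> 1) * (t - \<tau> 2)) + U1 * ((t - \<tau> 0) * (t - \<tau> 2)) + U2 * ((t - \<tau> 0) * (t - \<tau> 1))"
    unfolding form_inner three'(1) np3[OF k_eq] U0_def U1_def U2_def by (simp add: mult_ac)
  have P': "P' u t = U0 * (2 * t - \<tau> 1 - \<tau> 2) + U1 * (2 * t - \<tau> 0 - \<tau> 2) + U2 * (2 * t - \<tau> 0 - \<tau> 1)"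
    unfolding P'_def U0_def U1_def U2_def ..
  have g: "gap 0 = wt 0 * (\<tau> 1 - \<tau> 2)" "gap 1 = wt 1 * (\<tau> 2 - \<tau> 0)" "gap 2 = wt 2 * (\<tau> 0 - \<tau> 1)"
    by (simp_all add: gap_def)
  have b: "wt 0 * dw 0 x * bracket_coord 0 x u (Vt t x) = - (\<tau> 2 - \<tau> 0) * (U0 * X1 - U1 * X0) + (\<tau> 0 - \<tau> 1) * (U0 * X2 - U2 * X0)"
    "wt 1 * dw 1 x * bracket_coord 1 x u (Vt t x) = - (\<tau> 0 - \<tau> 1) * (U1 * X2 - U2 * X1) + (\<tau> 1 - \<tau> 2) * (U1 * X0 - U0 * X1)"
    "wt 2 * dw 2 x * bracket_coord 2 x u (Vt t x) = - (\<tau> 1 - \<tau> 2) * (U2 * X0 - U0 * X2) + (\<tau> 2 - \<tau> 0) * (U2 * X1 - U1 * X2)"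
    unfolding bracket_coord_def g X012 U0_def U1_def U2_def by (simp_all add: algebra_simps)
  have E: "wt 0 * dw 0 x * bracket_coord 0 x u (Vt t x)
      = P' u t * (wt 0 * dw 0 x * Vt t x $ e 0) - (form t x \<bullet> u) * (wt 0 * dw 0 x * t_deriv Vt t x $ e 0)"
    "wt 1 * dw 1 x * bracket_coord 1 x u (Vt t x)
      = P' u t * (wt 1 * dw 1 x * Vt t x $ e 1) - (form t x \<bullet> u) * (wt 1 * dw 1 x * t_deriv Vt t x $ e 1)"
    "wt 2 * dw 2 x * bracket_coord 2 x u (Vt t x)
      = P' u t * (wt 2 * dw 2 x * Vt t x $ e 2) - (form t x \<bullet> u) * (wt 2 * dw 2 x * t_deriv Vt t x $ e 2)"
    unfolding P P' b X X' X012 by algebra+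
  have "bracket_coord i x u (Vt t x) = P' u t * Vt t x $ e i - (form t x \<bullet> u) * t_deriv Vt t x $ e i" if i: "i \<le> k" for i
  proof -
    have "wt i * dw i x * bracket_coord i x u (Vt t x)
      = P' u t * (wt i * dw i x * Vt t x $ e i) - (form t x \<bullet> u) * (wt i * dw i x * t_deriv Vt t x $ e i)"
      using i E unfolding three'(5) by (elim disjE) simp_all
    then have "wt i * dw i x * bracket_coord i x u (Vt t x)
      = wt i * dw i x * (P' u t * Vt t x $ e i - (form t x \<bullet> u) * t_deriv Vt t x $ e i)" by (simp add: algebra_simps)
    then show ?thesis using wt_nonzero[OF i] dw_nonzero[OF i x] by simp
  qed
  then show ?thesis by blast
qed

lemma three_conn_paraconformal: "paraconformal_connection k U V three_conn"
  unfolding paraconformal_connection_def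
proof (intro allI impI ballI)
  fix Y :: "real ^ 'n \<Rightarrow> real ^ 'n" and t x assume x: "x \<in> U"
  obtain p where p: "\<And>i. i \<le> k \<Longrightarrow> bracket_coord i x (Y x) (Vt t x)
      = p * Vt t x $ e i - (form t x \<bullet> Y x) * t_deriv Vt t x $ e i"
    using bracket_V[OF x] by blast
  have "diff_tensor three_conn x (Y x) (Vt t x) = (wey_vec x \<bullet> Y x + hir x * p) *\<^sub>R Vt t x
      + (- (hir x * (form t x \<bullet> Y x))) *\<^sub>R t_deriv Vt t x"
    by (rule vec_eqI) (simp add: three_diff_coord[OF k_eq x] p algebra_simps)
  then show "nabla three_conn Y (Vt t) x \<in> span {Vt t x, t_deriv Vt t x}"
    unfolding nabla_V[OF x] by (simp only:) (intro span_add span_mul span_base, auto)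
qed

text \<open>The bracket is skew, so the difference tensor is purely scalar on the diagonal and
  \<open>totally_geodesicI\<close> applies.\<close>

lemma three_conn_totally_geodesic: "totally_geodesic_for_web U (\<lambda>t. ker_form (form t)) three_conn"
proof (rule totally_geodesicI[OF three_conn_connection[OF k_eq] smooth_on_continuous[OF smooth_wey_vec[OF k_eq]]])
  fix x v assume x: "x \<in> U"
  have b: "bracket_coord i x v v = 0" for i by (simp add: bracket_coord_def)
  show "diff_tensor three_conn x v v = (wey_vec x \<bullet> v) *\<^sub>R v"
    by (rule vec_eqI) (simp add: three_diff_coord[OF k_eq x] b)
qed

lemma three_conn_torsion_free: "torsion_free U three_conn"
  unfolding torsion_free_iff using three_conn_sym[OF k_eq] by blast

text \<open>The difference of two such connections is symmetric, osculating in its second argument,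
  and has the zero entries that total geodesy prescribes;
  \<open>symmetric_endomorphisms_zero\<close> leaves nothing.\<close>

lemma three_conn_unique:
  assumes conn: "connection U \<Gamma>" and tf: "torsion_free U \<Gamma>" and pc: "paraconformal_connection k U V \<Gamma>"
    and tg: "totally_geodesic_for_web U (\<lambda>t. ker_form (form t)) \<Gamma>" and x: "x \<in> U"
  shows "\<Gamma> x = three_conn x"
proof -
  note conn3 = three_conn_connection[OF k_eq]
  define T where "T u v = diff_tensor \<Gamma> x u v - diff_tensor three_conn x u v" for u v
  have T: "T u v = \<Gamma> x u v - three_conn x u v" for u v unfolding T_def diff_tensor_def by simp
  have sym: "T u v = T v u" for u v
  proof -
    have "\<Gamma> x u v = \<Gamma> x v u" using tf x unfolding torsion_free_iff by blast
    then show ?thesis unfolding T using three_conn_sym[OF k_eq] by simp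
  qed
  have lin: "linear (T u)" for u
  proof -
    have "linear (diff_tensor \<Gamma> x u)" "linear (diff_tensor three_conn x u)"
      using diff_tensor_bilinear[OF conn x] diff_tensor_bilinear[OF conn3 x] unfolding bilinear_def by simp_all
    then have "linear (\<lambda>v. diff_tensor \<Gamma> x u v - diff_tensor three_conn x u v)" by (rule linear_compose_sub)
    then show ?thesis unfolding T_def .
  qed
  have osc: "T u (Vt t x) \<in> span {Vt t x, t_deriv Vt t x}" for u t
    unfolding T_def
    by (intro span_diff paraconformal_diff_tensor[OF pc x] paraconformal_diff_tensor[OF three_conn_paraconformal x])
  have diag: "T (axis (e a) 1) (axis (e a) 1) $ e i = 0" if "a \<le> k" "i \<le> k" "i \<noteq> a" for a i
  proof -
    have z: "axis (e a) (1::real) $ e i = 0" using axis_coord[OF that(1,2)] that(3) by simp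
    show ?thesis unfolding T using totally_geodesicD[OF conn tg x that(2) z]
      totally_geodesicD[OF conn3 three_conn_totally_geodesic x that(2) z] by simp
  qed
  \<comment> \<open>The weights of i and j normalise the curve as in \<open>osculating_span\<close>;
    the further division by the weight of a restores the symmetry between a and j.\<close>
  define M where "M a i j = bw i * dw i x * T (axis (e a) 1) (axis (e j) 1) $ e i / (bw j * dw j x) / (bw a * dw a x)" for a i j
  have zero: "M a i j = 0" if aij: "a \<le> k" "i \<le> k" "j \<le> k" for a i j
  proof (rule symmetric_endomorphisms_zero[OF k_eq _ _ _ aij])
    fix a :: nat and t :: real assume "a \<le> k"
    obtain p q where pq: "\<And>i. i \<le> k \<Longrightarrow>
        (\<Sum>j\<le>k. bw i * dw i x * T (axis (e a) 1) (axis (e j) 1) $ e i / (bw j * dw j x) * (\<tau> j - t) ^ k)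
        = p * (\<tau> i - t) ^ k + q * (\<tau> i - t) ^ (k - 1)"
      using osculating_span[OF x lin osc] by blast
    have "(\<Sum>j\<le>k. M a i j * (\<tau> j - t) ^ k) = (p / (bw a * dw a x)) * (\<tau> i - t) ^ k + (q / (bw a * dw a x)) * (\<tau> i - t) ^ (k - 1)"
      if i: "i \<le> k" for i
    proof -
      have "(\<Sum>j\<le>k. M a i j * (\<tau> j - t) ^ k) =
        (\<Sum>j\<le>k. bw i * dw i x * T (axis (e a) 1) (axis (e j) 1) $ e i / (bw j * dw j x) * (\<tau> j - t) ^ k) / (bw a * dw a x)"
        unfolding M_def sum_divide_distrib by (rule sum.cong) (simp_all add: field_simps)
      then show ?thesis unfolding pq[OF i] by (simp add: add_divide_distrib)
    qed
    then show "\<exists>p q. \<forall>i\<le>k. (\<Sum>j\<le>k. M a i j * (\<tau> j - t) ^ k) = p * (\<tau> i - t) ^ k + q * (\<tau> i - t) ^ (k - 1)"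
      by blast
  next
    fix a i j :: nat
    show "M a i j = M j i a" unfolding M_def using sym[of "axis (e a) 1" "axis (e j) 1"] by (simp add: mult.commute)
  next
    fix a i :: nat assume "a \<le> k" "i \<le> k" "i \<noteq> a"
    then show "M a i a = 0" unfolding M_def using diag by simp
  qed
  have Tz: "T (axis (e a) 1) (axis (e j) 1) = 0" if "a \<le> k" "j \<le> k" for a j
  proof (rule vec_eqI)
    fix i assume i: "i \<le> k"
    have "M a i j = 0" by (rule zero[OF that(1) i that(2)])
    then show "T (axis (e a) 1) (axis (e j) 1) $ e i = 0 $ e i" unfolding M_def
      using bw_nonzero[OF i] dw_nonzero[OF i x] bw_nonzero[OF that(1)] dw_nonzero[OF that(1) x]
        bw_nonzero[OF that(2)] dw_nonzero[OF that(2) x] by simp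
  qed
  have T1: "T (axis (e a) 1) v = 0" if "a \<le> k" for a v
    using linear_coords[OF lin, of "axis (e a) 1" v] Tz[OF that] by simp
  have "T u v = 0" for u v
  proof -
    have "T v u = 0" using linear_coords[OF lin, of v u] T1 sym[of v] by simp
    then show ?thesis using sym by simp
  qed
  then show ?thesis unfolding T by (intro ext) simp
qed

abbreviation three_condition where
  "three_condition \<Gamma> \<equiv> torsion_free U \<Gamma> \<and> totally_geodesic_for_web U (\<lambda>t. ker_form (form t)) \<Gamma> \<and>
     paraconformal_connection k U V \<Gamma> \<and> einstein_weyl U (solution_metric e \<tau> w) \<Gamma>"

lemma three_connection_unique: "unique_connection U three_condition"
  unfolding unique_connection_def
proof (intro exI conjI allI impI ballI)
  show "connection U three_conn" by (rule three_conn_connection[OF k_eq])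
  show "torsion_free U three_conn" by (rule three_conn_torsion_free)
  show "totally_geodesic_for_web U (\<lambda>t. ker_form (form t)) three_conn" by (rule three_conn_totally_geodesic)
  show "paraconformal_connection k U V three_conn" by (rule three_conn_paraconformal)
  show "einstein_weyl U (solution_metric e \<tau> w) three_conn"
    by (rule three_einstein_weyl[OF k_eq three_conn_connection[OF k_eq] refl])
next
  fix \<Gamma> x assume "connection U \<Gamma> \<and> three_condition \<Gamma>" "x \<in> U"
  then show "\<Gamma> x = three_conn x" by (elim conjE) (rule three_conn_unique)
qed

lemma three_connection_weyl:
  assumes "connection U \<Gamma>" "three_condition \<Gamma>"
  shows "weyl_form U (solution_metric e \<tau> w) \<Gamma> (solution_weyl_form e w)"
proof (rule einstein_weyl_cong[OF three_conn_connection[OF k_eq] assms(1) _ three_weyl[OF k_eq]])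
  fix x assume "x \<in> U"
  then show "\<Gamma> x = three_conn x" using assms by (elim conjE) (rule three_conn_unique)
qed

text \<open>The W i are the coefficients with respect to the node polynomials, A, B, C those with
  respect to powers of s; both claims are then polynomial identities.\<close>

lemma metric_discriminant:
  fixes x v :: "real ^ 'n"
  defines "W \<equiv> \<lambda>i. wt i * dw i x * v $ e i"
  defines "A \<equiv> W 0 + W 1 + W 2" and "B \<equiv> - (W 0 * (\<tau> 1 + \<tau> 2) + W 1 * (\<tau> 0 + \<tau> 2) + W 2 * (\<tau> 0 + \<tau> 1))"
    and "C \<equiv> W 0 * (\<tau> 1 * \<tau> 2) + W 1 * (\<tau> 0 * \<tau> 2) + W 2 * (\<tau> 0 * \<tau> 1)"
  shows "form s x \<bullet> v = A * s ^ 2 + B * s + C" "solution_metric e \<tau> w x v v = 4 * A * C - B ^ 2"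
proof -
  have g: "gw 0 x * v $ e 0 = W 0 * (\<tau> 1 - \<tau> 2)" "gw 1 x * v $ e 1 = W 1 * (\<tau> 2 - \<tau> 0)" "gw 2 x * v $ e 2 = W 2 * (\<tau> 0 - \<tau> 1)"
    by (simp_all add: gap_def W_def)
  have "form s x \<bullet> v = W 0 * ((s - \<tau> 1) * (s - \<tau> 2)) + W 1 * ((s - \<tau> 0) * (s - \<tau> 2)) + W 2 * ((s - \<tau> 0) * (s - \<tau> 1))"
    unfolding form_inner three'(1) np3[OF k_eq] W_def by (simp add: mult_ac)
  then show "form s x \<bullet> v = A * s ^ 2 + B * s + C" unfolding A_def B_def C_def by (simp add: algebra_simps power2_eq_square)
  show "solution_metric e \<tau> w x v v = 4 * A * C - B ^ 2"
    unfolding metric_eq[OF k_eq] g A_def B_def C_def by (simp add: algebra_simps power2_eq_square)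
qed

lemma cone_metric:
  assumes x: "x \<in> U"
  shows "veronese_cone k V x = {v. solution_metric e \<tau> w x v v = 0}"
proof (intro equalityI subsetI)
  fix v assume "v \<in> veronese_cone k V x"
  then obtain a b c where v: "v = c *\<^sub>R (\<Sum>i\<le>k. (a ^ (k - i) * b ^ i) *\<^sub>R V i x)" unfolding veronese_cone_def by blast
  define C where "C = scale x / ((\<tau> 0 - \<tau> 1) * (\<tau> 1 - \<tau> 2) * (\<tau> 2 - \<tau> 0))"
  have vm: "v $ e m = (c * (a * \<tau> m - b) ^ 2) * (scale x / (bw m * dw m x))" if "m \<le> k" for m
    unfolding v using homogeneous_coord[OF x that, of a b] k_eq by simp
  have W: "wt 0 * dw 0 x * v $ e 0 = - C * (\<tau> 1 - \<tau> 2) * (c * (a * \<tau> 0 - b) ^ 2)"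
    "wt 1 * dw 1 x * v $ e 1 = - C * (\<tau> 2 - \<tau> 0) * (c * (a * \<tau> 1 - b) ^ 2)"
    "wt 2 * dw 2 x * v $ e 2 = - C * (\<tau> 0 - \<tau> 1) * (c * (a * \<tau> 2 - b) ^ 2)"
    unfolding vm[OF three'(2)] vm[OF three'(3)] vm[OF three'(4)] node_weight_V[OF x, folded C_def] by (rule refl)+
  have "solution_metric e \<tau> w x v v = 0" unfolding metric_discriminant(2) W by algebra
  then show "v \<in> {v. solution_metric e \<tau> w x v v = 0}" by simp
next
  fix v assume "v \<in> {v. solution_metric e \<tau> w x v v = 0}"
  then have z: "solution_metric e \<tau> w x v v = 0" by simp
  obtain A B C where F: "\<And>s. form s x \<bullet> v = A * s ^ 2 + B * s + C" and D: "4 * A * C - B ^ 2 = 0"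
  proof -
    have "\<exists>A B C. (\<forall>s. form s x \<bullet> v = A * s ^ 2 + B * s + C) \<and> 4 * A * C - B ^ 2 = 0"
      by (intro exI conjI allI, rule metric_discriminant(1), rule trans[OF metric_discriminant(2)[symmetric] z])
    then show thesis using that by (elim exE conjE) simp
  qed
  have "\<exists>a b c. v = c *\<^sub>R (\<Sum>i\<le>k. (a ^ (k - i) * b ^ i) *\<^sub>R V i x)"
  proof (cases "A = 0")
    case False
    \<comment> \<open>The double root of the quadratic is the parameter of the point on the
      cone.\<close>
    define t where "t = - B / (2 * A)"
    have "C = A * t ^ 2" "B = - 2 * A * t" using D False unfolding t_def by (auto simp: field_simps power2_eq_square)
    then have "\<forall>s. form s x \<bullet> v = A * (s - t) ^ k" unfolding F using k_eq by (simp add: algebra_simps power2_eq_square)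
    then have c: "\<And>i. i \<le> k \<Longrightarrow> v $ e i = A * (\<tau> i - t) ^ k / (bw i * dw i x)" using form_power_iff[OF x] by blast
    have "v = (A / scale x) *\<^sub>R (\<Sum>i\<le>k. (1 ^ (k - i) * t ^ i) *\<^sub>R V i x)"
    proof (rule vec_eqI)
      fix i assume i: "i \<le> k"
      show "v $ e i = ((A / scale x) *\<^sub>R (\<Sum>i\<le>k. (1 ^ (k - i) * t ^ i) *\<^sub>R V i x)) $ e i"
        using homogeneous_coord[OF x i, of 1 t] c[OF i] scale_nonzero[OF x] by simp
    qed
    then show ?thesis by blast
  next
    case True
    \<comment> \<open>A vanishing leading coefficient together with a vanishing discriminant leaves
      a constant: the double root lies at infinity, which is the point a = 0, b = 1.\<close>
    then have "form s x \<bullet> v = C" for s using F D by simp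
    then have c: "bw i * dw i x * v $ e i = C" if "i \<le> k" for i using form_at_node[OF that] by metis
    have "v = (C / scale x) *\<^sub>R (\<Sum>i\<le>k. (0 ^ (k - i) * 1 ^ i) *\<^sub>R V i x)"
    proof (rule vec_eqI)
      fix i assume i: "i \<le> k"
      have "(\<Sum>i\<le>k. (0 ^ (k - i) * 1 ^ i) *\<^sub>R V i x) $ e i = scale x / (bw i * dw i x)"
        using homogeneous_coord[OF x i, of 0 1] k_eq by simp
      then have h: "((C / scale x) *\<^sub>R (\<Sum>i\<le>k. (0 ^ (k - i) * 1 ^ i) *\<^sub>R V i x)) $ e i = C / scale x * (scale x / (bw i * dw i x))"
        by (simp only: vector_scaleR_component real_scaleR_def)
      show "v $ e i = ((C / scale x) *\<^sub>R (\<Sum>i\<le>k. (0 ^ (k - i) * 1 ^ i) *\<^sub>R V i x)) $ e i"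
        unfolding h using c[OF i] scale_nonzero[OF x] bw_nonzero[OF i] dw_nonzero[OF i x] by (simp add: field_simps)
    qed
    then show ?thesis by blast
  qed
  then show "v \<in> veronese_cone k V x" unfolding veronese_cone_def by blast
qed

end

end

section \<open>All assertions about the web of a solution\<close>

context solution
begin

lemma paraconformal_dual:
  assumes V: "dual_curve k U form V"
  shows "paraconformal_structure k U (veronese_cone k V)"
    and "paraconformal_of_web k U (\<lambda>t. ker_form (form t)) (veronese_cone k V)"
proof -
  have "smooth_frame k U V" using V unfolding dual_curve_def by simp
  then show "paraconformal_structure k U (veronese_cone k V)"
    unfolding paraconformal_structure_def using openU by blast
  have "web_form k U (\<lambda>t. ker_form (form t)) form" unfolding web_form_def using coframe by simp
  then show "paraconformal_of_web k U (\<lambda>t. ker_form (form t)) (veronese_cone k V)"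
    unfolding paraconformal_of_web_def using openU V by blast
qed

theorem solution_web:
  "(let \<omega> = solution_form k e \<tau> w; D = (\<lambda>t. ker_form (\<omega> t)) in
        coframe_curve k U \<omega> \<and> veronese_web k U D \<and> (\<exists>V. dual_curve k U \<omega> V) \<and>
        (\<forall>V. dual_curve k U \<omega> V \<longrightarrow>
           paraconformal_structure k U (veronese_cone k V) \<and>
           paraconformal_of_web k U D (veronese_cone k V) \<and>
           (k > 2 \<longrightarrow>
              (\<forall>\<alpha>. smooth_on U \<alpha> \<longrightarrow> (\<exists>\<Gamma>. solution_connection k e U w \<alpha> \<Gamma>)) \<and>
              (\<forall>\<Gamma>. connection U \<Gamma> \<longrightarrow>
                 (paraconformal_connection k U V \<Gamma> \<and> totally_geodesic_for_web U D \<Gamma> \<longleftrightarrow>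
                  (\<exists>\<alpha>. smooth_on U \<alpha> \<and> solution_connection k e U w \<alpha> \<Gamma>))) \<and>
              (let good = (\<lambda>\<alpha>. smooth_on U \<alpha> \<and>
                     (\<exists>\<Gamma>. solution_connection k e U w \<alpha> \<Gamma> \<and>
                        (\<forall>t. \<forall>x\<in>U. torsion \<Gamma> (poly_curve k V t) (t_deriv (poly_curve k V) t) x
                                     \<in> span {poly_curve k V t x})))
               in \<exists>\<alpha>. good \<alpha> \<and> (\<forall>\<beta>. good \<beta> \<longrightarrow> (\<forall>x\<in>U. \<beta> x = \<alpha> x)))) \<and>
           (k = 2 \<longrightarrow>
              (let g = solution_metric e \<tau> w;
                   P = (\<lambda>\<Gamma>. torsion_free U \<Gamma> \<and> totally_geodesic_for_web U D \<Gamma> \<and>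
                            paraconformal_connection k U V \<Gamma> \<and> einstein_weyl U g \<Gamma>)
               in metric_on U g \<and>
                  (\<forall>x\<in>U. veronese_cone k V x = {v. g x v v = 0}) \<and>
                  unique_connection U P \<and>
                  (\<forall>\<Gamma>. connection U \<Gamma> \<and> P \<Gamma> \<longrightarrow> weyl_form U g \<Gamma> (solution_weyl_form e w)))) \<and>
           (k = 1 \<longrightarrow>
              (let P = (\<lambda>\<Gamma>. torsion_free U \<Gamma> \<and> paraconformal_connection k U V \<Gamma> \<and>
                     (\<forall>Y t. smooth_on U Y \<longrightarrow>
                        (\<forall>x\<in>U. nabla \<Gamma> Y (poly_curve k V t) x \<in> span {poly_curve k V t x})))
               in unique_connection U P \<and>
                  (\<forall>\<Gamma>. connection U \<Gamma> \<and> P \<Gamma> \<longrightarrow>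
                     (\<forall>Y. smooth_on U Y \<longrightarrow> (\<forall>x\<in>U.
                        nabla \<Gamma> Y (\<lambda>_. axis (e 0) 1) x =
                          ((partial (e 0) (partial (e 0) w) x / partial (e 0) w x -
                            partial (e 0) (partial (e 1) w) x / partial (e 1) w x) * (Y x $ e 0))
                          *\<^sub>R axis (e 0) 1 \<and>
                        nabla \<Gamma> Y (\<lambda>_. axis (e 1) 1) x =
                          ((partial (e 1) (partial (e 1) w) x / partial (e 1) w x -
                            partial (e 0) (partial (e 1) w) x / partial (e 0) w x) * (Y x $ e 1))
                          *\<^sub>R axis (e 1) 1)))))))"
proof -
  have S: "solution_dual k \<tau> e U w V" if "dual_curve k U form V" for V
    by (rule solution_dual.intro[OF solution_axioms solution_dual_axioms.intro[OF that]])
  show ?thesis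
    unfolding Let_def
    apply (intro conjI allI impI)
    subgoal by (rule coframe)
    subgoal by (rule web)
    subgoal by (rule exI, rule dual_coeff_dual)
    subgoal by (rule paraconformal_dual)
    subgoal by (rule paraconformal_dual)
    subgoal by (rule solution_connection_exists)
    subgoal for V \<Gamma> by (rule solution_dual.classification[OF S])
    subgoal for V by (rule solution_dual.torsion_normalisation[OF S])
    subgoal by (rule metric_on_U)
    subgoal for V using solution_dual.cone_metric[OF S] by (intro ballI)
    subgoal for V using solution_dual.three_connection_unique[OF S] by simp
    subgoal for V \<Gamma> using solution_dual.three_connection_weyl[OF S] by simp
    subgoal for V using solution_dual.plane_connection_unique[OF S] by simp
    subgoal premises p for V \<Gamma> Y
      by (intro ballI conjI solution_dual.plane_connection_formula[OF S[OF p(1)] p(2) conjunct1[OF p(3)] conjunct2[OF p(3)]])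
    done
qed

end

section \<open>Local charts from functions with independent differentials\<close>

lemma smooth_on_det:
  fixes A :: "'a::real_normed_vector \<Rightarrow> real ^ 'n ^ 'n"
  assumes "open U" "\<And>i j. smooth_on U (\<lambda>x. A x $ i $ j)"
  shows "smooth_on U (\<lambda>x. det (A x))"
  unfolding det_def by (intro smooth_on_sum smooth_on_mult smooth_on_const smooth_on_prod assms)

text \<open>The inverse function theorem gives a once differentiable inverse g. Cramer's rule
  expresses its derivative through a smooth function of g y, so each order of smoothness of g yields
  the next.\<close>

lemma local_chart:
  fixes \<phi> :: "real ^ 'n \<Rightarrow> real ^ 'n::finite"
  assumes U: "open U" and s: "smooth_on U \<phi>" and p: "p \<in> U"
    and inj: "\<And>x v. x \<in> U \<Longrightarrow> frechet_derivative \<phi> (at x) v = 0 \<Longrightarrow> v = 0"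
  shows "\<exists>W. p \<in> W \<and> W \<subseteq> U \<and> coordinate_chart W \<phi>"
proof -
  define D where "D x = frechet_derivative \<phi> (at x)" for x
  have lin: "linear (D x)" if "x \<in> U" for x unfolding D_def by (rule smooth_on_linear_derivative[OF s that])
  have injD: "inj (D x)" if "x \<in> U" for x
    unfolding linear_injective_0[OF lin[OF that]] using inj[OF that] unfolding D_def by simp
  define F where "F x = Blinfun (D x)" for x
  have F: "blinfun_apply (F x) = D x" if "x \<in> U" for x
    unfolding F_def by (rule bounded_linear_Blinfun_apply) (simp add: linear_conv_bounded_linear[symmetric] lin[OF that])
  have contF: "continuous_on U F"
  proof (rule continuous_on_blinfun_componentwise)
    fix i :: "real ^ 'n"
    have "continuous_on U (\<lambda>x. D x i)" unfolding D_def by (rule smooth_on_continuous[OF smooth_on_frechet[OF s]])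
    then show "continuous_on U (\<lambda>x. blinfun_apply (F x) i)"
      by (rule continuous_on_eq) (simp add: F)
  qed
  have der: "(\<phi> has_derivative blinfun_apply (F x)) (at x)" if "x \<in> U" for x
    unfolding F[OF that] D_def by (rule smooth_on_has_derivative[OF s that])
  obtain G where G: "linear G" "G \<circ> D p = id" using linear_injective_left_inverse[OF lin[OF p] injD[OF p]] by blast
  have inv: "Blinfun G o\<^sub>L F p = id_blinfun"
  proof (rule blinfun_eqI)
    fix v
    have "bounded_linear G" using G(1) by (simp add: linear_conv_bounded_linear)
    then show "blinfun_apply (Blinfun G o\<^sub>L F p) v = blinfun_apply id_blinfun v"
      using fun_cong[OF G(2), of v] by (simp add: F[OF p] bounded_linear_Blinfun_apply)
  qed
  define A where "A x = matrix (D x)" for x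
  have A: "A x *v v = D x v" if "x \<in> U" for x v unfolding A_def
    by (rule matrix_works) (simp add: linear_matrix_vector_mul_eq lin[OF that])
  have A_entry: "A x $ i $ j = D x (axis j 1) $ i" for x i j unfolding A_def matrix_def by simp
  have detA: "det (A x) \<noteq> 0" if "x \<in> U" for x unfolding A_def using det_nz_iff_inj[OF lin[OF that]] injD[OF that] by blast
  \<comment> \<open>\<open>H v x\<close> is Cramer's solution h of D x h = v; its components are
    quotients of determinants, hence smooth in x.\<close>
  define H where "H v x = (\<chi> m. det (\<chi> i j. if j = m then v $ i else A x $ i $ j) / det (A x))" for v :: "real ^ 'n" and x
  have sA: "smooth_on U (\<lambda>x. A x $ i $ j)" for i j
    unfolding A_entry D_def by (rule smooth_on_nth[OF U smooth_on_frechet[OF s]])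
  have sH: "smooth_on U (H v)" for v
  proof -
    have "smooth_on U (\<lambda>x. det (\<chi> i j. if j = m then v $ i else A x $ i $ j))" for m
    proof (rule smooth_on_det[OF U])
      fix i j
      show "smooth_on U (\<lambda>x. (\<chi> i j. if j = m then v $ i else A x $ i $ j) $ i $ j)"
        by (cases "j = m") (simp_all add: sA smooth_on_const[OF U])
    qed
    then show ?thesis unfolding H_def
      by (intro smooth_on_vec_lambda[OF U] smooth_on_divide[OF U _ smooth_on_det[OF U sA] detA])
  qed
  show ?thesis
  proof (rule inverse_function_theorem[OF U der contF p inv])
    fix W V g g'
    assume W: "open W" "W \<subseteq> U" "p \<in> W" and V: "open V" "\<phi> p \<in> V" and hom: "homeomorphism W V \<phi> g"
      and g: "\<And>y. y \<in> V \<Longrightarrow> (g has_derivative (g' y)) (at y)"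
      and g': "\<And>y. y \<in> V \<Longrightarrow> g' y = inv (blinfun_apply (F (g y)))"
      and bij: "\<And>y. y \<in> V \<Longrightarrow> bij (blinfun_apply (F (g y)))"
    have gU: "g y \<in> U" if "y \<in> V" for y using homeomorphism_image2[OF hom] W(2) that by blast
    have fg: "frechet_derivative g (at y) v = H v (g y)" if y: "y \<in> V" for y v
    proof -
      have e: "frechet_derivative g (at y) = inv (D (g y))"
        using frechet_derivative_at[OF g[OF y]] g'[OF y] F[OF gU[OF y]] by simp
      have "D (g y) (inv (D (g y)) v) = v"
        using bij[OF y] unfolding F[OF gU[OF y]] by (simp add: bij_is_surj surj_f_inv_f)
      then have "A (g y) *v frechet_derivative g (at y) v = v" unfolding e A[OF gU[OF y]] .
      then show ?thesis unfolding H_def using cramer[OF detA[OF gU[OF y]]] by blast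
    qed
    have "Ck_on n V g" for n
    proof (induction n)
      case 0
      then show ?case using homeomorphism_cont2[OF hom] by simp
    next
      case (Suc n)
      have "Ck_on n V (\<lambda>y. frechet_derivative g (at y) v)" for v
      proof -
        have "Ck_param {0::real} n V (\<lambda>_ y. H v (g y))"
        proof (rule Ck_param_compose[OF V(1) U, where F = "H v" and q = "\<lambda>_. g"])
          show "Ck_on n U (H v)" using sH[of v] unfolding smooth_on_def by simp
          show "Ck_param {0::real} n V (\<lambda>_. g)" using Suc unfolding Ck_on_eq_Ck_param .
          show "\<And>s y. s \<in> {0::real} \<Longrightarrow> y \<in> V \<Longrightarrow> g y \<in> U" by (rule gU)
        qed
        then show ?thesis unfolding Ck_on_eq_Ck_param
          by (rule Ck_param_cong_imp[OF V(1), rotated]) (simp add: fg)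
      qed
      moreover have "\<forall>y\<in>V. g differentiable (at y)" using g differentiableI by metis
      ultimately show ?case by simp
    qed
    then have sg: "smooth_on V g" unfolding smooth_on_def by simp
    have im: "\<phi> ` W = V" by (rule homeomorphism_image1[OF hom])
    have injW: "inj_on \<phi> W" by (rule inj_on_inverseI[of _ g]) (rule homeomorphism_apply1[OF hom])
    have "smooth_on V (inv_into W \<phi>)"
    proof (rule smooth_on_cong[OF V(1) _ sg])
      fix y assume "y \<in> V"
      then obtain x where x: "x \<in> W" "y = \<phi> x" using im by blast
      then show "g y = inv_into W \<phi> y" using inv_into_f_f[OF injW x(1)] homeomorphism_apply1[OF hom x(1)] by simp
    qed
    then have "coordinate_chart W \<phi>" unfolding coordinate_chart_def im
      using W(1) V(1) injW smooth_on_subset[OF s W(2)] by simp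
    then show ?thesis using W by blast
  qed
qed

lemma chart_pushforward:
  fixes \<phi> :: "'a::euclidean_space \<Rightarrow> 'a" and f :: "'a \<Rightarrow> 'b::real_normed_vector"
  assumes ch: "coordinate_chart W \<phi>" and f: "smooth_on W f"
  defines "h \<equiv> \<lambda>y. f (inv_into W \<phi> y)"
  shows "smooth_on (\<phi> ` W) h"
    and "x \<in> W \<Longrightarrow> frechet_derivative h (at (\<phi> x)) (frechet_derivative \<phi> (at x) v) = frechet_derivative f (at x) v"
proof -
  note c = ch[unfolded coordinate_chart_def]
  have W: "open W" and V: "open (\<phi> ` W)" and inj: "inj_on \<phi> W" and s: "smooth_on W \<phi>"
    and g: "smooth_on (\<phi> ` W) (inv_into W \<phi>)" using c by auto
  show h: "smooth_on (\<phi> ` W) h" unfolding h_def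
    by (rule smooth_on_compose[OF V W f g]) (rule inv_into_into)
  show "frechet_derivative h (at (\<phi> x)) (frechet_derivative \<phi> (at x) v) = frechet_derivative f (at x) v" if x: "x \<in> W"
  proof -
    have "(h has_derivative frechet_derivative h (at (\<phi> x))) (at (\<phi> x))"
      by (rule smooth_on_has_derivative[OF h]) (use x in simp)
    then have "(h \<circ> \<phi> has_derivative frechet_derivative h (at (\<phi> x)) \<circ> frechet_derivative \<phi> (at x)) (at x)"
      by (rule diff_chain_at[OF smooth_on_has_derivative[OF s x]])
    then have e: "frechet_derivative (h \<circ> \<phi>) (at x) = frechet_derivative h (at (\<phi> x)) \<circ> frechet_derivative \<phi> (at x)"
      by (rule frechet_derivative_at[symmetric])
    have "frechet_derivative (h \<circ> \<phi>) (at x) = frechet_derivative f (at x)"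
      by (rule frechet_cong[OF W x f]) (simp add: h_def inv_into_f_f[OF inj])
    then show ?thesis using fun_cong[OF e, of v] by simp
  qed
qed

text \<open>One vector z outside the common kernel fixes the factor, and subtracting a multiple of z
  brings any other vector into the kernel.\<close>

lemma form_proportional:
  fixes a :: "'a::real_inner" and L :: "'a \<Rightarrow> real"
  assumes lin: "linear L" and nz: "L \<noteq> (\<lambda>v. 0)" and ker: "{v. a \<bullet> v = 0} = {v. L v = 0}"
  shows "\<exists>c. c \<noteq> 0 \<and> (\<forall>v. a \<bullet> v = c * L v)"
proof -
  obtain z where z: "L z \<noteq> 0" using nz by blast
  have az: "a \<bullet> z \<noteq> 0" using ker z by blast
  have "a \<bullet> v = (a \<bullet> z / L z) * L v" for v
  proof -
    have "L (v - (L v / L z) *\<^sub>R z) = 0" using z by (simp add: linear_diff[OF lin] linear_scale[OF lin])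
    then have "a \<bullet> (v - (L v / L z) *\<^sub>R z) = 0" using ker by blast
    then show ?thesis by (simp add: inner_diff_right)
  qed
  moreover have "a \<bullet> z / L z \<noteq> 0" using az z by simp
  ultimately show ?thesis by blast
qed

lemma vector_polynomial_eq:
  fixes a b :: "nat \<Rightarrow> real ^ 'n::finite"
  assumes "\<And>t. (\<Sum>j\<le>k. t ^ j *\<^sub>R a j) = (\<Sum>j\<le>k. t ^ j *\<^sub>R b j)" "j \<le> k"
  shows "a j = b j"
proof (rule vec_eq_iff[THEN iffD2], rule allI)
  fix m
  have "(\<Sum>j\<le>k. a j $ m * t ^ j) = (\<Sum>j\<le>k. b j $ m * t ^ j)" for t
    using arg_cong[OF assms(1)[of t], of "\<lambda>v. v $ m"] by (simp add: mult.commute)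
  then show "a j $ m = b j $ m" using polyfun_eq_coeffs[of "\<lambda>j. a j $ m" k "\<lambda>j. b j $ m"] assms(2) by blast
qed

section \<open>Normal form of a Veronese web\<close>

locale web_coordinates = nodes k \<tau> + coordinates k e
  for k :: nat and \<tau> :: "nat \<Rightarrow> real" and e :: "nat \<Rightarrow> 'n::finite"
begin

lemma solution_form_inner:
  "solution_form k e \<tau> w t x \<bullet> v = (\<Sum>i\<le>k. wt i * np i t * partial (e i) w x * v $ e i)" for v :: "real ^ 'n"
  unfolding solution_form_def poly_node_poly wt_def by (simp add: inner_sum_left inner_axis')

lemma np_mult_gap: "i \<le> k \<Longrightarrow> np i t * (t - \<tau> i) = (\<Prod>j\<le>k. t - \<tau> j)"
  unfolding poly_node_poly by (simp add: prod.remove[of "{..k}" i] mult.commute)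

text \<open>Here d\<Phi> is a function g times the form at s. Symmetry of the second derivatives of
  \<Phi> expresses g (b_j - b_i) \<partial>_i \<partial>_j w through dg, and the cyclic combination
  eliminates dg. What remains is the system times a factor that is nonzero because s is none of the
  nodes.\<close>

lemma system_from_exact:
  fixes \<Phi> w :: "real ^ 'n \<Rightarrow> real"
  assumes Y: "open Y" and \<Phi>: "smooth_on Y \<Phi>" and w: "smooth_on Y w"
    and s: "s \<notin> \<tau> ` {..k + 1}" and nz: "\<And>i y. i \<le> k \<Longrightarrow> y \<in> Y \<Longrightarrow> partial (e i) w y \<noteq> 0"
    and exact: "\<And>y. y \<in> Y \<Longrightarrow> \<exists>r. r \<noteq> 0 \<and> (\<forall>i\<le>k. partial (e i) \<Phi> y = r * (wt i * np i s * partial (e i) w y))"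
    and y: "y \<in> Y" and ijl: "i \<le> k" "j \<le> k" "l \<le> k"
  shows "(\<tau> i - \<tau> j) * wt l * partial (e i) (partial (e j) w) y * partial (e l) w y
    + (\<tau> j - \<tau> l) * wt i * partial (e j) (partial (e l) w) y * partial (e i) w y
    + (\<tau> l - \<tau> i) * wt j * partial (e l) (partial (e i) w) y * partial (e j) w y = 0"
proof -
  define b where "b i = wt i * np i s" for i
  define q where "q i = s - \<tau> i" for i
  define N where "N = (\<Prod>j\<le>k. s - \<tau> j)"
  have q: "q i \<noteq> 0" if "i \<le> k" for i
  proof -
    have "\<tau> i \<in> \<tau> ` {..k + 1}" using that by simp
    then show ?thesis using s unfolding q_def by auto
  qed
  have N: "N \<noteq> 0" unfolding N_def using q unfolding q_def by simp
  have bq: "b i * q i = wt i * N" if "i \<le> k" for i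
    unfolding b_def q_def N_def using np_mult_gap[OF that, of s] by simp
  have b: "b i \<noteq> 0" if "i \<le> k" for i using bq[OF that] wt_nonzero[OF that] N by auto
  \<comment> \<open>The integrating factor is read off from component 0, which shows that it is
    smooth.\<close>
  define g where "g z = partial (e 0) \<Phi> z / (b 0 * partial (e 0) w z)" for z
  have sg: "smooth_on Y g" unfolding g_def
    using b[of 0] nz[of 0] by (intro smooth_on_divide smooth_on_mult smooth_on_const smooth_on_partial Y \<Phi> w) simp
  have \<Phi>g: "g z \<noteq> 0 \<and> (\<forall>i\<le>k. partial (e i) \<Phi> z = g z * (b i * partial (e i) w z))" if z: "z \<in> Y" for z
  proof -
    obtain r where r: "r \<noteq> 0" "\<And>i. i \<le> k \<Longrightarrow> partial (e i) \<Phi> z = r * (b i * partial (e i) w z)"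
      using exact[OF z] unfolding b_def by blast
    have "g z = r" unfolding g_def r(2)[OF le0] using b[OF le0] nz[OF le0 z] by simp
    then show ?thesis using r by simp
  qed
  have second: "partial m (partial (e j) \<Phi>) y
      = g y * (b j * partial m (partial (e j) w) y) + partial m g y * (b j * partial (e j) w y)" if j: "j \<le> k" for m j
  proof -
    have sm: "smooth_on Y (\<lambda>z. g z * (b j * partial (e j) w z))"
      by (intro smooth_on_mult smooth_on_const smooth_on_partial Y sg w)
    have "frechet_derivative (partial (e j) \<Phi>) (at y) = frechet_derivative (\<lambda>z. g z * (b j * partial (e j) w z)) (at y)"
      by (rule frechet_cong[OF Y y sm]) (use \<Phi>g j in simp)
    also have "\<dots> = (\<lambda>h. g y * (b j * frechet_derivative (partial (e j) w) (at y) h)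
        + frechet_derivative g (at y) h * (b j * partial (e j) w y))"
      by (rule frechet_derivative_at[symmetric], rule has_derivative_mult,
          rule smooth_on_has_derivative[OF sg y], rule has_derivative_mult_right,
          rule smooth_on_has_derivative[OF smooth_on_partial[OF w] y])
    finally show ?thesis unfolding partial_def by simp
  qed
  have sym: "partial m (partial m' f) y = partial m' (partial m f) y" if "smooth_on Y f" for m m' and f :: "real ^ 'n \<Rightarrow> real"
    unfolding partial_def using smooth_derivative_symmetric[OF Y that y] .
  have E: "g y * (b j * partial (e i) (partial (e j) w) y) + partial (e i) g y * (b j * partial (e j) w y)
      = g y * (b i * partial (e i) (partial (e j) w) y) + partial (e j) g y * (b i * partial (e i) w y)"
    if "i \<le> k" "j \<le> k" for i j
    using sym[OF \<Phi>, of "e i" "e j"] unfolding second[OF that(1)] second[OF that(2)]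
    using sym[OF w, of "e i" "e j"] by simp
  define wi where "wi i = partial (e i) w y" for i
  define ww where "ww i j = partial (e i) (partial (e j) w) y" for i j
  define gi where "gi i = partial (e i) g y" for i
  note E' = E[folded wi_def ww_def gi_def]
  have e: "g y * ((b j - b i) * ww i j) = gi j * (b i * wi i) - gi i * (b j * wi j)" if "i \<le> k" "j \<le> k" for i j
    using E'[OF that] by (simp add: algebra_simps)
  have "g y * ((b j - b i) * b l * (ww i j * wi l) + (b l - b j) * b i * (ww j l * wi i) + (b i - b l) * b j * (ww l i * wi j))
    = (g y * ((b j - b i) * ww i j)) * (b l * wi l) + (g y * ((b l - b j) * ww j l)) * (b i * wi i)
      + (g y * ((b i - b l) * ww l i)) * (b j * wi j)"
    by (simp add: algebra_simps)
  also have "\<dots> = 0" unfolding e[OF ijl(1,2)] e[OF ijl(2,3)] e[OF ijl(3,1)] by (simp add: algebra_simps)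
  finally have "g y * ((b j - b i) * b l * (ww i j * wi l) + (b l - b j) * b i * (ww j l * wi i) + (b i - b l) * b j * (ww l i * wi j)) = 0" .
  then have z: "(b j - b i) * b l * (ww i j * wi l) + (b l - b j) * b i * (ww j l * wi i) + (b i - b l) * b j * (ww l i * wi j) = 0"
    using \<Phi>g[OF y] by simp
  define T where "T = \<tau> (k + 1)"
  \<comment> \<open>The factors q turn each b into wt times the full node product N, after which the
    difference factors; N^2 (T - s) is common to the three terms.\<close>
  have d: "(b j - b i) * b l * (q i * q j * q l) = - (N ^ 2 * (T - s) * ((\<tau> i - \<tau> j) * wt l))"
    if "i \<le> k" "j \<le> k" "l \<le> k" for i j l
  proof -
    have "(b j - b i) * b l * (q i * q j * q l) = (b j * q j) * (b l * q l) * q i - (b i * q i) * (b l * q l) * q j"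
      by (simp add: algebra_simps)
    also have "\<dots> = (wt j * N) * (wt l * N) * q i - (wt i * N) * (wt l * N) * q j" unfolding bq[OF that(1)] bq[OF that(2)] bq[OF that(3)] ..
    also have "\<dots> = - (N ^ 2 * (T - s) * ((\<tau> i - \<tau> j) * wt l))"
    proof -
      have "\<tau> i = T - wt i" "\<tau> j = T - wt j" unfolding wt_def T_def by simp_all
      then show ?thesis unfolding q_def by (simp only:) (simp add: algebra_simps power2_eq_square)
    qed
    finally show ?thesis .
  qed
  have "(N ^ 2 * (T - s)) * ((\<tau> i - \<tau> j) * wt l * ww i j * wi l + (\<tau> j - \<tau> l) * wt i * ww j l * wi i
      + (\<tau> l - \<tau> i) * wt j * ww l i * wi j)
    = - (((b j - b i) * b l * (q i * q j * q l)) * (ww i j * wi l) + ((b l - b j) * b i * (q j * q l * q i)) * (ww j l * wi i)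
      + ((b i - b l) * b j * (q l * q i * q j)) * (ww l i * wi j))"
    unfolding d[OF ijl] d[OF ijl(2,3,1)] d[OF ijl(3,1,2)] by (simp add: algebra_simps)
  also have "\<dots> = - ((q i * q j * q l) * ((b j - b i) * b l * (ww i j * wi l) + (b l - b j) * b i * (ww j l * wi i)
      + (b i - b l) * b j * (ww l i * wi j)))"
    by (simp add: algebra_simps)
  also have "\<dots> = 0" unfolding z by simp
  finally have "(N ^ 2 * (T - s)) * ((\<tau> i - \<tau> j) * wt l * ww i j * wi l + (\<tau> j - \<tau> l) * wt i * ww j l * wi i
      + (\<tau> l - \<tau> i) * wt j * ww l i * wi j) = 0" .
  moreover have "T - s \<noteq> 0" using s unfolding T_def by auto
  ultimately show ?thesis using N unfolding wi_def ww_def by simp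
qed

end

context web_coordinates
begin

theorem normal_form:
  fixes U :: "(real ^ 'n) set"
  assumes U: "open U" and web: "veronese_web k U D" and par: "paraconformal_of_web k U D C" and p: "p \<in> U"
  shows "\<exists>W \<phi> w V. p \<in> W \<and> W \<subseteq> U \<and> coordinate_chart W \<phi> \<and>
           admissible_solution k e \<tau> (\<phi> ` W) w \<and>
           dual_curve k (\<phi> ` W) (solution_form k e \<tau> w) V \<and>
           (\<forall>x\<in>W. (\<forall>t. D t x = {v. frechet_derivative \<phi> (at x) v
                                       \<in> ker_form (solution_form k e \<tau> w t) (\<phi> x)}) \<and>
                  C x = {v. frechet_derivative \<phi> (at x) v \<in> veronese_cone k V (\<phi> x)})"
proof -
  have "\<exists>W \<omega> V. open W \<and> p \<in> W \<and> W \<subseteq> U \<and> web_form k W D \<omega> \<and> dual_curve k W \<omega> V \<and> (\<forall>x\<in>W. C x = veronese_cone k V x)"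
    using par p unfolding paraconformal_of_web_def by (rule bspec)
  then obtain W0 \<omega> V0 where W0: "open W0" "p \<in> W0" "W0 \<subseteq> U" and wf: "web_form k W0 D \<omega>"
    and V0: "dual_curve k W0 \<omega> V0" and C: "\<And>x. x \<in> W0 \<Longrightarrow> C x = veronese_cone k V0 x"
    by (elim exE conjE) simp
  have D: "D t x = ker_form (\<omega> t) x" if "x \<in> W0" for t x using wf that unfolding web_form_def by simp
  obtain \<eta> where \<eta>: "smooth_frame k W0 \<eta>" and \<omega>\<eta>: "\<And>x t. x \<in> W0 \<Longrightarrow> \<omega> t x = poly_curve k \<eta> t x"
    using wf unfolding web_form_def coframe_curve_def by (elim exE conjE) simp
  have "\<exists>s::real. s \<notin> \<tau> ` {..k + 1}" by (rule ex_new_if_finite[OF infinite_UNIV_char_0]) simp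
  then obtain s where s: "s \<notin> \<tau> ` {..k + 1}" ..
  have "\<forall>t. \<exists>Y f. p \<in> Y \<and> defining_function Y (D t) f"
    using web p unfolding veronese_web_def codim1_foliation_def by blast
  then obtain Y where "\<forall>t. \<exists>f. p \<in> Y t \<and> defining_function (Y t) (D t) f" unfolding choice_iff ..
  then obtain f where Yf: "\<forall>t. p \<in> Y t \<and> defining_function (Y t) (D t) (f t)" unfolding choice_iff ..
  \<comment> \<open>Only finitely many foliations are used, so the domains of their defining
    functions have an open intersection; s is the further value outside all nodes.\<close>
  define S where "S = insert s (\<tau> ` {..k + 1})"
  have S_node: "\<tau> i \<in> S" if "i \<le> k" for i unfolding S_def using that by simp
  have S_last: "\<tau> (k + 1) \<in> S" and S_s: "s \<in> S" unfolding S_def by simp_all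
  define W1 where "W1 = W0 \<inter> (\<Inter>t\<in>S. Y t)"
  have openY: "open (Y t)" for t using Yf unfolding defining_function_def by blast
  have oW1: "open W1" unfolding W1_def using W0(1) openY by (intro open_Int open_INT) (simp_all add: S_def)
  have pW1: "p \<in> W1" unfolding W1_def using W0(2) Yf by simp
  have W1: "W1 \<subseteq> W0" "\<And>t. t \<in> S \<Longrightarrow> W1 \<subseteq> Y t" unfolding W1_def by auto
  have sf: "smooth_on W1 (f t)" if "t \<in> S" for t
  proof -
    have "smooth_on (Y t) (f t)" using Yf unfolding defining_function_def by simp
    then show ?thesis by (rule smooth_on_subset) (rule W1(2)[OF that])
  qed
  have prop_f: "\<exists>c. c \<noteq> 0 \<and> (\<forall>v. \<omega> t x \<bullet> v = c * frechet_derivative (f t) (at x) v)" if t: "t \<in> S" and x: "x \<in> W1" for t x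
  proof (rule form_proportional)
    show "linear (frechet_derivative (f t) (at x))" by (rule smooth_on_linear_derivative[OF sf[OF t] x])
    have "x \<in> Y t" using W1(2)[OF t] x by blast
    then have d: "frechet_derivative (f t) (at x) \<noteq> (\<lambda>v. 0) \<and> D t x = {v. frechet_derivative (f t) (at x) v = 0}"
      using Yf unfolding defining_function_def by blast
    then show "frechet_derivative (f t) (at x) \<noteq> (\<lambda>v. 0)" ..
    have "D t x = {v. \<omega> t x \<bullet> v = 0}" using D[of x t] W1(1) x unfolding ker_form_def by blast
    then show "{v. \<omega> t x \<bullet> v = 0} = {v. frechet_derivative (f t) (at x) v = 0}" using d by simp
  qed
  define P where "P x v = (\<Sum>j\<le>k. monom (\<eta> j x \<bullet> v) j)" for x v
  have degP: "degree (P x v) \<le> k" for x v unfolding P_def by (intro degree_sum_le) (auto intro: order_trans[OF degree_monom_le])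
  have polyP: "poly (P x v) t = \<omega> t x \<bullet> v" if "x \<in> W0" for x v t
    unfolding P_def \<omega>\<eta>[OF that] poly_curve_def by (simp add: poly_sum poly_monom inner_sum_left mult.commute)
  have coeffP: "coeff (P x v) j = \<eta> j x \<bullet> v" if "j \<le> k" for x v j
  proof -
    have "coeff (P x v) j = (\<Sum>i\<le>k. if i = j then \<eta> i x \<bullet> v else 0)" unfolding P_def by (simp add: coeff_sum)
    then show ?thesis using that by simp
  qed
  have Lag: "\<omega> t x \<bullet> v = (\<Sum>i\<le>k. \<omega> (\<tau> i) x \<bullet> v / np i (\<tau> i) * np i t)" if "x \<in> W0" for x v t
    using interpolation_poly[OF degP, of x v t] unfolding polyP[OF that] .
  \<comment> \<open>A polynomial of degree at most k with k + 1 roots is zero, and the coefficients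
    of the form are a coframe; this will make the derivative of \<open>\<phi>\<close>
    injective.\<close>
  have vanish: "v = 0" if x: "x \<in> W0" and z: "\<And>i. i \<le> k \<Longrightarrow> \<omega> (\<tau> i) x \<bullet> v = 0" for x v
  proof -
    have "poly (P x v) t = 0" for t unfolding polyP[OF x] Lag[OF x, of t] using z by simp
    then have "P x v = 0" using poly_all_0_iff_0 by blast
    then have "\<eta> j x \<bullet> v = 0" if "j \<le> k" for j using coeffP[OF that, of x v] by simp
    then have "orthogonal v y" if "y \<in> (\<lambda>i. \<eta> i x) ` {..k}" for y
      using that unfolding orthogonal_def by (auto simp: inner_commute)
    moreover have "v \<in> span ((\<lambda>i. \<eta> i x) ` {..k})" using \<eta> x unfolding smooth_frame_def by simp
    ultimately have "orthogonal v v" by (rule orthogonal_to_span[rotated])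
    then show ?thesis unfolding orthogonal_def by simp
  qed
  define \<phi> where "\<phi> x = (\<Sum>i\<le>k. f (\<tau> i) x *\<^sub>R axis (e i) (1::real))" for x
  have s\<phi>: "smooth_on W1 \<phi>" unfolding \<phi>_def
    by (intro smooth_on_sum smooth_on_scaleR smooth_on_const oW1 sf S_node) simp
  have \<phi>': "frechet_derivative \<phi> (at x) v $ e i = frechet_derivative (f (\<tau> i)) (at x) v" if "x \<in> W1" "i \<le> k" for x v i
  proof -
    have "(\<lambda>y. \<phi> y $ e i) = f (\<tau> i)" unfolding \<phi>_def using sum_axis_coord[OF that(2)] by (intro ext)
    then show ?thesis using frechet_nth[OF s\<phi> that(1), of v "e i"] by simp
  qed
  have inj\<phi>: "v = 0" if x: "x \<in> W1" and z: "frechet_derivative \<phi> (at x) v = 0" for x v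
  proof (rule vanish)
    show "x \<in> W0" using W1(1) x by blast
    fix i assume i: "i \<le> k"
    obtain c where "\<omega> (\<tau> i) x \<bullet> v = c * frechet_derivative (f (\<tau> i)) (at x) v" using prop_f[OF S_node[OF i] x] by blast
    then show "\<omega> (\<tau> i) x \<bullet> v = 0" unfolding \<phi>'[OF x i, symmetric] z by simp
  qed
  have "\<exists>W. p \<in> W \<and> W \<subseteq> W1 \<and> coordinate_chart W \<phi>" by (rule local_chart[OF oW1 s\<phi> pW1 inj\<phi>])
  then obtain W where W: "p \<in> W" "W \<subseteq> W1" and ch: "coordinate_chart W \<phi>" by (elim exE conjE)
  define h where "h t y = f t (inv_into W \<phi> y)" for t y
  have sh: "smooth_on (\<phi> ` W) (h t)" if "t \<in> S" for t
    unfolding h_def by (rule chart_pushforward(1)[OF ch smooth_on_subset[OF sf[OF that] W(2)]])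
  have h': "frechet_derivative (h t) (at (\<phi> x)) (frechet_derivative \<phi> (at x) v) = frechet_derivative (f t) (at x) v"
    if "t \<in> S" "x \<in> W" for t x v
    unfolding h_def by (rule chart_pushforward(2)[OF ch smooth_on_subset[OF sf[OF that(1)] W(2)] that(2)])
  have oV: "open (\<phi> ` W)" using ch unfolding coordinate_chart_def by blast
  define w where "w = h (\<tau> (k + 1))"
  have lin\<phi>: "linear (frechet_derivative \<phi> (at x))" if "x \<in> W" for x
    by (rule smooth_on_linear_derivative[OF s\<phi>]) (use that W(2) in blast)
  have inj: "inj (frechet_derivative \<phi> (at x))" if "x \<in> W" for x
    unfolding linear_injective_0[OF lin\<phi>[OF that]] using inj\<phi> that W(2) by blast
  have surj: "\<exists>v. frechet_derivative \<phi> (at x) v = u" if "x \<in> W" for x u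
    using linear_injective_imp_surjective[OF lin\<phi>[OF that] inj[OF that]] by (metis surjD)
  \<comment> \<open>The form is the Lagrange interpolation of its values at the nodes, which are
    multiples \<open>c (\<tau> i)\<close> of the coordinate differentials. At T = \<tau> (k + 1) it
    is a multiple of dw, and this expresses each \<open>c (\<tau> i)\<close> through \<partial>_i w;
    one factor K then serves for all t.\<close>
  have key: "(\<forall>i\<le>k. partial (e i) w (\<phi> x) \<noteq> 0) \<and> (\<exists>K. K \<noteq> 0 \<and>
      (\<forall>t v. \<omega> t x \<bullet> v = K * (solution_form k e \<tau> w t (\<phi> x) \<bullet> frechet_derivative \<phi> (at x) v)))" if xW: "x \<in> W" for x
  proof -
    have x: "x \<in> W1" "x \<in> W0" using xW W(2) W1(1) by auto
    have "\<forall>t. \<exists>c. t \<in> S \<longrightarrow> c \<noteq> 0 \<and> (\<forall>v. \<omega> t x \<bullet> v = c * frechet_derivative (f t) (at x) v)" using prop_f x(1) by blast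
    then obtain c where c: "\<And>t. t \<in> S \<Longrightarrow> c t \<noteq> 0" "\<And>t v. t \<in> S \<Longrightarrow> \<omega> t x \<bullet> v = c t * frechet_derivative (f t) (at x) v"
      unfolding choice_iff by blast
    define T where "T = \<tau> (k + 1)"
    have \<omega>_eq: "\<omega> t x \<bullet> v = (\<Sum>i\<le>k. c (\<tau> i) / np i (\<tau> i) * np i t * frechet_derivative \<phi> (at x) v $ e i)" for t v
      unfolding Lag[OF x(2), of t v]
      by (rule sum.cong[OF refl]) (simp add: c(2)[OF S_node] \<phi>'[OF x(1)])
    have dw: "c T * partial (e i) w (\<phi> x) = c (\<tau> i) / np i (\<tau> i) * np i T" if i: "i \<le> k" for i
    proof -
      obtain v where v: "frechet_derivative \<phi> (at x) v = axis (e i) 1" using surj[OF xW] by blast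
      have "c T * partial (e i) w (\<phi> x) = \<omega> T x \<bullet> v"
        unfolding partial_def w_def v[symmetric] h'[OF S_last xW] T_def c(2)[OF S_last] ..
      also have "\<dots> = (\<Sum>j\<le>k. if j = i then c (\<tau> j) / np j (\<tau> j) * np j T else 0)"
        unfolding \<omega>_eq v by (rule sum.cong[OF refl]) (use i in \<open>simp add: axis_coord\<close>)
      finally show ?thesis using i by simp
    qed
    have cT: "c T \<noteq> 0" unfolding T_def by (rule c(1)[OF S_last])
    define N where "N = (\<Prod>j\<le>k. T - \<tau> j)"
    \<comment> \<open>The product over all nodes does not depend on i, so the weights wt account for
      the node polynomials at T up to one factor.\<close>
    have N: "wt i * np i T = N" if "i \<le> k" for i
      using np_mult_gap[OF that, of T] unfolding N_def wt_def T_def by (simp add: mult.commute)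
    have npT: "np i T \<noteq> 0" if "i \<le> k" for i unfolding T_def by (rule np_last_nonzero[OF that])
    have N0: "N \<noteq> 0" using N[of 0] wt_nonzero[of 0] npT[of 0] by auto
    have nz: "partial (e i) w (\<phi> x) \<noteq> 0" if i: "i \<le> k" for i
    proof
      assume "partial (e i) w (\<phi> x) = 0"
      then have "c (\<tau> i) / np i (\<tau> i) * np i T = 0" using dw[OF i] by simp
      then show False using c(1)[OF S_node[OF i]] np_self_nonzero[OF i] npT[OF i] by simp
    qed
    have ci: "c (\<tau> i) / np i (\<tau> i) = c T / N * (wt i * partial (e i) w (\<phi> x))" if i: "i \<le> k" for i
    proof -
      have "c (\<tau> i) / np i (\<tau> i) * N = wt i * (c (\<tau> i) / np i (\<tau> i) * np i T)" unfolding N[OF i, symmetric] by simp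
      also have "\<dots> = wt i * (c T * partial (e i) w (\<phi> x))" unfolding dw[OF i] ..
      finally show ?thesis using N0 by (simp add: divide_simps mult_ac)
    qed
    have "\<omega> t x \<bullet> v = c T / N * (solution_form k e \<tau> w t (\<phi> x) \<bullet> frechet_derivative \<phi> (at x) v)" for t v
      unfolding \<omega>_eq solution_form_inner sum_distrib_left by (rule sum.cong[OF refl]) (simp add: ci mult_ac)
    moreover have "c T / N \<noteq> 0" using cT N0 by simp
    ultimately show ?thesis using nz by blast
  qed
  have nz: "partial (e i) w y \<noteq> 0" if "i \<le> k" "y \<in> \<phi> ` W" for i y using key that by blast
  \<comment> \<open>In the chart the form at s is a multiple both of d(h s) and of the solution
    form, which is the input of \<open>system_from_exact\<close>.\<close>
  have exact: "\<exists>r. r \<noteq> 0 \<and> (\<forall>i\<le>k. partial (e i) (h s) y = r * (wt i * np i s * partial (e i) w y))" if y: "y \<in> \<phi> ` W" for y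
  proof -
    obtain x where xW: "x \<in> W" and yx: "y = \<phi> x" using y by blast
    obtain K where K: "K \<noteq> 0" "\<And>t v. \<omega> t x \<bullet> v = K * (solution_form k e \<tau> w t (\<phi> x) \<bullet> frechet_derivative \<phi> (at x) v)"
      using key[OF xW] by blast
    obtain c where c: "c \<noteq> 0" "\<And>v. \<omega> s x \<bullet> v = c * frechet_derivative (f s) (at x) v" using prop_f[OF S_s] xW W(2) by blast
    have "partial (e i) (h s) y = K / c * (wt i * np i s * partial (e i) w y)" if i: "i \<le> k" for i
    proof -
      obtain v where v: "frechet_derivative \<phi> (at x) v = axis (e i) 1" using surj[OF xW] by blast
      have "solution_form k e \<tau> w s (\<phi> x) \<bullet> axis (e i) 1
          = (\<Sum>j\<le>k. if j = i then wt j * np j s * partial (e j) w (\<phi> x) else 0)"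
        unfolding solution_form_inner by (rule sum.cong[OF refl]) (use i in \<open>simp add: axis_coord\<close>)
      also have "\<dots> = wt i * np i s * partial (e i) w (\<phi> x)" using i by simp
      finally have "c * partial (e i) (h s) y = K * (wt i * np i s * partial (e i) w y)"
        unfolding partial_def[of _ "h s"] yx v[symmetric] h'[OF S_s xW] c(2)[symmetric] K(2) by simp
      then show ?thesis using c(1) by (simp add: field_simps)
    qed
    then show ?thesis using K(1) c(1) by (intro exI[of _ "K / c"]) simp
  qed
  have sw: "smooth_on (\<phi> ` W) w" unfolding w_def by (rule sh[OF S_last])
  have adm: "admissible_solution k e \<tau> (\<phi> ` W) w"
    unfolding admissible_solution_def system_coeff_def wt_def[symmetric]
  proof (intro conjI allI impI ballI)
    fix i j l y assume "i < j \<and> j < l \<and> l \<le> k" and y: "y \<in> \<phi> ` W"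
    then have ijl: "i \<le> k" "j \<le> k" "l \<le> k" by simp_all
    show "(\<tau> i - \<tau> j) * wt l * partial (e i) (partial (e j) w) y * partial (e l) w y
      + (\<tau> j - \<tau> l) * wt i * partial (e j) (partial (e l) w) y * partial (e i) w y
      + (\<tau> l - \<tau> i) * wt j * partial (e l) (partial (e i) w) y * partial (e j) w y = 0"
      by (rule system_from_exact[OF oV sh[OF S_s] sw s nz exact y ijl])
  qed (use sw nz in auto)
  interpret new: solution k \<tau> e "\<phi> ` W" w by unfold_locales (rule oV, rule adm)
  have main: "(\<forall>t. D t x = {v. frechet_derivative \<phi> (at x) v \<in> ker_form (solution_form k e \<tau> w t) (\<phi> x)}) \<and>
      C x = {v. frechet_derivative \<phi> (at x) v \<in> veronese_cone k new.dual_coeff (\<phi> x)}" if xW: "x \<in> W" for x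
  proof
    have x: "x \<in> W0" "\<phi> x \<in> \<phi> ` W" using xW W(2) W1(1) by auto
    let ?L = "frechet_derivative \<phi> (at x)"
    note lin = lin\<phi>[OF xW]
    obtain K where K: "K \<noteq> 0" "\<And>t v. \<omega> t x \<bullet> v = K * (solution_form k e \<tau> w t (\<phi> x) \<bullet> ?L v)"
      using key[OF xW] by blast
    show "\<forall>t. D t x = {v. ?L v \<in> ker_form (solution_form k e \<tau> w t) (\<phi> x)}"
      unfolding D[OF x(1)] ker_form_def K(2) using K(1) by simp
    \<comment> \<open>The image of the given dual curve under the derivative of
      \<open>\<phi>\<close> is dual to the solution form, hence one constant multiple of the
      standard dual curve for all t; comparing coefficients in t extends this to the whole cone,
      including its point at infinity.\<close>
    have "\<exists>c. \<forall>s. solution_form k e \<tau> w s (\<phi> x) \<bullet> (\<Sum>j\<le>k. t ^ j *\<^sub>R ?L (V0 j x)) = c * (s - t) ^ k" for t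
    proof -
      have "\<forall>j<k. poly_curve k V0 t x \<in> ker_form ((t_deriv ^^ j) \<omega> t) x" using V0 x(1) unfolding dual_curve_def by blast
      then have "\<exists>c. \<forall>s. \<omega> s x \<bullet> poly_curve k V0 t x = c * (s - t) ^ k"
        unfolding ker_derivatives_iff[of \<omega> x k \<eta>, OF \<omega>\<eta>[OF x(1)]] .
      then obtain c where c: "\<And>s. K * (solution_form k e \<tau> w s (\<phi> x) \<bullet> ?L (poly_curve k V0 t x)) = c * (s - t) ^ k"
        unfolding K(2) by blast
      have "?L (poly_curve k V0 t x) = (\<Sum>j\<le>k. t ^ j *\<^sub>R ?L (V0 j x))"
        unfolding poly_curve_def linear_sum[OF lin] by (simp add: linear_scale[OF lin])
      then have "solution_form k e \<tau> w s (\<phi> x) \<bullet> (\<Sum>j\<le>k. t ^ j *\<^sub>R ?L (V0 j x)) = c / K * (s - t) ^ k" for s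
        using c[of s] K(1) by (simp add: field_simps)
      then show ?thesis by blast
    qed
    then obtain c where c: "\<And>t i. i \<le> k \<Longrightarrow> (\<Sum>j\<le>k. t ^ j *\<^sub>R ?L (V0 j x)) $ e i
        = c * (\<tau> i - t) ^ k / (bw i * partial (e i) w (\<phi> x))"
      using new.dual_pointwise[OF x(2), of "\<lambda>j. ?L (V0 j x)"] by blast
    have curve: "(\<Sum>j\<le>k. t ^ j *\<^sub>R ?L (V0 j x)) = (\<Sum>j\<le>k. t ^ j *\<^sub>R (c *\<^sub>R new.dual_coeff j (\<phi> x)))" for t
    proof (rule vec_eqI)
      fix i assume i: "i \<le> k"
      have "(\<Sum>j\<le>k. t ^ j *\<^sub>R (c *\<^sub>R new.dual_coeff j (\<phi> x))) = c *\<^sub>R poly_curve k new.dual_coeff t (\<phi> x)"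
        unfolding poly_curve_def scaleR_sum_right by (simp add: mult.commute)
      then show "(\<Sum>j\<le>k. t ^ j *\<^sub>R ?L (V0 j x)) $ e i = (\<Sum>j\<le>k. t ^ j *\<^sub>R (c *\<^sub>R new.dual_coeff j (\<phi> x))) $ e i"
        unfolding c[OF i] using new.dual_coeff_curve[OF i, of t "\<phi> x"] by simp
    qed
    have L: "?L (V0 j x) = c *\<^sub>R new.dual_coeff j (\<phi> x)" if "j \<le> k" for j
      by (rule vector_polynomial_eq[OF curve that])
    have hom: "?L (\<Sum>i\<le>k. (a ^ (k - i) * b ^ i) *\<^sub>R V0 i x) = c *\<^sub>R (\<Sum>i\<le>k. (a ^ (k - i) * b ^ i) *\<^sub>R new.dual_coeff i (\<phi> x))" for a b :: real
      unfolding linear_sum[OF lin] scaleR_sum_right by (rule sum.cong[OF refl]) (simp add: linear_scale[OF lin] L mult.commute)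
    have "c \<noteq> 0"
    proof
      assume "c = 0"
      then have "?L (V0 0 x) = ?L 0" using L[OF le0] linear_0[OF lin] by simp
      then have "V0 0 x = 0" by (rule injD[OF inj[OF xW]])
      moreover have "independent ((\<lambda>i. V0 i x) ` {..k})" using V0 x(1) unfolding dual_curve_def smooth_frame_def by blast
      ultimately show False using dependent_zero[of "(\<lambda>i. V0 i x) ` {..k}"] by (metis atMost_iff image_eqI le0)
    qed
    show "C x = {v. ?L v \<in> veronese_cone k new.dual_coeff (\<phi> x)}"
    proof (intro equalityI subsetI)
      fix v assume "v \<in> C x"
      then obtain a b r where "v = r *\<^sub>R (\<Sum>i\<le>k. (a ^ (k - i) * b ^ i) *\<^sub>R V0 i x)"
        unfolding C[OF x(1)] veronese_cone_def by blast
      then have "?L v = (r * c) *\<^sub>R (\<Sum>i\<le>k. (a ^ (k - i) * b ^ i) *\<^sub>R new.dual_coeff i (\<phi> x))"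
        using hom[of a b] linear_scale[OF lin] by simp
      then show "v \<in> {v. ?L v \<in> veronese_cone k new.dual_coeff (\<phi> x)}" unfolding veronese_cone_def by blast
    next
      fix v assume "v \<in> {v. ?L v \<in> veronese_cone k new.dual_coeff (\<phi> x)}"
      then obtain a b r where "?L v = r *\<^sub>R (\<Sum>i\<le>k. (a ^ (k - i) * b ^ i) *\<^sub>R new.dual_coeff i (\<phi> x))"
        unfolding veronese_cone_def by blast
      then have "?L v = ?L ((r / c) *\<^sub>R (\<Sum>i\<le>k. (a ^ (k - i) * b ^ i) *\<^sub>R V0 i x))"
        unfolding linear_scale[OF lin] hom using \<open>c \<noteq> 0\<close> by simp
      then have "v = (r / c) *\<^sub>R (\<Sum>i\<le>k. (a ^ (k - i) * b ^ i) *\<^sub>R V0 i x)" by (rule injD[OF inj[OF xW]])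
      then show "v \<in> C x" unfolding C[OF x(1)] veronese_cone_def by blast
    qed
  qed
  have WU: "W \<subseteq> U" using W(2) W1(1) W0(3) by blast
  show ?thesis
    by (intro exI[of _ W] exI[of _ \<phi>] exI[of _ w] exI[of _ new.dual_coeff] conjI ballI)
      (rule W(1), rule WU, rule ch, rule adm, rule new.dual_coeff_dual, erule main[THEN conjunct1], erule main[THEN conjunct2])
qed

end

theorem theorem11p1:
  fixes k :: nat and e :: "nat \<Rightarrow> 'n::finite" and \<tau> :: "nat \<Rightarrow> real"
  assumes "k \<ge> 1"
    and "bij_betw e {..k} UNIV"
    and "inj_on \<tau> {..k + 1}"
  shows
    "(\<forall>(U :: (real ^ 'n) set) w. open U \<and> admissible_solution k e \<tau> U w \<longrightarrow>
       (let \<omega> = solution_form k e \<tau> w; D = (\<lambda>t. ker_form (\<omega> t)) in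
        coframe_curve k U \<omega> \<and> veronese_web k U D \<and> (\<exists>V. dual_curve k U \<omega> V) \<and>
        (\<forall>V. dual_curve k U \<omega> V \<longrightarrow>
           paraconformal_structure k U (veronese_cone k V) \<and>
           paraconformal_of_web k U D (veronese_cone k V) \<and>
           (k > 2 \<longrightarrow>
              (\<forall>\<alpha>. smooth_on U \<alpha> \<longrightarrow> (\<exists>\<Gamma>. solution_connection k e U w \<alpha> \<Gamma>)) \<and>
              (\<forall>\<Gamma>. connection U \<Gamma> \<longrightarrow>
                 (paraconformal_connection k U V \<Gamma> \<and> totally_geodesic_for_web U D \<Gamma> \<longleftrightarrow>
                  (\<exists>\<alpha>. smooth_on U \<alpha> \<and> solution_connection k e U w \<alpha> \<Gamma>))) \<and>
              (let good = (\<lambda>\<alpha>. smooth_on U \<alpha> \<and>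
                     (\<exists>\<Gamma>. solution_connection k e U w \<alpha> \<Gamma> \<and>
                        (\<forall>t. \<forall>x\<in>U. torsion \<Gamma> (poly_curve k V t) (t_deriv (poly_curve k V) t) x
                                     \<in> span {poly_curve k V t x})))
               in \<exists>\<alpha>. good \<alpha> \<and> (\<forall>\<beta>. good \<beta> \<longrightarrow> (\<forall>x\<in>U. \<beta> x = \<alpha> x)))) \<and>
           (k = 2 \<longrightarrow>
              (let g = solution_metric e \<tau> w;
                   P = (\<lambda>\<Gamma>. torsion_free U \<Gamma> \<and> totally_geodesic_for_web U D \<Gamma> \<and>
                            paraconformal_connection k U V \<Gamma> \<and> einstein_weyl U g \<Gamma>)
               in metric_on U g \<and>
                  (\<forall>x\<in>U. veronese_cone k V x = {v. g x v v = 0}) \<and>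
                  unique_connection U P \<and>
                  (\<forall>\<Gamma>. connection U \<Gamma> \<and> P \<Gamma> \<longrightarrow> weyl_form U g \<Gamma> (solution_weyl_form e w)))) \<and>
           (k = 1 \<longrightarrow>
              (let P = (\<lambda>\<Gamma>. torsion_free U \<Gamma> \<and> paraconformal_connection k U V \<Gamma> \<and>
                     (\<forall>Y t. smooth_on U Y \<longrightarrow>
                        (\<forall>x\<in>U. nabla \<Gamma> Y (poly_curve k V t) x \<in> span {poly_curve k V t x})))
               in unique_connection U P \<and>
                  (\<forall>\<Gamma>. connection U \<Gamma> \<and> P \<Gamma> \<longrightarrow>
                     (\<forall>Y. smooth_on U Y \<longrightarrow> (\<forall>x\<in>U.
                        nabla \<Gamma> Y (\<lambda>_. axis (e 0) 1) x =
                          ((partial (e 0) (partial (e 0) w) x / partial (e 0) w x -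
                            partial (e 0) (partial (e 1) w) x / partial (e 1) w x) * (Y x $ e 0))
                          *\<^sub>R axis (e 0) 1 \<and>
                        nabla \<Gamma> Y (\<lambda>_. axis (e 1) 1) x =
                          ((partial (e 1) (partial (e 1) w) x / partial (e 1) w x -
                            partial (e 0) (partial (e 1) w) x / partial (e 0) w x) * (Y x $ e 1))
                          *\<^sub>R axis (e 1) 1))))))))
     \<and>
     (\<forall>(U :: (real ^ 'n) set) D C.
        open U \<and> veronese_web k U D \<and> paraconformal_of_web k U D C \<longrightarrow>
        (\<forall>p\<in>U. \<exists>W \<phi> w V. p \<in> W \<and> W \<subseteq> U \<and> coordinate_chart W \<phi> \<and>
           admissible_solution k e \<tau> (\<phi> ` W) w \<and>
           dual_curve k (\<phi> ` W) (solution_form k e \<tau> w) V \<and>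
           (\<forall>x\<in>W. (\<forall>t. D t x = {v. frechet_derivative \<phi> (at x) v
                                       \<in> ker_form (solution_form k e \<tau> w t) (\<phi> x)}) \<and>
                  C x = {v. frechet_derivative \<phi> (at x) v \<in> veronese_cone k V (\<phi> x)})))"
proof -
  interpret web_coordinates k \<tau> e by unfold_locales (use assms in auto)
  show ?thesis
  proof (intro conjI allI impI ballI, goal_cases)
    case (1 U w)
    interpret solution k \<tau> e U w by unfold_locales (use 1 in auto)
    show ?case by (rule solution_web)
  next
    case (2 U D C p)
    then show ?case by (intro normal_form) simp_all
  qed
qed

end
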